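(* Let $\alpha>0$, $\alpha\neq 1$, and let $T:A^2(U^\alpha)\to A^2(U^\alpha)$ be a linear operator. If, for some $p>4$, $$\sup_{z\in U^\alpha}\big\|V_{f_\alpha(z)}U_zTk_z\big\|_{L^p(U^\alpha)}<\infty\quad\text{and}\quad \sup_{z\in U^\alpha}\big\|V_{f_\alpha(z)}U_zT^*k_z\big\|_{L^p(U^\alpha)}<\infty,$$ then $\lim_{d(z,0)\to 1}\|Tk_z\|=0$ if and only if $T$ is compact.
   Context: $U^\alpha=\{z=(z_1,z_2)\in\mathbb C^2: |z_1|^{2/\alpha}+|z_2|^2<1\}$; $d\sigma$ is Lebesgue measure; $\langle\cdot,\cdot\rangle$ and $\|\cdot\|$ are the inner product and norm of $L^2(U^\alpha)=L^2(U^\alpha,d\sigma)$, and $L^p(U^\alpha)=L^p(U^\alpha,d\sigma)$. $A^2(U^\alpha)$ is the Bergman space, the closed subspace of holomorphic functions in $L^2(U^\alpha)$; $K_{U^\alpha}(w;\bar z)$ is its Bergman (reproducing) kernel, $K_z=K_{U^\alpha}(\cdot;\bar z)$, and $k_z=K_z/\|K_z\|$. $\mathbb D$ is the open unit disc in $\mathbb C$. The Skwarczyński distance is $d(z,w)=(1-|\langle k_z,k_w\rangle|)^{1/2}$; on $U^\alpha$, $d(z,0)\to1$ means that $z$ approaches the boundary of $U^\alpha$. Convention on $T$, $T^*$: $T$ is a linear operator whose values on the linear span of $\{k_z\}$ lie in $A^2(U^\alpha)$, and $T^*$ is a linear operator from this span to $A^2(U^\alpha)$ with $\langle Tk_z,k_w\rangle=\langle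 k_z,T^*k_w\rangle$ for all $z,w\in U^\alpha$. The two supremum conditions imply that $T$ extends from the span to a bounded operator on $A^2(U^\alpha)$; $T$ denotes this bounded operator. For $b\in\mathbb D$ define $\varphi_b:U^\alpha\to U^\alpha$ by $$\varphi_b(w_1,w_2)=\Big(w_1\Big(\tfrac{\sqrt{1-|b|^2}}{1-\bar b w_2}\Big)^\alpha,\ \tfrac{b-w_2}{1-\bar b w_2}\Big)$$ (principal branch of the power). For $a\in\mathbb D$ define $\phi_a:U^\alpha\to U^\alpha$ by $\phi_a(w)=(\phi^{(1)}(w),\phi^{(2)}(w))$, where $$\phi^{(1)}(w)=\frac{a-w_1}{1-\bar a w_1},\qquad \phi^{(2)}(w)=w_2\,\frac{\sqrt{1-|a|^2}}{1-\bar a w_1}\sqrt{\frac{(1-|w_1|^2)(1-|\phi^{(1)}(w)|^{2/\alpha})}{(1-|w_1|^{2/\alpha})(1-|\phi^{(1)}(w)|^2)}}.$$ For $z=(z_1,z_2)\in U^\alpha$ put $f_\alpha(z)=z_1/(1-|z_2|^2)^{\alpha/2}\in\mathbb D$. $J$ denotes the holomorphic Jacobian determinant, i.e. the determinant of the matrix of derivatives $\partial/\partial w_j$ of the components (used also for the non-holomorphic map $\phi_a$, for which $J\phi_a=\frac{\partial\phi^{(1)}}{\partial w_1}\frac{\partial\phi^{(2)}}{\partial w_2}$). For functions $f$ on $U^\alpha$, $$U_zf(w)=f(\varphi_{z_2}(w))\,J\varphi_{z_2}(w)\quad(z=(z_1,z_2)\in U^\alpha),\qquad V_af(w)=f(\phi_a(w))\,J\phi_a(w)\quad(a\in\mathbb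 D).$$ *)

theory Defs
  imports
    "HOL-Analysis.Analysis"
    "HOL-Library.Function_Algebras"
    "HOL-Library.Going_To_Filter"
begin

definition U_dom :: "real \<Rightarrow> (complex \<times> complex) set" where
  "U_dom \<alpha> = {(z1, z2). norm z1 powr (2 / \<alpha>) + (norm z2)\<^sup>2 < 1}"

(* Complex Frechet differentiability at every point; meant for open S. *)
definition holomorphic2_on :: "(complex \<times> complex \<Rightarrow> complex) \<Rightarrow> (complex \<times> complex) set \<Rightarrow> bool" where
  "holomorphic2_on f S \<longleftrightarrow>
     (\<forall>z\<in>S. \<exists>a b. (f has_derivative (\<lambda>h. a * fst h + b * snd h)) (at z))"

definition inner_L2 :: "real \<Rightarrow> (complex \<times> complex \<Rightarrow> complex) \<Rightarrow> (complex \<times> complex \<Rightarrow> complex) \<Rightarrow> complex" where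
  "inner_L2 \<alpha> f g = (LINT w|lebesgue_on (U_dom \<alpha>). f w * cnj (g w))"

definition norm_L2 :: "real \<Rightarrow> (complex \<times> complex \<Rightarrow> complex) \<Rightarrow> real" where
  "norm_L2 \<alpha> f = sqrt (LINT w|lebesgue_on (U_dom \<alpha>). (norm (f w))\<^sup>2)"

(* The L^p norm with values in [0, \<infinity>]. *)
definition norm_Lp :: "real \<Rightarrow> real \<Rightarrow> (complex \<times> complex \<Rightarrow> complex) \<Rightarrow> ennreal" where
  "norm_Lp \<alpha> p f =
     (let I = (\<integral>\<^sup>+ w. ennreal (norm (f w) powr p) \<partial>lebesgue_on (U_dom \<alpha>))
      in if I = \<infinity> then \<infinity> else ennreal (enn2real I powr (1 / p)))"

(* Functions on the domain are represented by total functions; elements of the Bergman space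
   are normalised to vanish off the domain, so that equality in the Bergman space is equality
   in HOL. *)
definition bergman_space :: "real \<Rightarrow> (complex \<times> complex \<Rightarrow> complex) set" where
  "bergman_space \<alpha> = {f. holomorphic2_on f (U_dom \<alpha>) \<and>
     integrable (lebesgue_on (U_dom \<alpha>)) (\<lambda>w. (norm (f w))\<^sup>2) \<and>
     (\<forall>w. w \<notin> U_dom \<alpha> \<longrightarrow> f w = 0)}"

(* K_z, the unique element of the Bergman space reproducing the value at z. *)
definition bergman_kernel :: "real \<Rightarrow> complex \<times> complex \<Rightarrow> (complex \<times> complex \<Rightarrow> complex)" where
  "bergman_kernel \<alpha> z =
     (THE K. K \<in> bergman_space \<alpha> \<and> (\<forall>f\<in>bergman_space \<alpha>. f z = inner_L2 \<alpha> f K))"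

definition normalized_kernel :: "real \<Rightarrow> complex \<times> complex \<Rightarrow> (complex \<times> complex \<Rightarrow> complex)" where
  "normalized_kernel \<alpha> z =
     (\<lambda>w. bergman_kernel \<alpha> z w / of_real (norm_L2 \<alpha> (bergman_kernel \<alpha> z)))"

definition skwarczynski_dist :: "real \<Rightarrow> complex \<times> complex \<Rightarrow> complex \<times> complex \<Rightarrow> real" where
  "skwarczynski_dist \<alpha> z w =
     sqrt (1 - norm (inner_L2 \<alpha> (normalized_kernel \<alpha> z) (normalized_kernel \<alpha> w)))"

definition cscale :: "complex \<Rightarrow> ('a \<Rightarrow> complex) \<Rightarrow> ('a \<Rightarrow> complex)" where
  "cscale c f = (\<lambda>w. c * f w)"

interpretation cfun: vector_space "cscale :: complex \<Rightarrow> ('a \<Rightarrow> complex) \<Rightarrow> _"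
  by unfold_locales (auto simp: cscale_def fun_eq_iff algebra_simps)

definition clinear_on :: "('a \<Rightarrow> complex) set \<Rightarrow> (('a \<Rightarrow> complex) \<Rightarrow> ('a \<Rightarrow> complex)) \<Rightarrow> bool" where
  "clinear_on S T \<longleftrightarrow> (\<forall>f\<in>S. \<forall>g\<in>S. T (f + g) = T f + T g) \<and>
     (\<forall>c. \<forall>f\<in>S. T (cscale c f) = cscale c (T f))"

definition kernel_span :: "real \<Rightarrow> (complex \<times> complex \<Rightarrow> complex) set" where
  "kernel_span \<alpha> = cfun.span (normalized_kernel \<alpha> ` U_dom \<alpha>)"

definition bounded_operator :: "real \<Rightarrow> ((complex \<times> complex \<Rightarrow> complex) \<Rightarrow> (complex \<times> complex \<Rightarrow> complex)) \<Rightarrow> bool" where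
  "bounded_operator \<alpha> T \<longleftrightarrow> T ` bergman_space \<alpha> \<subseteq> bergman_space \<alpha> \<and>
     clinear_on (bergman_space \<alpha>) T \<and>
     (\<exists>C. \<forall>f\<in>bergman_space \<alpha>. norm_L2 \<alpha> (T f) \<le> C * norm_L2 \<alpha> f)"

definition bergman_topology :: "real \<Rightarrow> (complex \<times> complex \<Rightarrow> complex) topology" where
  "bergman_topology \<alpha> =
     Metric_space.mtopology (bergman_space \<alpha>) (\<lambda>f g. norm_L2 \<alpha> (f - g))"

(* The image of the closed unit ball is relatively compact in the norm topology. *)
definition compact_operator :: "real \<Rightarrow> ((complex \<times> complex \<Rightarrow> complex) \<Rightarrow> (complex \<times> complex \<Rightarrow> complex)) \<Rightarrow> bool" where
  "compact_operator \<alpha> T \<longleftrightarrow> bounded_operator \<alpha> T \<and>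
     compactin (bergman_topology \<alpha>)
       (bergman_topology \<alpha> closure_of (T ` {f \<in> bergman_space \<alpha>. norm_L2 \<alpha> f \<le> 1}))"

definition phi_b :: "real \<Rightarrow> complex \<Rightarrow> complex \<times> complex \<Rightarrow> complex \<times> complex" where
  "phi_b \<alpha> b = (\<lambda>(w1, w2).
     (w1 * (of_real (sqrt (1 - (norm b)\<^sup>2)) / (1 - cnj b * w2)) powr (of_real \<alpha>),
      (b - w2) / (1 - cnj b * w2)))"

definition phi_a :: "real \<Rightarrow> complex \<Rightarrow> complex \<times> complex \<Rightarrow> complex \<times> complex" where
  "phi_a \<alpha> a = (\<lambda>(w1, w2).
     let u = (a - w1) / (1 - cnj a * w1) in
     (u,
      w2 * (of_real (sqrt (1 - (norm a)\<^sup>2)) / (1 - cnj a * w1)) *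
        of_real (sqrt (((1 - (norm w1)\<^sup>2) * (1 - norm u powr (2 / \<alpha>))) /
                       ((1 - norm w1 powr (2 / \<alpha>)) * (1 - (norm u)\<^sup>2))))))"

definition f_alpha :: "real \<Rightarrow> complex \<times> complex \<Rightarrow> complex" where
  "f_alpha \<alpha> z = fst z / of_real ((1 - (norm (snd z))\<^sup>2) powr (\<alpha> / 2))"

(* The Wirtinger derivative (d/dx - i d/dy) / 2; it agrees with the complex derivative for
   holomorphic functions. *)
definition wirtinger :: "(complex \<Rightarrow> complex) \<Rightarrow> complex \<Rightarrow> complex" where
  "wirtinger g z =
     (vector_derivative (\<lambda>t::real. g (z + of_real t)) (at 0)
      - \<i> * vector_derivative (\<lambda>t::real. g (z + \<i> * of_real t)) (at 0)) / 2"

definition holo_jacobian :: "(complex \<times> complex \<Rightarrow> complex \<times> complex) \<Rightarrow> complex \<times> complex \<Rightarrow> complex" where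
  "holo_jacobian F = (\<lambda>(w1, w2).
     wirtinger (\<lambda>u. fst (F (u, w2))) w1 * wirtinger (\<lambda>v. snd (F (w1, v))) w2
     - wirtinger (\<lambda>v. fst (F (w1, v))) w2 * wirtinger (\<lambda>u. snd (F (u, w2))) w1)"

definition U_op :: "real \<Rightarrow> complex \<times> complex \<Rightarrow> (complex \<times> complex \<Rightarrow> complex) \<Rightarrow> (complex \<times> complex \<Rightarrow> complex)" where
  "U_op \<alpha> z f = (\<lambda>w. f (phi_b \<alpha> (snd z) w) * holo_jacobian (phi_b \<alpha> (snd z)) w)"

definition V_op :: "real \<Rightarrow> complex \<Rightarrow> (complex \<times> complex \<Rightarrow> complex) \<Rightarrow> (complex \<times> complex \<Rightarrow> complex)" where
  "V_op \<alpha> a f = (\<lambda>w. f (phi_a \<alpha> a w) * holo_jacobian (phi_a \<alpha> a) w)"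

end

(*
  Write h for the weight (1 - |w_2|^2)^(-(alpha - 1)/4) (1 - |w_2|^2 - |w_1|^(2/alpha))^(-3/4).
  The operator T is an integral operator with kernel ||K_w|| (T k_w)(z), and its boundedness
  follows from Schur's test with weight h.  In the column integral over z one substitutes
  z = phi_{z_2} (phi_{f_alpha(z)} (.)), a map with real Jacobian |J|^2 that moves the base point w
  to the origin.  Hoelder's inequality against the L^p hypothesis then leaves an integral of h with
  conjugate exponent q, which reduces to one-variable Forelli-Rudin integrals; these have the
  right growth exactly when q < 4/3, that is p > 4.  No explicit formula for K is needed: only its
  existence and the size of point evaluations enter.

  Where ||T k_w|| is small, interpolation between the L^p bound and this L^2 norm makes the column
  integral small, so if T k_w vanishes at the boundary, then T is small on functions living near the
  boundary, while bounded sequences have subsequences converging in L^2 on the sublevel sets of ||K_w||.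
  Conversely the normalized kernels converge weakly to zero at the boundary, because functions in the
  Bergman space are approximated by their dilations, which are bounded.
*)
theory Submission
  imports Defs "HOL-Complex_Analysis.Complex_Analysis" "HOL-Library.Diagonal_Subsequence"
begin

no_notation fps_nth (infixl \<open>$\<close> 75)

section \<open>Area measure on the complex plane\<close>

text \<open>The weight is, up to constants, the square root of \<open>Nz\<close>, which measures the
  size of the kernel norm; then \<open>h / Nz\<close> is of order \<open>1 / h\<close>, and Schur's
  test is balanced between rows and columns. Geometrically the obstacle is that \<open>phi_a\<close>
  is in general not holomorphic, so it cannot carry Bergman functions to Bergman functions. It
  serves only to change variables in integrals of absolute values, and there Fubini suffices,
  because both maps are skew products: a Moebius map in one coordinate and a multiplication in the
  other. Where holomorphy matters, in point evaluations, only \<open>phi_b\<close> is used and a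
  polydisc does the rest. The second obstacle is that \<open>T\<close> is given only on the span of
  the kernels. The candidate extension is written by duality with \<open>Tstar\<close>; its rows are
  controlled by \<open>Tstar\<close>, its columns by \<open>T\<close>. Its norm bound is first
  proved under the premise that the image lies in the Bergman space, which is known on the span, and
  then passed to limits. Pointwise values are carried along in the Hilbert space arguments, since
  limits are identified by their values.\<close>

lemma lborel_complex_eq_distr_vec:
  "(lborel :: complex measure) = distr (lborel :: (real^2) measure) borel (\<lambda>x. Complex (x $ 1) (x $ 2))"
proof (rule lborel_eqI)
  have m[measurable]: "(\<lambda>x::real^2. Complex (x $ 1) (x $ 2)) \<in> borel_measurable borel"
    by (intro borel_measurable_continuous_onI) (auto simp: Complex_eq intro!: continuous_intros)
  fix l u :: complex
  assume le: "\<And>b. b \<in> Basis \<Longrightarrow> l \<bullet> b \<le> u \<bullet> b"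
  define l' u' :: "real^2" where "l' = (\<chi> i. if i = 1 then Re l else Im l)"
    and "u' = (\<chi> i. if i = 1 then Re u else Im u)"
  have le': "Re l \<le> Re u" "Im l \<le> Im u"
    using le[of 1] le[of \<i>] by (auto simp: Basis_complex_def)
  have eq: "(\<lambda>x::real^2. Complex (x $ 1) (x $ 2)) -` box l u = box l' u'"
    by (auto simp: mem_box_cart in_box_complex_iff l'_def u'_def forall_2)
  have b2: "(Basis :: (real^2) set) = {axis 1 1, axis 2 1}"
    unfolding Basis_vec_def by (auto simp: UNIV_2)
  show "emeasure (distr lborel borel (\<lambda>x::real^2. Complex (x $ 1) (x $ 2))) (box l u) = (\<Prod>b\<in>Basis. (u - l) \<bullet> b)"
    using le' by (simp add: emeasure_distr eq emeasure_lborel_box_eq b2 inner_axis axis_eq_axis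
        Basis_complex_def l'_def u'_def)
qed simp

lemma lborel_complex_eq_distr_prod:
  "(lborel :: complex measure) = distr (lborel :: (real \<times> real) measure) borel (\<lambda>(s, t). Complex s t)"
proof (rule lborel_eqI)
  have m[measurable]: "(\<lambda>(s, t). Complex s t) \<in> borel_measurable borel"
    by (intro borel_measurable_continuous_onI)
       (auto simp: Complex_eq case_prod_beta intro!: continuous_intros)
  fix l u :: complex
  assume le: "\<And>b. b \<in> Basis \<Longrightarrow> l \<bullet> b \<le> u \<bullet> b"
  have le': "Re l \<le> Re u" "Im l \<le> Im u"
    using le[of 1] le[of \<i>] by (auto simp: Basis_complex_def)
  have eq: "(\<lambda>(s, t). Complex s t) -` box l u = box (Re l, Im l) (Re u, Im u)"
    by (auto simp: box_def Basis_prod_def Basis_complex_def)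
  have bp: "box (Re l, Im l) (Re u, Im u) = box (Re l) (Re u) \<times> box (Im l) (Im u)"
    by (auto simp: box_def Basis_prod_def)
  have e: "emeasure (lborel :: (real \<times> real) measure) (A \<times> B) = emeasure lborel A * emeasure lborel B"
    if "A \<in> sets borel" "B \<in> sets borel" for A B
    using that unfolding lborel_prod[symmetric] by (simp add: lborel.emeasure_pair_measure_Times)
  show "emeasure (distr lborel borel (\<lambda>(s, t). Complex s t)) (box l u) = (\<Prod>b\<in>Basis. (u - l) \<bullet> b)"
    using le' by (simp add: emeasure_distr eq bp e Basis_complex_def ennreal_mult)
qed simp

text \<open>The imaginary part is made the outer variable because the disc integrals below carry a
  weight in \<open>Im v\<close>, which is constant on horizontal slices.\<close>

lemma nn_integral_complex_rect:
  assumes [measurable]: "f \<in> borel_measurable borel"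
  shows "(\<integral>\<^sup>+z. f z \<partial>lborel) = (\<integral>\<^sup>+t. (\<integral>\<^sup>+s. f (Complex s t) \<partial>lborel) \<partial>lborel)"
proof -
  have m[measurable]: "(\<lambda>(s, t). Complex s t) \<in> borel_measurable (lborel \<Otimes>\<^sub>M lborel)"
    unfolding lborel_prod measurable_lborel2
    by (intro borel_measurable_continuous_onI)
       (auto simp: Complex_eq case_prod_beta intro!: continuous_intros)
  have "(\<integral>\<^sup>+z. f z \<partial>lborel) = (\<integral>\<^sup>+x. f (case x of (s, t) \<Rightarrow> Complex s t) \<partial>(lborel \<Otimes>\<^sub>M lborel))"
    by (subst lborel_complex_eq_distr_prod, subst nn_integral_distr)
       (use m in \<open>auto simp: lborel_prod\<close>)
  also have "\<dots> = (\<integral>\<^sup>+t. (\<integral>\<^sup>+s. f (Complex s t) \<partial>lborel) \<partial>lborel)"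
    by (subst lborel_pair.nn_integral_snd[symmetric]) auto
  finally show ?thesis .
qed

text \<open>Along the identification \<open>c2\<close> of the real plane with the complex line, f
  becomes a differentiable injection whose derivative is multiplication by f'. By Cauchy-Riemann its
  determinant is |f'|^2, so the real change of variables applies.\<close>

lemma emeasure_holomorphic_image:
  fixes f :: "complex \<Rightarrow> complex"
  assumes S: "open S" and f: "f holomorphic_on S" "inj_on f S" and A: "A \<in> sets borel" "A \<subseteq> S"
  shows "f ` A \<in> sets borel"
    and "emeasure lborel (f ` A) = (\<integral>\<^sup>+x. ennreal ((norm (deriv f x))\<^sup>2) * indicator A x \<partial>lborel)"
proof -
  \<comment> \<open>The holomorphic inverse exhibits the image of \<open>A\<close> as a preimage,
    hence Borel.\<close>
  obtain g where g: "g holomorphic_on f ` S" "\<And>z. z \<in> S \<Longrightarrow> g (f z) = z"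
    using holomorphic_has_inverse[OF f(1) S f(2)] by metis
  have opf: "open (f ` S)"
    using open_mapping_thm3[OF f(1) S f(2)] .
  have eqA: "f ` A = f ` S \<inter> g -` A"
    using g(2) A by force
  have "(\<lambda>x. if x \<in> f ` S then g x else 0) \<in> borel_measurable borel"
    using opf g(1) by (intro borel_measurable_continuous_on_if) (auto intro: holomorphic_on_imp_continuous_on)
  hence "f ` S \<inter> (\<lambda>x. if x \<in> f ` S then g x else 0) -` A \<in> sets borel"
    using opf A(1) by (auto intro!: sets.Int measurable_sets_borel)
  also have "f ` S \<inter> (\<lambda>x. if x \<in> f ` S then g x else 0) -` A = f ` A"
    unfolding eqA by auto
  finally show fA: "f ` A \<in> sets borel" .
  define c2 :: "real^2 \<Rightarrow> complex" where "c2 x = Complex (x $ 1) (x $ 2)" for x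
  define i2 :: "complex \<Rightarrow> real^2" where "i2 z = (\<chi> i. if i = 1 then Re z else Im z)" for z
  have c2i2[simp]: "c2 (i2 z) = z" for z by (auto simp: c2_def i2_def complex_eq_iff)
  have i2c2[simp]: "i2 (c2 x) = x" for x by (auto simp: c2_def i2_def vec_eq_iff forall_2)
  have bl: "bounded_linear c2" "bounded_linear i2"
    unfolding linear_conv_bounded_linear[symmetric]
    by (auto intro!: linearI simp: c2_def i2_def complex_eq_iff vec_eq_iff)
  have [measurable]: "c2 \<in> borel_measurable borel" "i2 \<in> borel_measurable borel"
    by (intro borel_measurable_continuous_onI bl[THEN linear_continuous_on])+
  have lb: "(lborel::complex measure) = distr lborel borel c2"
    by (subst lborel_complex_eq_distr_vec) (simp add: c2_def[abs_def])
  define A' where "A' = c2 -` A"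
  have A': "A' \<in> sets borel"
    using measurable_sets_borel[OF _ A(1), of c2] by (simp add: A'_def)
  have eq1: "emeasure lborel (f ` A) = emeasure lborel (c2 -` (f ` A))"
    by (subst lb) (use fA in \<open>simp add: emeasure_distr\<close>)
  have eq2: "c2 -` (f ` A) = (i2 \<circ> f \<circ> c2) ` A'"
  proof (intro equalityI subsetI)
    fix x assume "x \<in> c2 -` (f ` A)"
    then obtain z where z: "z \<in> A" "c2 x = f z" by auto
    hence "x = i2 (f z)" by (metis i2c2)
    thus "x \<in> (i2 \<circ> f \<circ> c2) ` A'"
      using z by (intro image_eqI[of _ _ "i2 z"]) (auto simp: A'_def)
  qed (auto simp: A'_def)
  have fA': "(i2 \<circ> f \<circ> c2) ` A' \<in> sets borel"
    unfolding eq2[symmetric] using measurable_sets_borel[OF _ fA, of c2] by simp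
  define D where "D x h = i2 (deriv f (c2 x) * c2 h)" for x h
  have der: "((i2 \<circ> f \<circ> c2) has_derivative D x) (at x within A')" if "x \<in> A'" for x
  proof -
    have "c2 x \<in> S" using that A by (auto simp: A'_def)
    hence "(f has_field_derivative deriv f (c2 x)) (at (c2 x))"
      using holomorphic_derivI[OF f(1) S] by blast
    hence "(f has_derivative (\<lambda>h. deriv f (c2 x) * h)) (at (c2 x))"
      by (simp add: has_field_derivative_def)
    from has_derivative_compose[OF bounded_linear_imp_has_derivative[OF bl(1)] this]
    have "((\<lambda>x. f (c2 x)) has_derivative (\<lambda>h. deriv f (c2 x) * c2 h)) (at x)" .
    from bounded_linear.has_derivative[OF bl(2) this]
    show ?thesis unfolding o_def D_def by (auto intro: has_derivative_at_withinI)
  qed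
  have det: "\<bar>det (matrix (D x))\<bar> = (norm (deriv f (c2 x)))\<^sup>2" for x
    by (simp add: det_2 matrix_def D_def i2_def c2_def axis_def cmod_def power2_eq_square
       abs_of_nonneg)
  have inj: "inj_on (i2 \<circ> f \<circ> c2) A'"
  proof (rule inj_onI)
    fix x y assume xy: "x \<in> A'" "y \<in> A'" "(i2 \<circ> f \<circ> c2) x = (i2 \<circ> f \<circ> c2) y"
    hence "f (c2 x) = f (c2 y)" by (metis c2i2 comp_apply)
    hence "c2 x = c2 y" using xy f(2) A by (auto simp: A'_def dest: inj_onD)
    thus "x = y" by (metis i2c2)
  qed
  have "A' \<in> sets lebesgue" using A' by auto
  note hm = has_measure_differentiable_image[OF this der inj, unfolded det]
  define k where "k z = (if z \<in> S then (norm (deriv f z))\<^sup>2 else 0)" for z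
  have k_nn: "k z \<ge> 0" for z by (simp add: k_def)
  have km[measurable]: "k \<in> borel_measurable borel"
    unfolding k_def using S f(1)
    by (intro borel_measurable_continuous_on_if)
       (auto intro!: continuous_intros holomorphic_on_imp_continuous_on holomorphic_deriv)
  let ?I = "\<integral>\<^sup>+x. ennreal ((norm (deriv f (c2 x)))\<^sup>2) * indicator A' x \<partial>lborel"
  have kA': "k (c2 x) * indicator A' x = (norm (deriv f (c2 x)))\<^sup>2 * indicator A' x" for x
    using A by (auto simp: k_def A'_def indicator_def)
  have eq3: "?I = (\<integral>\<^sup>+x. ennreal (k (c2 x) * indicator A' x) \<partial>lborel)"
    using A by (intro nn_integral_cong) (auto simp: k_def A'_def indicator_def)
  have eq4: "(\<integral>\<^sup>+x. ennreal ((norm (deriv f x))\<^sup>2) * indicator A x \<partial>lborel) = ?I"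
  proof -
    have "(\<integral>\<^sup>+x. ennreal ((norm (deriv f x))\<^sup>2) * indicator A x \<partial>lborel) = (\<integral>\<^sup>+x. ennreal (k x) * indicator A x \<partial>lborel)"
      using A by (intro nn_integral_cong) (auto simp: k_def indicator_def)
    also have "\<dots> = (\<integral>\<^sup>+x. ennreal (k (c2 x)) * indicator A (c2 x) \<partial>lborel)"
      by (subst lb, subst nn_integral_distr) (use A in auto)
    also have "\<dots> = ?I"
      unfolding eq3 by (intro nn_integral_cong) (auto simp: A'_def indicator_def)
    finally show ?thesis .
  qed
  have eq5: "emeasure lborel ((i2 \<circ> f \<circ> c2) ` A') = ?I"
  proof (cases "emeasure lborel ((i2 \<circ> f \<circ> c2) ` A') = \<infinity>")
    case False
    hence lm: "(i2 \<circ> f \<circ> c2) ` A' \<in> lmeasurable"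
      using fA' by (auto simp: fmeasurable_def top.not_eq_extremum)
    hence "((\<lambda>x. (norm (deriv f (c2 x)))\<^sup>2) has_integral measure lebesgue ((i2 \<circ> f \<circ> c2) ` A')) A'"
      using hm by blast
    from nn_integral_has_integral_lebesgue'[OF _ this]
    have "?I = measure lebesgue ((i2 \<circ> f \<circ> c2) ` A')" by simp
    also have "\<dots> = emeasure lborel ((i2 \<circ> f \<circ> c2) ` A')"
      using lm fA' emeasure_eq_measure2[OF lm] by simp
    finally show ?thesis by simp
  next
    case True
    \<comment> \<open>The equivalence \<open>hm\<close> runs both ways: a finite integral would
      force the image to have finite measure.\<close>
    show ?thesis
    proof (rule ccontr)
      assume "\<not> ?thesis"
      hence "?I \<noteq> \<infinity>" unfolding True by (rule not_sym)
      hence "?I < \<infinity>" by (simp add: less_top[symmetric])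
      then obtain r where r: "?I = ennreal r" "r \<ge> 0"
        by (cases ?I rule: ennreal_cases) auto
      have "((\<lambda>x. k (c2 x) * indicator A' x) has_integral r) UNIV"
        using A' r by (intro nn_integral_has_integral) (auto simp: eq3 k_nn)
      hence "((\<lambda>x. if x \<in> A' then (norm (deriv f (c2 x)))\<^sup>2 else 0) has_integral r) UNIV"
        unfolding kA' by (simp add: indicator_def of_bool_def if_distrib cong: if_cong)
      hence "((\<lambda>x. (norm (deriv f (c2 x)))\<^sup>2) has_integral r) A'"
        by (simp add: has_integral_restrict_UNIV)
      hence "(i2 \<circ> f \<circ> c2) ` A' \<in> lmeasurable" using hm by blast
      thus False using True fA' by (auto simp: fmeasurable_def)
    qed
  qed
  show "emeasure lborel (f ` A) = (\<integral>\<^sup>+x. ennreal ((norm (deriv f x))\<^sup>2) * indicator A x \<partial>lborel)"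
    unfolding eq1 eq2 eq4 eq5 ..
qed

text \<open>The set identity above says that two measures agree: the push-forward of |f'|^2 times
  area and Lebesgue measure on the image. \<open>F\<close> and \<open>k\<close> extend f and the
  density by 0 so that they are Borel on the whole plane.\<close>

lemma nn_integral_holomorphic_change:
  fixes f :: "complex \<Rightarrow> complex"
  assumes S: "open S" and f: "f holomorphic_on S" "inj_on f S" and g[measurable]: "g \<in> borel_measurable borel"
  shows "(\<integral>\<^sup>+x. g (f x) * ennreal ((norm (deriv f x))\<^sup>2) * indicator S x \<partial>lborel)
       = (\<integral>\<^sup>+x. g x * indicator (f ` S) x \<partial>lborel)"
proof -
  define F where "F z = (if z \<in> S then f z else 0)" for z
  define k where "k z = (if z \<in> S then (norm (deriv f z))\<^sup>2 else 0)" for z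
  have [measurable]: "F \<in> borel_measurable borel" "k \<in> borel_measurable borel" "S \<in> sets borel"
    unfolding F_def k_def using S f(1)
    by (auto intro!: borel_measurable_continuous_on_if continuous_intros
        holomorphic_on_imp_continuous_on holomorphic_deriv)
  have fS: "open (f ` S)"
    using open_mapping_thm3[OF f(1) S f(2)] .
  define \<nu> where "\<nu> = distr (density lborel (\<lambda>z. ennreal (k z))) borel F"
  define \<mu> where "\<mu> = density (lborel :: complex measure) (indicator (f ` S))"
  have "\<nu> = \<mu>"
  proof (rule measure_eqI)
    show "sets \<nu> = sets \<mu>" by (simp add: \<nu>_def \<mu>_def)
    fix B assume "B \<in> sets \<nu>"
    hence B[measurable]: "B \<in> sets borel" by (simp add: \<nu>_def)
    define A where "A = S \<inter> F -` B"
    have A: "A \<in> sets borel" "A \<subseteq> S"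
      using measurable_sets_borel[OF _ B, of F] by (auto simp: A_def)
    have "emeasure \<nu> B = (\<integral>\<^sup>+x. ennreal (k x) * indicator (F -` B) x \<partial>lborel)"
      using measurable_sets_borel[OF _ B, of F]
      by (simp add: \<nu>_def emeasure_distr emeasure_density)
    also have "\<dots> = (\<integral>\<^sup>+x. ennreal ((norm (deriv f x))\<^sup>2) * indicator A x \<partial>lborel)"
      by (intro nn_integral_cong) (auto simp: k_def A_def indicator_def)
    also have "\<dots> = emeasure lborel (f ` A)"
      using emeasure_holomorphic_image(2)[OF S f A] by simp
    also have "f ` A = f ` S \<inter> B"
      by (auto simp: A_def F_def)
    also have "emeasure lborel (f ` S \<inter> B) = emeasure \<mu> B"
      using fS by (simp add: \<mu>_def emeasure_density flip: indicator_inter_arith)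
    finally show "emeasure \<nu> B = emeasure \<mu> B" .
  qed
  have "(\<integral>\<^sup>+x. g (f x) * ennreal ((norm (deriv f x))\<^sup>2) * indicator S x \<partial>lborel)
      = (\<integral>\<^sup>+x. ennreal (k x) * g (F x) \<partial>lborel)"
    by (intro nn_integral_cong) (auto simp: k_def F_def indicator_def mult_ac)
  also have "\<dots> = (\<integral>\<^sup>+x. g x \<partial>\<nu>)"
    by (simp add: \<nu>_def nn_integral_distr nn_integral_density)
  also have "\<dots> = (\<integral>\<^sup>+x. g x * indicator (f ` S) x \<partial>lborel)"
    using fS by (simp add: \<open>\<nu> = \<mu>\<close> \<mu>_def nn_integral_density mult.commute)
  finally show ?thesis .
qed

lemma nn_integral_complex_mult:
  fixes c :: complex
  assumes "c \<noteq> 0" and [measurable]: "g \<in> borel_measurable borel"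
  shows "(\<integral>\<^sup>+x. g (c * x) * ennreal ((norm c)\<^sup>2) \<partial>lborel) = (\<integral>\<^sup>+x. g x \<partial>lborel)"
proof -
  have d: "deriv ((*) c) x = c" for x
    by (intro DERIV_imp_deriv) (auto intro!: derivative_eq_intros)
  have s: "range ((*) c) = UNIV"
    using assms(1) by (auto simp: image_iff intro!: exI[of _ "_ / c"])
  have i: "inj ((*) c)" using assms(1) by (auto intro: injI)
  have h: "(*) c holomorphic_on UNIV" by (intro holomorphic_intros)
  show ?thesis
    using nn_integral_holomorphic_change[of UNIV "(*) c" g, OF _ h i assms(2)] by (simp add: d s)
qed

lemma ball_in_borel[measurable]: "ball (c :: 'a :: metric_space) r \<in> sets borel"
  by simp

section \<open>Moebius transformations of the unit disc\<close>

text \<open>The involutive automorphism of the disc that exchanges 0 and \<open>a\<close>;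
  \<open>phi_b\<close> acts by it on the second coordinate and \<open>phi_a\<close> on the
  first.\<close>

definition mob :: "complex \<Rightarrow> complex \<Rightarrow> complex" where
  "mob a x = (a - x) / (1 - cnj a * x)"

lemma norm_cnj_mult_less_1:
  fixes a x :: complex
  assumes "norm a < 1" "norm x < 1"
  shows "norm (cnj a * x) < 1"
proof -
  have "norm a * norm x \<le> norm a * 1"
    using assms by (intro mult_left_mono) auto
  thus ?thesis using assms by (simp add: norm_mult)
qed

lemma one_minus_cnj_mult_nz:
  fixes a x :: complex
  assumes "norm a < 1" "norm x < 1"
  shows "1 - cnj a * x \<noteq> 0"
  using norm_cnj_mult_less_1[OF assms] by auto

lemma Re_one_minus_cnj_mult_pos:
  fixes a x :: complex
  assumes "norm a < 1" "norm x < 1"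
  shows "Re (1 - cnj a * x) > 0"
  using norm_cnj_mult_less_1[OF assms] complex_Re_le_cmod[of "cnj a * x"] by simp

lemma one_minus_norm_sq_pos:
  fixes a :: complex
  assumes "norm a < 1"
  shows "1 - (norm a)\<^sup>2 > 0"
  using assms by (simp add: power_less_one_iff abs_square_less_1)

lemma one_minus_cnj_mult_norm_le:
  fixes a x :: complex
  assumes "norm a < 1" "norm x < 1"
  shows "norm (1 - cnj a * x) \<le> 2"
  using norm_triangle_ineq4[of 1 "cnj a * x"] norm_cnj_mult_less_1[OF assms] by simp

text \<open>Since |1 - cnj a x| >= 1 - |x|, only the factor 1 + |x| <= 2 is lost. It lets powers of
  |1 - cnj a x| be traded for powers of 1 - |x|^2.\<close>

lemma one_minus_norm_sq_le:
  fixes a x :: complex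
  assumes "norm a < 1" "norm x < 1"
  shows "1 - (norm x)\<^sup>2 \<le> 2 * norm (1 - cnj a * x)"
proof -
  have "norm a * norm x \<le> norm x"
    using assms by (intro mult_left_le_one_le) auto
  hence "1 - norm x \<le> norm (1 - cnj a * x)"
    using norm_triangle_ineq2[of 1 "cnj a * x"] by (simp add: norm_mult)
  moreover have "1 - (norm x)\<^sup>2 = (1 - norm x) * (1 + norm x)"
    by (simp add: power2_eq_square algebra_simps)
  moreover have "(1 - norm x) * (1 + norm x) \<le> (1 - norm x) * 2"
    using assms by (intro mult_left_mono) auto
  ultimately have "1 - (norm x)\<^sup>2 \<le> (1 - norm x) * 2" by simp
  with \<open>1 - norm x \<le> norm (1 - cnj a * x)\<close> show ?thesis by argo
qed

context
  fixes a x :: complex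
  assumes a: "norm a < 1" and x: "norm x < 1"
begin

lemma one_minus_norm_sq_mob:
  "1 - (norm (mob a x))\<^sup>2 = (1 - (norm a)\<^sup>2) * (1 - (norm x)\<^sup>2) / (norm (1 - cnj a * x))\<^sup>2"
proof -
  have nz: "1 - cnj a * x \<noteq> 0" by (rule one_minus_cnj_mult_nz[OF a x])
  have "(norm (1 - cnj a * x))\<^sup>2 - (norm (a - x))\<^sup>2 = (1 - (norm a)\<^sup>2) * (1 - (norm x)\<^sup>2)"
    unfolding cmod_power2 by (simp add: power2_eq_square algebra_simps)
  moreover have "(norm (1 - cnj a * x))\<^sup>2 \<noteq> 0" using nz by simp
  ultimately show ?thesis
    by (simp add: mob_def norm_divide power_divide field_simps)
qed

lemma norm_mob_less_1: "norm (mob a x) < 1"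
proof -
  have "1 - (norm (mob a x))\<^sup>2 > 0"
    unfolding one_minus_norm_sq_mob
    using one_minus_norm_sq_pos[OF a] one_minus_norm_sq_pos[OF x] one_minus_cnj_mult_nz[OF a x] by simp
  thus ?thesis by (simp add: abs_square_less_1)
qed

lemma one_minus_cnj_mult_mob: "1 - cnj a * mob a x = of_real (1 - (norm a)\<^sup>2) / (1 - cnj a * x)"
proof -
  have nz: "1 - cnj a * x \<noteq> 0" by (rule one_minus_cnj_mult_nz[OF a x])
  have "of_real ((norm a)\<^sup>2) = cnj a * a"
    by (simp add: complex_norm_square[unfolded of_real_power] mult.commute)
  thus ?thesis using nz by (simp add: mob_def field_simps)
qed

lemma mob_mob: "mob a (mob a x) = x"
proof -
  have nz: "1 - cnj a * x \<noteq> 0" by (rule one_minus_cnj_mult_nz[OF a x])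
  have e: "of_real (1 - (norm a)\<^sup>2) = 1 - cnj a * a"
    by (simp add: complex_norm_square[unfolded of_real_power] mult.commute)
  have nz2: "1 - cnj a * a \<noteq> 0" by (rule one_minus_cnj_mult_nz[OF a a])
  have "mob a (mob a x) = (a - mob a x) * (1 - cnj a * x) / (1 - cnj a * a)"
    unfolding mob_def[of a "mob a x"] one_minus_cnj_mult_mob e using nz by simp
  also have "(a - mob a x) * (1 - cnj a * x) = x * (1 - cnj a * a)"
    using nz by (simp add: mob_def field_simps)
  finally show ?thesis using nz2 by simp
qed

lemma has_field_derivative_mob:
  "(mob a has_field_derivative (- of_real (1 - (norm a)\<^sup>2) / (1 - cnj a * x)\<^sup>2)) (at x)"
proof -
  have nz: "1 - cnj a * x \<noteq> 0" by (rule one_minus_cnj_mult_nz[OF a x])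
  have e: "of_real (1 - (norm a)\<^sup>2) = 1 - cnj a * a"
    by (simp add: complex_norm_square[unfolded of_real_power] mult.commute)
  show ?thesis
    unfolding mob_def[abs_def] e
    using nz by (auto intro!: derivative_eq_intros simp: power2_eq_square field_simps)
qed

end

lemma holomorphic_on_mob: "norm a < 1 \<Longrightarrow> mob a holomorphic_on ball 0 1"
  unfolding holomorphic_on_open[OF open_ball]
  by (intro ballI exI, rule has_field_derivative_mob) auto

lemma mob_image_ball: "norm a < 1 \<Longrightarrow> mob a ` ball 0 1 = ball 0 1"
  by (auto simp: norm_mob_less_1 image_iff intro!: bexI[of _ "mob a _"] mob_mob[symmetric])

lemma inj_on_mob: "norm a < 1 \<Longrightarrow> inj_on (mob a) (ball 0 1)"
  by (rule inj_on_inverseI[where g = "mob a"]) (simp add: mob_mob)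

lemma borel_measurable_mob[measurable]: "mob a \<in> borel_measurable borel"
  unfolding mob_def[abs_def] by measurable

lemma nn_integral_mob:
  assumes a: "norm a < 1" and [measurable]: "g \<in> borel_measurable borel"
  shows "(\<integral>\<^sup>+x. g (mob a x) * ennreal (((1 - (norm a)\<^sup>2) / (norm (1 - cnj a * x))\<^sup>2)\<^sup>2) * indicator (ball 0 1) x \<partial>lborel)
      = (\<integral>\<^sup>+x. g x * indicator (ball 0 1) x \<partial>lborel)"
proof -
  have "norm (deriv (mob a) x) = (1 - (norm a)\<^sup>2) / (norm (1 - cnj a * x))\<^sup>2" if "norm x < 1" for x
    using DERIV_imp_deriv[OF has_field_derivative_mob[OF a that]] one_minus_norm_sq_pos[OF a]
    by (simp add: norm_divide norm_power del: of_real_diff)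
  thus ?thesis
    unfolding nn_integral_holomorphic_change[OF open_ball holomorphic_on_mob[OF a] inj_on_mob[OF a] assms(2),
        unfolded mob_image_ball[OF a], symmetric]
    by (intro nn_integral_cong) (auto simp: indicator_def)
qed

lemma nn_integral_rotate:
  fixes c :: complex
  assumes "norm c = 1" and [measurable]: "g \<in> borel_measurable borel"
  shows "(\<integral>\<^sup>+x. g (c * x) \<partial>lborel) = (\<integral>\<^sup>+x. g x \<partial>lborel)"
  using nn_integral_complex_mult[of c g] assms by (cases "c = 0") auto

section \<open>Forelli--Rudin type integrals\<close>

text \<open>c - |s| is one of the two bases on the right. Thus two one-sided powers with elementary
  antiderivatives replace the absolute value.\<close>

lemma powr_sum_bound:
  fixes c s \<sigma> :: real
  assumes "\<bar>s\<bar> < c"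
  shows "(c - \<bar>s\<bar>) powr (-\<sigma>) \<le> (c - s) powr (-\<sigma>) + (c + s) powr (-\<sigma>)"
  by (cases "s \<ge> 0") auto

lemma has_integral_powr_interval:
  fixes c \<sigma> :: real
  assumes "c > 0" "\<sigma> < 1"
  shows "((\<lambda>s. (c + s) powr (-\<sigma>)) has_integral (2 * c) powr (1 - \<sigma>) / (1 - \<sigma>)) {-c..c}"
    and "((\<lambda>s. (c - s) powr (-\<sigma>)) has_integral (2 * c) powr (1 - \<sigma>) / (1 - \<sigma>)) {-c..c}"
proof -
  have "((\<lambda>s. (c + s) powr (-\<sigma>)) has_integral (c + c) powr (1 - \<sigma>) / (1 - \<sigma>) - (c + - c) powr (1 - \<sigma>) / (1 - \<sigma>)) {-c..c}"
  proof (rule fundamental_theorem_of_calculus_interior)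
    show "continuous_on {-c..c} (\<lambda>s. (c + s) powr (1 - \<sigma>) / (1 - \<sigma>))"
      using assms by (intro continuous_intros continuous_on_powr') auto
    fix s assume "s \<in> {-c<..<c}"
    hence "c + s > 0" by auto
    hence "((\<lambda>s. (c + s) powr (1 - \<sigma>)) has_real_derivative ((1 - \<sigma>) * (c + s) powr (1 - \<sigma> - 1)) * 1) (at s)"
      by (intro DERIV_chain2[of "\<lambda>x. x powr (1 - \<sigma>)"] has_real_derivative_powr)
         (auto intro!: derivative_eq_intros)
    from DERIV_cdivide[OF this, of "1 - \<sigma>"]
    show "((\<lambda>s. (c + s) powr (1 - \<sigma>) / (1 - \<sigma>)) has_vector_derivative (c + s) powr (-\<sigma>)) (at s)"
      using assms unfolding has_real_derivative_iff_has_vector_derivative[symmetric] by simp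
  qed (use assms in auto)
  thus 1: "((\<lambda>s. (c + s) powr (-\<sigma>)) has_integral (2 * c) powr (1 - \<sigma>) / (1 - \<sigma>)) {-c..c}"
    using assms by simp
  from has_integral_reflect_lemma_real[OF 1]
  show "((\<lambda>s. (c - s) powr (-\<sigma>)) has_integral (2 * c) powr (1 - \<sigma>) / (1 - \<sigma>)) {-c..c}"
    by simp
qed

lemma nn_integral_powr_interval_le:
  fixes c \<sigma> :: real
  assumes "c > 0" "\<sigma> < 1"
  shows "(\<integral>\<^sup>+s. ennreal ((c - \<bar>s\<bar>) powr (-\<sigma>)) * indicator {-c<..<c} s \<partial>lborel)
    \<le> ennreal (2 * ((2 * c) powr (1 - \<sigma>) / (1 - \<sigma>)))"
proof -
  have "(\<integral>\<^sup>+s. ennreal ((c - \<bar>s\<bar>) powr (-\<sigma>)) * indicator {-c<..<c} s \<partial>lborel)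
     \<le> (\<integral>\<^sup>+s. ennreal ((c - s) powr (-\<sigma>) + (c + s) powr (-\<sigma>)) * indicator {-c..c} s \<partial>lborel)"
    using powr_sum_bound[of _ c \<sigma>] by (intro nn_integral_mono) (auto simp: indicator_def simp del: ennreal_plus intro!: ennreal_leI)
  also have "\<dots> = ennreal ((2 * c) powr (1 - \<sigma>) / (1 - \<sigma>) + (2 * c) powr (1 - \<sigma>) / (1 - \<sigma>))"
    using has_integral_powr_interval[OF assms]
    by (intro nn_integral_has_integral_lebesgue' has_integral_add) auto
  finally show ?thesis by (simp only: mult_2)
qed

text \<open>The singularities at 0 and at the endpoints do not meet: for |t| <= 1/2 the second
  factor is at most 2, and for |t| > 1/2 the first is.\<close>

lemma nn_integral_abs_powr_finite:
  fixes r :: real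
  assumes "0 \<le> r" "r < 1"
  shows "(\<integral>\<^sup>+t. ennreal (\<bar>t\<bar> powr (-r) * (1 - t\<^sup>2) powr (-1/2)) * indicator {-1<..<1} t \<partial>lborel) < \<infinity>"
proof -
  have bd: "\<bar>t\<bar> powr (-r) * (1 - t\<^sup>2) powr (-1/2) \<le> 2 * \<bar>t\<bar> powr (-r) + 2 * (1 - \<bar>t\<bar>) powr (-(1/2))"
    if "\<bar>t\<bar> < 1" for t :: real
  proof -
    have "1 - \<bar>t\<bar> \<le> 1 - t\<^sup>2"
      using that mult_left_mono[of "\<bar>t\<bar>" 1 "\<bar>t\<bar>"] by (simp add: power2_eq_square)
    hence "(1 - t\<^sup>2) powr (-1/2) \<le> (1 - \<bar>t\<bar>) powr (-1/2)"
      using that by (intro powr_mono2') auto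
    hence "\<bar>t\<bar> powr (-r) * (1 - t\<^sup>2) powr (-1/2) \<le> \<bar>t\<bar> powr (-r) * (1 - \<bar>t\<bar>) powr (-1/2)"
      by (intro mult_left_mono) auto
    also have "\<dots> \<le> 2 * \<bar>t\<bar> powr (-r) + 2 * (1 - \<bar>t\<bar>) powr (-(1/2))"
    proof (cases "\<bar>t\<bar> \<le> 1/2")
      case True
      have "(1 - \<bar>t\<bar>) powr (-1/2) \<le> (1/2) powr (-1/2)"
        using True by (intro powr_mono2') auto
      also have "\<dots> \<le> (1/2) powr (-1::real)" by (intro powr_mono') auto
      also have "\<dots> = 2" by (simp add: powr_minus)
      finally have "\<bar>t\<bar> powr (-r) * (1 - \<bar>t\<bar>) powr (-1/2) \<le> \<bar>t\<bar> powr (-r) * 2"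
        by (intro mult_left_mono) auto
      moreover have "0 \<le> 2 * (1 - \<bar>t\<bar>) powr (-(1/2))" by simp
      ultimately show ?thesis by argo
    next
      case False
      have "\<bar>t\<bar> powr (-r) \<le> (1/2) powr (-r)"
        using False assms by (intro powr_mono2') auto
      also have "\<dots> \<le> (1/2) powr (-1::real)" using assms by (intro powr_mono') auto
      also have "\<dots> = 2" by (simp add: powr_minus)
      finally have "\<bar>t\<bar> powr (-r) * (1 - \<bar>t\<bar>) powr (-1/2) \<le> 2 * (1 - \<bar>t\<bar>) powr (-1/2)"
        by (intro mult_right_mono) auto
      thus ?thesis by (simp add: add_increasing)
    qed
    finally show ?thesis .
  qed
  have p0: "((\<lambda>t. t powr (-r)) has_integral (1 / (1 - r))) {0..1}"
    using has_integral_powr_from_0[of "-r" 1] assms by simp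
  have p1: "((\<lambda>t. \<bar>t\<bar> powr (-r)) has_integral (1 / (1 - r))) {0..1}"
    by (rule has_integral_eq[OF _ p0]) auto
  have p2: "((\<lambda>t. \<bar>t\<bar> powr (-r)) has_integral (1 / (1 - r))) {-1..0}"
    using has_integral_reflect_lemma_real[OF p1] by simp
  have p3: "((\<lambda>t. \<bar>t\<bar> powr (-r)) has_integral (1 / (1 - r) + 1 / (1 - r))) {-1..1}"
    by (rule has_integral_combine[OF _ _ p2 p1]) auto
  have "(\<integral>\<^sup>+t. ennreal (\<bar>t\<bar> powr (-r) * (1 - t\<^sup>2) powr (-1/2)) * indicator {-1<..<1} t \<partial>lborel)
     \<le> (\<integral>\<^sup>+t. 2 * (ennreal (\<bar>t\<bar> powr (-r)) * indicator {-1..1} t)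
          + 2 * (ennreal ((1 - \<bar>t\<bar>) powr (-(1/2))) * indicator {-1<..<1} t) \<partial>lborel)"
  proof (intro nn_integral_mono)
    fix t :: real
    show "ennreal (\<bar>t\<bar> powr (-r) * (1 - t\<^sup>2) powr (-1/2)) * indicator {-1<..<1} t \<le>
       2 * (ennreal (\<bar>t\<bar> powr (-r)) * indicator {-1..1} t)
          + 2 * (ennreal ((1 - \<bar>t\<bar>) powr (-(1/2))) * indicator {-1<..<1} t)"
    proof (cases "\<bar>t\<bar> < 1")
      case True
      have "ennreal (\<bar>t\<bar> powr (-r) * (1 - t\<^sup>2) powr (-1/2)) \<le> ennreal (2 * \<bar>t\<bar> powr (-r) + 2 * (1 - \<bar>t\<bar>) powr (-(1/2)))"
        by (rule ennreal_leI[OF bd[OF True]])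
      also have "\<dots> = 2 * ennreal (\<bar>t\<bar> powr (-r)) + 2 * ennreal ((1 - \<bar>t\<bar>) powr (-(1/2)))"
        by (simp add: ennreal_mult)
      finally show ?thesis using True by (auto simp: indicator_def)
    qed (auto simp: indicator_def)
  qed
  also have "\<dots> = 2 * (\<integral>\<^sup>+t. ennreal (\<bar>t\<bar> powr (-r)) * indicator {-1..1} t \<partial>lborel)
     + 2 * (\<integral>\<^sup>+t. ennreal ((1 - \<bar>t\<bar>) powr (-(1/2))) * indicator {-1<..<1} t \<partial>lborel)"
    by (subst nn_integral_add) (auto simp: nn_integral_cmult)
  also have "(\<integral>\<^sup>+t. ennreal (\<bar>t\<bar> powr (-r)) * indicator {-1..1} t \<partial>lborel) = ennreal (1 / (1 - r) + 1 / (1 - r))"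
    using p3 by (intro nn_integral_has_integral_lebesgue') auto
  also have "2 * \<dots> + 2 * (\<integral>\<^sup>+t. ennreal ((1 - \<bar>t\<bar>) powr (-(1/2))) * indicator {-1<..<1} t \<partial>lborel) < \<infinity>"
  proof -
    have "(\<integral>\<^sup>+t. ennreal ((1 - \<bar>t\<bar>) powr (-(1/2))) * indicator {-1<..<1} t \<partial>lborel) < \<infinity>"
      using nn_integral_powr_interval_le[of 1 "1/2"] by (auto intro: le_less_trans)
    thus ?thesis by (auto simp: ennreal_mult_less_top less_top)
  qed
  finally show ?thesis .
qed

text \<open>On the slice at height t, 1 - |v|^2 factors as (c - |s|)(c + |s|) with c = sqrt (1 -
  t^2). Bounding c + |s| below by c leaves an integrable power in s, and the slice integrals add up
  to the one-dimensional integral above.\<close>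

lemma nn_integral_disc_powr_finite:
  fixes r \<sigma> :: real
  assumes r: "0 \<le> r" "r < 1" and \<sigma>: "\<sigma> < 1"
  shows "(\<integral>\<^sup>+v. ennreal (\<bar>Im v\<bar> powr (-r) * (1 - (norm v)\<^sup>2) powr (-\<sigma>)) * indicator (ball 0 1) v \<partial>lborel) < \<infinity>"
proof -
  \<comment> \<open>A negative \<sigma> may be raised to 0, because the base is at most 1; with a
    nonnegative \<open>s0\<close> the power \<open>-s0\<close> is antitone in the base.\<close>
  define s0 where "s0 = max \<sigma> 0"
  have s0: "0 \<le> s0" "s0 < 1" "\<sigma> \<le> s0" using \<sigma> by (auto simp: s0_def)
  define K where "K = 2 * (2 powr (1 - s0) / (1 - s0))"
  have K: "K \<ge> 0" using s0 by (simp add: K_def)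
  have inner: "(\<integral>\<^sup>+s. ennreal (\<bar>t\<bar> powr (-r) * (1 - (norm (Complex s t))\<^sup>2) powr (-\<sigma>)) * indicator (ball 0 1) (Complex s t) \<partial>lborel)
      \<le> ennreal K * (ennreal (\<bar>t\<bar> powr (-r) * (1 - t\<^sup>2) powr (-1/2)) * indicator {-1<..<1} t)" (is "?L \<le> ?R") for t :: real
  proof (cases "\<bar>t\<bar> < 1")
    case False
    have "Complex s t \<notin> ball 0 1" for s
      using False abs_Im_le_cmod[of "Complex s t"] by auto
    thus ?thesis by simp
  next
    case True
    define c where "c = sqrt (1 - t\<^sup>2)"
    have c: "c > 0" "c \<le> 1" "c\<^sup>2 = 1 - t\<^sup>2"
      using True abs_square_less_1[of t] by (auto simp: c_def simp del: abs_square_less_1)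
    have ptw: "(1 - (norm (Complex s t))\<^sup>2) powr (-\<sigma>) \<le> c powr (-s0) * (c - \<bar>s\<bar>) powr (-s0)"
      and sc: "\<bar>s\<bar> < c" if "Complex s t \<in> ball 0 1" for s
    proof -
      have n: "(norm (Complex s t))\<^sup>2 = s\<^sup>2 + t\<^sup>2" by (simp add: cmod_power2)
      have "(norm (Complex s t))\<^sup>2 < 1" using that by (simp add: abs_square_less_1)
      hence "\<bar>s\<bar>\<^sup>2 < c\<^sup>2" using n c by simp
      thus sc: "\<bar>s\<bar> < c" using c by (meson power2_less_imp_less less_imp_le)
      have e: "1 - (norm (Complex s t))\<^sup>2 = (c - \<bar>s\<bar>) * (c + \<bar>s\<bar>)"
        using n c by (simp add: algebra_simps power2_eq_square)
      have "(1 - (norm (Complex s t))\<^sup>2) powr (-\<sigma>) \<le> (1 - (norm (Complex s t))\<^sup>2) powr (-s0)"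
        using s0 n by (intro powr_mono') (use \<open>(norm (Complex s t))\<^sup>2 < 1\<close> in auto)
      also have "\<dots> \<le> ((c - \<bar>s\<bar>) * c) powr (-s0)"
        unfolding e using sc c s0 by (intro powr_mono2' mult_left_mono) auto
      also have "\<dots> = c powr (-s0) * (c - \<bar>s\<bar>) powr (-s0)"
        using sc c by (simp add: powr_mult)
      finally show "(1 - (norm (Complex s t))\<^sup>2) powr (-\<sigma>) \<le> c powr (-s0) * (c - \<bar>s\<bar>) powr (-s0)" .
    qed
    have "?L \<le> (\<integral>\<^sup>+s. ennreal (\<bar>t\<bar> powr (-r) * c powr (-s0)) * (ennreal ((c - \<bar>s\<bar>) powr (-s0)) * indicator {-c<..<c} s) \<partial>lborel)"
    proof (intro nn_integral_mono)
      fix s :: real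
      show "ennreal (\<bar>t\<bar> powr (-r) * (1 - (norm (Complex s t))\<^sup>2) powr (-\<sigma>)) * indicator (ball 0 1) (Complex s t)
         \<le> ennreal (\<bar>t\<bar> powr (-r) * c powr (-s0)) * (ennreal ((c - \<bar>s\<bar>) powr (-s0)) * indicator {-c<..<c} s)"
      proof (cases "Complex s t \<in> ball 0 1")
        case True
        have "\<bar>t\<bar> powr (-r) * (1 - (norm (Complex s t))\<^sup>2) powr (-\<sigma>) \<le> \<bar>t\<bar> powr (-r) * (c powr (-s0) * (c - \<bar>s\<bar>) powr (-s0))"
          using ptw[OF True] by (intro mult_left_mono) auto
        thus ?thesis using True sc[OF True]
          by (auto simp: indicator_def mult.assoc ennreal_mult[symmetric] intro!: ennreal_leI)
      qed auto
    qed
    also have "\<dots> = ennreal (\<bar>t\<bar> powr (-r) * c powr (-s0)) * (\<integral>\<^sup>+s. (ennreal ((c - \<bar>s\<bar>) powr (-s0)) * indicator {-c<..<c} s) \<partial>lborel)"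
      by (rule nn_integral_cmult) auto
    also have "\<dots> \<le> ennreal (\<bar>t\<bar> powr (-r) * c powr (-s0)) * ennreal (2 * ((2 * c) powr (1 - s0) / (1 - s0)))"
      using nn_integral_powr_interval_le[of c s0] c s0 by (intro mult_left_mono) auto
    also have "\<dots> = ennreal (K * (\<bar>t\<bar> powr (-r) * (c powr (-s0) * c powr (1 - s0))))"
      using c s0 by (simp add: ennreal_mult[symmetric] K_def powr_mult field_simps)
    also have "\<dots> \<le> ennreal (K * (\<bar>t\<bar> powr (-r) * (1 - t\<^sup>2) powr (-1/2)))"
    proof -
      \<comment> \<open>The exponent 1 - 2 \<open>s0\<close> exceeds -1 and c <= 1;
        \<open>c powr (-1)\<close> is the endpoint weight (1 - t^2)^(-1/2).\<close>
      have "c powr (-s0) * c powr (1 - s0) \<le> c powr (-1)"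
        unfolding powr_add[symmetric] using c s0 by (intro powr_mono') auto
      also have "c powr (-1) = (1 - t\<^sup>2) powr (-1/2)"
        using c unfolding c(3)[symmetric] by (simp add: powr_minus powr_half_sqrt)
      finally show ?thesis
        using K by (intro ennreal_leI mult_left_mono) auto
    qed
    also have "\<dots> = ?R"
    proof -
      have "-1 < t" "t < 1" using True by auto
      thus ?thesis using K by (simp add: indicator_def ennreal_mult)
    qed
    finally show ?thesis .
  qed
  have m: "(\<lambda>v. ennreal (\<bar>Im v\<bar> powr (-r) * (1 - (norm v)\<^sup>2) powr (-\<sigma>)) * indicator (ball 0 1) v) \<in> borel_measurable borel"
    by measurable
  have "(\<integral>\<^sup>+v. ennreal (\<bar>Im v\<bar> powr (-r) * (1 - (norm v)\<^sup>2) powr (-\<sigma>)) * indicator (ball 0 1) v \<partial>lborel)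
     = (\<integral>\<^sup>+t. (\<integral>\<^sup>+s. ennreal (\<bar>t\<bar> powr (-r) * (1 - (norm (Complex s t))\<^sup>2) powr (-\<sigma>)) * indicator (ball 0 1) (Complex s t) \<partial>lborel) \<partial>lborel)"
    by (subst nn_integral_complex_rect) (use m in \<open>simp_all only: complex.sel\<close>)
  also have "\<dots> \<le> (\<integral>\<^sup>+t. ennreal K * (ennreal (\<bar>t\<bar> powr (-r) * (1 - t\<^sup>2) powr (-1/2)) * indicator {-1<..<1} t) \<partial>lborel)"
    by (intro nn_integral_mono inner)
  also have "\<dots> = ennreal K * (\<integral>\<^sup>+t. (ennreal (\<bar>t\<bar> powr (-r) * (1 - t\<^sup>2) powr (-1/2)) * indicator {-1<..<1} t) \<partial>lborel)"
    by (rule nn_integral_cmult) auto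
  also have "\<dots> < \<infinity>"
    using nn_integral_abs_powr_finite[OF r] by (auto simp: ennreal_mult_less_top less_top)
  finally show ?thesis .
qed

lemma AE_Im_nonzero: "AE v in (lborel :: complex measure). Im v \<noteq> 0"
proof -
  have [measurable]: "{v. Im v = 0} \<in> sets borel"
    by (intro borel_closed closed_Collect_eq continuous_intros)
  have "emeasure lborel {v. Im v = 0} = (\<integral>\<^sup>+v. indicator {v. Im v = 0} v \<partial>lborel)" by simp
  also have "\<dots> = (\<integral>\<^sup>+t. (\<integral>\<^sup>+s. indicator {0} t \<partial>(lborel::real measure)) \<partial>(lborel::real measure))"
    by (subst nn_integral_complex_rect) (auto simp: indicator_def intro!: nn_integral_cong)
  also have "\<dots> = 0" by (simp add: nn_integral_multc)
  finally have "{v. Im v = 0} \<in> null_sets lborel" by auto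
  thus ?thesis by (rule AE_I') auto
qed

text \<open>After a rotation b is real and nonnegative. Then |1 - b v| dominates half of |Im v| and
  half of 1 - |v|^2, so its power R is shared between the two; R + Q < 2 is what allows both
  resulting exponents to stay below 1.\<close>

lemma forelli_rudin_bounded:
  fixes R Q :: real
  assumes "Q < 1" "R \<ge> 0" "R + Q < 2"
  shows "\<exists>C\<ge>0. \<forall>b. norm b < 1 \<longrightarrow>
    (\<integral>\<^sup>+v. ennreal (norm (1 - cnj b * v) powr (-R) * (1 - (norm v)\<^sup>2) powr (-Q)) * indicator (ball 0 1) v \<partial>lborel) \<le> ennreal C"
proof -
  \<comment> \<open>If R < 1, everything goes to |Im v| and \<sigma> = Q. Otherwise the total R + Q
    is split evenly, or r = 0 when the total is negative; \<open>Q < 1 \<le> R\<close> gives r <=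
    R.\<close>
  define r where "r = (if R < 1 then R else max 0 ((R + Q) / 2))"
  define \<sigma> where "\<sigma> = R + Q - r"
  have r: "0 \<le> r" "r < 1" "r \<le> R" and \<sigma>: "\<sigma> < 1"
    using assms unfolding r_def \<sigma>_def by (auto simp: max_def field_simps)
  define I where "I = (\<integral>\<^sup>+v. ennreal (\<bar>Im v\<bar> powr (-r) * (1 - (norm v)\<^sup>2) powr (-\<sigma>)) * indicator (ball 0 1) v \<partial>lborel)"
  have I: "I < \<infinity>" unfolding I_def by (rule nn_integral_disc_powr_finite[OF r(1,2) \<sigma>])
  show ?thesis
  proof (intro exI[of _ "2 powr R * enn2real I"] conjI allI impI)
    fix b :: complex assume b: "norm b < 1"
    obtain c where c: "norm c = 1" "b = of_real (norm b) * c"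
      by (metis mult_1_right mult_zero_left norm_one norm_sgn of_real_0 scaleR_conv_of_real sgn_div_norm
            sgn_zero_iff norm_zero sgn_mult_self_eq rcis_cmod_Arg norm_cis rcis_def)
    have cc: "cnj b * (c * v) = of_real (norm b) * v" for v
    proof -
      have "cnj b * (c * v) = of_real (norm b) * (c * cnj c) * v"
        by (subst c(2)) (simp add: mult_ac)
      thus ?thesis using c(1) by (simp add: complex_norm_square[symmetric])
    qed
    have ptw: "norm (1 - of_real (norm b) * v) powr (-R) * (1 - (norm v)\<^sup>2) powr (-Q)
        \<le> 2 powr R * (\<bar>Im v\<bar> powr (-r) * (1 - (norm v)\<^sup>2) powr (-\<sigma>))" if v: "norm v < 1" "Im v \<noteq> 0" for v :: complex
    proof -
      define d where "d = norm (1 - of_real (norm b) * v)"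
      define m where "m = 1 - (norm v)\<^sup>2"
      have m: "m > 0" using one_minus_norm_sq_pos[OF v(1)] by (simp add: m_def)
      have dm: "m \<le> 2 * d"
        using one_minus_norm_sq_le[of "of_real (norm b)" v] b v by (simp add: d_def m_def)
      \<comment> \<open>The imaginary part of 1 - b v has modulus |b| |Im v|, useless for small b.
        Comparing with 1 - v instead costs (1 - |b|) |v|, which is again at most d.\<close>
      have "norm (1 - v) \<le> d + norm ((of_real (norm b) - 1) * v)"
        unfolding d_def by (rule order_trans[OF _ norm_triangle_ineq]) (simp add: algebra_simps)
      also have "norm ((of_real (norm b) - 1) * v) = (1 - norm b) * norm v"
      proof -
        have "norm (complex_of_real (norm b) - 1) = norm (complex_of_real (norm b - 1))" by simp
        also have "\<dots> = 1 - norm b" using b unfolding norm_of_real by simp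
        finally show ?thesis by (simp add: norm_mult)
      qed
      also have "\<dots> \<le> 1 - norm b * norm v"
        using v b by (simp add: algebra_simps)
      also have "\<dots> \<le> d"
        unfolding d_def using norm_triangle_ineq2[of 1 "of_real (norm b) * v"] by (simp add: norm_mult)
      finally have di: "\<bar>Im v\<bar> \<le> 2 * d"
        using abs_Im_le_cmod[of "1 - v"] by simp
      have d: "d > 0" using dm m by linarith
      have "(2 * d) powr (-r) * (2 * d) powr (-(R - r)) = (2 * d) powr (-R)"
        by (simp add: powr_add[symmetric])
      hence "d powr (-R) = 2 powr R * ((2 * d) powr (-r) * (2 * d) powr (-(R - r)))"
        using d by (simp add: powr_mult powr_minus)
      also have "\<dots> \<le> 2 powr R * (\<bar>Im v\<bar> powr (-r) * m powr (-(R - r)))"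
        using di dm m r v by (intro mult_left_mono mult_mono powr_mono2') auto
      finally have "d powr (-R) * m powr (-Q) \<le> 2 powr R * (\<bar>Im v\<bar> powr (-r) * m powr (-(R - r))) * m powr (-Q)"
        by (intro mult_right_mono) auto
      also have "\<dots> = 2 powr R * (\<bar>Im v\<bar> powr (-r) * m powr (-\<sigma>))"
        by (simp add: mult.assoc powr_add[symmetric] \<sigma>_def algebra_simps)
      finally show ?thesis by (simp add: d_def m_def)
    qed
    have "(\<integral>\<^sup>+v. ennreal (norm (1 - cnj b * v) powr (-R) * (1 - (norm v)\<^sup>2) powr (-Q)) * indicator (ball 0 1) v \<partial>lborel)
       = (\<integral>\<^sup>+v. ennreal (norm (1 - cnj b * (c * v)) powr (-R) * (1 - (norm (c * v))\<^sup>2) powr (-Q)) * indicator (ball 0 1) (c * v) \<partial>lborel)"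
      by (rule nn_integral_rotate[OF c(1), symmetric]) measurable
    also have "\<dots> = (\<integral>\<^sup>+(v::complex). ennreal (norm (1 - of_real (norm b) * v) powr (-R) * (1 - (norm v)\<^sup>2) powr (-Q)) * indicator (ball 0 1) v \<partial>lborel)"
      unfolding cc using c(1) by (simp add: norm_mult indicator_def)
    also have "\<dots> \<le> (\<integral>\<^sup>+(v::complex). ennreal (2 powr R) * (ennreal (\<bar>Im v\<bar> powr (-r) * (1 - (norm v)\<^sup>2) powr (-\<sigma>)) * indicator (ball 0 1) v) \<partial>lborel)"
      \<comment> \<open>\<open>0 powr (-r)\<close> is 0, so the majorant vanishes on the real axis
        and the pointwise bound holds only off this null set.\<close>
      using AE_Im_nonzero
      by (intro nn_integral_mono_AE, eventually_elim)
         (auto simp: indicator_def ennreal_mult[symmetric] intro!: ennreal_leI ptw)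
    also have "\<dots> = ennreal (2 powr R) * I"
      unfolding I_def by (rule nn_integral_cmult) auto
    also have "\<dots> = ennreal (2 powr R * enn2real I)"
      using I by (simp add: ennreal_mult less_top)
    finally show "(\<integral>\<^sup>+v. ennreal (norm (1 - cnj b * v) powr (-R) * (1 - (norm v)\<^sup>2) powr (-Q)) * indicator (ball 0 1) v \<partial>lborel)
       \<le> ennreal (2 powr R * enn2real I)" .
  qed auto
qed

text \<open>Substituting \<open>mob b\<close> pulls out B^(2-R-Q) with B = 1 - |b|^2 and turns the
  kernel power into |1 - cnj b v|^(R+2Q-4). That exponent is nonnegative by assumption, so this
  factor is bounded by a power of 2 and only the mass of (1 - |v|^2)^(-Q) remains.\<close>

lemma forelli_rudin_growth:
  fixes R Q :: real
  assumes "Q < 1" "R + 2 * Q \<ge> 4"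
  shows "\<exists>C\<ge>0. \<forall>b. norm b < 1 \<longrightarrow>
    (\<integral>\<^sup>+v. ennreal (norm (1 - cnj b * v) powr (-R) * (1 - (norm v)\<^sup>2) powr (-Q)) * indicator (ball 0 1) v \<partial>lborel)
      \<le> ennreal (C * (1 - (norm b)\<^sup>2) powr (2 - R - Q))"
proof -
  obtain C where C: "C \<ge> 0" "\<And>b. norm b < 1 \<Longrightarrow>
    (\<integral>\<^sup>+v. ennreal (norm (1 - cnj b * v) powr 0 * (1 - (norm v)\<^sup>2) powr (-Q)) * indicator (ball 0 1) v \<partial>lborel) \<le> ennreal C"
    using forelli_rudin_bounded[of Q 0] assms by auto
  define k where "k = R + 2 * Q - 4"
  show ?thesis
  proof (intro exI[of _ "2 powr k * C"] conjI allI impI)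
    fix b :: complex assume b: "norm b < 1"
    define B where "B = 1 - (norm b)\<^sup>2"
    have B: "B > 0" using one_minus_norm_sq_pos[OF b] by (simp add: B_def)
    have ptw: "norm (1 - cnj b * mob b v) powr (-R) * (1 - (norm (mob b v))\<^sup>2) powr (-Q) * (B / (norm (1 - cnj b * v))\<^sup>2)\<^sup>2
       \<le> (2 powr k * B powr (2 - R - Q)) * (norm (1 - cnj b * v) powr 0 * (1 - (norm v)\<^sup>2) powr (-Q))" if v: "norm v < 1" for v
    proof -
      define d where "d = norm (1 - cnj b * v)"
      define m where "m = 1 - (norm v)\<^sup>2"
      have m: "m > 0" using one_minus_norm_sq_pos[OF v] by (simp add: m_def)
      have d: "d > 0" "d \<le> 2"
        using one_minus_cnj_mult_nz[OF b v] one_minus_cnj_mult_norm_le[OF b v] by (auto simp: d_def)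
      have e1: "norm (1 - cnj b * mob b v) = B / d"
        using B unfolding one_minus_cnj_mult_mob[OF b v] d_def B_def norm_divide norm_of_real by simp
      have e2: "1 - (norm (mob b v))\<^sup>2 = B * m / d\<^sup>2"
        unfolding one_minus_norm_sq_mob[OF b v] by (simp add: B_def m_def d_def)
      have e3: "(B / d\<^sup>2)\<^sup>2 = B powr 2 * d powr (-4)"
        using B d by (simp add: powr_minus powr_numeral field_simps)
      have e4: "d\<^sup>2 powr x = d powr (2 * x)" for x
        using d by (simp add: powr_powr flip: powr_numeral)
      have "(B / d) powr (-R) * (B * m / d\<^sup>2) powr (-Q) * (B / d\<^sup>2)\<^sup>2
         = B powr (2 - R - Q) * (d powr k * m powr (-Q))"
        unfolding e3 using B d m
        by (simp add: e4 powr_divide powr_mult powr_powr powr_minus_divide powr_diff powr_add k_def field_simps powr_mult_base)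
      also have "\<dots> \<le> B powr (2 - R - Q) * (2 powr k * m powr (-Q))"
        using d assms by (intro mult_left_mono mult_right_mono powr_mono2) (auto simp: k_def)
      also have "\<dots> = (2 powr k * B powr (2 - R - Q)) * (d powr 0 * m powr (-Q))" using d by simp
      finally show ?thesis unfolding e1 e2 by (simp add: d_def m_def)
    qed
    have "(\<integral>\<^sup>+v. ennreal (norm (1 - cnj b * v) powr (-R) * (1 - (norm v)\<^sup>2) powr (-Q)) * indicator (ball 0 1) v \<partial>lborel)
      = (\<integral>\<^sup>+v. ennreal (norm (1 - cnj b * mob b v) powr (-R) * (1 - (norm (mob b v))\<^sup>2) powr (-Q)) * ennreal ((B / (norm (1 - cnj b * v))\<^sup>2)\<^sup>2) * indicator (ball 0 1) v \<partial>lborel)"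
      unfolding B_def by (rule nn_integral_mob[OF b, symmetric]) auto
    also have "\<dots> \<le> (\<integral>\<^sup>+v. ennreal (2 powr k * B powr (2 - R - Q)) *
          (ennreal (norm (1 - cnj b * v) powr 0 * (1 - (norm v)\<^sup>2) powr (-Q)) * indicator (ball 0 1) v) \<partial>lborel)"
      using ptw by (intro nn_integral_mono)
        (auto simp: indicator_def ennreal_mult[symmetric] simp del: powr_zero_eq_one intro!: ennreal_leI)
    also have "\<dots> = ennreal (2 powr k * B powr (2 - R - Q)) *
          (\<integral>\<^sup>+v. (ennreal (norm (1 - cnj b * v) powr 0 * (1 - (norm v)\<^sup>2) powr (-Q)) * indicator (ball 0 1) v) \<partial>lborel)"
      by (rule nn_integral_cmult) auto
    also have "\<dots> \<le> ennreal (2 powr k * B powr (2 - R - Q)) * ennreal C"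
      by (intro mult_left_mono C b) auto
    also have "\<dots> = ennreal (2 powr k * C * (1 - (norm b)\<^sup>2) powr (2 - R - Q))"
      using C by (simp add: ennreal_mult[symmetric] B_def mult_ac)
    finally show "(\<integral>\<^sup>+v. ennreal (norm (1 - cnj b * v) powr (-R) * (1 - (norm v)\<^sup>2) powr (-Q)) * indicator (ball 0 1) v \<partial>lborel)
       \<le> ennreal (2 powr k * C * (1 - (norm b)\<^sup>2) powr (2 - R - Q))" .
  qed (use C in auto)
qed

section \<open>Integrals over the whole plane and elementary comparison of powers\<close>

lemma nn_integral_one_plus_sq_powr_finite:
  fixes \<kappa> :: real
  assumes "\<kappa> > 1/2"
  shows "(\<integral>\<^sup>+t. ennreal ((1 + t\<^sup>2) powr (-\<kappa>)) \<partial>lborel) < \<infinity>"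
proof -
  have p: "((\<lambda>t. t powr (-(2 * \<kappa>))) has_integral (-(1 powr (-(2 * \<kappa>) + 1)) / (-(2 * \<kappa>) + 1))) {1..}"
    using assms by (intro has_integral_powr_to_inf) auto
  define L where "L = (-(1 powr (-(2 * \<kappa>) + 1)) / (-(2 * \<kappa>) + 1))"
  have p1: "(\<integral>\<^sup>+t. ennreal (t powr (-(2 * \<kappa>))) * indicator {1..} t \<partial>lborel) = ennreal L"
    unfolding L_def using p by (intro nn_integral_has_integral_lebesgue') auto
  have p2: "(\<integral>\<^sup>+t. ennreal ((-t) powr (-(2 * \<kappa>))) * indicator {1..} (-t) \<partial>lborel) = ennreal L"
  proof -
    have "(\<integral>\<^sup>+t. ennreal ((-t) powr (-(2 * \<kappa>))) * indicator {1..} (-t) \<partial>lborel)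
        = (\<integral>\<^sup>+t. ennreal (t powr (-(2 * \<kappa>))) * indicator {1..} t \<partial>distr lborel borel uminus)"
      by (subst nn_integral_distr) auto
    thus ?thesis using p1 by (simp add: lborel_distr_uminus)
  qed
  have "(\<integral>\<^sup>+t. ennreal ((1 + t\<^sup>2) powr (-\<kappa>)) \<partial>lborel) \<le>
    (\<integral>\<^sup>+t. indicator {-1..1} t + (ennreal (t powr (-(2 * \<kappa>))) * indicator {1..} t
        + ennreal ((-t) powr (-(2 * \<kappa>))) * indicator {1..} (-t)) \<partial>lborel)"
  proof (intro nn_integral_mono)
    fix t :: real
    have a: "(1 + t\<^sup>2) powr (-\<kappa>) \<le> 1"
      using assms powr_mono2'[of "-\<kappa>" 1 "1 + t\<^sup>2"] by auto
    have b: "(1 + t\<^sup>2) powr (-\<kappa>) \<le> \<bar>t\<bar> powr (-(2 * \<kappa>))" if "\<bar>t\<bar> \<ge> 1"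
    proof -
      have "(1 + t\<^sup>2) powr (-\<kappa>) \<le> (\<bar>t\<bar> powr 2) powr (-\<kappa>)"
        using that assms by (intro powr_mono2') (auto simp: powr_numeral)
      also have "(\<bar>t\<bar> powr 2) powr (-\<kappa>) = \<bar>t\<bar> powr (-(2 * \<kappa>))"
        by (simp only: powr_powr mult_minus_right)
      finally show ?thesis .
    qed
    consider "\<bar>t\<bar> \<le> 1" | "t > 1" | "t < -1" by linarith
    thus "ennreal ((1 + t\<^sup>2) powr (-\<kappa>)) \<le> indicator {-1..1} t + (ennreal (t powr (-(2 * \<kappa>))) * indicator {1..} t
        + ennreal ((-t) powr (-(2 * \<kappa>))) * indicator {1..} (-t))"
    proof cases
      case 1
      hence "ennreal ((1 + t\<^sup>2) powr (-\<kappa>)) \<le> indicator {-1..1} t"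
        using a by (auto simp: indicator_def)
      thus ?thesis by (rule order_trans) auto
    next
      case 2 thus ?thesis using b by (auto intro!: ennreal_leI)
    next
      case 3 thus ?thesis using b by (auto intro!: ennreal_leI)
    qed
  qed
  also have "\<dots> = 2 + (ennreal L + ennreal L)"
    by (subst nn_integral_add) (auto simp: nn_integral_add p1 p2)
  also have "\<dots> < \<infinity>" by (simp add: ennreal_add_eq_top less_top)
  finally show ?thesis .
qed

text \<open>Scaling v by sqrt \<epsilon> gives \<epsilon>^(-E) from the integrand and \<epsilon>
  from the area. The remaining constant is finite because (1 + s^2)(1 + t^2) <= (1 + s^2 + t^2)^2
  separates real and imaginary part, and E > 1.\<close>

lemma nn_integral_eps_plus_norm_sq_powr:
  fixes E :: real
  assumes "E > 1"
  shows "\<exists>C\<ge>0. \<forall>\<epsilon>>0. (\<integral>\<^sup>+v. ennreal ((\<epsilon> + (norm (v::complex))\<^sup>2) powr (-E)) \<partial>lborel) \<le> ennreal (C * \<epsilon> powr (1 - E))"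
proof -
  define J where "J = (\<integral>\<^sup>+t. ennreal ((1 + t\<^sup>2) powr (-(E/2))) \<partial>(lborel :: real measure))"
  have J: "J < \<infinity>" unfolding J_def using assms by (intro nn_integral_one_plus_sq_powr_finite) auto
  define I where "I = (\<integral>\<^sup>+v. ennreal ((1 + (norm (v::complex))\<^sup>2) powr (-E)) \<partial>lborel)"
  have ptw: "(1 + (norm (Complex s t))\<^sup>2) powr (-E) \<le> (1 + s\<^sup>2) powr (-(E/2)) * (1 + t\<^sup>2) powr (-(E/2))" for s t
  proof -
    have "(1 + s\<^sup>2) * (1 + t\<^sup>2) \<le> (1 + (s\<^sup>2 + t\<^sup>2))\<^sup>2"
    proof -
      have "(1 + (s\<^sup>2 + t\<^sup>2))\<^sup>2 - (1 + s\<^sup>2) * (1 + t\<^sup>2) = s\<^sup>2 + t\<^sup>2 + (s\<^sup>2)\<^sup>2 + (t\<^sup>2)\<^sup>2 + s\<^sup>2 * t\<^sup>2"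
        by algebra
      moreover have "s\<^sup>2 + t\<^sup>2 + (s\<^sup>2)\<^sup>2 + (t\<^sup>2)\<^sup>2 + s\<^sup>2 * t\<^sup>2 \<ge> 0" by simp
      ultimately show ?thesis by linarith
    qed
    hence "((1 + (s\<^sup>2 + t\<^sup>2))\<^sup>2) powr (-(E/2)) \<le> ((1 + s\<^sup>2) * (1 + t\<^sup>2)) powr (-(E/2))"
      using assms by (intro powr_mono2') (auto intro!: mult_pos_pos add_pos_nonneg)
    moreover have "((1 + (s\<^sup>2 + t\<^sup>2))\<^sup>2) powr (-(E/2)) = (1 + (s\<^sup>2 + t\<^sup>2)) powr (-E)"
      by (simp add: powr_powr flip: powr_numeral)
    ultimately show ?thesis by (simp add: cmod_power2 powr_mult)
  qed
  have "I = (\<integral>\<^sup>+t. (\<integral>\<^sup>+s. ennreal ((1 + (norm (Complex s t))\<^sup>2) powr (-E)) \<partial>lborel) \<partial>lborel)"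
    unfolding I_def by (rule nn_integral_complex_rect) auto
  also have "\<dots> \<le> (\<integral>\<^sup>+t. (\<integral>\<^sup>+s. ennreal ((1 + s\<^sup>2) powr (-(E/2))) * ennreal ((1 + t\<^sup>2) powr (-(E/2))) \<partial>lborel) \<partial>lborel)"
    by (intro nn_integral_mono) (auto simp: ennreal_mult[symmetric] intro!: ennreal_leI ptw)
  also have "\<dots> = J * J"
    by (simp add: nn_integral_multc nn_integral_cmult J_def)
  also have "\<dots> < \<infinity>" using J by (simp add: ennreal_mult_less_top)
  finally have I: "I < \<infinity>" .
  show ?thesis
  proof (intro exI[of _ "enn2real I"] conjI allI impI)
    fix \<epsilon> :: real assume \<epsilon>: "\<epsilon> > 0"
    have "(\<integral>\<^sup>+v. ennreal ((\<epsilon> + (norm (v::complex))\<^sup>2) powr (-E)) \<partial>lborel)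
       = (\<integral>\<^sup>+(v::complex). ennreal ((\<epsilon> + (norm (of_real (sqrt \<epsilon>) * v))\<^sup>2) powr (-E)) * ennreal ((norm (complex_of_real (sqrt \<epsilon>)))\<^sup>2) \<partial>lborel)"
      using \<epsilon> by (subst nn_integral_complex_mult) auto
    also have "\<dots> = (\<integral>\<^sup>+(v::complex). ennreal (\<epsilon> powr (1 - E)) * ennreal ((1 + (norm v)\<^sup>2) powr (-E)) \<partial>lborel)"
    proof (intro nn_integral_cong)
      fix v :: complex
      have "(\<epsilon> + (norm (of_real (sqrt \<epsilon>) * v))\<^sup>2) powr (-E) * (norm (complex_of_real (sqrt \<epsilon>)))\<^sup>2 = (\<epsilon> * (1 + (norm v)\<^sup>2)) powr (-E) * \<epsilon>"
        using \<epsilon> by (simp add: norm_mult power_mult_distrib algebra_simps)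
      also have "\<dots> = \<epsilon> powr (1 - E) * (1 + (norm v)\<^sup>2) powr (-E)"
        using \<epsilon> unfolding powr_mult[of \<epsilon> "1 + (norm v)\<^sup>2"]
        by (simp add: powr_diff powr_minus field_simps)
      finally show "ennreal ((\<epsilon> + (norm (of_real (sqrt \<epsilon>) * v))\<^sup>2) powr (-E)) * ennreal ((norm (complex_of_real (sqrt \<epsilon>)))\<^sup>2)
          = ennreal (\<epsilon> powr (1 - E)) * ennreal ((1 + (norm v)\<^sup>2) powr (-E))"
        by (simp add: ennreal_mult[symmetric])
    qed
    also have "\<dots> = ennreal (\<epsilon> powr (1 - E)) * I"
      unfolding I_def by (rule nn_integral_cmult) auto
    also have "\<dots> = ennreal (enn2real I * \<epsilon> powr (1 - E))"
      using I by (simp add: ennreal_mult less_top mult.commute)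
    finally show "(\<integral>\<^sup>+v. ennreal ((\<epsilon> + (norm (v::complex))\<^sup>2) powr (-E)) \<partial>lborel) \<le> ennreal (enn2real I * \<epsilon> powr (1 - E))"
      by simp
  qed auto
qed

text \<open>Weighted AM-GM with weights \<beta> and 1 - \<beta> gives s^\<beta> <= \<beta> s + (1 -
  \<beta>), the tangent line bound at s = 1.\<close>

lemma one_minus_powr_le:
  fixes s \<beta> :: real
  assumes "0 \<le> s" "s \<le> 1" "0 < \<beta>" "\<beta> \<le> 1"
  shows "\<beta> * (1 - s) \<le> 1 - s powr \<beta>" "1 - s powr \<beta> \<le> 1 - s"
proof -
  have "s powr \<beta> * 1 powr (1 - \<beta>) \<le> \<beta> * s + (1 - \<beta>) * 1"
    using Youngs_inequality_0[of \<beta> "1 - \<beta>" s 1] assms by (cases "s = 0") auto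
  thus "\<beta> * (1 - s) \<le> 1 - s powr \<beta>" by (simp add: algebra_simps)
  have "s powr 1 \<le> s powr \<beta>"
    using assms by (intro powr_mono') auto
  thus "1 - s powr \<beta> \<le> 1 - s" using assms by simp
qed

text \<open>For \<beta> > 1 the previous lemma is applied to s^\<beta> with exponent 1/\<beta>. With
  \<beta> = 1/\<alpha> and s = |x|^2 the result makes \<open>wt x\<close> comparable to 1 -
  |x|^2.\<close>

lemma one_minus_powr_bounds:
  fixes s \<beta> :: real
  assumes "0 \<le> s" "s \<le> 1" "0 < \<beta>"
  shows "min 1 \<beta> * (1 - s) \<le> 1 - s powr \<beta>" "1 - s powr \<beta> \<le> max 1 \<beta> * (1 - s)"
proof -
  have "min 1 \<beta> * (1 - s) \<le> 1 - s powr \<beta> \<and> 1 - s powr \<beta> \<le> max 1 \<beta> * (1 - s)"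
  proof (cases "\<beta> \<le> 1")
    case True
    thus ?thesis using one_minus_powr_le[of s \<beta>] assms by (simp add: min_def max_def)
  next
    case False
    have s: "s powr \<beta> \<le> 1" using powr_mono2[of \<beta> s 1] assms by simp
    have e: "(s powr \<beta>) powr (1 / \<beta>) = s" using assms False by (simp add: powr_powr)
    have "1 / \<beta> * (1 - s powr \<beta>) \<le> 1 - s" "1 - s \<le> 1 - s powr \<beta>"
      using one_minus_powr_le[of "s powr \<beta>" "1 / \<beta>"] s assms False unfolding e by auto
    thus ?thesis using False assms by (simp add: min_def max_def field_simps)
  qed
  thus "min 1 \<beta> * (1 - s) \<le> 1 - s powr \<beta>" "1 - s powr \<beta> \<le> max 1 \<beta> * (1 - s)" by auto
qed

text \<open>The modulus of the derivative of \<open>mob a\<close>, and at the same time the factor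
  by which \<open>mob a\<close> multiplies 1 - |x|^2.\<close>

definition mobd :: "complex \<Rightarrow> complex \<Rightarrow> real" where
  "mobd a x = (1 - (norm a)\<^sup>2) / (norm (1 - cnj a * x))\<^sup>2"

lemma borel_measurable_mobd[measurable]: "mobd a \<in> borel_measurable borel"
  unfolding mobd_def[abs_def] by measurable

lemma mobd_pos: "norm a < 1 \<Longrightarrow> norm x < 1 \<Longrightarrow> mobd a x > 0"
  unfolding mobd_def using one_minus_norm_sq_pos one_minus_cnj_mult_nz by simp

lemma one_minus_norm_sq_mob_eq_mobd: "norm a < 1 \<Longrightarrow> norm x < 1 \<Longrightarrow> 1 - (norm (mob a x))\<^sup>2 = mobd a x * (1 - (norm x)\<^sup>2)"
  by (simp add: one_minus_norm_sq_mob mobd_def)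

lemma mobd_mob: "norm a < 1 \<Longrightarrow> norm x < 1 \<Longrightarrow> mobd a (mob a x) = 1 / mobd a x"
  using one_minus_norm_sq_pos[of a] one_minus_cnj_mult_nz[of a x]
  unfolding mobd_def one_minus_cnj_mult_mob norm_divide norm_of_real
  by (simp add: power2_eq_square divide_simps)

lemma nn_integral_mobd:
  assumes "norm a < 1" "g \<in> borel_measurable borel"
  shows "(\<integral>\<^sup>+x. g (mob a x) * ennreal ((mobd a x)\<^sup>2) * indicator (ball 0 1) x \<partial>lborel)
      = (\<integral>\<^sup>+x. g x * indicator (ball 0 1) x \<partial>lborel)"
  using nn_integral_mob[OF assms] by (simp only: mobd_def)

section \<open>Fibrewise change of variables on pairs of complex numbers\<close>

lemma borel_measurable_fst_borel[measurable]: "fst \<in> borel_measurable (borel :: ('a::topological_space \<times> 'b::topological_space) measure)"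
  by (intro borel_measurable_continuous_onI continuous_intros)

lemma borel_measurable_snd_borel[measurable]: "snd \<in> borel_measurable (borel :: ('a::topological_space \<times> 'b::topological_space) measure)"
  by (intro borel_measurable_continuous_onI continuous_intros)

lemma nn_integral_lborel_fst_snd:
  assumes [measurable]: "f \<in> borel_measurable borel"
  shows "(\<integral>\<^sup>+w. f w \<partial>(lborel :: ('a::euclidean_space \<times> 'b::euclidean_space) measure)) = (\<integral>\<^sup>+x. (\<integral>\<^sup>+y. f (x, y) \<partial>lborel) \<partial>lborel)"
proof -
  have m: "f \<in> borel_measurable (lborel \<Otimes>\<^sub>M lborel)" by (simp add: lborel_prod)
  show ?thesis
    unfolding lborel.nn_integral_fst[OF m] by (simp add: lborel_prod)
qed

lemma nn_integral_lborel_swap: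
  assumes [measurable]: "f \<in> borel_measurable borel"
  shows "(\<integral>\<^sup>+w. f (snd w, fst w) \<partial>(lborel :: ('a::euclidean_space \<times> 'b::euclidean_space) measure)) = (\<integral>\<^sup>+w. f w \<partial>lborel)"
proof -
  have m: "f \<in> borel_measurable (lborel \<Otimes>\<^sub>M lborel)" by (simp add: lborel_prod)
  have sm[measurable]: "(\<lambda>w::'a\<times>'b. (snd w, fst w)) \<in> borel_measurable borel"
    by (intro borel_measurable_continuous_onI continuous_intros)
  have "(\<integral>\<^sup>+w. f (snd w, fst w) \<partial>(lborel :: ('a \<times> 'b) measure)) = (\<integral>\<^sup>+x. (\<integral>\<^sup>+y. f (y, x) \<partial>lborel) \<partial>lborel)"
    by (subst nn_integral_lborel_fst_snd) auto
  also have "\<dots> = (\<integral>\<^sup>+w. f w \<partial>(lborel \<Otimes>\<^sub>M lborel))"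
    by (rule lborel_pair.nn_integral_snd[OF m])
  finally show ?thesis by (simp add: lborel_prod)
qed

text \<open>A skew product changes volume by k^2 in the base and by |g|^2 in the linear fibre, so
  Fubini is enough. Asking of \<open>g\<close> only measurability and no zeros admits
  \<open>phi_a\<close>, whose fibre factor is in general not holomorphic.\<close>

lemma nn_integral_skew:
  fixes m g :: "complex \<Rightarrow> complex" and k :: "complex \<Rightarrow> real"
  assumes base: "\<And>f. f \<in> borel_measurable borel \<Longrightarrow>
      (\<integral>\<^sup>+x. f (m x) * ennreal ((k x)\<^sup>2) * indicator D x \<partial>lborel) = (\<integral>\<^sup>+x. f x * indicator D x \<partial>lborel)"
    and mg[measurable]: "m \<in> borel_measurable borel" "g \<in> borel_measurable borel" "k \<in> borel_measurable borel"
    and W[measurable]: "W \<in> sets borel" "D \<in> sets borel" and WD: "\<And>x y. (x, y) \<in> W \<Longrightarrow> x \<in> D"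
    and iff: "\<And>x y. x \<in> D \<Longrightarrow> (m x, g x * y) \<in> W \<longleftrightarrow> (x, y) \<in> W"
    and nz: "\<And>x. x \<in> D \<Longrightarrow> g x \<noteq> 0"
    and F[measurable]: "F \<in> borel_measurable borel"
  shows "(\<integral>\<^sup>+w. F (m (fst w), g (fst w) * snd w) * ennreal ((k (fst w) * norm (g (fst w)))\<^sup>2) * indicator W w \<partial>lborel)
      = (\<integral>\<^sup>+w. F w * indicator W w \<partial>lborel)"
proof -
  define G where "G w = F w * indicator W w" for w
  have G[measurable]: "G \<in> borel_measurable borel" unfolding G_def by measurable
  define H where "H x = (\<integral>\<^sup>+y. G (x, y) \<partial>lborel)" for x
  have H[measurable]: "H \<in> borel_measurable borel"
    unfolding H_def using lborel.borel_measurable_nn_integral_fst[of G lborel] G by (simp add: lborel_prod)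
  have pm[measurable]: "(\<lambda>w::complex\<times>complex. (m (fst w), g (fst w) * snd w)) \<in> borel_measurable borel"
    by measurable
  have "(\<integral>\<^sup>+w. F (m (fst w), g (fst w) * snd w) * ennreal ((k (fst w) * norm (g (fst w)))\<^sup>2) * indicator W w \<partial>lborel)
     = (\<integral>\<^sup>+w. G (m (fst w), g (fst w) * snd w) * ennreal ((norm (g (fst w)))\<^sup>2) * (ennreal ((k (fst w))\<^sup>2) * indicator D (fst w)) \<partial>lborel)"
  proof (intro nn_integral_cong)
    fix w :: "complex \<times> complex"
    show "F (m (fst w), g (fst w) * snd w) * ennreal ((k (fst w) * norm (g (fst w)))\<^sup>2) * indicator W w =
       G (m (fst w), g (fst w) * snd w) * ennreal ((norm (g (fst w)))\<^sup>2) * (ennreal ((k (fst w))\<^sup>2) * indicator D (fst w))"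
      using iff[of "fst w" "snd w"] WD[of "fst w" "snd w"]
      by (cases "fst w \<in> D"; cases "w \<in> W") (auto simp: G_def power_mult_distrib ennreal_mult mult_ac)
  qed
  also have "\<dots> = (\<integral>\<^sup>+x. (\<integral>\<^sup>+y. G (m x, g x * y) * ennreal ((norm (g x))\<^sup>2) * (ennreal ((k x)\<^sup>2) * indicator D x) \<partial>lborel) \<partial>lborel)"
  proof -
    have [measurable]: "G \<in> borel_measurable (borel \<Otimes>\<^sub>M borel)" by (simp add: borel_prod)
    have "(\<lambda>w. G (m (fst w), g (fst w) * snd w) * ennreal ((norm (g (fst w)))\<^sup>2) * (ennreal ((k (fst w))\<^sup>2) * indicator D (fst w)))
        \<in> borel_measurable (borel \<Otimes>\<^sub>M borel)" by measurable
    from nn_integral_lborel_fst_snd[OF this[unfolded borel_prod]] show ?thesis by simp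
  qed
  also have "\<dots> = (\<integral>\<^sup>+x. H (m x) * ennreal ((k x)\<^sup>2) * indicator D x \<partial>lborel)"
  proof (intro nn_integral_cong)
    fix x :: complex
    have my: "(\<lambda>y. G (m x, y)) \<in> borel_measurable borel" by measurable
    have "(\<integral>\<^sup>+y. G (m x, g x * y) * ennreal ((norm (g x))\<^sup>2) * (ennreal ((k x)\<^sup>2) * indicator D x) \<partial>lborel)
      = (\<integral>\<^sup>+y. G (m x, g x * y) * ennreal ((norm (g x))\<^sup>2) \<partial>lborel) * (ennreal ((k x)\<^sup>2) * indicator D x)"
      by (rule nn_integral_multc) measurable
    also have "\<dots> = H (m x) * (ennreal ((k x)\<^sup>2) * indicator D x)"
      using nn_integral_complex_mult[OF nz my, of x] by (cases "x \<in> D") (auto simp: H_def)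
    finally show "(\<integral>\<^sup>+y. G (m x, g x * y) * ennreal ((norm (g x))\<^sup>2) * (ennreal ((k x)\<^sup>2) * indicator D x) \<partial>lborel)
      = H (m x) * ennreal ((k x)\<^sup>2) * indicator D x" by (simp add: mult.assoc)
  qed
  also have "\<dots> = (\<integral>\<^sup>+x. H x * indicator D x \<partial>lborel)" by (rule base[OF H])
  also have "\<dots> = (\<integral>\<^sup>+x. H x \<partial>lborel)"
  proof (intro nn_integral_cong)
    fix x :: complex
    have "G (x, y) = 0" if "x \<notin> D" for y
      using that WD[of x y] by (auto simp: G_def indicator_def)
    thus "H x * indicator D x = H x" by (cases "x \<in> D") (auto simp: H_def)
  qed
  also have "\<dots> = (\<integral>\<^sup>+w. G w \<partial>lborel)"
    unfolding H_def by (subst nn_integral_lborel_fst_snd) auto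
  finally show ?thesis by (simp add: G_def)
qed

lemma nn_integral_skew_swap:
  fixes m g :: "complex \<Rightarrow> complex" and k :: "complex \<Rightarrow> real"
  assumes base: "\<And>f. f \<in> borel_measurable borel \<Longrightarrow>
      (\<integral>\<^sup>+x. f (m x) * ennreal ((k x)\<^sup>2) * indicator D x \<partial>lborel) = (\<integral>\<^sup>+x. f x * indicator D x \<partial>lborel)"
    and mg[measurable]: "m \<in> borel_measurable borel" "g \<in> borel_measurable borel" "k \<in> borel_measurable borel"
    and W[measurable]: "W \<in> sets borel" "D \<in> sets borel" and WD: "\<And>x y. (y, x) \<in> W \<Longrightarrow> x \<in> D"
    and iff: "\<And>x y. x \<in> D \<Longrightarrow> (g x * y, m x) \<in> W \<longleftrightarrow> (y, x) \<in> W"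
    and nz: "\<And>x. x \<in> D \<Longrightarrow> g x \<noteq> 0"
    and F[measurable]: "F \<in> borel_measurable borel"
  shows "(\<integral>\<^sup>+w. F (g (snd w) * fst w, m (snd w)) * ennreal ((k (snd w) * norm (g (snd w)))\<^sup>2) * indicator W w \<partial>lborel)
      = (\<integral>\<^sup>+w. F w * indicator W w \<partial>lborel)"
proof -
  define W' where "W' = {w. (snd w, fst w) \<in> W}"
  have sm[measurable]: "(\<lambda>w::complex\<times>complex. (snd w, fst w)) \<in> borel_measurable borel"
    by (intro borel_measurable_continuous_onI continuous_intros)
  have W'm[measurable]: "W' \<in> sets borel"
    using measurable_sets_borel[OF sm W(1)] by (simp add: W'_def vimage_def)
  have pm[measurable]: "(\<lambda>w::complex\<times>complex. (g (snd w) * fst w, m (snd w))) \<in> borel_measurable borel"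
    by measurable
  have iw: "indicator W' w = (indicator W (snd w, fst w) :: ennreal)" for w by (auto simp: W'_def indicator_def)
  have "(\<integral>\<^sup>+w. F (g (snd w) * fst w, m (snd w)) * ennreal ((k (snd w) * norm (g (snd w)))\<^sup>2) * indicator W w \<partial>lborel)
     = (\<integral>\<^sup>+w. F (g (fst w) * snd w, m (fst w)) * ennreal ((k (fst w) * norm (g (fst w)))\<^sup>2) * indicator W (snd w, fst w) \<partial>lborel)"
  proof -
    have [measurable]: "F \<in> borel_measurable (borel \<Otimes>\<^sub>M borel)"
      unfolding borel_prod by (rule F)
    have [measurable]: "W \<in> sets (borel \<Otimes>\<^sub>M borel)"
      unfolding borel_prod by (rule W(1))
    have "(\<lambda>w. F (g (snd w) * fst w, m (snd w)) * ennreal ((k (snd w) * norm (g (snd w)))\<^sup>2) * indicator W w)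
        \<in> borel_measurable (borel \<Otimes>\<^sub>M borel)" by measurable
    from nn_integral_lborel_swap[OF this[unfolded borel_prod]] show ?thesis by simp
  qed
  also have "\<dots> = (\<integral>\<^sup>+w. F (snd w, fst w) * indicator W (snd w, fst w) \<partial>lborel)"
    unfolding iw[symmetric]
    using nn_integral_skew[where F = "\<lambda>w. F (snd w, fst w)" and W = W' and D = D, OF base mg W'm W(2)] WD iff nz
    by (simp add: W'_def)
  also have "\<dots> = (\<integral>\<^sup>+w. F w * indicator W w \<partial>lborel)"
    by (rule nn_integral_lborel_swap) measurable
  finally show ?thesis .
qed

text \<open>The derivatives along 1 and i are D and i D, and (D - i (i D)) / 2 = D.\<close>

lemma wirtinger_eq_deriv:
  assumes "(g has_field_derivative D) (at z)"
  shows "wirtinger g z = D"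
proof -
  have g: "(g has_derivative (\<lambda>h. D * h)) (at z)"
    using assms by (simp add: has_field_derivative_def)
  have 1: "((\<lambda>t::real. z + of_real t) has_derivative (\<lambda>t. of_real t)) (at 0)"
    by (auto intro!: derivative_eq_intros)
  have 2: "((\<lambda>t::real. z + \<i> * of_real t) has_derivative (\<lambda>t. \<i> * of_real t)) (at 0)"
    by (auto intro!: derivative_eq_intros)
  have "((\<lambda>t::real. g (z + of_real t)) has_derivative (\<lambda>t. D * of_real t)) (at 0)"
    by (rule has_derivative_compose[OF 1]) (use g in simp)
  hence "((\<lambda>t::real. g (z + of_real t)) has_vector_derivative D) (at 0)"
    by (simp add: has_vector_derivative_def scaleR_conv_of_real mult.commute)
  moreover have "((\<lambda>t::real. g (z + \<i> * of_real t)) has_derivative (\<lambda>t. D * (\<i> * of_real t))) (at 0)"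
    by (rule has_derivative_compose[OF 2]) (use g in simp)
  hence "((\<lambda>t::real. g (z + \<i> * of_real t)) has_vector_derivative (\<i> * D)) (at 0)"
    by (simp add: has_vector_derivative_def scaleR_conv_of_real mult_ac)
  ultimately show ?thesis
    by (simp add: wirtinger_def vector_derivative_at)
qed

section \<open>The Thullen domain and its transformations\<close>

locale thullen =
  fixes \<alpha> :: real
  assumes alpha_pos: "\<alpha> > 0"
begin

abbreviation U where "U \<equiv> U_dom \<alpha>"

text \<open>Squared radius of the disc that \<open>U\<close> cuts out above the first coordinate
  x.\<close>

definition wt :: "complex \<Rightarrow> real" where "wt x = 1 - norm x powr (2 / \<alpha>)"

definition rho :: "complex \<times> complex \<Rightarrow> real" where
  "rho w = 1 - (norm (snd w))\<^sup>2 - norm (fst w) powr (2 / \<alpha>)"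

lemma mem_U_iff: "w \<in> U \<longleftrightarrow> rho w > 0"
  by (auto simp: U_dom_def rho_def case_prod_beta)

lemma mem_U_iff_wt: "w \<in> U \<longleftrightarrow> (norm (snd w))\<^sup>2 < wt (fst w)"
  by (auto simp: U_dom_def wt_def case_prod_beta)

lemma continuous_on_rho: "continuous_on A rho"
  unfolding rho_def using alpha_pos
  by (intro continuous_intros continuous_on_powr') auto

lemma open_U: "open U"
proof -
  have "U = {w. rho w > 0}" by (auto simp: mem_U_iff)
  thus ?thesis using open_Collect_less[OF continuous_on_const continuous_on_rho, of 0] by simp
qed

lemma U_in_borel[measurable]: "U \<in> sets borel"
  using open_U by simp

lemma borel_measurable_wt[measurable]: "wt \<in> borel_measurable borel"
  unfolding wt_def[abs_def] by measurable

lemma borel_measurable_rho[measurable]: "rho \<in> borel_measurable borel"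
  using continuous_on_rho[of UNIV] by (rule borel_measurable_continuous_onI)

lemma norm_fst_U: "w \<in> U \<Longrightarrow> norm (fst w) < 1"
proof (rule ccontr)
  assume w: "w \<in> U" and "\<not> norm (fst w) < 1"
  hence "1 powr (2 / \<alpha>) \<le> norm (fst w) powr (2 / \<alpha>)"
    using alpha_pos by (intro powr_mono2) auto
  thus False using w zero_le_power2[of "norm (snd w)"] unfolding mem_U_iff rho_def by simp
qed

lemma norm_snd_U: "w \<in> U \<Longrightarrow> norm (snd w) < 1"
proof -
  assume "w \<in> U"
  hence "(norm (snd w))\<^sup>2 < 1"
    using powr_ge_zero[of "norm (fst w)" "2 / \<alpha>"] unfolding mem_U_iff rho_def by linarith
  thus ?thesis by (simp add: abs_square_less_1)
qed

lemma norm_powr_2_div: "norm x powr (2 / \<alpha>) = ((norm x)\<^sup>2) powr (1 / \<alpha>)" for x :: complex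
  by (cases "x = 0") (auto simp: powr_powr simp flip: powr_numeral)

lemma wt_lower: "norm x < 1 \<Longrightarrow> min 1 (1 / \<alpha>) * (1 - (norm x)\<^sup>2) \<le> wt x"
  unfolding wt_def norm_powr_2_div using alpha_pos
  by (intro one_minus_powr_bounds) (auto simp: abs_square_le_1)

lemma wt_upper: "norm x < 1 \<Longrightarrow> wt x \<le> max 1 (1 / \<alpha>) * (1 - (norm x)\<^sup>2)"
  unfolding wt_def norm_powr_2_div using alpha_pos
  by (intro one_minus_powr_bounds) (auto simp: abs_square_le_1)

lemma wt_pos: "norm x < 1 \<Longrightarrow> wt x > 0"
proof -
  assume x: "norm x < 1"
  have "0 < min 1 (1 / \<alpha>) * (1 - (norm x)\<^sup>2)"
    using alpha_pos one_minus_norm_sq_pos[OF x] by simp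
  thus ?thesis using wt_lower[OF x] by linarith
qed

lemma norm_less_1_of_wt_pos: "wt x > 0 \<Longrightarrow> norm x < 1"
  using norm_fst_U[of "(x, 0)"] by (auto simp: mem_U_iff_wt)

text \<open>\<open>gb\<close> and \<open>ga\<close> are the fibre multipliers: with them
  \<open>phi_b\<close> and \<open>phi_a\<close> become skew products of a Moebius map with a
  multiplication.\<close>

definition gb :: "complex \<Rightarrow> complex \<Rightarrow> complex" where
  "gb b v = (of_real (sqrt (1 - (norm b)\<^sup>2)) / (1 - cnj b * v)) powr (of_real \<alpha>)"

definition ga :: "complex \<Rightarrow> complex \<Rightarrow> complex" where
  "ga a x = (of_real (sqrt (1 - (norm a)\<^sup>2)) / (1 - cnj a * x)) *
      of_real (sqrt (((1 - (norm x)\<^sup>2) * wt (mob a x)) / (wt x * (1 - (norm (mob a x))\<^sup>2))))"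

lemma borel_measurable_gb[measurable]: "gb b \<in> borel_measurable borel"
  unfolding gb_def[abs_def] by measurable

lemma borel_measurable_ga[measurable]: "ga a \<in> borel_measurable borel"
  unfolding ga_def[abs_def] by measurable

lemma phi_b_eq: "phi_b \<alpha> b w = (gb b (snd w) * fst w, mob b (snd w))"
  by (simp add: phi_b_def gb_def mob_def case_prod_beta mult.commute)

lemma phi_a_eq: "phi_a \<alpha> a w = (mob a (fst w), ga a (fst w) * snd w)"
  by (simp add: phi_a_def ga_def mob_def wt_def case_prod_beta Let_def mult_ac)

lemma measurable_phi_b[measurable]: "phi_b \<alpha> b \<in> borel_measurable borel"
  unfolding phi_b_eq[abs_def] by measurable

lemma measurable_phi_a[measurable]: "phi_a \<alpha> a \<in> borel_measurable borel"
  unfolding phi_a_eq[abs_def] by measurable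

lemma norm_gb:
  assumes "norm b < 1" "norm v < 1"
  shows "norm (gb b v) = mobd b v powr (\<alpha> / 2)"
proof -
  have B: "1 - (norm b)\<^sup>2 > 0" by (rule one_minus_norm_sq_pos[OF assms(1)])
  have "norm (of_real (sqrt (1 - (norm b)\<^sup>2)) / (1 - cnj b * v)) = sqrt (mobd b v)"
    using B by (simp add: norm_divide mobd_def real_sqrt_divide)
  hence "norm (gb b v) = sqrt (mobd b v) powr \<alpha>"
    unfolding gb_def by (subst norm_powr_real_powr') auto
  also have "\<dots> = mobd b v powr (\<alpha> / 2)"
    using mobd_pos[OF assms] by (simp add: powr_half_sqrt[symmetric] powr_powr)
  finally show ?thesis .
qed

lemma gb_nz: "norm b < 1 \<Longrightarrow> norm v < 1 \<Longrightarrow> gb b v \<noteq> 0"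
  using norm_gb[of b v] mobd_pos[of b v] by auto

text \<open>The square root in \<open>ga\<close> exchanges the ratio of the quantities 1 - |x|^2 for
  the ratio of the squared fibre radii \<open>wt\<close>. Hence \<open>phi_a\<close> carries the
  fibre over x onto the fibre over \<open>mob a x\<close>.\<close>

lemma norm_ga:
  assumes "norm a < 1" "norm x < 1"
  shows "norm (ga a x) = sqrt (wt (mob a x) / wt x)"
proof -
  have A: "1 - (norm a)\<^sup>2 > 0" "1 - (norm x)\<^sup>2 > 0" "mobd a x > 0" "wt x > 0" "wt (mob a x) > 0"
    using one_minus_norm_sq_pos assms mobd_pos wt_pos norm_mob_less_1 by auto
  have "norm (of_real (sqrt (1 - (norm a)\<^sup>2)) / (1 - cnj a * x)) = sqrt (mobd a x)"
    using A by (simp add: norm_divide mobd_def real_sqrt_divide)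
  hence "norm (ga a x) = sqrt (mobd a x) * sqrt (((1 - (norm x)\<^sup>2) * wt (mob a x)) / (wt x * (mobd a x * (1 - (norm x)\<^sup>2))))"
    using A one_minus_norm_sq_mob_eq_mobd[OF assms] unfolding ga_def norm_mult norm_of_real by simp
  also have "\<dots> = sqrt (mobd a x * (((1 - (norm x)\<^sup>2) * wt (mob a x)) / (wt x * (mobd a x * (1 - (norm x)\<^sup>2)))))"
    by (rule real_sqrt_mult[symmetric])
  also have "mobd a x * (((1 - (norm x)\<^sup>2) * wt (mob a x)) / (wt x * (mobd a x * (1 - (norm x)\<^sup>2)))) = wt (mob a x) / wt x"
    using A by (simp add: field_simps)
  finally show ?thesis .
qed

lemma ga_nz: "norm a < 1 \<Longrightarrow> norm x < 1 \<Longrightarrow> ga a x \<noteq> 0"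
  using norm_ga[of a x] wt_pos[of x] wt_pos[of "mob a x"] norm_mob_less_1[of a x] by auto

text \<open>The modulus of \<open>gb\<close> is the power \<alpha>/2 of \<open>mobd\<close>, so the
  exponent 2/\<alpha> in \<open>rho\<close> restores the first power, and this term scales exactly
  like 1 - |w2|^2.\<close>

lemma rho_phi_b:
  assumes "norm b < 1" "norm (snd w) < 1"
  shows "rho (phi_b \<alpha> b w) = mobd b (snd w) * rho w"
proof -
  have "norm (gb b (snd w) * fst w) powr (2 / \<alpha>) = mobd b (snd w) * norm (fst w) powr (2 / \<alpha>)"
    using mobd_pos[OF assms] alpha_pos by (simp add: norm_mult norm_gb[OF assms] powr_mult powr_powr)
  thus ?thesis
    using one_minus_norm_sq_mob_eq_mobd[OF assms] by (simp add: rho_def phi_b_eq algebra_simps)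
qed

lemma phi_b_in_U_iff: "norm b < 1 \<Longrightarrow> norm (snd w) < 1 \<Longrightarrow> phi_b \<alpha> b w \<in> U \<longleftrightarrow> w \<in> U"
  using mobd_pos[of b "snd w"] by (simp add: mem_U_iff rho_phi_b zero_less_mult_iff)

lemma phi_a_in_U_iff:
  assumes "norm a < 1" "norm (fst w) < 1"
  shows "phi_a \<alpha> a w \<in> U \<longleftrightarrow> w \<in> U"
proof -
  have p: "wt (fst w) > 0" "wt (mob a (fst w)) > 0"
    using wt_pos assms norm_mob_less_1 by auto
  have "(norm (ga a (fst w) * snd w))\<^sup>2 = wt (mob a (fst w)) / wt (fst w) * (norm (snd w))\<^sup>2"
    using p by (simp add: norm_mult norm_ga[OF assms] power_mult_distrib)
  moreover have "p / q * n < p \<longleftrightarrow> n < q" if "p > 0" "q > 0" for p q n :: real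
    using that by (simp add: field_simps)
  ultimately show ?thesis using p by (simp add: mem_U_iff_wt phi_a_eq)
qed

text \<open>\<open>jb\<close> and \<open>ja\<close> are the moduli of the holomorphic Jacobians.
  Their squares are the volume factors, also for the non-holomorphic \<open>phi_a\<close>, since it
  is a skew product.\<close>

definition jb :: "complex \<Rightarrow> complex \<times> complex \<Rightarrow> real" where
  "jb b w = mobd b (snd w) * norm (gb b (snd w))"

definition ja :: "complex \<Rightarrow> complex \<times> complex \<Rightarrow> real" where
  "ja a w = mobd a (fst w) * norm (ga a (fst w))"

lemma borel_measurable_jb[measurable]: "jb b \<in> borel_measurable borel"
  unfolding jb_def[abs_def] by measurable

lemma borel_measurable_ja[measurable]: "ja b \<in> borel_measurable borel"
  unfolding ja_def[abs_def] by measurable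

lemma jb_eq: "norm b < 1 \<Longrightarrow> norm (snd w) < 1 \<Longrightarrow> jb b w = mobd b (snd w) powr (1 + \<alpha> / 2)"
  using mobd_pos[of b "snd w"] by (simp add: jb_def norm_gb powr_add)

lemma jb_pos: "norm b < 1 \<Longrightarrow> norm (snd w) < 1 \<Longrightarrow> jb b w > 0"
  using mobd_pos[of b "snd w"] by (simp add: jb_eq)

lemma ja_pos: "norm a < 1 \<Longrightarrow> norm (fst w) < 1 \<Longrightarrow> ja a w > 0"
  using mobd_pos[of a "fst w"] ga_nz[of a "fst w"] by (simp add: ja_def)

text \<open>\<open>mob a\<close> is an involution, so \<open>mobd\<close> and the ratio of the
  \<open>wt\<close> values are both inverted. This allows a power of the Jacobian to be rewritten at
  the image point before substituting.\<close>

lemma ja_phi_a: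
  assumes "norm a < 1" "norm (fst w) < 1"
  shows "ja a (phi_a \<alpha> a w) = 1 / ja a w"
proof -
  have m: "norm (mob a (fst w)) < 1" by (rule norm_mob_less_1[OF assms])
  have p: "wt (fst w) > 0" "wt (mob a (fst w)) > 0" using wt_pos assms m by auto
  show ?thesis
    unfolding ja_def phi_a_eq using p m assms
    by (simp add: norm_ga mob_mob mobd_mob real_sqrt_divide)
qed

lemma norm_holo_jacobian_phi_b:
  assumes "norm b < 1" "norm (snd w) < 1"
  shows "norm (holo_jacobian (phi_b \<alpha> b) w) = jb b w"
proof -
  obtain w1 w2 where w: "w = (w1, w2)" by force
  have 1: "wirtinger (\<lambda>u. fst (phi_b \<alpha> b (u, w2))) w1 = gb b w2"
    by (rule wirtinger_eq_deriv) (auto simp: phi_b_eq intro!: derivative_eq_intros)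
  have 2: "wirtinger (\<lambda>u. snd (phi_b \<alpha> b (u, w2))) w1 = 0"
    by (rule wirtinger_eq_deriv) (auto simp: phi_b_eq)
  have 3: "wirtinger (\<lambda>v. snd (phi_b \<alpha> b (w1, v))) w2 = - of_real (1 - (norm b)\<^sup>2) / (1 - cnj b * w2)\<^sup>2"
    using has_field_derivative_mob[of b w2] assms w by (intro wirtinger_eq_deriv) (simp add: phi_b_eq)
  have 4: "norm (- of_real (1 - (norm b)\<^sup>2) / (1 - cnj b * w2)\<^sup>2) = mobd b w2"
    using one_minus_norm_sq_pos[OF assms(1)]
    unfolding norm_divide norm_minus_cancel norm_of_real norm_power mobd_def by simp
  show ?thesis
    unfolding holo_jacobian_def w prod.case 1 2 3 mult_zero_left mult_zero_right diff_zero norm_mult 4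
    by (simp add: jb_def)
qed

text \<open>The first component of \<open>phi_a\<close> does not involve w2, so the one derivative
  of the non-holomorphic factor is multiplied by 0 and never has to be computed.\<close>

lemma norm_holo_jacobian_phi_a:
  assumes "norm a < 1" "norm (fst w) < 1"
  shows "norm (holo_jacobian (phi_a \<alpha> a) w) = ja a w"
proof -
  obtain w1 w2 where w: "w = (w1, w2)" by force
  have 1: "wirtinger (\<lambda>v. snd (phi_a \<alpha> a (w1, v))) w2 = ga a w1"
    by (rule wirtinger_eq_deriv) (auto simp: phi_a_eq intro!: derivative_eq_intros)
  have 2: "wirtinger (\<lambda>v. fst (phi_a \<alpha> a (w1, v))) w2 = 0"
    by (rule wirtinger_eq_deriv) (auto simp: phi_a_eq)
  have 3: "wirtinger (\<lambda>u. fst (phi_a \<alpha> a (u, w2))) w1 = - of_real (1 - (norm a)\<^sup>2) / (1 - cnj a * w1)\<^sup>2"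
    using has_field_derivative_mob[of a w1] assms w by (intro wirtinger_eq_deriv) (simp add: phi_a_eq)
  have 4: "norm (- of_real (1 - (norm a)\<^sup>2) / (1 - cnj a * w1)\<^sup>2) = mobd a w1"
    using one_minus_norm_sq_pos[OF assms(1)]
    unfolding norm_divide norm_minus_cancel norm_of_real norm_power mobd_def by simp
  show ?thesis
    unfolding holo_jacobian_def w prod.case 1 2 3 mult_zero_left mult_zero_right diff_zero norm_mult 4
    by (simp add: ja_def)
qed

lemma nn_integral_phi_b:
  assumes "norm b < 1" and [measurable]: "F \<in> borel_measurable borel"
  shows "(\<integral>\<^sup>+w. F (phi_b \<alpha> b w) * ennreal ((jb b w)\<^sup>2) * indicator U w \<partial>lborel) = (\<integral>\<^sup>+w. F w * indicator U w \<partial>lborel)"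
  unfolding phi_b_eq jb_def
proof (rule nn_integral_skew_swap[where D = "ball 0 1"])
  show "(gb b x * y, mob b x) \<in> U \<longleftrightarrow> (y, x) \<in> U" if "x \<in> ball 0 1" for x y
    using phi_b_in_U_iff[OF assms(1), of "(y, x)"] that by (simp add: phi_b_eq)
  show "x \<in> ball 0 1" if "(y, x) \<in> U" for x y
    using norm_snd_U[OF that] by simp
qed (use assms in \<open>auto simp: nn_integral_mobd gb_nz\<close>)

lemma nn_integral_phi_a:
  assumes "norm a < 1" and [measurable]: "F \<in> borel_measurable borel"
  shows "(\<integral>\<^sup>+w. F (phi_a \<alpha> a w) * ennreal ((ja a w)\<^sup>2) * indicator U w \<partial>lborel) = (\<integral>\<^sup>+w. F w * indicator U w \<partial>lborel)"
  unfolding phi_a_eq ja_def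
proof (rule nn_integral_skew[where D = "ball 0 1"])
  show "(mob a x, ga a x * y) \<in> U \<longleftrightarrow> (x, y) \<in> U" if "x \<in> ball 0 1" for x y
    using phi_a_in_U_iff[OF assms(1), of "(x, y)"] that by (simp add: phi_a_eq)
  show "x \<in> ball 0 1" if "(x, y) \<in> U" for x y
    using norm_fst_U[OF that] by simp
qed (use assms in \<open>auto simp: nn_integral_mobd ga_nz\<close>)

end

section \<open>The weighted integral estimate\<close>

text \<open>Young's inequality for X / \<eta> and Y / S, integrated. Positive upper bounds in place
  of the norms themselves avoid dividing by a norm that may be zero.\<close>

lemma nn_integral_Holder:
  fixes X Y :: "'a \<Rightarrow> real"
  assumes p: "p > 1" "q > 1" "1/p + 1/q = 1" and [measurable]: "X \<in> borel_measurable M" "Y \<in> borel_measurable M"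
    and nn: "\<And>x. X x \<ge> 0" "\<And>x. Y x \<ge> 0" and pos: "\<eta> > 0" "S > 0"
    and X: "(\<integral>\<^sup>+x. ennreal (X x powr p) \<partial>M) \<le> ennreal (\<eta> powr p)"
    and Y: "(\<integral>\<^sup>+x. ennreal (Y x powr q) \<partial>M) \<le> ennreal (S powr q)"
  shows "(\<integral>\<^sup>+x. ennreal (X x * Y x) \<partial>M) \<le> ennreal (\<eta> * S)"
proof -
  have "(\<integral>\<^sup>+x. ennreal (X x * Y x) \<partial>M) \<le>
     (\<integral>\<^sup>+x. ennreal (\<eta> * S / (p * \<eta> powr p)) * ennreal (X x powr p) + ennreal (\<eta> * S / (q * S powr q)) * ennreal (Y x powr q) \<partial>M)"
  proof (intro nn_integral_mono)
    fix x
    have "X x / \<eta> * (Y x / S) \<le> (X x / \<eta>) powr p / p + (Y x / S) powr q / q"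
      using p nn pos by (intro Youngs_inequality) auto
    hence "(\<eta> * S) * (X x / \<eta> * (Y x / S)) \<le> (\<eta> * S) * ((X x / \<eta>) powr p / p + (Y x / S) powr q / q)"
      using pos by (intro mult_left_mono) auto
    also have "(\<eta> * S) * (X x / \<eta> * (Y x / S)) = X x * Y x" using pos by simp
    also have "(\<eta> * S) * ((X x / \<eta>) powr p / p + (Y x / S) powr q / q)
       = \<eta> * S / (p * \<eta> powr p) * X x powr p + \<eta> * S / (q * S powr q) * Y x powr q"
      using pos nn p by (simp add: powr_divide field_simps)
    finally have "ennreal (X x * Y x) \<le> ennreal (\<eta> * S / (p * \<eta> powr p) * X x powr p + \<eta> * S / (q * S powr q) * Y x powr q)"
      by (rule ennreal_leI)
    also have "\<dots> = ennreal (\<eta> * S / (p * \<eta> powr p)) * ennreal (X x powr p) + ennreal (\<eta> * S / (q * S powr q)) * ennreal (Y x powr q)"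
      using pos p by (simp add: ennreal_mult[symmetric] ennreal_plus[symmetric] del: ennreal_plus)
    finally show "ennreal (X x * Y x) \<le> \<dots>" .
  qed
  also have "\<dots> = ennreal (\<eta> * S / (p * \<eta> powr p)) * (\<integral>\<^sup>+x. ennreal (X x powr p) \<partial>M)
      + ennreal (\<eta> * S / (q * S powr q)) * (\<integral>\<^sup>+x. ennreal (Y x powr q) \<partial>M)"
    by (subst nn_integral_add) (auto simp: nn_integral_cmult)
  also have "\<dots> \<le> ennreal (\<eta> * S / (p * \<eta> powr p)) * ennreal (\<eta> powr p)
      + ennreal (\<eta> * S / (q * S powr q)) * ennreal (S powr q)"
    by (intro add_mono mult_left_mono X Y) auto
  also have "\<dots> = ennreal (\<eta> * S / (p * \<eta> powr p) * \<eta> powr p + \<eta> * S / (q * S powr q) * S powr q)"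
    using pos p by (simp add: ennreal_mult[symmetric] ennreal_plus[symmetric] del: ennreal_plus)
  also have "\<eta> * S / (p * \<eta> powr p) * \<eta> powr p + \<eta> * S / (q * S powr q) * S powr q = \<eta> * S * (1/p + 1/q)"
    using pos p by (simp add: field_simps)
  finally show ?thesis using p by simp
qed

context thullen
begin

text \<open>Half of the exponent 1 + \<alpha>/2 with which \<open>mobd\<close> occurs in
  \<open>jb\<close>; multiplication by the Jacobian therefore turns the power \<open>- expA\<close>
  into \<open>expA\<close>.\<close>

definition expA :: real where "expA = (2 + \<alpha>) / 4"

lemma expA_eq: "- expA + (1 + \<alpha> / 2) = expA"
  by (simp add: expA_def field_simps)

text \<open>On \<open>U\<close>, \<open>rho\<close> is 1 - |w2|^2 times \<open>wt\<close> of
  \<open>f_alpha\<close>. So this is the power \<open>- expA\<close> of 1 - |w2|^2 times the power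
  -3/4 of that \<open>wt\<close>, and the exponents are half of those in \<open>Nz\<close>.\<close>

definition h :: "complex \<times> complex \<Rightarrow> real" where
  "h w = (1 - (norm (snd w))\<^sup>2) powr (- (expA - 3/4)) * rho w powr (- (3/4))"

lemma borel_measurable_h[measurable]: "h \<in> borel_measurable borel"
  unfolding h_def[abs_def] by measurable

lemma h_nonneg: "h w \<ge> 0"
  by (simp add: h_def)

lemma h_pos: "w \<in> U \<Longrightarrow> h w > 0"
  using one_minus_norm_sq_pos[OF norm_snd_U, of w] by (simp add: h_def mem_U_iff)

lemma h_phi_b:
  assumes "norm b < 1" "w \<in> U"
  shows "h (phi_b \<alpha> b w) = mobd b (snd w) powr (- expA) * h w"
proof -
  have v: "norm (snd w) < 1" by (rule norm_snd_U[OF assms(2)])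
  have p: "mobd b (snd w) > 0" using mobd_pos[OF assms(1) v] .
  have "h (phi_b \<alpha> b w) = (mobd b (snd w) * (1 - (norm (snd w))\<^sup>2)) powr (- (expA - 3/4)) * (mobd b (snd w) * rho w) powr (- (3/4))"
    unfolding h_def rho_phi_b[OF assms(1) v] by (simp add: phi_b_eq one_minus_norm_sq_mob_eq_mobd[OF assms(1) v])
  also have "\<dots> = mobd b (snd w) powr (- (expA - 3/4) + - (3/4)) * h w"
    unfolding powr_mult powr_add h_def by simp
  finally show ?thesis by simp
qed

text \<open>\<open>f_alpha\<close> divides the first coordinate by the radius of its fibre over w2.
  Together with the second coordinate it maps \<open>U\<close> to a product of discs, and
  \<open>rho\<close> splits accordingly.\<close>

lemma rho_f_alpha:
  assumes "norm (snd z) < 1"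
  shows "rho z = (1 - (norm (snd z))\<^sup>2) * wt (f_alpha \<alpha> z)"
proof -
  have p: "1 - (norm (snd z))\<^sup>2 > 0" by (rule one_minus_norm_sq_pos[OF assms])
  have "norm (fst z) = norm (f_alpha \<alpha> z) * (1 - (norm (snd z))\<^sup>2) powr (\<alpha> / 2)"
    using p by (simp add: f_alpha_def norm_divide)
  hence "norm (fst z) powr (2 / \<alpha>) = norm (f_alpha \<alpha> z) powr (2 / \<alpha>) * (1 - (norm (snd z))\<^sup>2)"
    using p alpha_pos by (simp add: powr_mult powr_powr)
  thus ?thesis by (simp add: rho_def wt_def algebra_simps)
qed

lemma f_alpha_less_1:
  assumes "z \<in> U"
  shows "norm (f_alpha \<alpha> z) < 1"
  using assms rho_f_alpha[OF norm_snd_U[OF assms]] one_minus_norm_sq_pos[OF norm_snd_U[OF assms]]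
  by (intro norm_less_1_of_wt_pos) (simp add: mem_U_iff zero_less_mult_iff)

definition wtmin :: real where "wtmin = min 1 (1 / \<alpha>)"
definition wtmax :: real where "wtmax = max 1 (1 / \<alpha>)"

lemma wtmin_pos: "wtmin > 0" and wtmax_pos: "wtmax > 0"
  using alpha_pos by (auto simp: wtmin_def wtmax_def)

text \<open>\<open>wt\<close> is comparable to 1 - |x|^2, so the fibre part of the Jacobian is at
  most a constant times the square root of \<open>mobd\<close>; with the base part this makes the
  exponent 3/2.\<close>

lemma ja_le:
  assumes "norm a < 1" "norm (fst w) < 1"
  shows "ja a w \<le> sqrt (wtmax / wtmin) * mobd a (fst w) powr (3/2)"
proof -
  let ?x = "fst w"
  have m: "norm (mob a ?x) < 1" by (rule norm_mob_less_1[OF assms])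
  have p: "mobd a ?x > 0" "wt ?x > 0" "1 - (norm ?x)\<^sup>2 > 0"
    using mobd_pos assms wt_pos one_minus_norm_sq_pos by auto
  have "wt (mob a ?x) / wt ?x \<le> (wtmax * (mobd a ?x * (1 - (norm ?x)\<^sup>2))) / (wtmin * (1 - (norm ?x)\<^sup>2))"
    using wt_upper[OF m] wt_lower[OF assms(2)] p wtmin_pos wtmax_pos
    unfolding one_minus_norm_sq_mob_eq_mobd[OF assms]
    by (intro frac_le) (auto simp: wtmax_def wtmin_def)
  also have "\<dots> = wtmax / wtmin * mobd a ?x" using p wtmin_pos by (simp add: field_simps)
  finally have "sqrt (wt (mob a ?x) / wt ?x) \<le> sqrt (wtmax / wtmin) * sqrt (mobd a ?x)"
    unfolding real_sqrt_mult[symmetric] by (rule real_sqrt_le_mono)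
  hence "ja a w \<le> mobd a ?x * (sqrt (wtmax / wtmin) * sqrt (mobd a ?x))"
    unfolding ja_def norm_ga[OF assms] using p by (intro mult_left_mono) auto
  also have "\<dots> = sqrt (wtmax / wtmin) * (mobd a ?x powr 1 * mobd a ?x powr (1/2))"
    using p by (simp add: powr_half_sqrt)
  also have "mobd a ?x powr 1 * mobd a ?x powr (1/2) = mobd a ?x powr (3/2)"
    unfolding powr_add[symmetric] by simp
  finally show ?thesis .
qed

text \<open>In the coordinates \<open>f_alpha w\<close> and \<open>snd w\<close> the domain is a
  product of two discs. Rescaling the complex line over v by (1 - |v|^2)^(\<alpha>/2) costs the
  square of that factor.\<close>

lemma nn_integral_U_coords:
  assumes [measurable]: "f \<in> borel_measurable borel"
  shows "(\<integral>\<^sup>+w. f w * indicator U w \<partial>lborel) =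
    (\<integral>\<^sup>+v. ennreal ((1 - (norm v)\<^sup>2) powr \<alpha>) * indicator (ball 0 1) v *
       (\<integral>\<^sup>+u. f (of_real ((1 - (norm v)\<^sup>2) powr (\<alpha>/2)) * u, v) * indicator (ball 0 1) u \<partial>lborel) \<partial>lborel)"
proof -
  define G where "G w = f w * indicator U w" for w
  have [measurable]: "G \<in> borel_measurable borel" unfolding G_def by measurable
  have "(\<integral>\<^sup>+w. G w \<partial>lborel) = (\<integral>\<^sup>+w. G (snd w, fst w) \<partial>lborel)"
    by (rule nn_integral_lborel_swap[symmetric]) measurable
  also have "\<dots> = (\<integral>\<^sup>+v. (\<integral>\<^sup>+x. G (x, v) \<partial>lborel) \<partial>lborel)"
    by (subst nn_integral_lborel_fst_snd) auto
  also have "\<dots> = (\<integral>\<^sup>+v. ennreal ((1 - (norm v)\<^sup>2) powr \<alpha>) * indicator (ball 0 1) v *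
       (\<integral>\<^sup>+u. f (of_real ((1 - (norm v)\<^sup>2) powr (\<alpha>/2)) * u, v) * indicator (ball 0 1) u \<partial>lborel) \<partial>lborel)"
  proof (intro nn_integral_cong)
    fix v :: complex
    show "(\<integral>\<^sup>+x. G (x, v) \<partial>lborel) = ennreal ((1 - (norm v)\<^sup>2) powr \<alpha>) * indicator (ball 0 1) v *
       (\<integral>\<^sup>+u. f (of_real ((1 - (norm v)\<^sup>2) powr (\<alpha>/2)) * u, v) * indicator (ball 0 1) u \<partial>lborel)"
    proof (cases "norm v < 1")
      case False
      hence "G (x, v) = 0" for x using norm_snd_U[of "(x, v)"] by (auto simp: G_def indicator_def)
      thus ?thesis using False by simp
    next
      case True
      define c :: complex where "c = of_real ((1 - (norm v)\<^sup>2) powr (\<alpha>/2))"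
      have p: "1 - (norm v)\<^sup>2 > 0" by (rule one_minus_norm_sq_pos[OF True])
      have c: "c \<noteq> 0" "(norm c)\<^sup>2 = (1 - (norm v)\<^sup>2) powr \<alpha>"
        using p by (auto simp: c_def powr_powr simp flip: powr_numeral)
      have fa: "f_alpha \<alpha> (c * u, v) = u" for u
        using p by (simp add: f_alpha_def c_def)
      have iU: "indicator U (c * u, v) = (indicator (ball 0 1) u :: ennreal)" for u
      proof -
        have "rho (c * u, v) = (1 - (norm v)\<^sup>2) * wt u"
          using rho_f_alpha[of "(c * u, v)"] True by (simp add: fa)
        hence "(c * u, v) \<in> U \<longleftrightarrow> wt u > 0" using p by (simp add: mem_U_iff zero_less_mult_iff)
        also have "\<dots> \<longleftrightarrow> norm u < 1" using wt_pos norm_less_1_of_wt_pos by blast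
        finally show ?thesis by (simp add: indicator_def)
      qed
      have "(\<lambda>x. G (x, v)) \<in> borel_measurable borel" by measurable
      from nn_integral_complex_mult[OF c(1) this]
      have "(\<integral>\<^sup>+x. G (x, v) \<partial>lborel) = (\<integral>\<^sup>+u. (f (c * u, v) * indicator (ball 0 1) u) * ennreal ((1 - (norm v)\<^sup>2) powr \<alpha>) \<partial>lborel)"
        by (simp add: G_def iU c(2))
      also have "\<dots> = (\<integral>\<^sup>+u. (f (c * u, v) * indicator (ball 0 1) u) \<partial>lborel) * ennreal ((1 - (norm v)\<^sup>2) powr \<alpha>)"
        by (rule nn_integral_multc) measurable
      finally show ?thesis using True by (simp add: c_def mult.commute)
    qed
  qed
  finally show ?thesis by (simp add: G_def)
qed

text \<open>The right side is at least e + (1 - e) k s with k = min 1 \<alpha>. For e <= 1/2 both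
  terms are comparable to what is claimed; for larger e the first alone suffices, since e + s <= 2.
  In use, e is 1 - |a|^2 and s is |v|^2.\<close>

lemma outer_lower_bound:
  fixes e s :: real
  assumes "0 < e" "e \<le> 1" "0 \<le> s" "s \<le> 1"
  shows "min 1 \<alpha> / 4 * (e + s) \<le> 1 - (1 - e) * (1 - s) powr \<alpha>"
proof -
  define k where "k = min 1 \<alpha>"
  have k: "0 < k" "k \<le> 1" using alpha_pos by (auto simp: k_def)
  have "k * s \<le> 1 - (1 - s) powr \<alpha>"
    using one_minus_powr_bounds(1)[of "1 - s" \<alpha>] assms alpha_pos by (simp add: k_def)
  hence "(1 - e) * (1 - s) powr \<alpha> \<le> (1 - e) * (1 - k * s)"
    using assms by (intro mult_left_mono) auto
  hence "1 - (1 - e) * (1 - k * s) \<le> 1 - (1 - e) * (1 - s) powr \<alpha>" by simp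
  moreover have "k / 4 * (e + s) \<le> 1 - (1 - e) * (1 - k * s)"
  proof (cases "e \<le> 1/2")
    case True
    have "k * e \<le> 1 * e" using k assms by (intro mult_right_mono) auto
    moreover have "1/2 * (k * s) \<le> (1 - e) * (k * s)" using True k assms by (intro mult_right_mono) auto
    moreover have "0 \<le> k * s" using k assms by simp
    moreover have "1 - (1 - e) * (1 - k * s) = e + (1 - e) * (k * s)" by (simp add: algebra_simps)
    moreover have "k / 4 * (e + s) = (k * e + k * s) / 4" by (simp add: field_simps)
    ultimately show ?thesis using assms by argo
  next
    case False
    have "k / 4 * (e + s) \<le> 1 / 4 * 2" using k assms by (intro mult_mono) auto
    moreover have "0 \<le> (1 - e) * (k * s)" using k assms by simp
    moreover have "1 - (1 - e) * (1 - k * s) = e + (1 - e) * (k * s)" by (simp add: algebra_simps)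
    ultimately show ?thesis using False by linarith
  qed
  ultimately show ?thesis by (simp add: k_def)
qed

text \<open>The last factor is large only for v near 0 with |a| near 1. For |v|^2 <= 1/4 it is
  compared with (e + |v|^2)^(-E), e = 1 - |a|^2, whose plane integral gives e^(1-E). Elsewhere it is
  bounded, and the remaining Forelli-Rudin integral is absorbed by 1 <= e^(1-E).\<close>

lemma outer_integral:
  fixes E R Q :: real
  assumes E: "E > 1" and RQ: "Q < 1" "R \<ge> 0" "R + Q < 2"
  shows "\<exists>C\<ge>0. \<forall>a b. norm a < 1 \<longrightarrow> norm b < 1 \<longrightarrow>
    (\<integral>\<^sup>+v. ennreal (norm (1 - cnj b * v) powr (-R) * (1 - (norm v)\<^sup>2) powr (-Q) *
        (1 - (norm a)\<^sup>2 * (1 - (norm v)\<^sup>2) powr \<alpha>) powr (-E)) * indicator (ball 0 1) v \<partial>lborel)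
     \<le> ennreal (C * (1 - (norm (a::complex))\<^sup>2) powr (1 - E))"
proof -
  obtain C1 where C1: "C1 \<ge> 0" "\<And>b. norm b < 1 \<Longrightarrow>
    (\<integral>\<^sup>+v. ennreal (norm (1 - cnj b * v) powr (-R) * (1 - (norm v)\<^sup>2) powr (-Q)) * indicator (ball 0 1) v \<partial>lborel) \<le> ennreal C1"
    using forelli_rudin_bounded[OF RQ] by blast
  obtain C2 where C2: "C2 \<ge> 0" "\<And>\<epsilon>. \<epsilon> > 0 \<Longrightarrow> (\<integral>\<^sup>+v. ennreal ((\<epsilon> + (norm (v::complex))\<^sup>2) powr (-E)) \<partial>lborel) \<le> ennreal (C2 * \<epsilon> powr (1 - E))"
    using nn_integral_eps_plus_norm_sq_powr[OF E] by blast
  define c1 where "c1 = 2 powr R * (3/4) powr (-\<bar>Q\<bar>) * (min 1 \<alpha> / 4) powr (-E)"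
  define c3 where "c3 = (1 - (3/4) powr \<alpha>) powr (-E)"
  have p34: "(3/4) powr \<alpha> < (1::real)" using powr_less_mono2[of \<alpha> "3/4" 1] alpha_pos by simp
  show ?thesis
  proof (intro exI[of _ "c1 * C2 + c3 * C1"] conjI allI impI)
    show "0 \<le> c1 * C2 + c3 * C1" using C1 C2 by (simp add: c1_def c3_def)
    fix a b :: complex assume a: "norm a < 1" and b: "norm b < 1"
    define e where "e = 1 - (norm a)\<^sup>2"
    have e: "0 < e" "e \<le> 1" using one_minus_norm_sq_pos[OF a] by (auto simp: e_def)
    have ptw: "norm (1 - cnj b * v) powr (-R) * (1 - (norm v)\<^sup>2) powr (-Q) *
        (1 - (1 - e) * (1 - (norm v)\<^sup>2) powr \<alpha>) powr (-E)
       \<le> c1 * (e + (norm v)\<^sup>2) powr (-E) + c3 * (norm (1 - cnj b * v) powr (-R) * (1 - (norm v)\<^sup>2) powr (-Q))"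
      if v: "norm v < 1" for v
    proof -
      define s where "s = (norm v)\<^sup>2"
      have s: "0 \<le> s" "s < 1" using one_minus_norm_sq_pos[OF v] by (auto simp: s_def)
      let ?X = "norm (1 - cnj b * v) powr (-R)" and ?Y = "(1 - s) powr (-Q)"
      let ?Z = "(1 - (1 - e) * (1 - s) powr \<alpha>) powr (-E)"
      have "?X * ?Y * ?Z \<le> c1 * (e + s) powr (-E) + c3 * (?X * ?Y)"
      proof (cases "s \<le> 1/4")
        case True
        have "(norm v)\<^sup>2 \<le> (1/2)\<^sup>2" using True by (simp add: s_def power2_eq_square)
        hence nv: "norm v \<le> 1/2" by (rule power2_le_imp_le) simp
        have "norm b * norm v \<le> 1 * (1/2)" using nv b by (intro mult_mono) auto
        hence "1/2 \<le> norm (1 - cnj b * v)"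
          using norm_triangle_ineq2[of 1 "cnj b * v"] by (simp add: norm_mult)
        hence "?X \<le> (1/2) powr (-R)" using RQ by (intro powr_mono2') auto
        hence X: "?X \<le> 2 powr R" by (simp add: powr_minus powr_divide)
        have Y: "?Y \<le> (3/4) powr (-\<bar>Q\<bar>)"
        proof -
          \<comment> \<open>Q may be negative in the application, hence
            \<open>-\<bar>Q\<bar>\<close>.\<close>
          have "?Y \<le> (1 - s) powr (-\<bar>Q\<bar>)" using s by (intro powr_mono') auto
          also have "\<dots> \<le> (3/4) powr (-\<bar>Q\<bar>)" using True by (intro powr_mono2') auto
          finally show ?thesis .
        qed
        have "?Z \<le> (min 1 \<alpha> / 4 * (e + s)) powr (-E)"
          using outer_lower_bound[of e s] e s E alpha_pos by (intro powr_mono2') auto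
        also have "\<dots> = (min 1 \<alpha> / 4) powr (-E) * (e + s) powr (-E)" by (rule powr_mult)
        finally have Z: "?Z \<le> (min 1 \<alpha> / 4) powr (-E) * (e + s) powr (-E)" .
        have "?X * ?Y * ?Z \<le> 2 powr R * (3/4) powr (-\<bar>Q\<bar>) * ((min 1 \<alpha> / 4) powr (-E) * (e + s) powr (-E))"
          by (intro mult_mono X Y Z) auto
        also have "\<dots> = c1 * (e + s) powr (-E)" by (simp add: c1_def)
        finally show ?thesis by (simp add: c3_def add_increasing2)
      next
        case False
        have "(1 - s) powr \<alpha> \<le> (3/4) powr \<alpha>" using False s alpha_pos by (intro powr_mono2) auto
        moreover have "(1 - e) * (1 - s) powr \<alpha> \<le> 1 * (1 - s) powr \<alpha>"
          using e by (intro mult_right_mono) auto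
        ultimately have "?Z \<le> c3"
          unfolding c3_def using p34 E by (intro powr_mono2') auto
        hence "?X * ?Y * ?Z \<le> ?X * ?Y * c3" by (intro mult_left_mono) auto
        thus ?thesis by (simp add: c1_def add_increasing mult.commute)
      qed
      thus ?thesis by (simp add: s_def)
    qed
    have "(\<integral>\<^sup>+v. ennreal (norm (1 - cnj b * v) powr (-R) * (1 - (norm v)\<^sup>2) powr (-Q) *
        (1 - (norm a)\<^sup>2 * (1 - (norm v)\<^sup>2) powr \<alpha>) powr (-E)) * indicator (ball 0 1) v \<partial>lborel)
      \<le> (\<integral>\<^sup>+v. ennreal c1 * ennreal ((e + (norm v)\<^sup>2) powr (-E)) +
          ennreal c3 * (ennreal (norm (1 - cnj b * v) powr (-R) * (1 - (norm v)\<^sup>2) powr (-Q)) * indicator (ball 0 1) v) \<partial>lborel)"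
    proof (intro nn_integral_mono)
      fix v :: complex
      show "ennreal (norm (1 - cnj b * v) powr (-R) * (1 - (norm v)\<^sup>2) powr (-Q) *
        (1 - (norm a)\<^sup>2 * (1 - (norm v)\<^sup>2) powr \<alpha>) powr (-E)) * indicator (ball 0 1) v
       \<le> ennreal c1 * ennreal ((e + (norm v)\<^sup>2) powr (-E)) +
          ennreal c3 * (ennreal (norm (1 - cnj b * v) powr (-R) * (1 - (norm v)\<^sup>2) powr (-Q)) * indicator (ball 0 1) v)"
      proof (cases "norm v < 1")
        case True
        have "c1 \<ge> 0" "c3 \<ge> 0" by (auto simp: c1_def c3_def)
        thus ?thesis using True ennreal_leI[OF ptw[OF True]]
          by (simp add: e_def ennreal_mult ennreal_plus)
      qed simp
    qed
    also have "\<dots> = ennreal c1 * (\<integral>\<^sup>+v. ennreal ((e + (norm (v::complex))\<^sup>2) powr (-E)) \<partial>lborel) +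
          ennreal c3 * (\<integral>\<^sup>+v. (ennreal (norm (1 - cnj b * v) powr (-R) * (1 - (norm v)\<^sup>2) powr (-Q)) * indicator (ball 0 1) v) \<partial>lborel)"
      by (subst nn_integral_add, measurable) (simp add: nn_integral_cmult)
    also have "\<dots> \<le> ennreal c1 * ennreal (C2 * e powr (1 - E)) + ennreal c3 * ennreal C1"
      by (intro add_mono mult_left_mono C1 C2 e b) auto
    also have "\<dots> = ennreal (c1 * C2 * e powr (1 - E) + c3 * C1)"
      using C1 C2 by (simp add: ennreal_mult[symmetric] ennreal_plus[symmetric] c1_def c3_def mult.assoc del: ennreal_plus)
    also have "\<dots> \<le> ennreal ((c1 * C2 + c3 * C1) * e powr (1 - E))"
    proof (rule ennreal_leI)
      have "1 \<le> e powr (1 - E)" using powr_mono2'[of "1 - E" e 1] e E by simp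
      hence "c3 * C1 * 1 \<le> c3 * C1 * e powr (1 - E)" using C1 by (intro mult_left_mono) (auto simp: c3_def)
      thus "c1 * C2 * e powr (1 - E) + c3 * C1 \<le> (c1 * C2 + c3 * C1) * e powr (1 - E)"
        by (simp add: algebra_simps)
    qed
    finally show "(\<integral>\<^sup>+v. ennreal (norm (1 - cnj b * v) powr (-R) * (1 - (norm v)\<^sup>2) powr (-Q) *
        (1 - (norm a)\<^sup>2 * (1 - (norm v)\<^sup>2) powr \<alpha>) powr (-E)) * indicator (ball 0 1) v \<partial>lborel)
      \<le> ennreal ((c1 * C2 + c3 * C1) * (1 - (norm a)\<^sup>2) powr (1 - E))" by (simp add: e_def)
  qed
qed

text \<open>In product coordinates the inner integral is a growing Forelli-Rudin integral with a
  replaced by a times the fibre radius. Its growth becomes the singular factor treated in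
  \<open>outer_integral\<close>.\<close>

lemma key_integral:
  fixes q :: real
  assumes q: "1 < q" "q < 4/3"
  shows "\<exists>C>0. \<forall>a b. norm a < 1 \<longrightarrow> norm b < 1 \<longrightarrow>
    (\<integral>\<^sup>+w. ennreal ((h (phi_b \<alpha> b w) * jb b w) powr q * ja a w powr (2 - q)) * indicator U w \<partial>lborel)
     \<le> ennreal (C * ((1 - (norm b)\<^sup>2) powr expA * (1 - (norm a)\<^sup>2) powr (3/4)) powr q)"
proof -
  \<comment> \<open>R comes from the power 2 - q of the Jacobian with the exponent 3/2 of
    \<open>ja_le\<close> and the square in \<open>mobd\<close>; Q from the exponent 3/4 in
    \<open>h\<close>; E is the growth of the inner integral. \<open>Q < 1\<close>,
    \<open>E > 1\<close> and the strict bound on \<open>expA * q\<close> below are each equivalent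
    to q < 4/3, and \<open>R + 2 * Q \<ge> 4\<close> to q <= 4/3.\<close>
  define R where "R = 3 * (2 - q)"
  define Q where "Q = 3/4 * q"
  define E where "E = R + Q - 2"
  have E: "E > 1" using q by (simp add: E_def R_def Q_def)
  have RQ: "Q < 1" "R + 2 * Q \<ge> 4" using q by (auto simp: R_def Q_def)
  obtain C1 where C1: "C1 \<ge> 0" "\<And>b. norm b < 1 \<Longrightarrow>
    (\<integral>\<^sup>+v. ennreal (norm (1 - cnj b * v) powr (-R) * (1 - (norm v)\<^sup>2) powr (-Q)) * indicator (ball 0 1) v \<partial>lborel)
      \<le> ennreal (C1 * (1 - (norm b)\<^sup>2) powr (2 - R - Q))"
    using forelli_rudin_growth[OF RQ] by blast
  have Aq: "3 * (expA * q) < 2 + \<alpha>" "expA * q \<ge> 0"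
  proof -
    have "(2 + \<alpha>) * q < (2 + \<alpha>) * (4/3)" using q alpha_pos by (intro mult_strict_left_mono) auto
    thus "3 * (expA * q) < 2 + \<alpha>" by (simp add: expA_def field_simps)
    show "expA * q \<ge> 0" using q alpha_pos by (simp add: expA_def)
  qed
  have RQ2: "expA * q - \<alpha> < 1" "2 * (expA * q) \<ge> 0" "2 * (expA * q) + (expA * q - \<alpha>) < 2"
    using Aq alpha_pos by argo+
  obtain C2 where C2: "C2 \<ge> 0" "\<And>a b. norm (a::complex) < 1 \<Longrightarrow> norm b < 1 \<Longrightarrow>
    (\<integral>\<^sup>+v. ennreal (norm (1 - cnj b * v) powr (-(2 * (expA * q))) * (1 - (norm v)\<^sup>2) powr (-(expA * q - \<alpha>)) *
        (1 - (norm a)\<^sup>2 * (1 - (norm v)\<^sup>2) powr \<alpha>) powr (-E)) * indicator (ball 0 1) v \<partial>lborel)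
     \<le> ennreal (C2 * (1 - (norm a)\<^sup>2) powr (1 - E))"
    using outer_integral[OF E RQ2] by blast
  define c1 where "c1 = sqrt (wtmax / wtmin) powr (2 - q)"
  define c2 where "c2 = wtmin powr (-Q)"
  have c12: "c1 \<ge> 0" "c2 \<ge> 0" by (auto simp: c1_def c2_def)
  show ?thesis
  \<comment> \<open>The added 1 only secures a positive constant.\<close>
  proof (intro exI[of _ "c1 * c2 * C1 * C2 + 1"] conjI allI impI)
    show "0 < c1 * c2 * C1 * C2 + 1" using c12 C1 C2 by (simp add: add_nonneg_pos)
    fix a b :: complex assume a: "norm a < 1" and b: "norm b < 1"
    define ea where "ea = 1 - (norm a)\<^sup>2"
    define eb where "eb = 1 - (norm b)\<^sup>2"
    have e: "ea > 0" "eb > 0" using one_minus_norm_sq_pos a b by (auto simp: ea_def eb_def)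
    define L where "L = c1 * c2 * ea powr (R / 2) * eb powr (expA * q)"
    have L: "L \<ge> 0" using c12 by (simp add: L_def)
    \<comment> \<open>Apart from \<open>fst w\<close> in one kernel factor, this majorant depends on
      w through \<open>f_alpha w\<close> and \<open>snd w\<close> only, ready for
      \<open>nn_integral_U_coords\<close>.\<close>
    define P where "P w = L * (norm (1 - cnj b * snd w) powr (-(2 * (expA * q))) * (1 - (norm (snd w))\<^sup>2) powr (-(expA * q))
          * (norm (1 - cnj a * fst w) powr (-R) * (1 - (norm (f_alpha \<alpha> w))\<^sup>2) powr (-Q)))" for w
    have fam[measurable]: "f_alpha \<alpha> \<in> borel_measurable borel"
      unfolding f_alpha_def[abs_def] by measurable
    have Pm[measurable]: "P \<in> borel_measurable borel" unfolding P_def[abs_def] by measurable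
    have ptw: "(h (phi_b \<alpha> b w) * jb b w) powr q * ja a w powr (2 - q) \<le> P w" if w: "w \<in> U" for w
    proof -
      define v where "v = 1 - (norm (snd w))\<^sup>2"
      define u where "u = 1 - (norm (f_alpha \<alpha> w))\<^sup>2"
      have n: "norm (fst w) < 1" "norm (snd w) < 1" "norm (f_alpha \<alpha> w) < 1"
        using w norm_fst_U norm_snd_U f_alpha_less_1 by auto
      have v: "v > 0" and u: "u > 0" using one_minus_norm_sq_pos n by (auto simp: v_def u_def)
      define mb where "mb = mobd b (snd w)"
      define ma where "ma = mobd a (fst w)"
      have m: "mb > 0" "ma > 0" using mobd_pos a b n by (auto simp: mb_def ma_def)
      have 1: "h (phi_b \<alpha> b w) * jb b w = mb powr expA * h w"
      proof -
        have "h (phi_b \<alpha> b w) * jb b w = mb powr (- expA) * mb powr (1 + \<alpha> / 2) * h w"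
          by (simp add: h_phi_b[OF b w] jb_eq[OF b n(2)] mb_def)
        also have "mb powr (- expA) * mb powr (1 + \<alpha> / 2) = mb powr expA"
          unfolding powr_add[symmetric] expA_eq ..
        finally show ?thesis .
      qed
      have 2: "h w powr q \<le> c2 * (v powr (-(expA * q)) * u powr (-Q))"
      proof -
        have "h w powr q = v powr (- (expA - 3/4) * q) * rho w powr (-Q)"
          using w v by (simp add: h_def powr_mult powr_powr v_def Q_def mem_U_iff)
        also have "\<dots> \<le> v powr (- (expA - 3/4) * q) * (v * (wtmin * u)) powr (-Q)"
          unfolding rho_f_alpha[OF n(2)] v_def[symmetric]
          using wt_lower[OF n(3)] v u wtmin_pos q
          by (intro mult_left_mono powr_mono2') (auto simp: wtmin_def u_def Q_def)
        also have "\<dots> = c2 * ((v powr (- (expA - 3/4) * q) * v powr (-Q)) * u powr (-Q))"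
          by (simp add: powr_mult c2_def)
        also have "v powr (- (expA - 3/4) * q) * v powr (-Q) = v powr (-(expA * q))"
          unfolding powr_add[symmetric] by (simp add: Q_def algebra_simps)
        finally show ?thesis .
      qed
      have 3: "ja a w powr (2 - q) \<le> c1 * (ea powr (R / 2) * norm (1 - cnj a * fst w) powr (-R))"
      proof -
        have "ja a w powr (2 - q) \<le> (sqrt (wtmax / wtmin) * ma powr (3/2)) powr (2 - q)"
          using ja_le[OF a n(1)] ja_pos[OF a n(1)] q by (intro powr_mono2) (auto simp: ma_def)
        also have "\<dots> = c1 * ma powr (R / 2)"
          by (simp add: powr_mult powr_powr c1_def R_def)
        also have "ma powr (R / 2) = ea powr (R / 2) * norm (1 - cnj a * fst w) powr (-R)"
        proof -
          have d: "norm (1 - cnj a * fst w) > 0" using one_minus_cnj_mult_nz[OF a n(1)] by simp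
          have "((norm (1 - cnj a * fst w))\<^sup>2) powr (R / 2) = norm (1 - cnj a * fst w) powr R"
            using d by (simp add: powr_powr flip: powr_numeral)
          thus ?thesis unfolding ma_def mobd_def ea_def powr_divide powr_minus_divide by simp
        qed
        finally show ?thesis .
      qed
      have 4: "mb powr (expA * q) = eb powr (expA * q) * norm (1 - cnj b * snd w) powr (-(2 * (expA * q)))"
      proof -
        have d: "norm (1 - cnj b * snd w) > 0" using one_minus_cnj_mult_nz[OF b n(2)] by simp
        have "((norm (1 - cnj b * snd w))\<^sup>2) powr (expA * q) = norm (1 - cnj b * snd w) powr (2 * (expA * q))"
          using d by (simp add: powr_powr flip: powr_numeral)
        thus ?thesis unfolding mb_def mobd_def eb_def powr_divide powr_minus_divide by simp
      qed
      have "(h (phi_b \<alpha> b w) * jb b w) powr q * ja a w powr (2 - q) = mb powr (expA * q) * h w powr q * ja a w powr (2 - q)"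
        unfolding 1 by (simp add: powr_mult powr_powr)
      also have "\<dots> \<le> mb powr (expA * q) * (c2 * (v powr (-(expA * q)) * u powr (-Q))) * (c1 * (ea powr (R / 2) * norm (1 - cnj a * fst w) powr (-R)))"
        by (intro mult_mono 2 3 order_refl) (use c12 in auto)
      also have "\<dots> = P w"
        unfolding 4 P_def L_def v_def u_def by (simp add: mult_ac)
      finally show ?thesis .
    qed
    have "(\<integral>\<^sup>+w. ennreal ((h (phi_b \<alpha> b w) * jb b w) powr q * ja a w powr (2 - q)) * indicator U w \<partial>lborel)
       \<le> (\<integral>\<^sup>+w. ennreal (P w) * indicator U w \<partial>lborel)"
      using ptw by (intro nn_integral_mono) (auto simp: indicator_def intro!: ennreal_leI)
    also have "\<dots> = (\<integral>\<^sup>+v. ennreal ((1 - (norm v)\<^sup>2) powr \<alpha>) * indicator (ball 0 1) v *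
       (\<integral>\<^sup>+u. ennreal (P (of_real ((1 - (norm v)\<^sup>2) powr (\<alpha>/2)) * u, v)) * indicator (ball 0 1) u \<partial>lborel) \<partial>lborel)"
      by (rule nn_integral_U_coords) measurable
    also have "\<dots> \<le> (\<integral>\<^sup>+v. ennreal (L * C1) * (ennreal (norm (1 - cnj b * v) powr (-(2 * (expA * q))) * (1 - (norm v)\<^sup>2) powr (-(expA * q - \<alpha>)) *
        (1 - (norm a)\<^sup>2 * (1 - (norm v)\<^sup>2) powr \<alpha>) powr (-E)) * indicator (ball 0 1) v) \<partial>lborel)"
    proof (intro nn_integral_mono)
      fix v :: complex
      let ?\<tau> = "(1 - (norm v)\<^sup>2) powr (\<alpha>/2)"
      show "ennreal ((1 - (norm v)\<^sup>2) powr \<alpha>) * indicator (ball 0 1) v *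
       (\<integral>\<^sup>+u. ennreal (P (of_real ?\<tau> * u, v)) * indicator (ball 0 1) u \<partial>lborel)
        \<le> ennreal (L * C1) * (ennreal (norm (1 - cnj b * v) powr (-(2 * (expA * q))) * (1 - (norm v)\<^sup>2) powr (-(expA * q - \<alpha>)) *
        (1 - (norm a)\<^sup>2 * (1 - (norm v)\<^sup>2) powr \<alpha>) powr (-E)) * indicator (ball 0 1) v)"
      proof (cases "norm v < 1")
        case True
        define M where "M = L * (norm (1 - cnj b * v) powr (-(2 * (expA * q))) * (1 - (norm v)\<^sup>2) powr (-(expA * q)))"
        have M: "M \<ge> 0" using L by (simp add: M_def)
        have p: "1 - (norm v)\<^sup>2 > 0" by (rule one_minus_norm_sq_pos[OF True])
        have t: "0 < ?\<tau>" "?\<tau> \<le> 1"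
          using p alpha_pos powr_mono2[of "\<alpha>/2" "1 - (norm v)\<^sup>2" 1] by auto
        \<comment> \<open>On the fibre over v the first coordinate is \<tau> u, so the parameter of
          the inner integral is a \<tau>, and 1 - |a \<tau>|^2 is the base whose power -E
          \<open>outer_integral\<close> handles.\<close>
        have at: "norm (a * of_real ?\<tau>) < 1"
        proof -
          have "norm a * ?\<tau> \<le> norm a * 1" using t by (intro mult_left_mono) auto
          thus ?thesis using a t by (simp add: norm_mult)
        qed
        have at2: "1 - (norm (a * of_real ?\<tau>))\<^sup>2 = 1 - (norm a)\<^sup>2 * (1 - (norm v)\<^sup>2) powr \<alpha>"
        proof -
          have "?\<tau>\<^sup>2 = (1 - (norm v)\<^sup>2) powr \<alpha>" using t by (simp add: powr_powr flip: powr_numeral)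
          thus ?thesis using t by (simp add: norm_mult power_mult_distrib)
        qed
        have fa: "f_alpha \<alpha> (of_real ?\<tau> * u, v) = u" for u
          using t by (simp add: f_alpha_def)
        have "(\<integral>\<^sup>+u. ennreal (P (of_real ?\<tau> * u, v)) * indicator (ball 0 1) u \<partial>lborel)
            = (\<integral>\<^sup>+u. ennreal M * (ennreal (norm (1 - cnj (a * of_real ?\<tau>) * u) powr (-R) * (1 - (norm u)\<^sup>2) powr (-Q)) * indicator (ball 0 1) u) \<partial>lborel)"
          unfolding P_def fa M_def
          using L by (intro nn_integral_cong) (simp add: ennreal_mult[symmetric] mult_ac)
        also have "\<dots> = ennreal M * (\<integral>\<^sup>+u. (ennreal (norm (1 - cnj (a * of_real ?\<tau>) * u) powr (-R) * (1 - (norm u)\<^sup>2) powr (-Q)) * indicator (ball 0 1) u) \<partial>lborel)"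
          by (rule nn_integral_cmult) measurable
        also have "\<dots> \<le> ennreal M * ennreal (C1 * (1 - (norm (a * of_real ?\<tau>))\<^sup>2) powr (2 - R - Q))"
          by (intro mult_left_mono C1(2)[OF at]) auto
        also have "\<dots> = ennreal (M * (C1 * (1 - (norm a)\<^sup>2 * (1 - (norm v)\<^sup>2) powr \<alpha>) powr (-E)))"
        proof -
          have "2 - R - Q = - E" by (simp add: E_def)
          thus ?thesis using M C1 unfolding at2 by (simp add: ennreal_mult[symmetric])
        qed
        finally have "ennreal ((1 - (norm v)\<^sup>2) powr \<alpha>) * (\<integral>\<^sup>+u. ennreal (P (of_real ?\<tau> * u, v)) * indicator (ball 0 1) u \<partial>lborel)
           \<le> ennreal ((1 - (norm v)\<^sup>2) powr \<alpha>) * ennreal (M * (C1 * (1 - (norm a)\<^sup>2 * (1 - (norm v)\<^sup>2) powr \<alpha>) powr (-E)))"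
          by (rule mult_left_mono) auto
        also have "\<dots> = ennreal (L * C1 * (norm (1 - cnj b * v) powr (-(2 * (expA * q))) * ((1 - (norm v)\<^sup>2) powr \<alpha> * (1 - (norm v)\<^sup>2) powr (-(expA * q))) *
           (1 - (norm a)\<^sup>2 * (1 - (norm v)\<^sup>2) powr \<alpha>) powr (-E)))"
        proof -
          have nn: "0 \<le> M * (C1 * (1 - (norm a)\<^sup>2 * (1 - (norm v)\<^sup>2) powr \<alpha>) powr (-E))"
            using M C1 by simp
          show ?thesis
            unfolding ennreal_mult''[OF nn, symmetric] by (simp add: M_def mult_ac)
        qed
        also have "(1 - (norm v)\<^sup>2) powr \<alpha> * (1 - (norm v)\<^sup>2) powr (-(expA * q)) = (1 - (norm v)\<^sup>2) powr (-(expA * q - \<alpha>))"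
          unfolding powr_add[symmetric] by simp
        finally show ?thesis using True L C1 by (simp add: ennreal_mult)
      qed simp
    qed
    also have "\<dots> = ennreal (L * C1) * (\<integral>\<^sup>+v. (ennreal (norm (1 - cnj b * v) powr (-(2 * (expA * q))) * (1 - (norm v)\<^sup>2) powr (-(expA * q - \<alpha>)) *
        (1 - (norm a)\<^sup>2 * (1 - (norm v)\<^sup>2) powr \<alpha>) powr (-E)) * indicator (ball 0 1) v) \<partial>lborel)"
      by (rule nn_integral_cmult) measurable
    also have "\<dots> \<le> ennreal (L * C1) * ennreal (C2 * (1 - (norm a)\<^sup>2) powr (1 - E))"
      by (intro mult_left_mono C2(2)[OF a b]) auto
    also have "\<dots> = ennreal (c1 * c2 * C1 * C2 * (eb powr (expA * q) * (ea powr (R / 2) * ea powr (1 - E))))"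
      using L C1 C2 by (simp add: ennreal_mult[symmetric] L_def ea_def mult_ac)
    also have "ea powr (R / 2) * ea powr (1 - E) = ea powr (3/4 * q)"
      unfolding powr_add[symmetric] by (simp add: E_def R_def Q_def field_simps)
    also have "eb powr (expA * q) * ea powr (3/4 * q) = (eb powr expA * ea powr (3/4)) powr q"
      by (simp add: powr_mult powr_powr)
    also have "ennreal (c1 * c2 * C1 * C2 * (eb powr expA * ea powr (3/4)) powr q)
       \<le> ennreal ((c1 * c2 * C1 * C2 + 1) * (eb powr expA * ea powr (3/4)) powr q)"
      by (intro ennreal_leI mult_right_mono) auto
    finally show "(\<integral>\<^sup>+w. ennreal ((h (phi_b \<alpha> b w) * jb b w) powr q * ja a w powr (2 - q)) * indicator U w \<partial>lborel)
      \<le> ennreal ((c1 * c2 * C1 * C2 + 1) * ((1 - (norm b)\<^sup>2) powr expA * (1 - (norm a)\<^sup>2) powr (3/4)) powr q)"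
      by (simp add: ea_def eb_def)
  qed
qed

text \<open>Comparable to the norm of the Bergman kernel at \<open>z\<close>.\<close>

definition Nz :: "complex \<times> complex \<Rightarrow> real" where
  "Nz z = (1 - (norm (snd z))\<^sup>2) powr (- (1 + \<alpha> / 2)) * (1 - (norm (f_alpha \<alpha> z))\<^sup>2) powr (- (3/2))"

lemma Nz_pos: "z \<in> U \<Longrightarrow> Nz z > 0"
  using one_minus_norm_sq_pos[OF norm_snd_U, of z] one_minus_norm_sq_pos[OF f_alpha_less_1, of z] by (simp add: Nz_def)

text \<open>h is comparable to \<open>Nz\<close>^(1/2), and the left side is exactly
  \<open>Nz\<close>^(-1/2). This converts the output of \<open>key_integral\<close> into the form
  needed for Schur's test.\<close>

lemma h_div_Nz_ge:
  assumes z: "z \<in> U"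
  shows "(1 - (norm (snd z))\<^sup>2) powr expA * (1 - (norm (f_alpha \<alpha> z))\<^sup>2) powr (3/4) \<le> wtmax powr (3/4) * (h z / Nz z)"
proof -
  define v where "v = 1 - (norm (snd z))\<^sup>2"
  define u where "u = 1 - (norm (f_alpha \<alpha> z))\<^sup>2"
  have v: "v > 0" and u: "u > 0"
    using one_minus_norm_sq_pos norm_snd_U[OF z] f_alpha_less_1[OF z] by (auto simp: v_def u_def)
  have wf: "0 < wt (f_alpha \<alpha> z)" "wt (f_alpha \<alpha> z) \<le> wtmax * u"
    using wt_upper wt_pos f_alpha_less_1[OF z] by (auto simp: wtmax_def u_def)
  have "h z = v powr (- (expA - 3/4)) * v powr (- (3/4)) * wt (f_alpha \<alpha> z) powr (- (3/4))"
    unfolding h_def rho_f_alpha[OF norm_snd_U[OF z]] by (simp add: powr_mult v_def)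
  also have "v powr (- (expA - 3/4)) * v powr (- (3/4)) = v powr (- expA)"
    unfolding powr_add[symmetric] by simp
  finally have hz: "h z = v powr (- expA) * wt (f_alpha \<alpha> z) powr (- (3/4))" .
  have "v powr (- expA) * (wtmax powr (-(3/4)) * u powr (-(3/4))) \<le> h z"
    unfolding hz powr_mult[symmetric] using wf v u by (intro mult_left_mono powr_mono2') auto
  hence "wtmax powr (3/4) * (v powr (- expA) * (wtmax powr (-(3/4)) * u powr (-(3/4)))) / Nz z \<le> wtmax powr (3/4) * h z / Nz z"
    using Nz_pos[OF z] by (intro divide_right_mono mult_left_mono) auto
  moreover have "wtmax powr (3/4) * (v powr (- expA) * (wtmax powr (-(3/4)) * u powr (-(3/4)))) / Nz z
     = v powr expA * u powr (3/4)"
  proof -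
    have "wtmax powr (3/4) * wtmax powr (-(3/4)) = 1"
      unfolding powr_add[symmetric] using wtmax_pos by simp
    hence "wtmax powr (3/4) * (v powr (- expA) * (wtmax powr (-(3/4)) * u powr (-(3/4)))) = v powr (- expA) * u powr (-(3/4))"
      by (simp add: mult_ac)
    also have "\<dots> / Nz z = (v powr (- expA) * v powr (1 + \<alpha> / 2)) * (u powr (-(3/4)) * u powr (3/2))"
      using v u by (simp add: Nz_def v_def[symmetric] u_def[symmetric] powr_minus field_simps)
    also have "v powr (- expA) * v powr (1 + \<alpha> / 2) = v powr expA"
      unfolding powr_add[symmetric] expA_eq ..
    also have "u powr (-(3/4)) * u powr (3/2) = u powr (3/4)"
      unfolding powr_add[symmetric] by simp
    finally show ?thesis .
  qed
  ultimately show ?thesis by (simp add: v_def u_def)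
qed

text \<open>The point transformation inside is \<open>phi_b\<close> after \<open>phi_a\<close>,
  which takes the origin to z.\<close>

definition VU :: "complex \<times> complex \<Rightarrow> (complex \<times> complex \<Rightarrow> complex) \<Rightarrow> (complex \<times> complex \<Rightarrow> complex)" where
  "VU z f = V_op \<alpha> (f_alpha \<alpha> z) (U_op \<alpha> z f)"

lemma norm_VU:
  assumes z: "z \<in> U" and w: "w \<in> U"
  shows "norm (VU z F w) = norm (F (phi_b \<alpha> (snd z) (phi_a \<alpha> (f_alpha \<alpha> z) w))) * jb (snd z) (phi_a \<alpha> (f_alpha \<alpha> z) w) * ja (f_alpha \<alpha> z) w"
proof -
  have a: "norm (f_alpha \<alpha> z) < 1" and b: "norm (snd z) < 1"
    using f_alpha_less_1 norm_snd_U z by auto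
  have w': "phi_a \<alpha> (f_alpha \<alpha> z) w \<in> U"
    using phi_a_in_U_iff[OF a norm_fst_U[OF w]] w by simp
  show ?thesis
    unfolding VU_def V_op_def U_op_def norm_mult
    by (simp add: norm_holo_jacobian_phi_a[OF a norm_fst_U[OF w]] norm_holo_jacobian_phi_b[OF b norm_snd_U[OF w']])
qed

text \<open>Only \<open>phi_a\<close> is substituted. The p-th power of its Jacobian, written at the
  image point, is a power -p; two factors are spent on the substitution, which leaves 2 - p. The map
  \<open>phi_b\<close> stays, to be paired with h composed with \<open>phi_b\<close>.\<close>

lemma nn_integral_VU:
  assumes z: "z \<in> U" and [measurable]: "F \<in> borel_measurable borel"
  shows "(\<integral>\<^sup>+w. ennreal (norm (VU z F w) powr p) * indicator U w \<partial>lborel)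
    = (\<integral>\<^sup>+w. ennreal ((norm (F (phi_b \<alpha> (snd z) w)) * jb (snd z) w) powr p * ja (f_alpha \<alpha> z) w powr (2 - p)) * indicator U w \<partial>lborel)"
proof -
  define a where "a = f_alpha \<alpha> z"
  define b where "b = snd z"
  have a: "norm a < 1" and b: "norm b < 1"
    using f_alpha_less_1 norm_snd_U z by (auto simp: a_def b_def)
  define G where "G w = ennreal ((norm (F (phi_b \<alpha> b w)) * jb b w) powr p * ja a w powr (2 - p))" for w
  have G[measurable]: "G \<in> borel_measurable borel"
    unfolding G_def[abs_def] by measurable
  have "(\<integral>\<^sup>+w. ennreal (norm (VU z F w) powr p) * indicator U w \<partial>lborel)
     = (\<integral>\<^sup>+w. G (phi_a \<alpha> a w) * ennreal ((ja a w)\<^sup>2) * indicator U w \<partial>lborel)"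
  proof (intro nn_integral_cong)
    fix w
    show "ennreal (norm (VU z F w) powr p) * indicator U w = G (phi_a \<alpha> a w) * ennreal ((ja a w)\<^sup>2) * indicator U w"
    proof (cases "w \<in> U")
      case True
      let ?k = "norm (F (phi_b \<alpha> b (phi_a \<alpha> a w))) * jb b (phi_a \<alpha> a w)"
      have j: "ja a w > 0" "ja a (phi_a \<alpha> a w) = 1 / ja a w"
        using ja_pos[OF a norm_fst_U[OF True]] ja_phi_a[OF a norm_fst_U[OF True]] by auto
      have "norm (VU z F w) powr p = ?k powr p * ja a w powr p"
        unfolding norm_VU[OF z True] by (simp add: powr_mult a_def b_def)
      also have "ja a w powr p = ja a (phi_a \<alpha> a w) powr (2 - p) * (ja a w)\<^sup>2"
      proof -
        have "ja a (phi_a \<alpha> a w) powr (2 - p) = ja a w powr (- (2 - p))"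
          unfolding j(2) by (simp only: powr_minus_divide powr_divide powr_one_eq_one)
        moreover have "(ja a w)\<^sup>2 = ja a w powr 2" using j by (simp add: powr_numeral)
        ultimately show ?thesis by (simp only: powr_add[symmetric]) simp
      qed
      finally show ?thesis using True by (simp add: G_def ennreal_mult mult_ac)
    qed simp
  qed
  also have "\<dots> = (\<integral>\<^sup>+w. G w * indicator U w \<partial>lborel)"
    by (rule nn_integral_phi_a[OF a G])
  finally show ?thesis by (simp add: G_def a_def b_def)
qed

text \<open>At p = 2 the leftover Jacobian power is trivial, so \<open>VU z\<close> preserves the L2
  norm. This makes the norm of \<open>T (kk w)\<close> available for interpolation.\<close>

lemma nn_integral_VU_square:
  assumes z: "z \<in> U" and [measurable]: "F \<in> borel_measurable borel"
  shows "(\<integral>\<^sup>+w. ennreal (norm (VU z F w) powr 2) * indicator U w \<partial>lborel)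
    = (\<integral>\<^sup>+w. ennreal ((norm (F w))\<^sup>2) * indicator U w \<partial>lborel)"
proof -
  have a: "norm (f_alpha \<alpha> z) < 1" and b: "norm (snd z) < 1"
    using f_alpha_less_1 norm_snd_U z by auto
  have "(\<integral>\<^sup>+w. ennreal (norm (VU z F w) powr 2) * indicator U w \<partial>lborel)
      = (\<integral>\<^sup>+w. ennreal ((norm (F (phi_b \<alpha> (snd z) w)))\<^sup>2) * ennreal ((jb (snd z) w)\<^sup>2) * indicator U w \<partial>lborel)"
    unfolding nn_integral_VU[OF assms]
  proof (intro nn_integral_cong)
    fix w
    show "ennreal ((norm (F (phi_b \<alpha> (snd z) w)) * jb (snd z) w) powr 2 * ja (f_alpha \<alpha> z) w powr (2 - 2)) * indicator U w
       = ennreal ((norm (F (phi_b \<alpha> (snd z) w)))\<^sup>2) * ennreal ((jb (snd z) w)\<^sup>2) * indicator U w"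
    proof (cases "w \<in> U")
      case True
      thus ?thesis using ja_pos[OF a norm_fst_U[OF True]] jb_pos[OF b norm_snd_U[OF True]]
        by (simp add: ennreal_mult[symmetric] power_mult_distrib)
    qed simp
  qed
  also have "\<dots> = (\<integral>\<^sup>+w. ennreal ((norm (F w))\<^sup>2) * indicator U w \<partial>lborel)"
    using nn_integral_phi_b[OF b, of "\<lambda>w. ennreal ((norm (F w))\<^sup>2)"] by simp
  finally show ?thesis .
qed

text \<open>The bound is linear in \<eta> with a constant uniform in z and F, so that a small norm
  later yields a small column integral.\<close>

theorem weighted_estimate:
  fixes p :: real
  assumes p: "p > 4"
  shows "\<exists>C>0. \<forall>z\<in>U. \<forall>F\<in>borel_measurable borel. \<forall>\<eta>>0.
    (\<integral>\<^sup>+w. ennreal (norm (VU z F w) powr p) * indicator U w \<partial>lborel) \<le> ennreal (\<eta> powr p) \<longrightarrow>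
    (\<integral>\<^sup>+w. ennreal (norm (F w) * h w) * indicator U w \<partial>lborel) \<le> ennreal (C * \<eta> * (h z / Nz z))"
proof -
  define q where "q = p / (p - 1)"
  have q: "1 < q" "q < 4/3" "1/p + 1/q = 1" using p by (auto simp: q_def field_simps)
  obtain C where C: "C > 0" "\<And>a b. norm a < 1 \<Longrightarrow> norm b < 1 \<Longrightarrow>
    (\<integral>\<^sup>+w. ennreal ((h (phi_b \<alpha> b w) * jb b w) powr q * ja a w powr (2 - q)) * indicator U w \<partial>lborel)
     \<le> ennreal (C * ((1 - (norm b)\<^sup>2) powr expA * (1 - (norm a)\<^sup>2) powr (3/4)) powr q)"
    using key_integral[OF q(1,2)] by blast
  show ?thesis
  proof (intro exI[of _ "C powr (1/q) * wtmax powr (3/4)"] conjI ballI allI impI)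
    show "0 < C powr (1/q) * wtmax powr (3/4)" using C wtmax_pos by simp
    fix z F and \<eta> :: real
    assume z: "z \<in> U" and F[measurable]: "F \<in> borel_measurable borel" and \<eta>: "\<eta> > 0"
      and hyp: "(\<integral>\<^sup>+w. ennreal (norm (VU z F w) powr p) * indicator U w \<partial>lborel) \<le> ennreal (\<eta> powr p)"
    define a where "a = f_alpha \<alpha> z"
    define b where "b = snd z"
    have a: "norm a < 1" and b: "norm b < 1"
      using f_alpha_less_1 norm_snd_U z by (auto simp: a_def b_def)
    define D where "D = (1 - (norm b)\<^sup>2) powr expA * (1 - (norm a)\<^sup>2) powr (3/4)"
    have D: "D > 0" using one_minus_norm_sq_pos[OF a] one_minus_norm_sq_pos[OF b] by (simp add: D_def)
    define S where "S = C powr (1/q) * D"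
    have S: "S > 0" using C D by (simp add: S_def)
    \<comment> \<open>The exponents (2 - p)/p and (p - 2)/p cancel in the product X Y and become 2 -
      p and 2 - q after raising to the powers p and q.\<close>
    define X where "X w = norm (F (phi_b \<alpha> b w)) * jb b w * ja a w powr ((2 - p) / p) * indicator U w" for w
    define Y where "Y w = h (phi_b \<alpha> b w) * jb b w * ja a w powr ((p - 2) / p) * indicator U w" for w
    have X[measurable]: "X \<in> borel_measurable lborel" unfolding X_def[abs_def] by measurable
    have Y[measurable]: "Y \<in> borel_measurable lborel" unfolding Y_def[abs_def] by measurable
    have jbn: "jb b w \<ge> 0" "ja a w \<ge> 0" for w
      using one_minus_norm_sq_pos[OF b] one_minus_norm_sq_pos[OF a] by (auto simp: jb_def ja_def mobd_def)
    have XY: "X w \<ge> 0" "Y w \<ge> 0" for w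
      by (auto simp: X_def Y_def jbn h_nonneg)
    have Xi: "(\<integral>\<^sup>+w. ennreal (X w powr p) \<partial>lborel) \<le> ennreal (\<eta> powr p)"
    proof -
      have "(\<integral>\<^sup>+w. ennreal (X w powr p) \<partial>lborel) = (\<integral>\<^sup>+w. ennreal (norm (VU z F w) powr p) * indicator U w \<partial>lborel)"
        unfolding nn_integral_VU[OF z F]
      proof (intro nn_integral_cong)
        fix w
        have "(2 - p) / p * p = 2 - p" using p by simp
        thus "ennreal (X w powr p) = ennreal ((norm (F (phi_b \<alpha> (snd z) w)) * jb (snd z) w) powr p * ja (f_alpha \<alpha> z) w powr (2 - p)) * indicator U w"
          by (cases "w \<in> U") (simp_all add: X_def powr_mult powr_powr a_def b_def)
      qed
      thus ?thesis using hyp by simp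
    qed
    have Yi: "(\<integral>\<^sup>+w. ennreal (Y w powr q) \<partial>lborel) \<le> ennreal (S powr q)"
    proof -
      have "(\<integral>\<^sup>+w. ennreal (Y w powr q) \<partial>lborel) = (\<integral>\<^sup>+w. ennreal ((h (phi_b \<alpha> b w) * jb b w) powr q * ja a w powr (2 - q)) * indicator U w \<partial>lborel)"
      proof (intro nn_integral_cong)
        fix w
        have "(p - 2) / p * q = 2 - q" using p by (simp add: q_def field_simps)
        thus "ennreal (Y w powr q) = ennreal ((h (phi_b \<alpha> b w) * jb b w) powr q * ja a w powr (2 - q)) * indicator U w"
          by (cases "w \<in> U") (simp_all add: Y_def powr_mult powr_powr)
      qed
      also have "\<dots> \<le> ennreal (C * D powr q)" unfolding D_def by (rule C(2)[OF a b])
      also have "C * D powr q = S powr q" using C q by (simp add: S_def powr_mult powr_powr)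
      finally show ?thesis .
    qed
    have "(\<integral>\<^sup>+w. ennreal (norm (F w) * h w) * indicator U w \<partial>lborel)
       = (\<integral>\<^sup>+w. ennreal (norm (F (phi_b \<alpha> b w)) * h (phi_b \<alpha> b w)) * ennreal ((jb b w)\<^sup>2) * indicator U w \<partial>lborel)"
      using nn_integral_phi_b[OF b, of "\<lambda>w. ennreal (norm (F w) * h w)"] by simp
    also have "\<dots> = (\<integral>\<^sup>+w. ennreal (X w * Y w) \<partial>lborel)"
    proof (intro nn_integral_cong)
      fix w
      show "ennreal (norm (F (phi_b \<alpha> b w)) * h (phi_b \<alpha> b w)) * ennreal ((jb b w)\<^sup>2) * indicator U w = ennreal (X w * Y w)"
      proof (cases "w \<in> U")
        case True
        have "ja a w powr ((2 - p) / p) * ja a w powr ((p - 2) / p) = 1"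
          unfolding powr_add[symmetric] using ja_pos[OF a norm_fst_U[OF True]] by (simp add: diff_divide_distrib)
        hence "X w * Y w = norm (F (phi_b \<alpha> b w)) * h (phi_b \<alpha> b w) * (jb b w)\<^sup>2"
          using True by (simp add: X_def Y_def power2_eq_square mult_ac)
        thus ?thesis using True by (simp add: ennreal_mult h_nonneg)
      qed (simp add: X_def)
    qed
    also have "\<dots> \<le> ennreal (\<eta> * S)"
      using p q \<eta> S by (intro nn_integral_Holder[where p = p and q = q] Xi Yi XY X Y) auto
    also have "\<dots> \<le> ennreal (C powr (1/q) * wtmax powr (3/4) * \<eta> * (h z / Nz z))"
    proof (rule ennreal_leI)
      have "\<eta> * S \<le> \<eta> * (C powr (1/q) * (wtmax powr (3/4) * (h z / Nz z)))"
        unfolding S_def D_def a_def b_def using h_div_Nz_ge[OF z] \<eta> by (intro mult_left_mono) auto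
      thus "\<eta> * S \<le> C powr (1/q) * wtmax powr (3/4) * \<eta> * (h z / Nz z)" by (simp add: mult_ac)
    qed
    finally show "(\<integral>\<^sup>+w. ennreal (norm (F w) * h w) * indicator U w \<partial>lborel)
      \<le> ennreal (C powr (1/q) * wtmax powr (3/4) * \<eta> * (h z / Nz z))" .
  qed
qed

end

section \<open>Mean values of holomorphic functions over balanced sets\<close>

lemma mean_value_circle:
  fixes F :: "complex \<Rightarrow> complex"
  assumes S: "open S" "cball 0 1 \<subseteq> S" and F: "F holomorphic_on S"
  shows "(LINT \<theta>|lborel. indicator {0..1} \<theta> *\<^sub>R F (exp (2 * of_real pi * \<i> * of_real \<theta>))) = F 0"
proof -
  have cF: "continuous_on (cball 0 1) F"
    using F S holomorphic_on_imp_continuous_on holomorphic_on_subset by blast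
  have "((\<lambda>u. F u / (u - 0)) has_contour_integral (2 * of_real pi * \<i> * F 0)) (circlepath 0 1)"
  proof (rule Cauchy_integral_circlepath)
    show "continuous_on (cball 0 1) F" by (rule cF)
    show "F holomorphic_on ball 0 1"
      using F S ball_subset_cball holomorphic_on_subset by blast
  qed simp
  hence "((\<lambda>x. F (circlepath 0 1 x) / circlepath 0 1 x * vector_derivative (circlepath 0 1) (at x within {0..1})) has_integral (2 * of_real pi * \<i> * F 0)) {0..1}"
    by (simp add: has_contour_integral_def)
  hence "((\<lambda>x. 2 * of_real pi * \<i> * F (exp (2 * of_real pi * \<i> * of_real x))) has_integral (2 * of_real pi * \<i> * F 0)) {0..1}"
    by (rule has_integral_eq[rotated]) (subst vector_derivative_circlepath01, auto simp: circlepath)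
  from has_integral_mult_right[OF this, of "1 / (2 * of_real pi * \<i>)"]
  have i: "((\<lambda>x. F (exp (2 * of_real pi * \<i> * of_real x))) has_integral F 0) {0..1}"
    by simp
  have c: "continuous_on {0..1::real} (\<lambda>x. F (exp (2 * of_real pi * \<i> * of_real x)))"
    by (rule continuous_on_compose2[OF cF]) (auto intro!: continuous_intros simp: norm_exp_i_times[of "2 * pi * _", simplified of_real_mult] mult_ac)
  have si: "set_integrable lborel {0..1::real} (\<lambda>x. F (exp (2 * of_real pi * \<i> * of_real x)))"
    using c by (rule borel_integrable_atLeastAtMost')
  show ?thesis
    using set_borel_integral_eq_integral(2)[OF si] i
    by (simp add: set_lebesgue_integral_def integral_unique)
qed

lemma distr_lborel_rotate:
  fixes c :: complex
  assumes c: "norm c = 1"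
  shows "distr lborel borel (\<lambda>w. (c * fst w, c * snd w)) = (lborel :: (complex \<times> complex) measure)"
proof (rule measure_eqI)
  have m[measurable]: "(\<lambda>w::complex\<times>complex. (c * fst w, c * snd w)) \<in> borel_measurable borel" by measurable
  fix A assume "A \<in> sets (distr lborel borel (\<lambda>w::complex\<times>complex. (c * fst w, c * snd w)))"
  hence A[measurable]: "A \<in> sets borel" by simp
  have A'[measurable]: "A \<in> sets (borel \<Otimes>\<^sub>M borel)"
    unfolding borel_prod by (rule A)
  have "emeasure (distr lborel borel (\<lambda>w. (c * fst w, c * snd w))) A
     = (\<integral>\<^sup>+w. indicator A w \<partial>distr lborel borel (\<lambda>w. (c * fst w, c * snd w)))" by simp
  also have "\<dots> = (\<integral>\<^sup>+w. indicator A (c * fst w, c * snd w) \<partial>lborel)"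
    by (subst nn_integral_distr) auto
  also have "\<dots> = (\<integral>\<^sup>+x. (\<integral>\<^sup>+y. indicator A (c * x, c * y) \<partial>lborel) \<partial>lborel)"
  proof -
    have "(\<lambda>w. indicator A (c * fst w, c * snd w) :: ennreal) \<in> borel_measurable (borel \<Otimes>\<^sub>M borel)" by measurable
    from nn_integral_lborel_fst_snd[OF this[unfolded borel_prod]] show ?thesis by simp
  qed
  also have "\<dots> = (\<integral>\<^sup>+x. (\<integral>\<^sup>+y. indicator A (c * x, y) \<partial>lborel) \<partial>lborel)"
  proof (rule nn_integral_cong)
    fix x :: complex
    have "(\<lambda>y. indicator A (c * x, y) :: ennreal) \<in> borel_measurable borel" by measurable
    from nn_integral_rotate[OF c this]
    show "(\<integral>\<^sup>+y. indicator A (c * x, c * y) \<partial>lborel) = (\<integral>\<^sup>+y. indicator A (c * x, y) \<partial>lborel)" by simp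
  qed
  also have "\<dots> = (\<integral>\<^sup>+x. (\<integral>\<^sup>+y. indicator A (x, y) \<partial>lborel) \<partial>lborel)"
  proof -
    have "(\<lambda>x. \<integral>\<^sup>+y. indicator A (x, y) \<partial>lborel) \<in> borel_measurable lborel"
      by (rule lborel.borel_measurable_nn_integral_fst) (simp add: lborel_prod)
    hence "(\<lambda>x. \<integral>\<^sup>+y. indicator A (x, y) \<partial>lborel) \<in> borel_measurable borel" by simp
    from nn_integral_rotate[OF c this] show ?thesis by simp
  qed
  also have "\<dots> = (\<integral>\<^sup>+w. indicator A w \<partial>lborel)"
    by (rule nn_integral_lborel_fst_snd[symmetric]) measurable
  finally show "emeasure (distr lborel borel (\<lambda>w. (c * fst w, c * snd w))) A = emeasure lborel A" by simp
qed simp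

text \<open>Every rotation by e^(i \<theta>) preserves \<open>P\<close> and the measure, so the
  integral may be averaged over \<theta>. After Fubini the inner average is that of a one-variable
  holomorphic function over the unit circle of the complex line through w, which is its value at
  0.\<close>

lemma mean_value_balanced:
  fixes g :: "complex \<times> complex \<Rightarrow> complex"
  assumes P[measurable]: "P \<in> sets borel" "emeasure lborel P < \<infinity>"
    and rot: "\<And>w t. w \<in> P \<Longrightarrow> norm t = 1 \<Longrightarrow> (t * fst w, t * snd w) \<in> P"
    and g[measurable]: "g \<in> borel_measurable borel"
    and int: "integrable lborel (\<lambda>w. indicator P w *\<^sub>R g w)"
    and hol: "\<And>w. w \<in> P \<Longrightarrow> \<exists>S. open S \<and> cball 0 1 \<subseteq> S \<and> (\<lambda>t. g (t * fst w, t * snd w)) holomorphic_on S"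
  shows "(LINT w|lborel. indicator P w *\<^sub>R g w) = measure lborel P *\<^sub>R g (0, 0)"
proof -
  define e where "e \<theta> = exp (2 * of_real pi * \<i> * of_real \<theta>)" for \<theta> :: real
  have e: "norm (e \<theta>) = 1" for \<theta> by (simp add: e_def)
  have em[measurable]: "e \<in> borel_measurable borel"
    unfolding e_def[abs_def] by (intro borel_measurable_continuous_onI continuous_intros)
  have iP: "indicator P (t * fst w, t * snd w) = (indicator P w :: real)" if "norm t = 1" for t w
  proof -
    have "t \<noteq> 0" "norm (inverse t) = 1" using that by (auto simp: norm_inverse)
    hence "(t * fst w, t * snd w) \<in> P \<longleftrightarrow> w \<in> P"
      using rot[OF _ that, of w] rot[of "(t * fst w, t * snd w)" "inverse t"] that by (auto simp: field_simps)
    thus ?thesis by (simp add: indicator_def)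
  qed
  define f where "f \<theta> w = indicator {0..1} \<theta> *\<^sub>R (indicator P w *\<^sub>R g (e \<theta> * fst w, e \<theta> * snd w))" for \<theta> :: real and w
  have rm: "(\<lambda>w::complex\<times>complex. (e \<theta> * fst w, e \<theta> * snd w)) \<in> borel_measurable lborel" for \<theta> by simp
  have Im: "(\<lambda>w. indicator P w *\<^sub>R g w) \<in> borel_measurable borel" by measurable
  have fm: "case_prod f \<in> borel_measurable (lborel \<Otimes>\<^sub>M lborel)"
  proof -
    have gm[measurable]: "g \<in> borel_measurable (borel \<Otimes>\<^sub>M borel)" unfolding borel_prod by (rule g)
    have Pm[measurable]: "P \<in> sets (borel \<Otimes>\<^sub>M borel)" unfolding borel_prod by (rule P(1))
    have "(\<lambda>(\<theta>, w). f \<theta> w) \<in> borel_measurable (borel \<Otimes>\<^sub>M (borel \<Otimes>\<^sub>M borel))"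
      unfolding f_def by measurable
    thus ?thesis by (simp add: lborel_prod borel_prod)
  qed
  have A: "(LINT w|lborel. indicator P w *\<^sub>R g (e \<theta> * fst w, e \<theta> * snd w)) = (LINT w|lborel. indicator P w *\<^sub>R g w)" for \<theta>
    using integral_distr[OF rm Im, of \<theta>] by (simp add: distr_lborel_rotate[OF e] iP[OF e])
  have B: "(\<integral>\<^sup>+w. norm (indicator P w *\<^sub>R g (e \<theta> * fst w, e \<theta> * snd w)) \<partial>lborel) = (\<integral>\<^sup>+w. norm (indicator P w *\<^sub>R g w) \<partial>lborel)" for \<theta>
  proof -
    have "(\<integral>\<^sup>+w. ennreal (norm (indicator P w *\<^sub>R g w)) \<partial>distr lborel borel (\<lambda>w. (e \<theta> * fst w, e \<theta> * snd w)))
        = (\<integral>\<^sup>+w. ennreal (norm (indicator P (e \<theta> * fst w, e \<theta> * snd w) *\<^sub>R g (e \<theta> * fst w, e \<theta> * snd w))) \<partial>lborel)"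
      by (rule nn_integral_distr) (use rm in auto)
    thus ?thesis by (simp add: distr_lborel_rotate[OF e] iP[OF e])
  qed
  have "integrable (lborel \<Otimes>\<^sub>M lborel) (case_prod f)"
  proof (rule integrableI_bounded[OF fm])
    have "(\<integral>\<^sup>+x. norm (case_prod f x) \<partial>(lborel \<Otimes>\<^sub>M lborel)) = (\<integral>\<^sup>+\<theta>. (\<integral>\<^sup>+w. norm (f \<theta> w) \<partial>lborel) \<partial>lborel)"
      using lborel.nn_integral_fst[of "\<lambda>x. ennreal (norm (case_prod f x))" lborel] fm by simp
    also have "\<dots> = (\<integral>\<^sup>+\<theta>. indicator {0..1::real} \<theta> * (\<integral>\<^sup>+w. norm (indicator P w *\<^sub>R g w) \<partial>lborel) \<partial>lborel)"
    proof (intro nn_integral_cong)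
      fix \<theta> :: real
      show "(\<integral>\<^sup>+w. norm (f \<theta> w) \<partial>lborel) = indicator {0..1::real} \<theta> * (\<integral>\<^sup>+w. norm (indicator P w *\<^sub>R g w) \<partial>lborel)"
        unfolding B[symmetric, of \<theta>] by (cases "\<theta> \<in> {0..1}") (auto simp: f_def)
    qed
    also have "\<dots> = (\<integral>\<^sup>+w. norm (indicator P w *\<^sub>R g w) \<partial>lborel)"
      by (simp add: nn_integral_multc)
    also have "\<dots> < \<infinity>" using int by (simp add: integrable_iff_bounded)
    finally show "(\<integral>\<^sup>+x. norm (case_prod f x) \<partial>(lborel \<Otimes>\<^sub>M lborel)) < \<infinity>" .
  qed
  from lborel_pair.Fubini_integral[OF this]
  have "(LINT w|lborel. (LINT \<theta>|lborel. f \<theta> w)) = (LINT \<theta>|lborel. (LINT w|lborel. f \<theta> w))" .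
  also have "\<dots> = (LINT \<theta>|lborel. indicator {0..1::real} \<theta> *\<^sub>R (LINT w|lborel. indicator P w *\<^sub>R g w))"
  proof (rule Bochner_Integration.integral_cong[OF refl])
    fix \<theta> :: real
    show "(LINT w|lborel. f \<theta> w) = indicator {0..1} \<theta> *\<^sub>R (LINT w|lborel. indicator P w *\<^sub>R g w)"
      using A[of \<theta>] by (cases "\<theta> \<in> {0..1}") (auto simp: f_def)
  qed
  also have "\<dots> = (LINT w|lborel. indicator P w *\<^sub>R g w)"
    by simp
  also have "(LINT w|lborel. (LINT \<theta>|lborel. f \<theta> w)) = (LINT w|lborel. indicator P w *\<^sub>R g (0, 0))"
  proof (intro Bochner_Integration.integral_cong refl)
    fix w
    show "(LINT \<theta>|lborel. f \<theta> w) = indicator P w *\<^sub>R g (0, 0)"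
    proof (cases "w \<in> P")
      case True
      obtain S where S: "open S" "cball 0 1 \<subseteq> S" "(\<lambda>t. g (t * fst w, t * snd w)) holomorphic_on S"
        using hol[OF True] by blast
      show ?thesis
        using mean_value_circle[OF S] True by (simp add: f_def e_def)
    qed (simp add: f_def)
  qed
  also have "\<dots> = measure lborel P *\<^sub>R g (0, 0)"
    using P by simp
  finally show ?thesis by simp
qed

section \<open>Holomorphic functions of two variables\<close>

lemma holomorphic2_on_compose_curve:
  assumes f: "holomorphic2_on f U" and S: "open S" and h: "g1 holomorphic_on S" "g2 holomorphic_on S"
    and im: "\<And>t. t \<in> S \<Longrightarrow> (g1 t, g2 t) \<in> U"
  shows "(\<lambda>t. f (g1 t, g2 t)) holomorphic_on S"
  unfolding holomorphic_on_open[OF S]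
proof
  fix t assume t: "t \<in> S"
  obtain a b where ab: "(f has_derivative (\<lambda>h. a * fst h + b * snd h)) (at (g1 t, g2 t))"
    using f im[OF t] by (auto simp: holomorphic2_on_def)
  have d: "(g1 has_derivative (\<lambda>h. deriv g1 t * h)) (at t)" "(g2 has_derivative (\<lambda>h. deriv g2 t * h)) (at t)"
    using holomorphic_derivI[OF h(1) S t] holomorphic_derivI[OF h(2) S t] by (auto simp: has_field_derivative_def)
  have "((\<lambda>t. f (g1 t, g2 t)) has_derivative (\<lambda>h. a * (deriv g1 t * h) + b * (deriv g2 t * h))) (at t)"
    using has_derivative_compose[OF has_derivative_Pair[OF d] ab] by simp
  hence "((\<lambda>t. f (g1 t, g2 t)) has_field_derivative (a * deriv g1 t + b * deriv g2 t)) (at t)"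
    unfolding has_field_derivative_def
    by (rule has_derivative_eq_rhs) (auto simp: algebra_simps fun_eq_iff)
  thus "\<exists>f'. ((\<lambda>t. f (g1 t, g2 t)) has_field_derivative f') (at t)" by blast
qed

lemma holomorphic2_on_imp_continuous_on: "holomorphic2_on f U \<Longrightarrow> continuous_on U f"
  unfolding holomorphic2_on_def
  by (intro continuous_at_imp_continuous_on ballI) (metis has_derivative_continuous)

lemma holomorphic2_on_add: "holomorphic2_on f U \<Longrightarrow> holomorphic2_on g U \<Longrightarrow> holomorphic2_on (f + g) U"
  unfolding holomorphic2_on_def
proof
  fix z assume fg: "\<forall>z\<in>U. \<exists>a b. (f has_derivative (\<lambda>h. a * fst h + b * snd h)) (at z)"
    "\<forall>z\<in>U. \<exists>a b. (g has_derivative (\<lambda>h. a * fst h + b * snd h)) (at z)" and z: "z \<in> U"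
  obtain a b c d where "(f has_derivative (\<lambda>h. a * fst h + b * snd h)) (at z)"
    "(g has_derivative (\<lambda>h. c * fst h + d * snd h)) (at z)" using fg z by blast
  from has_derivative_add[OF this]
  have "((f + g) has_derivative (\<lambda>h. (a + c) * fst h + (b + d) * snd h)) (at z)"
    by (simp add: plus_fun_def algebra_simps)
  thus "\<exists>a b. ((f + g) has_derivative (\<lambda>h. a * fst h + b * snd h)) (at z)" by blast
qed

lemma holomorphic2_on_cscale: "holomorphic2_on f U \<Longrightarrow> holomorphic2_on (cscale k f) U"
  unfolding holomorphic2_on_def
proof
  fix z assume f: "\<forall>z\<in>U. \<exists>a b. (f has_derivative (\<lambda>h. a * fst h + b * snd h)) (at z)" and z: "z \<in> U"
  obtain a b where "(f has_derivative (\<lambda>h. a * fst h + b * snd h)) (at z)" using f z by blast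
  from has_derivative_mult_right[OF this, of k]
  have "(cscale k f has_derivative (\<lambda>h. (k * a) * fst h + (k * b) * snd h)) (at z)"
    by (simp add: cscale_def[abs_def] algebra_simps)
  thus "\<exists>a b. (cscale k f has_derivative (\<lambda>h. a * fst h + b * snd h)) (at z)" by blast
qed

section \<open>The space of square integrable functions\<close>

context thullen
begin

abbreviation M where "M \<equiv> lebesgue_on U"
abbreviation ip where "ip \<equiv> inner_L2 \<alpha>"
abbreviation nm where "nm \<equiv> norm_L2 \<alpha>"

text \<open>Functions, not classes modulo null sets: \<open>nm\<close> is only a seminorm here. It
  becomes definite on \<open>A2\<close>, by point evaluation.\<close>

definition L2 :: "(complex \<times> complex \<Rightarrow> complex) set" where
  "L2 = {f. f \<in> borel_measurable M \<and> integrable M (\<lambda>w. (norm (f w))\<^sup>2)}"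

lemma L2_measurable: "f \<in> L2 \<Longrightarrow> f \<in> borel_measurable M"
  and L2_integrable: "f \<in> L2 \<Longrightarrow> integrable M (\<lambda>w. (norm (f w))\<^sup>2)"
  by (auto simp: L2_def)

lemma L2_add: "f \<in> L2 \<Longrightarrow> g \<in> L2 \<Longrightarrow> f + g \<in> L2"
proof -
  assume f: "f \<in> L2" and g: "g \<in> L2"
  note [measurable] = L2_measurable[OF f] L2_measurable[OF g]
  have bd: "norm ((norm (f w + g w))\<^sup>2) \<le> norm (2 * (norm (f w))\<^sup>2 + 2 * (norm (g w))\<^sup>2)" for w
  proof -
    have "(norm (f w + g w))\<^sup>2 \<le> (norm (f w) + norm (g w))\<^sup>2"
      by (intro power_mono norm_triangle_ineq) auto
    also have "\<dots> \<le> 2 * (norm (f w))\<^sup>2 + 2 * (norm (g w))\<^sup>2"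
      using sum_squares_bound[of "norm (f w)" "norm (g w)"] by (simp add: power2_sum)
    finally show ?thesis by simp
  qed
  have i: "integrable M (\<lambda>w. 2 * (norm (f w))\<^sup>2 + 2 * (norm (g w))\<^sup>2)"
    using L2_integrable[OF f] L2_integrable[OF g] by simp
  have m: "(\<lambda>w. f w + g w) \<in> borel_measurable M" by measurable
  have "integrable M (\<lambda>w. (norm (f w + g w))\<^sup>2)"
    by (rule Bochner_Integration.integrable_bound[OF i]) (measurable, rule AE_I2, rule bd)
  thus ?thesis using m by (simp add: L2_def plus_fun_def)
qed

lemma L2_cscale: "f \<in> L2 \<Longrightarrow> cscale c f \<in> L2"
  by (auto simp: L2_def cscale_def norm_mult power_mult_distrib)

lemma cscale_minus_one: "cscale (-1) f = - f"
  by (auto simp: cscale_def)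

lemma L2_diff: "f \<in> L2 \<Longrightarrow> g \<in> L2 \<Longrightarrow> f - g \<in> L2"
  using L2_add[of f "cscale (-1) g"] L2_cscale[of g "-1"] by (simp add: cscale_minus_one)

lemma L2_integrable_mult:
  assumes f: "f \<in> L2" and g: "g \<in> L2"
  shows "integrable M (\<lambda>w. f w * cnj (g w))"
proof -
  note [measurable] = L2_measurable[OF f] L2_measurable[OF g]
  have bd: "norm (f w * cnj (g w)) \<le> norm ((norm (f w))\<^sup>2 + (norm (g w))\<^sup>2)" for w
  proof -
    have "norm (f w * cnj (g w)) \<le> 2 * norm (f w) * norm (g w)" by (simp add: norm_mult)
    also have "\<dots> \<le> (norm (f w))\<^sup>2 + (norm (g w))\<^sup>2" by (rule sum_squares_bound)
    finally show ?thesis by simp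
  qed
  have i: "integrable M (\<lambda>w. (norm (f w))\<^sup>2 + (norm (g w))\<^sup>2)"
    using L2_integrable[OF f] L2_integrable[OF g] by simp
  have "(\<lambda>w. cnj (g w)) \<in> borel_measurable M"
    by (rule measurable_compose[OF L2_measurable[OF g] borel_measurable_continuous_onI])
       (intro continuous_intros)
  hence m: "(\<lambda>w. f w * cnj (g w)) \<in> borel_measurable M" by measurable
  show ?thesis
    by (rule Bochner_Integration.integrable_bound[OF i m]) (rule AE_I2, rule bd)
qed

lemma nm_nonneg: "nm f \<ge> 0"
  by (simp add: norm_L2_def)

lemma nm_square: "(nm f)\<^sup>2 = (LINT w|M. (norm (f w))\<^sup>2)"
  by (simp add: norm_L2_def)

lemma nn_integral_nm: "f \<in> L2 \<Longrightarrow> (\<integral>\<^sup>+w. ennreal ((norm (f w))\<^sup>2) \<partial>M) = ennreal ((nm f)\<^sup>2)"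
  unfolding nm_square by (intro nn_integral_eq_integral L2_integrable) auto

lemma ip_self: "ip f f = of_real ((nm f)\<^sup>2)"
  unfolding nm_square inner_L2_def integral_complex_of_real[symmetric] complex_norm_square by simp

lemma ip_cnj: "ip g f = cnj (ip f g)"
proof -
  have "cnj (LINT w|M. f w * cnj (g w)) = (LINT w|M. cnj (f w * cnj (g w)))"
    by (rule Bochner_Integration.integral_cnj[symmetric])
  thus ?thesis by (simp add: inner_L2_def mult.commute)
qed

lemma ip_add_left: "f \<in> L2 \<Longrightarrow> g \<in> L2 \<Longrightarrow> k \<in> L2 \<Longrightarrow> ip (f + g) k = ip f k + ip g k"
  unfolding inner_L2_def
  by (subst Bochner_Integration.integral_add[symmetric]) (auto intro: L2_integrable_mult simp: algebra_simps)

lemma ip_diff_left: "f \<in> L2 \<Longrightarrow> g \<in> L2 \<Longrightarrow> k \<in> L2 \<Longrightarrow> ip (f - g) k = ip f k - ip g k"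
  unfolding inner_L2_def
  by (subst Bochner_Integration.integral_diff[symmetric]) (auto intro: L2_integrable_mult simp: algebra_simps)

lemma ip_cscale_left: "ip (cscale c f) k = c * ip f k"
  unfolding inner_L2_def cscale_def by (simp add: mult.assoc)

lemma ip_add_right: "f \<in> L2 \<Longrightarrow> g \<in> L2 \<Longrightarrow> k \<in> L2 \<Longrightarrow> ip k (f + g) = ip k f + ip k g"
  unfolding ip_cnj[of k] by (simp add: ip_add_left)

lemma ip_diff_right: "f \<in> L2 \<Longrightarrow> g \<in> L2 \<Longrightarrow> k \<in> L2 \<Longrightarrow> ip k (f - g) = ip k f - ip k g"
  unfolding ip_cnj[of k] by (simp add: ip_diff_left)

lemma ip_cscale_right: "ip k (cscale c f) = cnj c * ip k f"
  unfolding ip_cnj[of k] by (simp add: ip_cscale_left)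

lemma nm_cscale: "nm (cscale c f) = norm c * nm f"
  by (simp add: norm_L2_def cscale_def norm_mult power_mult_distrib real_sqrt_mult)

lemma nm_minus_commute: "nm (f - g) = nm (g - f)"
  by (simp add: norm_L2_def norm_minus_commute)

lemma Cauchy_Schwarz_ip:
  assumes f: "f \<in> L2" and g: "g \<in> L2"
  shows "norm (ip f g) \<le> nm f * nm g"
proof -
  note [measurable] = L2_measurable[OF f] L2_measurable[OF g]
  define I where "I = (LINT w|M. norm (f w * cnj (g w)))"
  have I0: "I \<ge> 0" by (simp add: I_def)
  have "ennreal I = (\<integral>\<^sup>+w. ennreal (norm (f w)) * ennreal (norm (g w)) \<partial>M)"
    unfolding I_def using L2_integrable_mult[OF f g]
    by (subst nn_integral_eq_integral[symmetric]) (auto simp: norm_mult ennreal_mult dest: integrable_norm)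
  hence "ennreal (I\<^sup>2) = (\<integral>\<^sup>+w. ennreal (norm (f w)) * ennreal (norm (g w)) \<partial>M)\<^sup>2"
    using I0 by (simp add: ennreal_power[symmetric])
  also have "\<dots> \<le> (\<integral>\<^sup>+w. (ennreal (norm (f w)))\<^sup>2 \<partial>M) * (\<integral>\<^sup>+w. (ennreal (norm (g w)))\<^sup>2 \<partial>M)"
    by (rule Cauchy_Schwarz_nn_integral) auto
  also have "\<dots> = ennreal ((nm f * nm g)\<^sup>2)"
    using nn_integral_nm[OF f] nn_integral_nm[OF g]
    by (simp add: ennreal_power power_mult_distrib ennreal_mult)
  finally have "I\<^sup>2 \<le> (nm f * nm g)\<^sup>2" by (simp add: ennreal_le_iff)
  hence "I \<le> nm f * nm g" by (rule power2_le_imp_le) (simp add: nm_nonneg)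
  moreover have "norm (ip f g) \<le> I"
    unfolding inner_L2_def I_def by (rule integral_norm_bound)
  ultimately show ?thesis by linarith
qed

lemma nm_add_square:
  assumes f: "f \<in> L2" and g: "g \<in> L2"
  shows "(nm (f + g))\<^sup>2 = (nm f)\<^sup>2 + (nm g)\<^sup>2 + 2 * Re (ip f g)"
proof -
  have "complex_of_real ((nm (f + g))\<^sup>2) = ip f f + ip g g + (ip f g + ip g f)"
    unfolding ip_self[symmetric] using f g L2_add[OF f g] by (simp add: ip_add_left ip_add_right)
  also have "ip f g + ip g f = complex_of_real (2 * Re (ip f g))"
    unfolding ip_cnj[of g f] by (rule complex_add_cnj)
  also have "ip f f + ip g g + complex_of_real (2 * Re (ip f g)) = complex_of_real ((nm f)\<^sup>2 + (nm g)\<^sup>2 + 2 * Re (ip f g))"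
    unfolding ip_self by simp
  finally show ?thesis unfolding of_real_eq_iff .
qed

lemma nm_triangle:
  assumes f: "f \<in> L2" and g: "g \<in> L2"
  shows "nm (f + g) \<le> nm f + nm g"
proof -
  have "(nm (f + g))\<^sup>2 \<le> (nm f + nm g)\<^sup>2"
    using nm_add_square[OF f g] Cauchy_Schwarz_ip[OF f g] complex_Re_le_cmod[of "ip f g"]
    by (simp add: power2_sum)
  thus ?thesis by (rule power2_le_imp_le) (simp add: nm_nonneg)
qed

lemma nm_uminus: "nm (- f) = nm f"
  by (simp add: norm_L2_def)

lemma nm_triangle_diff:
  assumes "f \<in> L2" "g \<in> L2" "k \<in> L2"
  shows "nm (f - k) \<le> nm (f - g) + nm (g - k)"
  using nm_triangle[OF L2_diff[OF assms(1,2)] L2_diff[OF assms(2,3)]] by simp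

lemma nm_le_diff:
  assumes "f \<in> L2" "g \<in> L2"
  shows "nm f \<le> nm g + nm (f - g)"
  using nm_triangle[OF assms(2) L2_diff[OF assms]] by simp

text \<open>Behind both the Cauchy property of minimising sequences and the norm convergence of
  dilations.\<close>

lemma nm_parallelogram:
  assumes f: "f \<in> L2" and g: "g \<in> L2"
  shows "(nm (f - g))\<^sup>2 = 2 * (nm f)\<^sup>2 + 2 * (nm g)\<^sup>2 - (nm (f + g))\<^sup>2"
proof -
  have 1: "f + cscale (-1) g = f - g" by (simp add: cscale_minus_one)
  have 2: "nm (cscale (-1) g) = nm g" "ip f (cscale (-1) g) = - ip f g"
    by (simp_all only: nm_cscale ip_cscale_right) simp_all
  show ?thesis
    using nm_add_square[OF f g] nm_add_square[OF f L2_cscale[OF g, of "-1"]]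
    unfolding 1 2 by simp
qed

lemma borel_in_M: "f \<in> borel_measurable borel \<Longrightarrow> f \<in> borel_measurable M"
  by (intro measurable_restrict_space1 measurable_completion) simp

text \<open>Bridge between the completed measure restricted to \<open>U\<close>, used in the
  definitions, and \<open>lborel\<close> with an indicator, used in the estimates.\<close>

lemma nn_integral_M: "(\<integral>\<^sup>+w. f w \<partial>M) = (\<integral>\<^sup>+w. f w * indicator U w \<partial>lborel)"
  using open_U by (simp add: nn_integral_restrict_space nn_integral_completion)

lemma L2_borelI:
  assumes f[measurable]: "f \<in> borel_measurable borel" and "(\<integral>\<^sup>+w. ennreal ((norm (f w))\<^sup>2) * indicator U w \<partial>lborel) < \<infinity>"
  shows "f \<in> L2"
  using assms(2) nn_integral_M[of "\<lambda>w. ennreal ((norm (f w))\<^sup>2)"] borel_in_M[OF f]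
  by (auto simp: L2_def integrable_iff_bounded)

lemma emeasure_U_finite: "emeasure lborel U < \<infinity>"
proof -
  have "U \<subseteq> ball 0 2"
  proof
    fix w assume w: "w \<in> U"
    have "norm w \<le> norm (fst w) + norm (snd w)"
      using norm_Pair_le[of "fst w" "snd w"] by simp
    thus "w \<in> ball 0 2" using norm_fst_U[OF w] norm_snd_U[OF w] by simp
  qed
  hence "bounded U" using bounded_ball bounded_subset by blast
  thus ?thesis by (rule emeasure_bounded_finite)
qed

section \<open>The Bergman space\<close>

abbreviation A2 where "A2 \<equiv> bergman_space \<alpha>"

lemma A2_borel: 
  assumes "f \<in> A2"
  shows "f \<in> borel_measurable borel"
proof -
  have "continuous_on U f" using assms holomorphic2_on_imp_continuous_on by (auto simp: bergman_space_def)
  hence "(\<lambda>w. if w \<in> U then f w else 0) \<in> borel_measurable borel"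
    using open_U by (intro borel_measurable_continuous_on_if) auto
  moreover have "(\<lambda>w. if w \<in> U then f w else 0) = f" using assms by (auto simp: bergman_space_def)
  ultimately show ?thesis by simp
qed

lemma A2_L2: "f \<in> A2 \<Longrightarrow> f \<in> L2"
  using borel_in_M[OF A2_borel] by (auto simp: L2_def bergman_space_def)

lemma A2_holomorphic: "f \<in> A2 \<Longrightarrow> holomorphic2_on f U"
  and A2_zero_outside: "f \<in> A2 \<Longrightarrow> w \<notin> U \<Longrightarrow> f w = 0"
  unfolding bergman_space_def by blast+

lemma A2_continuous: "f \<in> A2 \<Longrightarrow> continuous_on U f"
  using A2_holomorphic holomorphic2_on_imp_continuous_on by blast

lemma A2_I: "holomorphic2_on f U \<Longrightarrow> f \<in> L2 \<Longrightarrow> (\<And>w. w \<notin> U \<Longrightarrow> f w = 0) \<Longrightarrow> f \<in> A2"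
  by (auto simp: bergman_space_def L2_def)

lemma A2_add: "f \<in> A2 \<Longrightarrow> g \<in> A2 \<Longrightarrow> f + g \<in> A2"
  by (rule A2_I[OF holomorphic2_on_add[OF A2_holomorphic A2_holomorphic] L2_add[OF A2_L2 A2_L2]])
     (simp_all add: A2_zero_outside)

lemma A2_cscale: "f \<in> A2 \<Longrightarrow> cscale c f \<in> A2"
  by (rule A2_I[OF holomorphic2_on_cscale[OF A2_holomorphic] L2_cscale[OF A2_L2]])
     (simp_all add: A2_zero_outside cscale_def)

lemma A2_diff: "f \<in> A2 \<Longrightarrow> g \<in> A2 \<Longrightarrow> f - g \<in> A2"
  using A2_add[of f "cscale (-1) g"] A2_cscale[of g "-1"] by (simp add: cscale_minus_one)

lemma A2_zero: "0 \<in> A2"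
proof (rule A2_I)
  show "holomorphic2_on 0 U"
    unfolding holomorphic2_on_def zero_fun_def by (auto intro!: exI[of _ 0])
  show "0 \<in> L2" by (simp add: L2_def zero_fun_def)
qed simp

lemma A2_nn_integral: "f \<in> A2 \<Longrightarrow> (\<integral>\<^sup>+w. ennreal ((norm (f w))\<^sup>2) * indicator U w \<partial>lborel) = ennreal ((nm f)\<^sup>2)"
  using A2_borel[of f] nn_integral_nm[OF A2_L2, of f] by (subst nn_integral_M[symmetric]) auto

text \<open>With m the measure of \<open>P\<close>, the mean value bounds m |g(0)| by the integral
  of |g| over \<open>P\<close>, and Cauchy-Schwarz bounds this by B sqrt m. The same bound supplies
  the integrability that the mean value lemma asks for.\<close>

lemma mean_value_bound:
  assumes P[measurable]: "P \<in> sets borel" "emeasure lborel P < \<infinity>"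
    and rot: "\<And>w t. w \<in> P \<Longrightarrow> norm t = 1 \<Longrightarrow> (t * fst w, t * snd w) \<in> P"
    and g[measurable]: "g \<in> borel_measurable borel"
    and hol: "\<And>w. w \<in> P \<Longrightarrow> \<exists>S. open S \<and> cball 0 1 \<subseteq> S \<and> (\<lambda>t. g (t * fst w, t * snd w)) holomorphic_on S"
    and bd: "(\<integral>\<^sup>+w. ennreal ((norm (g w))\<^sup>2) * indicator P w \<partial>lborel) \<le> ennreal (B\<^sup>2)" "B \<ge> 0"
  shows "sqrt (measure lborel P) * norm (g (0, 0)) \<le> B"
proof -
  define m where "m = measure lborel P"
  have m: "emeasure lborel P = ennreal m" "m \<ge> 0"
    using P by (auto simp: m_def emeasure_eq_ennreal_measure)
  have "(\<integral>\<^sup>+w. ennreal (norm (indicator P w *\<^sub>R g w)) \<partial>lborel)\<^sup>2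
      = (\<integral>\<^sup>+w. (ennreal (norm (g w)) * indicator P w) * indicator P w \<partial>lborel)\<^sup>2"
    by (intro arg_cong[where f = "\<lambda>x. x\<^sup>2"] nn_integral_cong) (auto simp: indicator_def)
  also have "\<dots> \<le> (\<integral>\<^sup>+w. (ennreal (norm (g w)) * indicator P w)\<^sup>2 \<partial>lborel) * (\<integral>\<^sup>+w. (indicator P w)\<^sup>2 \<partial>lborel)"
    by (rule Cauchy_Schwarz_nn_integral) auto
  also have "(\<integral>\<^sup>+w. (ennreal (norm (g w)) * indicator P w)\<^sup>2 \<partial>lborel) = (\<integral>\<^sup>+w. ennreal ((norm (g w))\<^sup>2) * indicator P w \<partial>lborel)"
    by (intro nn_integral_cong) (auto simp: indicator_def ennreal_power)
  also have "(\<integral>\<^sup>+w. (indicator P w)\<^sup>2 \<partial>lborel) = (\<integral>\<^sup>+w. indicator P w \<partial>(lborel :: (complex \<times> complex) measure) :: ennreal)"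
    by (intro nn_integral_cong) (auto simp: indicator_def)
  also have "\<dots> = ennreal m" using m by simp
  also have "(\<integral>\<^sup>+w. ennreal ((norm (g w))\<^sup>2) * indicator P w \<partial>lborel) * ennreal m \<le> ennreal (B\<^sup>2) * ennreal m"
    by (intro mult_right_mono bd) auto
  also have "\<dots> = ennreal ((B * sqrt m)\<^sup>2)"
    using m by (simp add: ennreal_mult[symmetric] power_mult_distrib)
  finally have sq: "(\<integral>\<^sup>+w. ennreal (norm (indicator P w *\<^sub>R g w)) \<partial>lborel)\<^sup>2 \<le> ennreal ((B * sqrt m)\<^sup>2)" .
  have le: "(\<integral>\<^sup>+w. ennreal (norm (indicator P w *\<^sub>R g w)) \<partial>lborel) \<le> ennreal (B * sqrt m)"
  proof (cases "\<integral>\<^sup>+w. ennreal (norm (indicator P w *\<^sub>R g w)) \<partial>lborel" rule: ennreal_cases)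
    case (real r)
    hence "r\<^sup>2 \<le> (B * sqrt m)\<^sup>2"
      using sq by (simp add: ennreal_power ennreal_le_iff)
    hence "r \<le> B * sqrt m" by (rule power2_le_imp_le) (use bd m in simp)
    thus ?thesis unfolding real by (rule ennreal_leI)
  next
    case top
    thus ?thesis using sq by (simp add: top_power_ennreal top_unique)
  qed
  hence int: "integrable lborel (\<lambda>w. indicator P w *\<^sub>R g w)"
    by (auto simp: integrable_iff_bounded intro: le_less_trans)
  have "norm (m *\<^sub>R g (0, 0)) = norm (LINT w|lborel. indicator P w *\<^sub>R g w)"
    using mean_value_balanced[OF P rot g int hol] by (simp add: m_def)
  also have "ennreal \<dots> \<le> (\<integral>\<^sup>+w. ennreal (norm (indicator P w *\<^sub>R g w)) \<partial>lborel)"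
    by (rule integral_norm_bound_ennreal[OF int])
  also have "\<dots> \<le> ennreal (B * sqrt m)" by (rule le)
  finally have "norm (m *\<^sub>R g (0, 0)) \<le> B * sqrt m"
    using bd m by (simp add: ennreal_le_iff)
  hence "sqrt m * (sqrt m * norm (g (0, 0))) \<le> sqrt m * B"
    using m by (simp add: mult.assoc[symmetric] mult.commute)
  hence "sqrt m * norm (g (0, 0)) \<le> B"
    using m bd by (cases "m = 0") (simp_all add: mult_le_cancel_left_pos)
  thus ?thesis by (simp add: m_def)
qed

lemma nn_integral_translate:
  assumes [measurable]: "f \<in> borel_measurable borel"
  shows "(\<integral>\<^sup>+w. f (c + w) \<partial>(lborel :: 'a::euclidean_space measure)) = (\<integral>\<^sup>+w. f w \<partial>lborel)"
  using nn_integral_distr[of "(+) c" "lborel :: 'a measure" borel f] by (simp add: lborel_distr_plus)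

text \<open>A ball is invariant under rotations about its centre, so after translation the mean
  value bound applies to it.\<close>

lemma eval_local_bound:
  assumes f: "f \<in> A2" and sub: "ball z r \<subseteq> U" and r: "r > 0"
  shows "sqrt (measure lborel (ball (0 :: complex \<times> complex) r)) * norm (f z) \<le> nm f"
proof -
  note [measurable] = A2_borel[OF f]
  have n: "norm (t * fst w, t * snd w) = norm t * norm w" for t and w :: "complex \<times> complex"
    by (simp add: norm_prod_def norm_mult power_mult_distrib real_sqrt_mult flip: distrib_left)
  have "sqrt (measure lborel (ball (0 :: complex \<times> complex) r)) * norm (f (z + (0, 0))) \<le> nm f"
  proof (rule mean_value_bound[where g = "\<lambda>w. f (z + w)"])
    show "emeasure lborel (ball (0 :: complex \<times> complex) r) < \<infinity>" by (rule emeasure_bounded_finite) simp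
    show "(t * fst w, t * snd w) \<in> ball 0 r" if "w \<in> ball 0 r" "norm t = 1" for w :: "complex \<times> complex" and t :: complex
      using that by (simp add: n)
    show "\<exists>S. open S \<and> cball 0 1 \<subseteq> S \<and> (\<lambda>t. f (z + (t * fst w, t * snd w))) holomorphic_on S" if w: "w \<in> ball 0 r" for w :: "complex \<times> complex"
    proof (intro exI conjI)
      let ?S = "{t :: complex. norm t * norm w < r}"
      show S: "open ?S" by (intro open_Collect_less continuous_intros)
      show "cball 0 1 \<subseteq> ?S"
      proof
        fix t :: complex assume "t \<in> cball 0 1"
        hence "norm t * norm w \<le> 1 * norm w" by (intro mult_right_mono) auto
        thus "t \<in> ?S" using w by simp
      qed
      have zv: "z + v \<in> U" if "norm v < r" for v
      proof -
        have "z + v \<in> ball z r" using that by (simp add: dist_norm)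
        thus ?thesis using sub by blast
      qed
      have im: "(fst z + t * fst w, snd z + t * snd w) \<in> U" if "t \<in> ?S" for t
        using zv[of "(t * fst w, t * snd w)"] that by (simp add: n plus_prod_def)
      have "(\<lambda>t. f (fst z + t * fst w, snd z + t * snd w)) holomorphic_on ?S"
        by (rule holomorphic2_on_compose_curve[OF A2_holomorphic[OF f] S])
           (use im in \<open>auto intro!: holomorphic_intros\<close>)
      thus "(\<lambda>t. f (z + (t * fst w, t * snd w))) holomorphic_on ?S" by (simp add: plus_prod_def)
    qed
    have "(\<integral>\<^sup>+w. ennreal ((norm (f (z + w)))\<^sup>2) * indicator (ball 0 r) w \<partial>lborel)
       = (\<integral>\<^sup>+w. ennreal ((norm (f (z + w)))\<^sup>2) * indicator (ball z r) (z + w) \<partial>lborel)"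
      by (intro nn_integral_cong) (auto simp: indicator_def dist_norm)
    also have "\<dots> = (\<integral>\<^sup>+w. ennreal ((norm (f w))\<^sup>2) * indicator (ball z r) w \<partial>lborel)"
      by (rule nn_integral_translate) measurable
    also have "\<dots> \<le> (\<integral>\<^sup>+w. ennreal ((norm (f w))\<^sup>2) * indicator U w \<partial>lborel)"
      using sub by (intro nn_integral_mono) (auto simp: indicator_def)
    finally show "(\<integral>\<^sup>+w. ennreal ((norm (f (z + w)))\<^sup>2) * indicator (ball 0 r) w \<partial>lborel) \<le> ennreal ((nm f)\<^sup>2)"
      by (simp add: A2_nn_integral[OF f])
  qed (auto simp: nm_nonneg)
  thus ?thesis by (simp flip: zero_prod_def)
qed

subsection \<open>Completeness\<close>

lemma ball_content_pos: "r > 0 \<Longrightarrow> measure lborel (ball (0 :: complex \<times> complex) r) > 0"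
  by simp

text \<open>Cauchy's inequality on the two coordinate circles of radius s around z.\<close>

lemma partials_bound:
  assumes f: "f \<in> A2" and der: "(f has_derivative (\<lambda>h. a * fst h + b * snd h)) (at z)"
    and sub: "ball z r \<subseteq> U" and r: "0 < s" "s < r" and B: "\<And>w. w \<in> cball z s \<Longrightarrow> norm (f w) \<le> B"
  shows "norm a \<le> B / s" "norm b \<le> B / s"
proof -
  have zin: "(\<zeta>, snd z) \<in> ball z r" if "norm (fst z - \<zeta>) < r" for \<zeta>
    using that by (cases z) (simp add: dist_norm norm_prod_def)
  have zin2: "(fst z, \<zeta>) \<in> ball z r" if "norm (snd z - \<zeta>) < r" for \<zeta>
    using that by (cases z) (simp add: dist_norm norm_prod_def)
  have h1: "(\<lambda>\<zeta>. f (\<zeta>, snd z)) holomorphic_on ball (fst z) r"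
    by (rule holomorphic2_on_compose_curve[OF A2_holomorphic[OF f]])
       (use sub zin in \<open>auto intro!: holomorphic_intros simp: dist_norm\<close>)
  have h2: "(\<lambda>\<zeta>. f (fst z, \<zeta>)) holomorphic_on ball (snd z) r"
    by (rule holomorphic2_on_compose_curve[OF A2_holomorphic[OF f]])
       (use sub zin2 in \<open>auto intro!: holomorphic_intros simp: dist_norm\<close>)
  have sub2: "cball (c :: complex) s \<subseteq> ball c r" "ball c s \<subseteq> ball c r" for c using r by auto
  have p1: "((\<lambda>\<zeta>. (\<zeta>, snd z)) has_derivative (\<lambda>h. (h, 0))) (at (fst z))"
    by (auto intro!: derivative_eq_intros)
  have p2: "((\<lambda>\<zeta>. (fst z, \<zeta>)) has_derivative (\<lambda>h. (0, h))) (at (snd z))"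
    by (auto intro!: derivative_eq_intros)
  have "((\<lambda>\<zeta>. f (\<zeta>, snd z)) has_derivative (\<lambda>h. a * h)) (at (fst z))"
    using has_derivative_compose[OF p1, of f "\<lambda>h. a * fst h + b * snd h"] der by simp
  hence d1: "deriv (\<lambda>\<zeta>. f (\<zeta>, snd z)) (fst z) = a"
    by (intro DERIV_imp_deriv) (simp add: has_field_derivative_def)
  have "((\<lambda>\<zeta>. f (fst z, \<zeta>)) has_derivative (\<lambda>h. b * h)) (at (snd z))"
    using has_derivative_compose[OF p2, of f "\<lambda>h. a * fst h + b * snd h"] der by simp
  hence d2: "deriv (\<lambda>\<zeta>. f (fst z, \<zeta>)) (snd z) = b"
    by (intro DERIV_imp_deriv) (simp add: has_field_derivative_def)
  have "norm ((deriv ^^ 1) (\<lambda>\<zeta>. f (\<zeta>, snd z)) (fst z)) \<le> fact 1 * B / s ^ 1"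
  proof (rule Cauchy_inequality)
    show "(\<lambda>\<zeta>. f (\<zeta>, snd z)) holomorphic_on ball (fst z) s"
      using h1 sub2 holomorphic_on_subset by blast
    show "continuous_on (cball (fst z) s) (\<lambda>\<zeta>. f (\<zeta>, snd z))"
      using h1 sub2 holomorphic_on_imp_continuous_on continuous_on_subset by blast
    show "norm (f (x, snd z)) \<le> B" if "norm (fst z - x) = s" for x
      using that r by (intro B) (cases z, simp add: dist_norm norm_prod_def)
  qed (use r in auto)
  thus "norm a \<le> B / s" using d1 by simp
  have "norm ((deriv ^^ 1) (\<lambda>\<zeta>. f (fst z, \<zeta>)) (snd z)) \<le> fact 1 * B / s ^ 1"
  proof (rule Cauchy_inequality)
    show "(\<lambda>\<zeta>. f (fst z, \<zeta>)) holomorphic_on ball (snd z) s"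
      using h2 sub2 holomorphic_on_subset by blast
    show "continuous_on (cball (snd z) s) (\<lambda>\<zeta>. f (fst z, \<zeta>))"
      using h2 sub2 holomorphic_on_imp_continuous_on continuous_on_subset by blast
    show "norm (f (fst z, x)) \<le> B" if "norm (snd z - x) = s" for x
      using that r by (intro B) (cases z, simp add: dist_norm norm_prod_def)
  qed (use r in auto)
  thus "norm b \<le> B / s" using d2 by simp
qed

lemma local_bound_A2:
  assumes z: "z \<in> U"
  shows "\<exists>r>0. \<exists>C>0. ball z r \<subseteq> U \<and> (\<forall>w\<in>ball z r. \<forall>f\<in>A2. norm (f w) \<le> C * nm f \<and>
     (\<forall>a b. (f has_derivative (\<lambda>h. a * fst h + b * snd h)) (at w) \<longrightarrow> norm a \<le> C * nm f \<and> norm b \<le> C * nm f))"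
proof -
  obtain R where R: "R > 0" "ball z R \<subseteq> U"
    using open_U z open_contains_ball by blast
  \<comment> \<open>A quarter leaves room for three moves of length r: from z to w, from w to the
    points of a Cauchy circle, and from these across a mean value ball.\<close>
  define r where "r = R / 4"
  have r: "r > 0" using R by (simp add: r_def)
  define m where "m = sqrt (measure lborel (ball (0 :: complex \<times> complex) r))"
  have m: "m > 0" unfolding m_def using ball_content_pos[OF r] by (simp only: real_sqrt_gt_zero)
  have bd: "norm (f w) \<le> nm f / m" if "w \<in> ball z (3 * r)" "f \<in> A2" for w f
  proof -
    have "ball w r \<subseteq> ball z R"
    proof
      fix x assume "x \<in> ball w r"
      thus "x \<in> ball z R" using that(1) dist_triangle[of z x w] R by (simp add: r_def)
    qed
    hence "m * norm (f w) \<le> nm f"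
      unfolding m_def using R by (intro eval_local_bound[OF that(2) _ r]) auto
    thus ?thesis using m by (simp add: field_simps)
  qed
  define C where "C = max (1 / m) (1 / m / r)"
  have C: "C > 0" "1 / m \<le> C" "1 / m / r \<le> C" using m by (auto simp: C_def less_max_iff_disj)
  show ?thesis
  proof (rule exI[of _ r], rule conjI[OF r], rule exI[of _ C], intro conjI ballI allI impI)
    show "ball z r \<subseteq> U"
    proof -
      have "ball z r \<subseteq> ball z R" by (rule subset_ball) (use R in \<open>simp add: r_def\<close>)
      thus ?thesis using R by blast
    qed
    fix w f assume w: "w \<in> ball z r" and f: "f \<in> A2"
    have "norm (f w) \<le> nm f / m" using w r by (intro bd f) auto
    also have "\<dots> = 1 / m * nm f" by simp
    also have "\<dots> \<le> C * nm f" using C by (intro mult_right_mono nm_nonneg) auto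
    finally show "norm (f w) \<le> C * nm f" .
    fix a b assume d: "(f has_derivative (\<lambda>h. a * fst h + b * snd h)) (at w)"
    have sub: "ball w (2 * r) \<subseteq> U"
    proof
      fix x assume "x \<in> ball w (2 * r)"
      hence "x \<in> ball z R" using w dist_triangle[of z x w] R by (simp add: r_def)
      thus "x \<in> U" using R by blast
    qed
    have Bd: "norm (f x) \<le> nm f / m" if "x \<in> cball w r" for x
      using that w r dist_triangle[of z x w] by (intro bd f) auto
    have e: "nm f / m / r \<le> C * nm f"
    proof -
      have "nm f / m / r = 1 / m / r * nm f" by simp
      also have "\<dots> \<le> C * nm f" using C by (intro mult_right_mono nm_nonneg) auto
      finally show ?thesis .
    qed
    show "norm a \<le> C * nm f" "norm b \<le> C * nm f"
      using partials_bound[OF f d sub r _ Bd] r e by linarith+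
  qed (use r C in auto)
qed

lemma eval_bound:
  assumes z: "z \<in> U"
  shows "\<exists>C>0. \<forall>f\<in>A2. norm (f z) \<le> C * nm f"
proof -
  obtain r C where C: "r > 0" "C > 0" "\<forall>w\<in>ball z r. \<forall>f\<in>A2. norm (f w) \<le> C * nm f \<and>
     (\<forall>a b. (f has_derivative (\<lambda>h. a * fst h + b * snd h)) (at w) \<longrightarrow> norm a \<le> C * nm f \<and> norm b \<le> C * nm f)"
    using local_bound_A2[OF z] by blast
  have "z \<in> ball z r" using C by simp
  thus ?thesis using C(2,3) by blast
qed

text \<open>By the local bounds, the values of a norm-Cauchy sequence converge and both partials
  converge locally uniformly, so the limit is holomorphic; Fatou's lemma then gives norm
  convergence. Pointwise convergence is recorded because limits are identified through it
  later.\<close>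

lemma A2_complete:
  fixes F :: "nat \<Rightarrow> complex \<times> complex \<Rightarrow> complex"
  assumes F: "\<And>n. F n \<in> A2" and C: "\<And>e. e > 0 \<Longrightarrow> \<exists>N. \<forall>m\<ge>N. \<forall>n\<ge>N. nm (F m - F n) < e"
  shows "\<exists>f\<in>A2. (\<lambda>n. nm (F n - f)) \<longlonglongrightarrow> 0 \<and> (\<forall>z\<in>U. (\<lambda>n. F n z) \<longlonglongrightarrow> f z)"
proof -
  define f where "f z = (if z \<in> U then lim (\<lambda>n. F n z) else 0)" for z
  have Cauchy_of: "Cauchy X" if "k \<ge> 0" "\<And>m n. norm (X m - X n) \<le> k * nm (F m - F n)" for X :: "nat \<Rightarrow> complex" and k
  proof (rule metric_CauchyI)
    fix e :: real assume e: "e > 0"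
    have "e / (k + 1) > 0" using e \<open>k \<ge> 0\<close> by (intro divide_pos_pos) auto
    from C[OF this] obtain N where N: "\<forall>m\<ge>N. \<forall>n\<ge>N. nm (F m - F n) < e / (k + 1)" by blast
    have "dist (X m) (X n) < e" if "m \<ge> N" "n \<ge> N" for m n
    proof -
      have "nm (F m - F n) < e / (k + 1)" using N that by blast
      hence "(k + 1) * nm (F m - F n) < e" using \<open>k \<ge> 0\<close> by (simp add: field_simps)
      moreover have "k * nm (F m - F n) \<le> (k + 1) * nm (F m - F n)"
        by (intro mult_right_mono nm_nonneg) auto
      ultimately show ?thesis using \<open>norm (X m - X n) \<le> k * nm (F m - F n)\<close>
        unfolding dist_norm by linarith
    qed
    thus "\<exists>N. \<forall>m\<ge>N. \<forall>n\<ge>N. dist (X m) (X n) < e" by blast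
  qed
  have dF: "\<exists>a b. (F n has_derivative (\<lambda>h. a * fst h + b * snd h)) (at w)" if "w \<in> U" for n w
    using A2_holomorphic[OF F] that by (auto simp: holomorphic2_on_def)
  define D where "D n w = (SOME p. (F n has_derivative (\<lambda>h. fst p * fst h + snd p * snd h)) (at w))" for n w
  define a where "a n w = fst (D n w)" for n w
  define b where "b n w = snd (D n w)" for n w
  have ab: "(F n has_derivative (\<lambda>h. a n w * fst h + b n w * snd h)) (at w)" if w: "w \<in> U" for n w
  proof -
    have "\<exists>p. (F n has_derivative (\<lambda>h. fst p * fst h + snd p * snd h)) (at w)"
      using dF[OF w, of n] by force
    thus ?thesis unfolding a_def b_def D_def by (rule someI_ex)
  qed
  have lim: "(\<lambda>n. F n z) \<longlonglongrightarrow> f z" if z: "z \<in> U" for z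
  proof -
    obtain K where K: "K > 0" "\<And>g. g \<in> A2 \<Longrightarrow> norm (g z) \<le> K * nm g"
      using eval_bound[OF z] by blast
    have "Cauchy (\<lambda>n. F n z)"
      by (rule Cauchy_of[of K]) (use K(1) K(2)[OF A2_diff[OF F F]] in auto)
    thus ?thesis using z by (simp add: f_def Cauchy_convergent_iff convergent_LIMSEQ_iff)
  qed
  have hol: "holomorphic2_on f U"
    unfolding holomorphic2_on_def
  proof
    fix z assume z: "z \<in> U"
    obtain r K where K: "r > 0" "K > 0" "ball z r \<subseteq> U" "\<And>w g. w \<in> ball z r \<Longrightarrow> g \<in> A2 \<Longrightarrow> norm (g w) \<le> K * nm g"
      "\<And>w g a b. w \<in> ball z r \<Longrightarrow> g \<in> A2 \<Longrightarrow> (g has_derivative (\<lambda>h. a * fst h + b * snd h)) (at w)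
         \<Longrightarrow> norm a \<le> K * nm g \<and> norm b \<le> K * nm g"
      using local_bound_A2[OF z] by blast
    have diff: "norm (a m w - a n w) \<le> K * nm (F m - F n)" "norm (b m w - b n w) \<le> K * nm (F m - F n)"
      if w: "w \<in> ball z r" for m n w
    proof -
      have wU: "w \<in> U" using w K by blast
      have "((F m - F n) has_derivative (\<lambda>h. (a m w - a n w) * fst h + (b m w - b n w) * snd h)) (at w)"
        using has_derivative_diff[OF ab[OF wU, of m] ab[OF wU, of n]]
        by (simp add: fun_diff_def algebra_simps)
      from K(5)[OF w A2_diff[OF F F] this]
      show "norm (a m w - a n w) \<le> K * nm (F m - F n)" "norm (b m w - b n w) \<le> K * nm (F m - F n)" by auto
    qed
    define a' where "a' w = lim (\<lambda>n. a n w)" for w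
    define b' where "b' w = lim (\<lambda>n. b n w)" for w
    have la: "(\<lambda>n. a n w) \<longlonglongrightarrow> a' w" and lb: "(\<lambda>n. b n w) \<longlonglongrightarrow> b' w" if w: "w \<in> ball z r" for w
    proof -
      have "Cauchy (\<lambda>n. a n w)" "Cauchy (\<lambda>n. b n w)"
        by (rule Cauchy_of[of K]; use K diff[OF w] in auto)+
      thus "(\<lambda>n. a n w) \<longlonglongrightarrow> a' w" "(\<lambda>n. b n w) \<longlonglongrightarrow> b' w"
        by (simp_all add: a'_def b'_def Cauchy_convergent_iff convergent_LIMSEQ_iff)
    qed
    have unif: "\<forall>\<^sub>F n in sequentially. \<forall>w\<in>ball z r. \<forall>h. norm ((a n w * fst h + b n w * snd h) - (a' w * fst h + b' w * snd h)) \<le> e * norm h"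
      if e: "e > 0" for e
    proof -
      obtain N where N: "\<forall>m\<ge>N. \<forall>n\<ge>N. nm (F m - F n) < e / (2 * K)"
        using C[of "e / (2 * K)"] e K by auto
      have le: "norm (a n w - a' w) \<le> e / 2 \<and> norm (b n w - b' w) \<le> e / 2" if n: "n \<ge> N" and w: "w \<in> ball z r" for n w
      proof -
        have ev: "\<forall>\<^sub>F m in sequentially. norm (a n w - a m w) \<le> e / 2 \<and> norm (b n w - b m w) \<le> e / 2"
          using eventually_ge_at_top[of N]
        proof eventually_elim
          case (elim m)
          have "K * nm (F n - F m) \<le> K * (e / (2 * K))"
            using N n elim K by (intro mult_left_mono less_imp_le) auto
          also have "\<dots> = e / 2" using K by simp
          finally show ?case using diff[OF w, of n m] by auto
        qed
        have "(\<lambda>m. norm (a n w - a m w)) \<longlonglongrightarrow> norm (a n w - a' w)"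
          by (intro tendsto_intros la w)
        hence "norm (a n w - a' w) \<le> e / 2"
          by (rule tendsto_upperbound) (use ev in \<open>auto elim: eventually_mono\<close>)
        moreover have "(\<lambda>m. norm (b n w - b m w)) \<longlonglongrightarrow> norm (b n w - b' w)"
          by (intro tendsto_intros lb w)
        hence "norm (b n w - b' w) \<le> e / 2"
          by (rule tendsto_upperbound) (use ev in \<open>auto elim: eventually_mono\<close>)
        ultimately show ?thesis by blast
      qed
      show ?thesis
        using eventually_ge_at_top[of N]
      proof eventually_elim
        case (elim n)
        show ?case
        proof (intro ballI allI)
          fix w and h :: "complex \<times> complex" assume w: "w \<in> ball z r"
          have "(a n w * fst h + b n w * snd h) - (a' w * fst h + b' w * snd h)
             = (a n w - a' w) * fst h + (b n w - b' w) * snd h" by (simp add: algebra_simps)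
          also have "norm \<dots> \<le> norm (a n w - a' w) * norm (fst h) + norm (b n w - b' w) * norm (snd h)"
            by (rule order_trans[OF norm_triangle_ineq]) (simp add: norm_mult)
          also have "\<dots> \<le> e / 2 * norm h + e / 2 * norm h"
            using le[OF elim w] norm_fst_le[of "fst h" "snd h"] norm_snd_le[of "snd h" "fst h"] e
            by (intro add_mono mult_mono) auto
          finally show "norm ((a n w * fst h + b n w * snd h) - (a' w * fst h + b' w * snd h)) \<le> e * norm h" by simp
        qed
      qed
    qed
    have "\<exists>g. \<forall>x\<in>ball z r. (\<lambda>n. F n x) \<longlonglongrightarrow> g x \<and> (g has_derivative (\<lambda>h. a' x * fst h + b' x * snd h)) (at x within ball z r)"
    proof (rule has_derivative_sequence[where f' = "\<lambda>n x h. a n x * fst h + b n x * snd h"])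
      show "(F n has_derivative (\<lambda>h. a n x * fst h + b n x * snd h)) (at x within ball z r)" if "x \<in> ball z r" for n x
        using has_derivative_at_withinI[OF ab] that K(3) by blast
      show "(\<lambda>n. F n z) \<longlonglongrightarrow> f z" by (rule lim[OF z])
      show "z \<in> ball z r" using K by simp
    qed (use unif in auto)
    then obtain g where g: "\<And>x. x \<in> ball z r \<Longrightarrow> (\<lambda>n. F n x) \<longlonglongrightarrow> g x"
      "\<And>x. x \<in> ball z r \<Longrightarrow> (g has_derivative (\<lambda>h. a' x * fst h + b' x * snd h)) (at x within ball z r)" by blast
    have zr: "z \<in> ball z r" using K by simp
    have "(g has_derivative (\<lambda>h. a' z * fst h + b' z * snd h)) (at z)"
      using g(2)[OF zr] at_within_open[OF zr open_ball] by simp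
    moreover have "g x = f x" if "x \<in> ball z r" for x
      using g(1)[OF that] lim[of x] that K LIMSEQ_unique by blast
    ultimately have "(f has_derivative (\<lambda>h. a' z * fst h + b' z * snd h)) (at z)"
      by (rule has_derivative_transform_within_open[OF _ open_ball zr])
    thus "\<exists>a b. (f has_derivative (\<lambda>h. a * fst h + b * snd h)) (at z)" by blast
  qed
  have cf: "continuous_on U f" by (rule holomorphic2_on_imp_continuous_on[OF hol])
  have fb[measurable]: "f \<in> borel_measurable borel"
  proof -
    have "(\<lambda>w. if w \<in> U then f w else 0) \<in> borel_measurable borel"
      using open_U cf by (intro borel_measurable_continuous_on_if) auto
    moreover have "(\<lambda>w. if w \<in> U then f w else 0) = f" by (auto simp: f_def)
    ultimately show ?thesis by simp
  qed
  note [measurable] = A2_borel[OF F]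
  have fatou: "(\<integral>\<^sup>+w. ennreal ((norm (F n w - f w))\<^sup>2) * indicator U w \<partial>lborel) \<le> ennreal (e\<^sup>2)"
    if N: "\<forall>m\<ge>N. \<forall>n\<ge>N. nm (F m - F n) < e" and n: "n \<ge> N" for N n e
  proof -
    have e: "e > 0" using N nm_nonneg[of "F N - F N"] by (meson le_less_trans order_refl)
    have "(\<integral>\<^sup>+w. ennreal ((norm (F n w - f w))\<^sup>2) * indicator U w \<partial>lborel)
       = (\<integral>\<^sup>+w. liminf (\<lambda>m. ennreal ((norm (F n w - F m w))\<^sup>2) * indicator U w) \<partial>lborel)"
    proof (rule nn_integral_cong)
      fix w
      show "ennreal ((norm (F n w - f w))\<^sup>2) * indicator U w = liminf (\<lambda>m. ennreal ((norm (F n w - F m w))\<^sup>2) * indicator U w)"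
      proof (cases "w \<in> U")
        case True
        have "(\<lambda>m. ennreal ((norm (F n w - F m w))\<^sup>2)) \<longlonglongrightarrow> ennreal ((norm (F n w - f w))\<^sup>2)"
          by (intro tendsto_ennrealI tendsto_intros lim True)
        from lim_imp_Liminf[OF _ this] show ?thesis using True by simp
      qed (simp add: Liminf_const)
    qed
    also have "\<dots> \<le> liminf (\<lambda>m. \<integral>\<^sup>+w. ennreal ((norm (F n w - F m w))\<^sup>2) * indicator U w \<partial>lborel)"
      by (rule nn_integral_liminf) measurable
    also have "\<dots> \<le> ennreal (e\<^sup>2)"
    proof -
      have "\<forall>\<^sub>F m in sequentially. (\<integral>\<^sup>+w. ennreal ((norm (F n w - F m w))\<^sup>2) * indicator U w \<partial>lborel) \<le> ennreal (e\<^sup>2)"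
        using eventually_ge_at_top[of N]
      proof eventually_elim
        case (elim m)
        have "nm (F n - F m) < e" using N n elim by blast
        hence "(nm (F n - F m))\<^sup>2 \<le> e\<^sup>2" using nm_nonneg by (intro power_mono) auto
        thus ?case using A2_nn_integral[OF A2_diff[OF F F], of n m] by (simp add: ennreal_leI)
      qed
      from Liminf_mono[OF this] show ?thesis by (simp add: Liminf_const)
    qed
    finally show ?thesis .
  qed
  obtain N where N: "\<forall>m\<ge>N. \<forall>n\<ge>N. nm (F m - F n) < 1" using C[of 1] by auto
  have "(\<integral>\<^sup>+w. ennreal ((norm ((F N - f) w))\<^sup>2) * indicator U w \<partial>lborel) < \<infinity>"
    using fatou[OF N, of N] by (auto intro: le_less_trans)
  hence dL2: "F N - f \<in> L2"
    by (intro L2_borelI) (auto simp: fun_diff_def)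
  have fL2: "f \<in> L2" using L2_diff[OF A2_L2[OF F[of N]] dL2] by simp
  have fA2: "f \<in> A2" by (rule A2_I[OF hol fL2]) (auto simp: f_def)
  have "(\<lambda>n. nm (F n - f)) \<longlonglongrightarrow> 0"
  proof (rule metric_LIMSEQ_I)
    fix e :: real assume e: "e > 0"
    obtain N where N: "\<forall>m\<ge>N. \<forall>n\<ge>N. nm (F m - F n) < e / 2" using C[of "e / 2"] e by auto
    have "dist (nm (F n - f)) 0 < e" if "n \<ge> N" for n
    proof -
      have "ennreal ((nm (F n - f))\<^sup>2) \<le> ennreal ((e / 2)\<^sup>2)"
        using fatou[OF N that] A2_nn_integral[OF A2_diff[OF F fA2], of n] by simp
      hence "(nm (F n - f))\<^sup>2 \<le> (e / 2)\<^sup>2" by (simp add: ennreal_le_iff)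
      hence "nm (F n - f) \<le> e / 2" by (rule power2_le_imp_le) (use e in simp)
      thus ?thesis using e nm_nonneg[of "F n - f"] by (simp add: dist_norm)
    qed
    thus "\<exists>N. \<forall>n\<ge>N. dist (nm (F n - f)) 0 < e" by blast
  qed
  thus ?thesis using fA2 lim by blast
qed

lemma nm_zero: "nm 0 = 0"
  by (simp add: norm_L2_def zero_fun_def)

lemma nm_eq_0_A2:
  assumes f: "f \<in> A2" and "nm f = 0"
  shows "f = 0"
proof
  fix w
  show "f w = 0 w"
  proof (cases "w \<in> U")
    case True
    obtain K where "\<And>g. g \<in> A2 \<Longrightarrow> norm (g w) \<le> K * nm g"
      using eval_bound[OF True] by blast
    from this[OF f] show ?thesis using assms by simp
  qed (simp add: A2_zero_outside[OF f])
qed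

subsection \<open>Orthogonal projection, reproducing kernel and density\<close>

lemma Cauchy_Schwarz_limit:
  assumes "\<And>n. F n \<in> L2" "f \<in> L2" "g \<in> L2" "(\<lambda>n. nm (F n - f)) \<longlonglongrightarrow> 0"
  shows "(\<lambda>n. ip (F n) g) \<longlonglongrightarrow> ip f g"
proof -
  have "(\<lambda>n. nm (F n - f) * nm g) \<longlonglongrightarrow> 0" using tendsto_mult_right[OF assms(4), of "nm g"] by simp
  hence "(\<lambda>n. ip (F n) g - ip f g) \<longlonglongrightarrow> 0"
    by (rule Lim_null_comparison[rotated])
       (use Cauchy_Schwarz_ip[OF L2_diff[OF assms(1) assms(2)] assms(3)] assms in \<open>auto simp: ip_diff_left\<close>)
  thus ?thesis by (simp add: LIM_zero_iff)
qed

lemma nm_limit: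
  assumes "\<And>n. F n \<in> L2" "f \<in> L2" "(\<lambda>n. nm (F n - f)) \<longlonglongrightarrow> 0"
  shows "(\<lambda>n. nm (F n)) \<longlonglongrightarrow> nm f"
proof -
  have "norm (nm (F n) - nm f) \<le> nm (F n - f)" for n
    using nm_le_diff[OF assms(1) assms(2), of n] nm_le_diff[OF assms(2) assms(1), of n]
    by (simp add: nm_minus_commute[of f])
  hence "(\<lambda>n. nm (F n) - nm f) \<longlonglongrightarrow> 0"
    by (intro Lim_null_comparison[OF _ assms(3)]) auto
  thus ?thesis by (simp add: LIM_zero_iff)
qed

text \<open>Orthogonal projection without closedness: a minimising sequence in c + L is Cauchy, and
  its limit g may leave c + L. It is still orthogonal to L, because g + k is a limit of elements of
  c + L and so no shorter than the infimum.\<close>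

lemma affine_minimizer:
  assumes L: "L \<subseteq> A2" "0 \<in> L" "\<And>f g. f \<in> L \<Longrightarrow> g \<in> L \<Longrightarrow> f + g \<in> L" "\<And>f k. f \<in> L \<Longrightarrow> cscale k f \<in> L"
    and c: "c \<in> A2"
  shows "\<exists>g\<in>A2. \<exists>l. (\<forall>n::nat. l n \<in> L) \<and> (\<lambda>n. nm (c + l n - g)) \<longlonglongrightarrow> 0 \<and> (\<forall>z\<in>U. (\<lambda>n. (c + l n) z) \<longlonglongrightarrow> g z) \<and> (\<forall>k\<in>L. ip g k = 0)"
proof -
  have inv: "(\<lambda>n. 1 / real (Suc n)) \<longlonglongrightarrow> 0"
    using LIMSEQ_inverse_real_of_nat by (simp add: inverse_eq_divide)
  define S where "S = (\<lambda>l. nm (c + l)) ` L"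
  define m where "m = Inf S"
  have bS: "bdd_below S" by (auto simp: S_def bdd_below_def intro!: exI[of _ 0] nm_nonneg)
  have neS: "S \<noteq> {}" using L(2) by (auto simp: S_def)
  have m0: "m \<ge> 0" unfolding m_def using neS by (intro cInf_greatest) (auto simp: S_def nm_nonneg)
  have mle: "m \<le> nm (c + l)" if "l \<in> L" for l
    unfolding m_def using bS that by (intro cInf_lower) (auto simp: S_def)
  have "\<exists>l\<in>L. nm (c + l) < m + 1 / Suc n" for n
  proof -
    have "Inf S < m + 1 / Suc n" by (simp add: m_def)
    from cInf_lessD[OF neS this] show ?thesis by (auto simp: S_def)
  qed
  then obtain l where l: "\<And>n. l n \<in> L" "\<And>n. nm (c + l n) < m + 1 / Suc n" by metis
  have cl: "c + k \<in> A2" if "k \<in> L" for k using that L c A2_add by blast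
  \<comment> \<open>The midpoint of two elements of c + L lies again in c + L, so its norm is at
    least m.\<close>
  have par: "(nm ((c + l i) - (c + l j)))\<^sup>2 \<le> 2 * (m + 1 / Suc i)\<^sup>2 + 2 * (m + 1 / Suc j)\<^sup>2 - 4 * m\<^sup>2" for i j
  proof -
    let ?k = "cscale (1/2) (l i + l j)"
    have k: "?k \<in> L" using L l by blast
    have eq: "(c + l i) + (c + l j) = cscale 2 (c + ?k)"
      by (auto simp: cscale_def fun_eq_iff algebra_simps)
    have "m\<^sup>2 \<le> (nm (c + ?k))\<^sup>2" using mle[OF k] m0 by (intro power_mono) auto
    hence "4 * m\<^sup>2 \<le> (nm ((c + l i) + (c + l j)))\<^sup>2"
      unfolding eq nm_cscale by (simp add: power_mult_distrib)
    moreover have "(nm (c + l n))\<^sup>2 \<le> (m + 1 / Suc n)\<^sup>2" for n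
      using l(2)[of n] nm_nonneg by (intro power_mono) auto
    ultimately show ?thesis
      using nm_parallelogram[OF A2_L2[OF cl] A2_L2[OF cl], OF l(1) l(1), of i j] by (smt (verit))
  qed
  have ex: "\<exists>g\<in>A2. (\<lambda>n. nm ((c + l n) - g)) \<longlonglongrightarrow> 0 \<and> (\<forall>z\<in>U. (\<lambda>n. (c + l n) z) \<longlonglongrightarrow> g z)"
  proof (rule A2_complete)
    show "c + l n \<in> A2" for n using cl l by blast
    fix e :: real assume e: "e > 0"
    have "(\<lambda>n. 4 * (m + 1 / Suc n)\<^sup>2 - 4 * m\<^sup>2) \<longlonglongrightarrow> 4 * (m + 0)\<^sup>2 - 4 * m\<^sup>2"
      by (intro tendsto_intros inv)
    hence "\<forall>\<^sub>F n in sequentially. 4 * (m + 1 / Suc n)\<^sup>2 - 4 * m\<^sup>2 < e\<^sup>2"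
      using e by (intro order_tendstoD) auto
    then obtain N where N: "\<And>n. n \<ge> N \<Longrightarrow> 4 * (m + 1 / Suc n)\<^sup>2 - 4 * m\<^sup>2 < e\<^sup>2"
      by (auto simp: eventually_sequentially)
    have "nm ((c + l i) - (c + l j)) < e" if "i \<ge> N" "j \<ge> N" for i j
    proof -
      have "(nm ((c + l i) - (c + l j)))\<^sup>2 < e\<^sup>2"
        using par[of i j] N[OF that(1)] N[OF that(2)] by argo
      thus ?thesis by (rule power2_less_imp_less) (use e in simp)
    qed
    thus "\<exists>N. \<forall>i\<ge>N. \<forall>j\<ge>N. nm ((c + l i) - (c + l j)) < e" by blast
  qed
  then obtain g where g: "g \<in> A2" "(\<lambda>n. nm ((c + l n) - g)) \<longlonglongrightarrow> 0" "\<forall>z\<in>U. (\<lambda>n. (c + l n) z) \<longlonglongrightarrow> g z"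
    by blast
  have gm: "nm g \<le> m"
  proof -
    have "(\<lambda>n. nm (c + l n)) \<longlonglongrightarrow> nm g"
      by (rule nm_limit[OF A2_L2[OF cl] A2_L2[OF g(1)] g(2), OF l(1)])
    moreover have "(\<lambda>n. m + 1 / Suc n) \<longlonglongrightarrow> m + 0"
      by (intro tendsto_intros inv)
    ultimately have "nm g \<le> m + 0"
      by (rule LIMSEQ_le) (use l(2) in \<open>auto intro: less_imp_le\<close>)
    thus ?thesis by simp
  qed
  have gk: "m \<le> nm (g + k)" if k: "k \<in> L" for k
  proof -
    have kA: "k \<in> A2" using k L by blast
    have "(\<lambda>n. nm (c + (l n + k))) \<longlonglongrightarrow> nm (g + k)"
    proof (rule nm_limit)
      show "c + (l n + k) \<in> L2" for n using A2_L2[OF cl] L(3)[OF l(1) k] by blast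
      show "g + k \<in> L2" using A2_L2 A2_add g(1) kA by blast
      show "(\<lambda>n. nm (c + (l n + k) - (g + k))) \<longlonglongrightarrow> 0" using g(2) by (simp add: algebra_simps)
    qed
    thus ?thesis by (rule tendsto_lowerbound) (use mle L(3)[OF l(1) k] in auto)
  qed
  have "ip g k = 0" if k: "k \<in> L" for k
  proof (cases "nm k = 0")
    case True
    have "k \<in> A2" using k L by blast
    hence "norm (ip g k) \<le> nm g * nm k" using Cauchy_Schwarz_ip A2_L2 g(1) by blast
    thus ?thesis using True by simp
  next
    case False
    have kA: "k \<in> A2" using k L by blast
    \<comment> \<open>This t minimises the norm of g + t k; a nonzero inner product would make g + t
      k shorter than the infimum.\<close>
    define t where "t = - ip g k / of_real ((nm k)\<^sup>2)"
    have "m\<^sup>2 \<le> (nm (g + cscale t k))\<^sup>2" using gk[OF L(4)[OF k]] m0 by (intro power_mono) auto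
    also have "\<dots> = (nm g)\<^sup>2 + (nm (cscale t k))\<^sup>2 + 2 * Re (ip g (cscale t k))"
      by (rule nm_add_square[OF A2_L2[OF g(1)] L2_cscale[OF A2_L2[OF kA]]])
    also have "(nm (cscale t k))\<^sup>2 = (norm (ip g k))\<^sup>2 / (nm k)\<^sup>2"
      unfolding nm_cscale t_def using False nm_nonneg[of k]
      by (simp add: norm_divide norm_mult power_divide power_mult_distrib power2_eq_square)
    also have "ip g (cscale t k) = - of_real ((norm (ip g k))\<^sup>2 / (nm k)\<^sup>2)"
    proof -
      have "cnj (ip g k) * ip g k = of_real ((norm (ip g k))\<^sup>2)"
        by (simp only: complex_norm_square mult.commute)
      thus ?thesis unfolding ip_cscale_right t_def by simp
    qed
    finally have "m\<^sup>2 \<le> (nm g)\<^sup>2 - (norm (ip g k))\<^sup>2 / (nm k)\<^sup>2" by simp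
    moreover have "(nm g)\<^sup>2 \<le> m\<^sup>2" using gm nm_nonneg by (intro power_mono) auto
    ultimately have "(norm (ip g k))\<^sup>2 / (nm k)\<^sup>2 \<le> 0" by linarith
    moreover have "(nm k)\<^sup>2 > 0" using False by simp
    ultimately show ?thesis by (simp add: divide_le_0_iff)
  qed
  thus ?thesis using g l(1) by blast
qed

definition one_U :: "complex \<times> complex \<Rightarrow> complex" where "one_U w = indicator U w"

lemma one_U_A2: "one_U \<in> A2"
proof (rule A2_I)
  show "holomorphic2_on one_U U"
    unfolding holomorphic2_on_def
  proof
    fix z assume z: "z \<in> U"
    have "((\<lambda>_. 1 :: complex) has_derivative (\<lambda>h. 0 * fst h + 0 * snd h)) (at z)" by simp
    hence "(one_U has_derivative (\<lambda>h. 0 * fst h + 0 * snd h)) (at z)"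
      by (rule has_derivative_transform_within_open[OF _ open_U z]) (simp add: one_U_def)
    thus "\<exists>a b. (one_U has_derivative (\<lambda>h. a * fst h + b * snd h)) (at z)" by blast
  qed
  have "(\<integral>\<^sup>+w. ennreal ((norm (one_U w))\<^sup>2) * indicator U w \<partial>lborel) = (\<integral>\<^sup>+w. indicator U w \<partial>lborel)"
    by (intro nn_integral_cong) (auto simp: one_U_def indicator_def)
  thus "one_U \<in> L2"
    using emeasure_U_finite by (intro L2_borelI) (auto simp: one_U_def[abs_def])
qed (simp add: one_U_def)

abbreviation K where "K \<equiv> bergman_kernel \<alpha>"

lemma kernel_unique:
  assumes z: "z \<in> U" and k: "k \<in> A2" "\<And>f. f \<in> A2 \<Longrightarrow> f z = ip f k"
    and k': "k' \<in> A2" "\<And>f. f \<in> A2 \<Longrightarrow> f z = ip f k'"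
  shows "k = k'"
proof -
  have d: "k - k' \<in> A2" using A2_diff k k' by blast
  have "ip (k - k') (k - k') = ip (k - k') k - ip (k - k') k'"
    using d k k' A2_L2 by (intro ip_diff_right) auto
  also have "\<dots> = 0" using k(2)[OF d] k'(2)[OF d] by simp
  finally have "nm (k - k') = 0" by (simp add: ip_self)
  from nm_eq_0_A2[OF d this] show ?thesis by simp
qed

text \<open>Riesz representation for evaluation at z: g is the part of the constant 1 orthogonal to
  the functions vanishing at z. Pointwise convergence keeps g z = 1, so g is nonzero and a multiple
  of it reproduces.\<close>

lemma kernel_exists:
  assumes z: "z \<in> U"
  shows "\<exists>k\<in>A2. \<forall>f\<in>A2. f z = ip f k"
proof -
  define L where "L = {f \<in> A2. f z = 0}"
  have "\<exists>g\<in>A2. \<exists>l. (\<forall>n::nat. l n \<in> L) \<and> (\<lambda>n. nm (one_U + l n - g)) \<longlonglongrightarrow> 0 \<and> (\<forall>z\<in>U. (\<lambda>n. (one_U + l n) z) \<longlonglongrightarrow> g z) \<and> (\<forall>k\<in>L. ip g k = 0)"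
    by (rule affine_minimizer) (auto simp: L_def A2_zero A2_add A2_cscale one_U_A2 cscale_def[abs_def] intro: A2_cscale[unfolded cscale_def])
  then obtain g l where g: "g \<in> A2" "\<And>n::nat. l n \<in> L" "(\<lambda>n. (one_U + l n) z) \<longlonglongrightarrow> g z" "\<And>k. k \<in> L \<Longrightarrow> ip g k = 0"
    using z by blast
  have "(one_U + l n) z = 1" for n using g(2)[of n] z by (simp add: L_def one_U_def)
  hence "(\<lambda>n. 1) \<longlonglongrightarrow> g z" using g(3) by simp
  hence "g z = 1" by (simp add: LIMSEQ_const_iff)
  have nz: "nm g \<noteq> 0" using nm_eq_0_A2[OF g(1)] \<open>g z = 1\<close> by auto
  define k where "k = cscale (1 / of_real ((nm g)\<^sup>2)) g"
  have "f z = ip f k" if f: "f \<in> A2" for f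
  proof -
    let ?d = "f - cscale (f z) g"
    have dL: "?d \<in> L" using f g(1) \<open>g z = 1\<close> A2_diff[OF f A2_cscale[OF g(1)]] by (simp add: L_def cscale_def)
    have "ip ?d g = 0" using g(4)[OF dL] ip_cnj[of ?d g] by simp
    moreover have "ip ?d g = ip f g - f z * of_real ((nm g)\<^sup>2)"
      using f g(1) by (simp add: ip_diff_left A2_L2 L2_cscale ip_cscale_left ip_self)
    ultimately have "ip f g = f z * of_real ((nm g)\<^sup>2)" by simp
    thus ?thesis using nz by (simp add: k_def ip_cscale_right)
  qed
  moreover have "k \<in> A2" unfolding k_def by (rule A2_cscale[OF g(1)])
  ultimately show ?thesis by blast
qed

lemma K_props:
  assumes z: "z \<in> U"
  shows K_A2: "K z \<in> A2" and K_reproducing: "\<And>f. f \<in> A2 \<Longrightarrow> f z = ip f (K z)"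
proof -
  have "\<exists>!k. k \<in> A2 \<and> (\<forall>f\<in>A2. f z = ip f k)"
    using kernel_exists[OF z] kernel_unique[OF z] by blast
  from theI'[OF this] show "K z \<in> A2" "\<And>f. f \<in> A2 \<Longrightarrow> f z = ip f (K z)"
    unfolding bergman_kernel_def by auto
qed

text \<open>The limit g of f + l n is f minus its projection onto the closed span. Being orthogonal
  to S it vanishes, so the negatives of l n approximate f.\<close>

lemma span_dense:
  assumes S: "S \<subseteq> A2" and orth: "\<And>g. g \<in> A2 \<Longrightarrow> (\<And>s. s \<in> S \<Longrightarrow> ip g s = 0) \<Longrightarrow> g = 0"
    and f: "f \<in> A2"
  shows "\<exists>s. (\<forall>n::nat. s n \<in> cfun.span S) \<and> (\<lambda>n. nm (s n - f)) \<longlonglongrightarrow> 0"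
proof -
  have sub: "cfun.span S \<subseteq> A2"
  proof
    fix g assume "g \<in> cfun.span S"
    thus "g \<in> A2"
      by (induction rule: cfun.span_induct_alt) (use S A2_zero A2_add A2_cscale in blast)+
  qed
  obtain g l where g: "g \<in> A2" "\<And>n::nat. l n \<in> cfun.span S" "(\<lambda>n. nm (f + l n - g)) \<longlonglongrightarrow> 0" "\<And>k. k \<in> cfun.span S \<Longrightarrow> ip g k = 0"
    using affine_minimizer[OF sub cfun.span_zero cfun.span_add cfun.span_scale f] by blast
  have "g = 0" using g(4) cfun.span_base by (intro orth[OF g(1)]) blast
  show ?thesis
  proof (intro exI[of _ "\<lambda>n. cscale (-1) (l n)"] conjI allI)
    show "cscale (-1) (l n) \<in> cfun.span S" for n using g(2) by (rule cfun.span_scale)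
    have "nm (cscale (-1) (l n) - f) = nm (f + l n - g)" for n
    proof -
      have "cscale (-1) (l n) - f = - (f + l n - g)" using \<open>g = 0\<close> by (simp add: cscale_minus_one)
      thus ?thesis by (simp only: nm_uminus)
    qed
    thus "(\<lambda>n. nm (cscale (-1) (l n) - f)) \<longlonglongrightarrow> 0" using g(3) by simp
  qed
qed

end

section \<open>Point evaluations and the Schur test\<close>

context thullen
begin

lemma measure_ball_complex: "r \<ge> 0 \<Longrightarrow> measure lborel (ball (c :: complex) r) = pi * r\<^sup>2"
  by (simp add: content_ball unit_ball_vol_2)

lemma measure_polydisc:
  assumes "r \<ge> 0" "s \<ge> 0"
  shows "measure lborel (ball (0 :: complex) r \<times> ball (0 :: complex) s) = (pi * r\<^sup>2) * (pi * s\<^sup>2)"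
proof -
  have "emeasure lborel (ball (0 :: complex) r \<times> ball (0 :: complex) s) = emeasure lborel (ball (0 :: complex) r) * emeasure lborel (ball (0 :: complex) s)"
    unfolding lborel_prod[symmetric] by (rule lborel.emeasure_pair_measure_Times) auto
  thus ?thesis
    by (simp add: measure_def enn2real_mult) (simp add: measure_def[symmetric] measure_ball_complex assms)
qed

text \<open>The base of the power has positive real part, because Re (1 - cnj b v) > 0, and so
  avoids the branch cut.\<close>

lemma holomorphic_on_gb: "norm b < 1 \<Longrightarrow> gb b holomorphic_on ball 0 1"
proof -
  assume b: "norm b < 1"
  have "of_real (sqrt (1 - (norm b)\<^sup>2)) / (1 - cnj b * v) \<notin> \<real>\<^sub>\<le>\<^sub>0" if "norm v < 1" for v
  proof -
    have s: "sqrt (1 - (norm b)\<^sup>2) > 0" using one_minus_norm_sq_pos[OF b] by simp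
    have "Re (of_real (sqrt (1 - (norm b)\<^sup>2)) / (1 - cnj b * v)) = sqrt (1 - (norm b)\<^sup>2) * (Re (1 - cnj b * v) / (norm (1 - cnj b * v))\<^sup>2)"
      by (simp add: Re_divide cmod_power2)
    also have "\<dots> > 0"
      using s Re_one_minus_cnj_mult_pos[OF b that] one_minus_cnj_mult_nz[OF b that]
      by (intro mult_pos_pos divide_pos_pos) auto
    finally show ?thesis by (auto simp: complex_nonpos_Reals_iff)
  qed
  thus ?thesis
    unfolding gb_def[abs_def] using one_minus_cnj_mult_nz[OF b] by (intro holomorphic_intros) auto
qed

text \<open>The holomorphic map \<open>phi_b\<close> reduces z to (a, 0) with a =
  \<open>f_alpha z\<close>; a polydisc around that point takes the place of a second automorphism.
  Its radii are of order 1 - |a| and (1 - |a|)^(1/2), and the square root of its volume yields the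
  exponent 3/2 in \<open>Nz\<close>.\<close>

lemma point_evaluation_bound:
  "\<exists>C>0. \<forall>z\<in>U. \<forall>f\<in>A2. norm (f z) \<le> C * Nz z * nm f"
proof -
  \<comment> \<open>The polydisc below has volume k (1 - |a|)^3.\<close>
  define k where "k = pi\<^sup>2 * wtmin / 8"
  have k: "k > 0" using wtmin_pos by (simp add: k_def)
  show ?thesis
  proof (intro exI[of _ "2 powr (3/2) / sqrt k"] conjI ballI)
    show "0 < 2 powr (3/2) / sqrt k" using k by simp
    fix z f assume z: "z \<in> U" and f: "f \<in> A2"
    note [measurable] = A2_borel[OF f]
    define b where "b = snd z"
    define a where "a = f_alpha \<alpha> z"
    have b: "norm b < 1" and a: "norm a < 1" using norm_snd_U f_alpha_less_1 z by (auto simp: a_def b_def)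
    define ea where "ea = 1 - norm a"
    have ea: "0 < ea" "ea \<le> 1" using a by (auto simp: ea_def)
    define r where "r = ea / 2"
    define s where "s = sqrt (wtmin * ea / 2)"
    have rs: "r > 0" "s > 0" "s\<^sup>2 = wtmin * ea / 2" using ea wtmin_pos by (auto simp: r_def s_def)
    define P where "P = ball (0 :: complex) r \<times> ball (0 :: complex) s"
    have P[measurable]: "P \<in> sets borel" unfolding P_def by (intro borel_open open_Times) auto
    have "bounded P" unfolding P_def by (intro bounded_Times) auto
    hence Pf: "emeasure lborel P < \<infinity>" by (rule emeasure_bounded_finite)
    have inU: "(a + x, y) \<in> U" if "norm x < r" "norm y < s" for x y
    proof -
      have "norm (a + x) \<le> norm a + norm x" by (rule norm_triangle_ineq)
      hence nx: "norm (a + x) \<le> 1 - ea / 2" using that(1) unfolding r_def ea_def by argo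
      hence n1: "norm (a + x) < 1" using ea by simp
      have "(norm (a + x))\<^sup>2 \<le> norm (a + x)"
        using n1 by (simp add: power2_eq_square mult_left_le_one_le)
      hence "ea / 2 \<le> 1 - (norm (a + x))\<^sup>2" using nx by simp
      hence "wtmin * (ea / 2) \<le> wtmin * (1 - (norm (a + x))\<^sup>2)" using wtmin_pos by (intro mult_left_mono) auto
      also have "\<dots> \<le> wt (a + x)" using wt_lower[OF n1] by (simp add: wtmin_def)
      finally have "s\<^sup>2 \<le> wt (a + x)" using rs by simp
      moreover have "(norm y)\<^sup>2 < s\<^sup>2" using that(2) by (intro power_strict_mono) auto
      ultimately show ?thesis by (simp add: mem_U_iff_wt)
    qed
    \<comment> \<open>Up to sign the derivative of \<open>mob b\<close>, so that \<open>g\<close> is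
      f pulled back by \<open>phi_b\<close>, with a holomorphic factor whose modulus is
      \<open>jb\<close>.\<close>
    define D where "D v = of_real (1 - (norm b)\<^sup>2) / (1 - cnj b * v)\<^sup>2" for v
    define g where "g w = f (phi_b \<alpha> b ((a, 0) + w)) * (gb b (snd w) * D (snd w))" for w
    have Dm[measurable]: "D \<in> borel_measurable borel" unfolding D_def[abs_def] by measurable
    have tm[measurable]: "(\<lambda>w :: complex \<times> complex. (a, 0) + w) \<in> borel_measurable borel" by measurable
    have gm[measurable]: "g \<in> borel_measurable borel" unfolding g_def[abs_def] by measurable
    have nD: "norm (gb b v * D v) = jb b ((a, 0) + w)" if "v = snd w" for w v
      using one_minus_norm_sq_pos[OF b] that
      unfolding norm_mult jb_def D_def norm_divide norm_power norm_of_real mobd_def by simp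
    have main: "sqrt (measure lborel P) * norm (g (0, 0)) \<le> nm f"
    proof (rule mean_value_bound[OF P Pf _ gm])
      show "(t * fst w, t * snd w) \<in> P" if "w \<in> P" "norm t = 1" for w t
        using that by (auto simp: P_def norm_mult)
      show "\<exists>S. open S \<and> cball 0 1 \<subseteq> S \<and> (\<lambda>t. g (t * fst w, t * snd w)) holomorphic_on S" if w: "w \<in> P" for w
      proof (intro exI conjI)
        let ?S = "{t :: complex. norm t * norm (fst w) < r} \<inter> {t. norm t * norm (snd w) < s}"
        show S: "open ?S" by (intro open_Int open_Collect_less continuous_intros)
        show "cball 0 1 \<subseteq> ?S"
        proof
          fix t :: complex assume "t \<in> cball 0 1"
          hence "norm t * norm (fst w) \<le> 1 * norm (fst w)" "norm t * norm (snd w) \<le> 1 * norm (snd w)"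
            by (intro mult_right_mono; simp)+
          thus "t \<in> ?S" using w by (auto simp: P_def)
        qed
        have inU': "(a + t * fst w, t * snd w) \<in> U" if "t \<in> ?S" for t
          using that by (intro inU) (auto simp: norm_mult)
        have n2: "norm (t * snd w) < 1" if "t \<in> ?S" for t
          using norm_snd_U[OF inU'[OF that]] by simp
        have hg: "(\<lambda>t. gb b (t * snd w)) holomorphic_on ?S"
          by (rule holomorphic_on_compose_gen[OF _ holomorphic_on_gb[OF b], unfolded o_def])
             (use n2 in \<open>auto intro!: holomorphic_intros\<close>)
        have hm: "(\<lambda>t. mob b (t * snd w)) holomorphic_on ?S"
          by (rule holomorphic_on_compose_gen[OF _ holomorphic_on_mob[OF b], unfolded o_def])
             (use n2 in \<open>auto intro!: holomorphic_intros\<close>)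
        have hD: "(\<lambda>t. D (t * snd w)) holomorphic_on ?S"
          unfolding D_def using one_minus_cnj_mult_nz[OF b n2] by (intro holomorphic_intros) auto
        have "(\<lambda>t. f (gb b (t * snd w) * (a + t * fst w), mob b (t * snd w))) holomorphic_on ?S"
        proof (rule holomorphic2_on_compose_curve[OF A2_holomorphic[OF f] S _ hm])
          show "(\<lambda>t. gb b (t * snd w) * (a + t * fst w)) holomorphic_on ?S"
            by (intro holomorphic_intros hg)
          show "(gb b (t * snd w) * (a + t * fst w), mob b (t * snd w)) \<in> U" if "t \<in> ?S" for t
            using phi_b_in_U_iff[OF b, of "(a + t * fst w, t * snd w)"] n2[OF that] inU'[OF that] by (simp add: phi_b_eq)
        qed
        thus "(\<lambda>t. g (t * fst w, t * snd w)) holomorphic_on ?S"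
          unfolding g_def phi_b_eq by (auto intro!: holomorphic_intros hg hD)
      qed
      have "(\<integral>\<^sup>+w. ennreal ((norm (g w))\<^sup>2) * indicator P w \<partial>lborel)
        \<le> (\<integral>\<^sup>+w. ennreal ((norm (f (phi_b \<alpha> b ((a, 0) + w))))\<^sup>2) * ennreal ((jb b ((a, 0) + w))\<^sup>2) * indicator U ((a, 0) + w) \<partial>lborel)"
      proof (rule nn_integral_mono)
        fix w :: "complex \<times> complex"
        have "norm (g w) = norm (f (phi_b \<alpha> b ((a, 0) + w))) * jb b ((a, 0) + w)"
          unfolding g_def norm_mult[of "f _"] nD[OF refl] ..
        moreover have "(a, 0) + w \<in> U" if "w \<in> P"
          using that inU[of "fst w" "snd w"] by (auto simp: P_def plus_prod_def)
        ultimately show "ennreal ((norm (g w))\<^sup>2) * indicator P w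
           \<le> ennreal ((norm (f (phi_b \<alpha> b ((a, 0) + w))))\<^sup>2) * ennreal ((jb b ((a, 0) + w))\<^sup>2) * indicator U ((a, 0) + w)"
          by (auto simp: indicator_def power_mult_distrib ennreal_mult)
      qed
      also have "\<dots> = (\<integral>\<^sup>+w. ennreal ((norm (f (phi_b \<alpha> b w)))\<^sup>2) * ennreal ((jb b w)\<^sup>2) * indicator U w \<partial>lborel)"
        by (rule nn_integral_translate) measurable
      also have "\<dots> = (\<integral>\<^sup>+w. ennreal ((norm (f w))\<^sup>2) * indicator U w \<partial>lborel)"
        by (rule nn_integral_phi_b[OF b]) measurable
      also have "\<dots> = ennreal ((nm f)\<^sup>2)" by (rule A2_nn_integral[OF f])
      finally show "(\<integral>\<^sup>+w. ennreal ((norm (g w))\<^sup>2) * indicator P w \<partial>lborel) \<le> ennreal ((nm f)\<^sup>2)" .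
    qed (rule nm_nonneg)
    have mP: "measure lborel P = k * ea ^ 3"
      unfolding P_def measure_polydisc[OF less_imp_le[OF rs(1)] less_imp_le[OF rs(2)]] rs(3)
      by (simp add: r_def k_def power2_eq_square power3_eq_cube field_simps)
    have v: "1 - (norm b)\<^sup>2 > 0" by (rule one_minus_norm_sq_pos[OF b])
    have gb0: "gb b 0 = of_real ((1 - (norm b)\<^sup>2) powr (\<alpha> / 2))"
    proof -
      have "gb b 0 = of_real (sqrt (1 - (norm b)\<^sup>2) powr \<alpha>)"
        using v by (simp add: gb_def powr_of_real)
      also have "sqrt (1 - (norm b)\<^sup>2) powr \<alpha> = (1 - (norm b)\<^sup>2) powr (\<alpha> / 2)"
        using v by (simp add: powr_half_sqrt[symmetric] powr_powr)
      finally show ?thesis .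
    qed
    have "phi_b \<alpha> b ((a, 0) + (0, 0)) = z"
    proof -
      have "gb b 0 * a = fst z" unfolding gb0 a_def f_alpha_def using v by (simp add: b_def)
      thus ?thesis by (simp add: phi_b_eq mob_def) (simp add: b_def)
    qed
    hence "g (0, 0) = f z * (gb b 0 * D 0)" by (simp add: g_def)
    moreover have "norm (gb b 0 * D 0) = (1 - (norm b)\<^sup>2) powr (1 + \<alpha> / 2)"
      using v unfolding norm_mult gb0 D_def norm_divide norm_power norm_of_real by (simp add: powr_add)
    ultimately have ng: "norm (g (0, 0)) = norm (f z) * (1 - (norm b)\<^sup>2) powr (1 + \<alpha> / 2)"
      by (simp only: norm_mult)
    have sq: "sqrt k * (2 powr (-(3/2)) * (1 - (norm a)\<^sup>2) powr (3/2)) \<le> sqrt (measure lborel P)"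
    proof -
      have "(1 - (norm a)\<^sup>2) = (1 + norm a) * ea" by (simp add: ea_def power2_eq_square algebra_simps)
      also have "\<dots> \<le> 2 * ea" using a ea by (intro mult_right_mono) auto
      finally have "(1 - (norm a)\<^sup>2) powr (3/2) \<le> (2 * ea) powr (3/2)"
        using one_minus_norm_sq_pos[OF a] by (intro powr_mono2) auto
      hence "2 powr (-(3/2)) * (1 - (norm a)\<^sup>2) powr (3/2) \<le> 2 powr (-(3/2)) * (2 * ea) powr (3/2)"
        by (intro mult_left_mono) auto
      also have "\<dots> = ea powr (3/2)" by (simp add: powr_mult powr_minus)
      also have "\<dots> = sqrt (ea ^ 3)"
        using ea by (simp add: powr_half_sqrt[symmetric] powr_powr flip: powr_numeral)
      finally have "sqrt k * (2 powr (-(3/2)) * (1 - (norm a)\<^sup>2) powr (3/2)) \<le> sqrt k * sqrt (ea ^ 3)"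
        using k by (intro mult_left_mono) auto
      thus ?thesis by (simp add: mP real_sqrt_mult)
    qed
    define u where "u = 1 - (norm a)\<^sup>2"
    have u: "u > 0" using one_minus_norm_sq_pos[OF a] by (simp add: u_def)
    have "sqrt k * (2 powr (-(3/2)) * u powr (3/2)) * norm (g (0, 0)) \<le> sqrt (measure lborel P) * norm (g (0, 0))"
      using sq by (intro mult_right_mono) (auto simp: u_def)
    also note main
    finally have "sqrt k * (2 powr (-(3/2)) * u powr (3/2)) * (norm (f z) * (1 - (norm b)\<^sup>2) powr (1 + \<alpha> / 2)) \<le> nm f"
      unfolding ng .
    hence "norm (f z) \<le> nm f / (sqrt k * (2 powr (-(3/2)) * u powr (3/2)) * (1 - (norm b)\<^sup>2) powr (1 + \<alpha> / 2))"
      using k u v by (subst pos_le_divide_eq) (auto simp: mult_ac)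
    also have "\<dots> = 2 powr (3/2) / sqrt k * Nz z * nm f"
      unfolding Nz_def a_def[symmetric] b_def[symmetric] u_def[symmetric]
      by (simp only: powr_minus) (simp add: field_simps)
    finally show "norm (f z) \<le> 2 powr (3/2) / sqrt k * Nz z * nm f" .
  qed
qed

section \<open>The kernel norm, normalized kernels and their span\<close>

definition X :: "complex \<times> complex \<Rightarrow> real" where "X z = nm (K z)"

abbreviation kk where "kk \<equiv> normalized_kernel \<alpha>"

lemma kk_eq: "kk z = cscale (1 / of_real (X z)) (K z)"
  by (simp add: normalized_kernel_def cscale_def X_def)

text \<open>The constant 1 has value 1 at z, so the kernel reproducing it cannot have norm
  0.\<close>

lemma X_pos: "z \<in> U \<Longrightarrow> X z > 0"
proof -
  assume z: "z \<in> U"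
  have "1 = ip one_U (K z)" using K_reproducing[OF z one_U_A2] z by (simp add: one_U_def)
  hence "1 \<le> nm one_U * X z"
    using Cauchy_Schwarz_ip[OF A2_L2[OF one_U_A2] A2_L2[OF K_A2[OF z]]] by (simp add: X_def)
  thus ?thesis using nm_nonneg[of "K z"] by (cases "X z = 0") (auto simp: X_def)
qed

lemma kk_A2: "z \<in> U \<Longrightarrow> kk z \<in> A2"
  unfolding kk_eq by (intro A2_cscale K_A2)

lemma nm_kk: "z \<in> U \<Longrightarrow> nm (kk z) = 1"
  using X_pos[of z] unfolding kk_eq nm_cscale by (simp add: norm_divide X_def)

lemma kk_span: "z \<in> U \<Longrightarrow> kk z \<in> kernel_span \<alpha>"
  unfolding kernel_span_def by (intro cfun.span_base) auto

lemma ip_kk: "z \<in> U \<Longrightarrow> f \<in> A2 \<Longrightarrow> ip f (kk z) = f z / of_real (X z)"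
  unfolding kk_eq ip_cscale_right by (simp add: K_reproducing[symmetric])

lemma kernel_span_A2: "kernel_span \<alpha> \<subseteq> A2"
proof
  fix g assume "g \<in> kernel_span \<alpha>"
  thus "g \<in> A2" unfolding kernel_span_def
    by (induction rule: cfun.span_induct_alt) (use kk_A2 A2_zero A2_add A2_cscale in blast)+
qed

lemma norm_le_X: "z \<in> U \<Longrightarrow> f \<in> A2 \<Longrightarrow> norm (f z) \<le> X z * nm f"
  using Cauchy_Schwarz_ip[OF A2_L2 A2_L2[OF K_A2], of f z] K_reproducing[of z f] by (simp add: X_def mult.commute)

text \<open>The evaluation bound is applied to the kernel itself, whose value at z is the square of
  its norm.\<close>

lemma X_le_Nz: "\<exists>C>0. \<forall>z\<in>U. X z \<le> C * Nz z"
proof -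
  obtain C where C: "C > 0" "\<forall>z\<in>U. \<forall>f\<in>A2. norm (f z) \<le> C * Nz z * nm f"
    using point_evaluation_bound by blast
  have "X z \<le> C * Nz z" if z: "z \<in> U" for z
  proof -
    have "(X z)\<^sup>2 = norm (K z z)"
      using K_reproducing[OF z K_A2[OF z]] by (simp add: ip_self X_def del: of_real_power)
    also have "\<dots> \<le> C * Nz z * X z" unfolding X_def using C z K_A2 by blast
    finally show ?thesis using X_pos[OF z] by (simp add: power2_eq_square)
  qed
  thus ?thesis using C by blast
qed

lemma A2_eqI:
  assumes "f \<in> A2" "g \<in> A2" "\<And>z. z \<in> U \<Longrightarrow> f z = g z"
  shows "f = g"
  using assms(3) A2_zero_outside[OF assms(1)] A2_zero_outside[OF assms(2)] by (metis ext)

lemma kernel_span_dense: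
  assumes f: "f \<in> A2"
  shows "\<exists>s. (\<forall>n::nat. s n \<in> kernel_span \<alpha>) \<and> (\<lambda>n. nm (s n - f)) \<longlonglongrightarrow> 0"
  unfolding kernel_span_def
proof (rule span_dense[OF _ _ f])
  show "kk ` U \<subseteq> A2" using kk_A2 by blast
  fix g assume g: "g \<in> A2" and o: "\<And>s. s \<in> kk ` U \<Longrightarrow> ip g s = 0"
  have "g z = 0" if z: "z \<in> U" for z using o[of "kk z"] ip_kk[OF z g] X_pos[OF z] z by simp
  thus "g = 0" using A2_zero_outside[OF g] by (auto simp: fun_eq_iff)
qed

text \<open>Replacing the first argument by its simple approximation \<open>q n\<close> gives a
  finite sum of products; continuity in the first argument gives the limit. Approximants outside
  \<open>U\<close> contribute 0, and since \<open>U\<close> is open there are none for large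
  n.\<close>

lemma borel_measurable_caratheodory:
  fixes F :: "complex \<times> complex \<Rightarrow> complex \<times> complex \<Rightarrow> complex"
  assumes c: "\<And>w. continuous_on U (\<lambda>z. F z w)" and m: "\<And>z. z \<in> U \<Longrightarrow> F z \<in> borel_measurable borel"
  shows "(\<lambda>x. indicator U (fst x) *\<^sub>R F (fst x) (snd x)) \<in> borel_measurable (borel \<Otimes>\<^sub>M borel)"
proof -
  obtain q :: "nat \<Rightarrow> complex \<times> complex \<Rightarrow> complex \<times> complex" where q: "\<And>n. simple_function borel (q n)"
    "\<And>z. (\<lambda>n. q n z) \<longlonglongrightarrow> z"
    using borel_measurable_implies_sequence_metric[of "\<lambda>z. z" borel undefined] by auto
  define G where "G n x = (\<Sum>c\<in>range (q n) \<inter> U. indicator (q n -` {c}) (fst x) *\<^sub>R F c (snd x))" for n x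
  have fin: "finite (range (q n))" for n using simple_functionD(1)[OF q(1), of n] by simp
  have Gm: "G n \<in> borel_measurable (borel \<Otimes>\<^sub>M borel)" for n
    unfolding G_def
  proof (rule borel_measurable_sum)
    fix c assume c: "c \<in> range (q n) \<inter> U"
    have [measurable]: "q n -` {c} \<in> sets borel" using simple_functionD(2)[OF q(1), of n "{c}"] by simp
    have [measurable]: "F c \<in> borel_measurable borel" using m c by blast
    show "(\<lambda>x. indicator (q n -` {c}) (fst x) *\<^sub>R F c (snd x)) \<in> borel_measurable (borel \<Otimes>\<^sub>M borel)"
      by measurable
  qed
  have Geq: "G n x = (if q n (fst x) \<in> U then F (q n (fst x)) (snd x) else 0)" for n x
  proof -
    have "G n x = (\<Sum>c\<in>range (q n) \<inter> U. if c = q n (fst x) then F c (snd x) else 0)"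
      unfolding G_def by (intro sum.cong) (auto simp: indicator_def)
    also have "\<dots> = (if q n (fst x) \<in> range (q n) \<inter> U then F (q n (fst x)) (snd x) else 0)"
      using fin by (subst sum.delta) auto
    finally show ?thesis by auto
  qed
  have lim: "(\<lambda>n. indicator U (fst x) *\<^sub>R G n x) \<longlonglongrightarrow> indicator U (fst x) *\<^sub>R F (fst x) (snd x)" for x
  proof (cases "fst x \<in> U")
    case True
    have ev: "\<forall>\<^sub>F n in sequentially. q n (fst x) \<in> U"
      using topological_tendstoD[OF q(2) open_U True] .
    have "isCont (\<lambda>z. F z (snd x)) (fst x)"
      using c[of "snd x"] open_U True by (simp add: continuous_on_eq_continuous_at)
    hence "(\<lambda>n. F (q n (fst x)) (snd x)) \<longlonglongrightarrow> F (fst x) (snd x)"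
      using q(2)[of "fst x"] by (rule isCont_tendsto_compose)
    hence "(\<lambda>n. G n x) \<longlonglongrightarrow> F (fst x) (snd x)"
      by (rule Lim_transform_eventually) (use ev in \<open>auto elim!: eventually_mono simp: Geq\<close>)
    thus ?thesis using True by simp
  qed simp
  show ?thesis
    by (rule borel_measurable_LIMSEQ_metric[OF _ lim]) (use Gm in measurable)
qed

text \<open>The integrand is split as sqrt (r h) times sqrt (r / h) g, and Cauchy-Schwarz is
  followed by Tonelli. The column bound is asked for only on \<open>E\<close>, which allows
  different constants near and away from the boundary.\<close>

lemma schur_test:
  fixes r :: "complex \<times> complex \<Rightarrow> complex \<times> complex \<Rightarrow> real" and g :: "complex \<times> complex \<Rightarrow> real"
  assumes rm: "(\<lambda>x. r (fst x) (snd x)) \<in> borel_measurable (borel \<Otimes>\<^sub>M borel)" and rn: "\<And>z w. r z w \<ge> 0"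
    and E[measurable]: "E \<in> sets borel" "E \<subseteq> U" and gm[measurable]: "g \<in> borel_measurable borel" and gn: "\<And>w. g w \<ge> 0"
    and C: "C1 \<ge> 0" "C2 \<ge> 0"
    and 1: "\<And>z. z \<in> U \<Longrightarrow> (\<integral>\<^sup>+w. ennreal (r z w * h w) * indicator U w \<partial>lborel) \<le> ennreal (C1 * h z)"
    and 2: "\<And>w. w \<in> E \<Longrightarrow> (\<integral>\<^sup>+z. ennreal (r z w * h z) * indicator U z \<partial>lborel) \<le> ennreal (C2 * h w)"
  shows "(\<integral>\<^sup>+z. (\<integral>\<^sup>+w. ennreal (r z w * g w) * indicator E w \<partial>lborel)\<^sup>2 * indicator U z \<partial>lborel)
     \<le> ennreal (C1 * C2) * (\<integral>\<^sup>+w. ennreal ((g w)\<^sup>2) * indicator E w \<partial>lborel)"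
proof -
  have rm2[measurable]: "case_prod r \<in> borel_measurable (borel \<Otimes>\<^sub>M borel)"
    using rm by (simp add: case_prod_beta')
  have rz[measurable]: "r z \<in> borel_measurable borel" for z
    using measurable_compose[OF measurable_Pair1'[of z borel borel] rm] by simp
  define J where "J z = (\<integral>\<^sup>+w. ennreal (r z w * ((g w)\<^sup>2 / h w)) * indicator E w \<partial>lborel)" for z
  have step: "(\<integral>\<^sup>+w. ennreal (r z w * g w) * indicator E w \<partial>lborel)\<^sup>2 * indicator U z
      \<le> ennreal C1 * (\<integral>\<^sup>+w. ennreal (h z * (r z w * ((g w)\<^sup>2 / h w))) * indicator E w * indicator U z \<partial>lborel)" for z
  proof (cases "z \<in> U")
    case z: True
    have "(\<integral>\<^sup>+w. ennreal (r z w * g w) * indicator E w \<partial>lborel)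
       = (\<integral>\<^sup>+w. (ennreal (sqrt (r z w * h w)) * indicator U w) * (ennreal (sqrt (r z w / h w) * g w) * indicator E w) \<partial>lborel)"
    proof (rule nn_integral_cong)
      fix w
      show "ennreal (r z w * g w) * indicator E w = (ennreal (sqrt (r z w * h w)) * indicator U w) * (ennreal (sqrt (r z w / h w) * g w) * indicator E w)"
      proof (cases "w \<in> E")
        case True
        hence w: "w \<in> U" using E by blast
        have "sqrt (r z w * h w) * (sqrt (r z w / h w) * g w) = sqrt ((r z w)\<^sup>2) * g w"
          using h_pos[OF w] by (simp add: real_sqrt_mult[symmetric] mult.assoc[symmetric] power2_eq_square)
        also have "\<dots> = r z w * g w" using rn by simp
        finally have e: "sqrt (r z w * h w) * (sqrt (r z w / h w) * g w) = r z w * g w" .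
        show ?thesis unfolding e[symmetric] using True w rn gn h_pos[OF w] by (simp add: ennreal_mult mult_ac)
      qed simp
    qed
    hence "(\<integral>\<^sup>+w. ennreal (r z w * g w) * indicator E w \<partial>lborel)\<^sup>2
       \<le> (\<integral>\<^sup>+w. (ennreal (sqrt (r z w * h w)) * indicator U w)\<^sup>2 \<partial>lborel) * (\<integral>\<^sup>+w. (ennreal (sqrt (r z w / h w) * g w) * indicator E w)\<^sup>2 \<partial>lborel)"
      using Cauchy_Schwarz_nn_integral[of "\<lambda>w. ennreal (sqrt (r z w * h w)) * indicator U w" lborel "\<lambda>w. ennreal (sqrt (r z w / h w) * g w) * indicator E w"]
      by simp
    also have "(\<integral>\<^sup>+w. (ennreal (sqrt (r z w * h w)) * indicator U w)\<^sup>2 \<partial>lborel) = (\<integral>\<^sup>+w. ennreal (r z w * h w) * indicator U w \<partial>lborel)"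
      using rn h_nonneg by (intro nn_integral_cong) (auto simp: indicator_def ennreal_power)
    also have "(\<integral>\<^sup>+w. (ennreal (sqrt (r z w / h w) * g w) * indicator E w)\<^sup>2 \<partial>lborel) = J z"
      unfolding J_def using rn gn h_nonneg
      by (intro nn_integral_cong) (auto simp: indicator_def ennreal_power power_mult_distrib)
    also have "(\<integral>\<^sup>+w. ennreal (r z w * h w) * indicator U w \<partial>lborel) * J z \<le> ennreal (C1 * h z) * J z"
      by (intro mult_right_mono 1 z) auto
    also have "\<dots> = ennreal C1 * (ennreal (h z) * J z)"
      using C h_nonneg by (simp add: ennreal_mult mult.assoc)
    also have "ennreal (h z) * J z = (\<integral>\<^sup>+w. ennreal (h z) * (ennreal (r z w * ((g w)\<^sup>2 / h w)) * indicator E w) \<partial>lborel)"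
      unfolding J_def by (rule nn_integral_cmult[symmetric]) measurable
    also have "\<dots> = (\<integral>\<^sup>+w. ennreal (h z * (r z w * ((g w)\<^sup>2 / h w))) * indicator E w * indicator U z \<partial>lborel)"
      using z by (intro nn_integral_cong) (simp add: ennreal_mult'[OF h_nonneg] mult.assoc del: times_divide_eq_right)
    finally show ?thesis using z by simp
  qed simp
  have m1: "(\<lambda>x. ennreal (h (fst x) * (r (fst x) (snd x) * ((g (snd x))\<^sup>2 / h (snd x)))) * indicator E (snd x) * indicator U (fst x)) \<in> borel_measurable (borel \<Otimes>\<^sub>M borel)"
    using rm by measurable
  have m1': "case_prod (\<lambda>z w. ennreal (h z * (r z w * ((g w)\<^sup>2 / h w))) * indicator E w * indicator U z) \<in> borel_measurable (lborel \<Otimes>\<^sub>M lborel)"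
    using m1 by (simp add: case_prod_beta' borel_prod lborel_prod)
  have m2: "(\<lambda>z. \<integral>\<^sup>+w. ennreal (h z * (r z w * ((g w)\<^sup>2 / h w))) * indicator E w * indicator U z \<partial>lborel) \<in> borel_measurable lborel"
    using lborel.borel_measurable_nn_integral_fst[OF m1'] by simp
  have "(\<integral>\<^sup>+z. (\<integral>\<^sup>+w. ennreal (r z w * g w) * indicator E w \<partial>lborel)\<^sup>2 * indicator U z \<partial>lborel)
    \<le> (\<integral>\<^sup>+z. ennreal C1 * (\<integral>\<^sup>+w. ennreal (h z * (r z w * ((g w)\<^sup>2 / h w))) * indicator E w * indicator U z \<partial>lborel) \<partial>lborel)"
    by (rule nn_integral_mono) (rule step)
  also have "\<dots> = ennreal C1 * (\<integral>\<^sup>+z. (\<integral>\<^sup>+w. ennreal (h z * (r z w * ((g w)\<^sup>2 / h w))) * indicator E w * indicator U z \<partial>lborel) \<partial>lborel)"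
    by (rule nn_integral_cmult[OF m2])
  also have "(\<integral>\<^sup>+z. (\<integral>\<^sup>+w. ennreal (h z * (r z w * ((g w)\<^sup>2 / h w))) * indicator E w * indicator U z \<partial>lborel) \<partial>lborel)
     = (\<integral>\<^sup>+w. (\<integral>\<^sup>+z. ennreal (h z * (r z w * ((g w)\<^sup>2 / h w))) * indicator E w * indicator U z \<partial>lborel) \<partial>lborel)"
    using lborel_pair.Fubini'[OF m1'] by simp
  also have "\<dots> \<le> (\<integral>\<^sup>+w. ennreal C2 * (ennreal ((g w)\<^sup>2) * indicator E w) \<partial>lborel)"
  proof (rule nn_integral_mono)
    fix w
    have rw: "(\<lambda>z. r z w) \<in> borel_measurable borel"
      using measurable_compose[OF measurable_Pair2'[of w borel borel] rm] by simp
    show "(\<integral>\<^sup>+z. ennreal (h z * (r z w * ((g w)\<^sup>2 / h w))) * indicator E w * indicator U z \<partial>lborel)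
       \<le> ennreal C2 * (ennreal ((g w)\<^sup>2) * indicator E w)"
    proof (cases "w \<in> E")
      case True
      hence w: "h w > 0" using E h_pos by blast
      have "(\<integral>\<^sup>+z. ennreal (h z * (r z w * ((g w)\<^sup>2 / h w))) * indicator E w * indicator U z \<partial>lborel)
         = (\<integral>\<^sup>+z. ennreal ((g w)\<^sup>2 / h w) * (ennreal (r z w * h z) * indicator U z) \<partial>lborel)"
        using True w rn h_nonneg by (intro nn_integral_cong) (auto simp: ennreal_mult[symmetric] mult_ac indicator_def)
      also have "\<dots> = ennreal ((g w)\<^sup>2 / h w) * (\<integral>\<^sup>+z. (ennreal (r z w * h z) * indicator U z) \<partial>lborel)"
        using rw by (intro nn_integral_cmult) measurable
      also have "\<dots> \<le> ennreal ((g w)\<^sup>2 / h w) * ennreal (C2 * h w)"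
        by (intro mult_left_mono 2 True) auto
      also have "\<dots> = ennreal (C2 * (g w)\<^sup>2)"
        using w C by (simp add: ennreal_mult[symmetric])
      finally show ?thesis using True C by (simp add: ennreal_mult)
    qed simp
  qed
  also have "\<dots> = ennreal C2 * (\<integral>\<^sup>+w. ennreal ((g w)\<^sup>2) * indicator E w \<partial>lborel)"
    by (rule nn_integral_cmult) measurable
  also have "ennreal C1 * (ennreal C2 * (\<integral>\<^sup>+w. ennreal ((g w)\<^sup>2) * indicator E w \<partial>lborel)) = ennreal (C1 * C2) * (\<integral>\<^sup>+w. ennreal ((g w)\<^sup>2) * indicator E w \<partial>lborel)"
    using C by (simp add: ennreal_mult mult.assoc)
  finally show ?thesis by (simp add: mult_left_mono)
qed

end

section \<open>Operators given on the span of the kernels\<close>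

text \<open>The threshold is the t at which \<delta> t^(p-s) = 1: above it the first term dominates,
  below it t^(s-2) is at most the same power of the threshold.\<close>

lemma powr_interpolation:
  fixes t p s \<delta> :: real
  assumes "t \<ge> 0" "2 < s" "s < p" "\<delta> > 0"
  shows "t powr s \<le> \<delta> * t powr p + (\<delta> powr (-1 / (p - s))) powr (s - 2) * t powr 2"
proof (cases "t \<ge> \<delta> powr (-1 / (p - s))")
  case True
  have e: "-1 / (p - s) * (p - s) = -1" using assms by simp
  have "1 = \<delta> * (\<delta> powr (-1 / (p - s))) powr (p - s)"
    unfolding powr_powr e using assms by (simp add: powr_minus)
  also have "\<dots> \<le> \<delta> * t powr (p - s)"
    using True assms by (intro mult_left_mono powr_mono2) auto
  finally have "t powr s * 1 \<le> t powr s * (\<delta> * t powr (p - s))" by (intro mult_left_mono) auto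
  also have "\<dots> = \<delta> * (t powr s * t powr (p - s))" by simp
  also have "t powr s * t powr (p - s) = t powr p" unfolding powr_add[symmetric] by simp
  finally show ?thesis by (simp add: add_increasing2)
next
  case False
  have "t powr s = t powr (s - 2) * t powr 2" unfolding powr_add[symmetric] by simp
  also have "\<dots> \<le> (\<delta> powr (-1 / (p - s))) powr (s - 2) * t powr 2"
    using False assms by (intro mult_right_mono powr_mono2) auto
  finally show ?thesis using assms by (simp add: add_increasing)
qed

text \<open>A finite supremum rules out the infinite branch of \<open>norm_Lp\<close>. The witness
  is \<open>B + 1\<close> rather than \<open>B\<close> because the estimates expect a positive
  \<eta>.\<close>

lemma (in thullen) Lp_bound:
  assumes "(SUP z\<in>U. norm_Lp \<alpha> p (VU z (F z))) < \<infinity>" and p: "p > 0"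
  shows "\<exists>\<eta>>0. \<forall>z\<in>U. (\<integral>\<^sup>+w. ennreal (norm (VU z (F z) w) powr p) * indicator U w \<partial>lborel) \<le> ennreal (\<eta> powr p)"
proof -
  obtain B where B: "(SUP z\<in>U. norm_Lp \<alpha> p (VU z (F z))) = ennreal B" "B \<ge> 0"
    using assms by (metis ennreal_cases infinity_ennreal_def less_irrefl)
  have "(\<integral>\<^sup>+w. ennreal (norm (VU z (F z) w) powr p) * indicator U w \<partial>lborel) \<le> ennreal ((B + 1) powr p)" if z: "z \<in> U" for z
  proof -
    define I where "I = (\<integral>\<^sup>+w. ennreal (norm (VU z (F z) w) powr p) * indicator U w \<partial>lborel)"
    have IM: "(\<integral>\<^sup>+w. ennreal (norm (VU z (F z) w) powr p) \<partial>M) = I"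
      unfolding I_def by (rule nn_integral_M)
    have le: "norm_Lp \<alpha> p (VU z (F z)) \<le> ennreal B"
      unfolding B(1)[symmetric] by (rule SUP_upper[OF z])
    have "I \<noteq> \<infinity>"
      using le unfolding norm_Lp_def Let_def IM by (auto simp: top_unique split: if_splits)
    then obtain r where r: "I = ennreal r" "r \<ge> 0" by (cases I rule: ennreal_cases) auto
    have "ennreal (r powr (1 / p)) \<le> ennreal B"
      using le \<open>I \<noteq> \<infinity>\<close> unfolding norm_Lp_def Let_def IM by (simp add: r)
    hence "r powr (1 / p) \<le> B" using B by (simp add: ennreal_le_iff)
    hence "(r powr (1 / p)) powr p \<le> (B + 1) powr p" using p B by (intro powr_mono2) auto
    moreover have "(r powr (1 / p)) powr p = r" using p r by (simp add: powr_powr)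
    ultimately show ?thesis unfolding I_def[symmetric] r by (simp add: ennreal_leI)
  qed
  thus ?thesis using B by (intro exI[of _ "B + 1"]) auto
qed

locale thullen_op = thullen +
  fixes p :: real and T Tstar :: "(complex \<times> complex \<Rightarrow> complex) \<Rightarrow> (complex \<times> complex \<Rightarrow> complex)"
  assumes T_lin: "clinear_on (kernel_span \<alpha>) T" and T_im: "T ` kernel_span \<alpha> \<subseteq> A2"
    and Tstar_im: "Tstar ` kernel_span \<alpha> \<subseteq> A2"
    and adj: "\<And>z w. z \<in> U \<Longrightarrow> w \<in> U \<Longrightarrow> ip (T (kk z)) (kk w) = ip (kk z) (Tstar (kk w))"
    and p_gt_4: "p > 4"
    and T_bd: "(SUP z\<in>U. norm_Lp \<alpha> p (VU z (T (kk z)))) < \<infinity>"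
    and Tstar_bd: "(SUP z\<in>U. norm_Lp \<alpha> p (VU z (Tstar (kk z)))) < \<infinity>"
begin

lemma T_kk_A2: "z \<in> U \<Longrightarrow> T (kk z) \<in> A2" and Tstar_kk_A2: "z \<in> U \<Longrightarrow> Tstar (kk z) \<in> A2"
  using T_im Tstar_im kk_span by blast+

text \<open>The value at \<open>z\<close> of the image of the (unnormalized) kernel \<open>K\<^sub>w\<close>, which is the integral kernel of the operator.\<close>

definition tk :: "complex \<times> complex \<Rightarrow> complex \<times> complex \<Rightarrow> complex" where
  "tk z w = (if w \<in> U then of_real (X w) * T (kk w) z else 0)"

text \<open>The reproducing property on both sides of the adjoint relation. In w the integral kernel
  is the conjugate of a Bergman function, so rows are governed by \<open>Tstar\<close> and columns
  by \<open>T\<close>.\<close>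

lemma tk_adj:
  assumes z: "z \<in> U" and w: "w \<in> U"
  shows "tk z w = of_real (X z) * cnj (Tstar (kk z) w)"
proof -
  have "T (kk w) z / of_real (X z) = ip (T (kk w)) (kk z)"
    by (rule ip_kk[OF z T_kk_A2[OF w], symmetric])
  also have "\<dots> = ip (kk w) (Tstar (kk z))" by (rule adj[OF w z])
  also have "\<dots> = cnj (ip (Tstar (kk z)) (kk w))" by (rule ip_cnj)
  also have "\<dots> = cnj (Tstar (kk z) w) / of_real (X w)" by (simp add: ip_kk[OF w Tstar_kk_A2[OF z]])
  finally show ?thesis using X_pos[OF z] X_pos[OF w] w by (simp add: tk_def field_simps)
qed

text \<open>\<open>tk\<close> already vanishes for w outside \<open>U\<close>; cutting off in z as
  well makes \<open>r\<close> Borel on the whole product.\<close>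

definition r :: "complex \<times> complex \<Rightarrow> complex \<times> complex \<Rightarrow> real" where
  "r z w = norm (indicator U z *\<^sub>R tk z w)"

lemma r_nonneg: "r z w \<ge> 0" by (simp add: r_def)

lemma r_eq: "z \<in> U \<Longrightarrow> r z w = norm (tk z w)" by (simp add: r_def)

text \<open>The kernel is continuous in z because \<open>T (kk w)\<close> is holomorphic, and Borel
  in w because of \<open>tk_adj\<close>.\<close>

lemma measurable_r: "(\<lambda>x. r (fst x) (snd x)) \<in> borel_measurable (borel \<Otimes>\<^sub>M borel)"
proof -
  have "(\<lambda>x. indicator U (fst x) *\<^sub>R tk (fst x) (snd x)) \<in> borel_measurable (borel \<Otimes>\<^sub>M borel)"
  proof (rule borel_measurable_caratheodory)
    show "continuous_on U (\<lambda>z. tk z w)" for w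
      unfolding tk_def by (cases "w \<in> U") (auto intro!: continuous_intros A2_continuous[OF T_kk_A2])
    fix z assume z: "z \<in> U"
    have [measurable]: "Tstar (kk z) \<in> borel_measurable borel" by (rule A2_borel[OF Tstar_kk_A2[OF z]])
    have "(\<lambda>w. cnj (Tstar (kk z) w)) \<in> borel_measurable borel"
      by (rule measurable_compose[OF A2_borel[OF Tstar_kk_A2[OF z]] borel_measurable_continuous_onI])
         (intro continuous_intros)
    hence "(\<lambda>w. indicator U w *\<^sub>R (of_real (X z) * cnj (Tstar (kk z) w))) \<in> borel_measurable borel" by measurable
    moreover have "tk z = (\<lambda>w. indicator U w *\<^sub>R (of_real (X z) * cnj (Tstar (kk z) w)))"
    proof
      fix w show "tk z w = indicator U w *\<^sub>R (of_real (X z) * cnj (Tstar (kk z) w))"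
        by (cases "w \<in> U") (simp add: tk_adj[OF z], simp add: tk_def)
    qed
    ultimately show "tk z \<in> borel_measurable borel" by simp
  qed
  thus ?thesis unfolding r_def by measurable
qed

text \<open>The factor \<open>X z\<close> cancels 1 / \<open>Nz z\<close> up to a constant. The
  exponent s is free because it will be both p and an exponent strictly between 4 and p.\<close>

lemma weighted_estimate_kernel:
  assumes "s > 4"
  shows "\<exists>C>0. \<forall>z\<in>U. \<forall>f\<in>A2. \<forall>\<eta>>0. (\<integral>\<^sup>+w. ennreal (norm (VU z f w) powr s) * indicator U w \<partial>lborel) \<le> ennreal (\<eta> powr s) \<longrightarrow>
      (\<integral>\<^sup>+w. ennreal (X z * norm (f w) * h w) * indicator U w \<partial>lborel) \<le> ennreal (C * \<eta> * h z)"
proof -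
  obtain C where C: "C > 0" "\<forall>z\<in>U. \<forall>F\<in>borel_measurable borel. \<forall>\<eta>>0.
    (\<integral>\<^sup>+w. ennreal (norm (VU z F w) powr s) * indicator U w \<partial>lborel) \<le> ennreal (\<eta> powr s) \<longrightarrow>
    (\<integral>\<^sup>+w. ennreal (norm (F w) * h w) * indicator U w \<partial>lborel) \<le> ennreal (C * \<eta> * (h z / Nz z))"
    using weighted_estimate[OF assms] by blast
  obtain D where D: "D > 0" "\<forall>z\<in>U. X z \<le> D * Nz z" using X_le_Nz by blast
  show ?thesis
  proof (intro exI[of _ "C * D"] conjI ballI allI impI)
    show "0 < C * D" using C D by simp
    fix z f and \<eta> :: real
    assume z: "z \<in> U" and f: "f \<in> A2" and \<eta>: "\<eta> > 0"
      and hyp: "(\<integral>\<^sup>+w. ennreal (norm (VU z f w) powr s) * indicator U w \<partial>lborel) \<le> ennreal (\<eta> powr s)"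
    note [measurable] = A2_borel[OF f]
    have "(\<integral>\<^sup>+w. ennreal (X z * norm (f w) * h w) * indicator U w \<partial>lborel)
        = (\<integral>\<^sup>+w. ennreal (X z) * (ennreal (norm (f w) * h w) * indicator U w) \<partial>lborel)"
      using X_pos[OF z] h_nonneg by (intro nn_integral_cong) (simp add: ennreal_mult mult_ac)
    also have "\<dots> = ennreal (X z) * (\<integral>\<^sup>+w. (ennreal (norm (f w) * h w) * indicator U w) \<partial>lborel)"
      by (rule nn_integral_cmult) measurable
    also have "\<dots> \<le> ennreal (D * Nz z) * ennreal (C * \<eta> * (h z / Nz z))"
      using C(2) D(2) z A2_borel[OF f] \<eta> hyp by (intro mult_mono ennreal_leI) auto
    also have "\<dots> = ennreal (C * D * \<eta> * h z)"
      using C D Nz_pos[OF z] h_nonneg[of z] \<eta> by (simp add: ennreal_mult[symmetric] field_simps)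
    finally show "(\<integral>\<^sup>+w. ennreal (X z * norm (f w) * h w) * indicator U w \<partial>lborel) \<le> ennreal (C * D * \<eta> * h z)" .
  qed
qed

text \<open>By \<open>tk_adj\<close> a row has the modulus of \<open>Tstar (kk z)\<close> times
  \<open>X z\<close>, so the second supremum condition applies.\<close>

lemma schur_row: "\<exists>C>0. \<forall>z\<in>U. (\<integral>\<^sup>+w. ennreal (r z w * h w) * indicator U w \<partial>lborel) \<le> ennreal (C * h z)"
proof -
  obtain C where C: "C > 0" "\<forall>z\<in>U. \<forall>f\<in>A2. \<forall>\<eta>>0. (\<integral>\<^sup>+w. ennreal (norm (VU z f w) powr p) * indicator U w \<partial>lborel) \<le> ennreal (\<eta> powr p) \<longrightarrow>
      (\<integral>\<^sup>+w. ennreal (X z * norm (f w) * h w) * indicator U w \<partial>lborel) \<le> ennreal (C * \<eta> * h z)"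
    using weighted_estimate_kernel[OF p_gt_4] by blast
  obtain \<eta> where \<eta>: "\<eta> > 0" "\<forall>z\<in>U. (\<integral>\<^sup>+w. ennreal (norm (VU z (Tstar (kk z)) w) powr p) * indicator U w \<partial>lborel) \<le> ennreal (\<eta> powr p)"
    using Lp_bound[OF Tstar_bd] p_gt_4 by auto
  have "(\<integral>\<^sup>+w. ennreal (r z w * h w) * indicator U w \<partial>lborel) \<le> ennreal (C * \<eta> * h z)" if z: "z \<in> U" for z
  proof -
    have "(\<integral>\<^sup>+w. ennreal (r z w * h w) * indicator U w \<partial>lborel) = (\<integral>\<^sup>+w. ennreal (X z * norm (Tstar (kk z) w) * h w) * indicator U w \<partial>lborel)"
      using X_pos[OF z] by (intro nn_integral_cong) (auto simp: indicator_def r_eq[OF z] tk_adj[OF z] norm_mult)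
    thus ?thesis using C \<eta> z Tstar_kk_A2[OF z] by auto
  qed
  thus ?thesis using C \<eta> by (intro exI[of _ "C * \<eta>"]) auto
qed

text \<open>Stated for a single w and arbitrary s and \<eta>, so as to serve both the uniform and
  the small column bound.\<close>

lemma schur_column_of_bound:
  assumes C: "\<forall>z\<in>U. \<forall>f\<in>A2. \<forall>\<eta>>0. (\<integral>\<^sup>+w. ennreal (norm (VU z f w) powr s) * indicator U w \<partial>lborel) \<le> ennreal (\<eta> powr s) \<longrightarrow>
      (\<integral>\<^sup>+w. ennreal (X z * norm (f w) * h w) * indicator U w \<partial>lborel) \<le> ennreal (C * \<eta> * h z)"
    and w: "w \<in> U" and \<eta>: "\<eta> > 0" "(\<integral>\<^sup>+v. ennreal (norm (VU w (T (kk w)) v) powr s) * indicator U v \<partial>lborel) \<le> ennreal (\<eta> powr s)"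
  shows "(\<integral>\<^sup>+z. ennreal (r z w * h z) * indicator U z \<partial>lborel) \<le> ennreal (C * \<eta> * h w)"
proof -
  have "(\<integral>\<^sup>+z. ennreal (r z w * h z) * indicator U z \<partial>lborel) = (\<integral>\<^sup>+z. ennreal (X w * norm (T (kk w) z) * h z) * indicator U z \<partial>lborel)"
    using X_pos[OF w] w by (intro nn_integral_cong) (auto simp: indicator_def r_eq tk_def norm_mult)
  thus ?thesis using C w \<eta> T_kk_A2[OF w] by auto
qed

lemma schur_column: "\<exists>C>0. \<forall>w\<in>U. (\<integral>\<^sup>+z. ennreal (r z w * h z) * indicator U z \<partial>lborel) \<le> ennreal (C * h w)"
proof -
  obtain C where C: "C > 0" "\<forall>z\<in>U. \<forall>f\<in>A2. \<forall>\<eta>>0. (\<integral>\<^sup>+w. ennreal (norm (VU z f w) powr p) * indicator U w \<partial>lborel) \<le> ennreal (\<eta> powr p) \<longrightarrow>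
      (\<integral>\<^sup>+w. ennreal (X z * norm (f w) * h w) * indicator U w \<partial>lborel) \<le> ennreal (C * \<eta> * h z)"
    using weighted_estimate_kernel[OF p_gt_4] by blast
  obtain \<eta> where \<eta>: "\<eta> > 0" "\<forall>z\<in>U. (\<integral>\<^sup>+w. ennreal (norm (VU z (T (kk z)) w) powr p) * indicator U w \<partial>lborel) \<le> ennreal (\<eta> powr p)"
    using Lp_bound[OF T_bd] p_gt_4 by auto
  show ?thesis
    using schur_column_of_bound[OF C(2) _ \<eta>(1)] \<eta> C by (intro exI[of _ "C * \<eta>"]) auto
qed

text \<open>Interpolating between the uniform \<open>L\<^sup>p\<close> bound and the small \<open>L\<^sup>2\<close> norm of \<open>T k\<^sub>w\<close> makes the column
  bound small wherever \<open>T k\<^sub>w\<close> is small.\<close>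

lemma schur_column_small:
  assumes \<epsilon>: "\<epsilon> > 0"
  shows "\<exists>\<delta>>0. \<forall>w\<in>U. nm (T (kk w)) < \<delta> \<longrightarrow> (\<integral>\<^sup>+z. ennreal (r z w * h z) * indicator U z \<partial>lborel) \<le> ennreal (\<epsilon> * h w)"
proof -
  \<comment> \<open>The midpoint is still above 4, so the weighted estimate holds with it, and it is
    below p, so there is room for interpolation.\<close>
  define s where "s = (4 + p) / 2"
  have s: "4 < s" "2 < s" "s < p" using p_gt_4 by (auto simp: s_def)
  obtain C where C: "C > 0" "\<forall>z\<in>U. \<forall>f\<in>A2. \<forall>\<eta>>0. (\<integral>\<^sup>+w. ennreal (norm (VU z f w) powr s) * indicator U w \<partial>lborel) \<le> ennreal (\<eta> powr s) \<longrightarrow>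
      (\<integral>\<^sup>+w. ennreal (X z * norm (f w) * h w) * indicator U w \<partial>lborel) \<le> ennreal (C * \<eta> * h z)"
    using weighted_estimate_kernel[OF s(1)] by blast
  obtain B where B: "B > 0" "\<forall>z\<in>U. (\<integral>\<^sup>+w. ennreal (norm (VU z (T (kk z)) w) powr p) * indicator U w \<partial>lborel) \<le> ennreal (B powr p)"
    using Lp_bound[OF T_bd] p_gt_4 by auto
  define \<eta> where "\<eta> = \<epsilon> / C"
  have \<eta>: "\<eta> > 0" using \<epsilon> C by (simp add: \<eta>_def)
  \<comment> \<open>\<open>a\<close> and, further down, \<delta> are chosen so that the term with
    the power p and the L2 term contribute at most half of \<eta>^s each.\<close>
  define a where "a = \<eta> powr s / (2 * B powr p)"
  have a: "a > 0" using \<eta> B by (simp add: a_def)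
  define c where "c = (a powr (-1 / (p - s))) powr (s - 2)"
  have c: "c > 0" using a by (simp add: c_def)
  define \<delta> where "\<delta> = sqrt (\<eta> powr s / (2 * c))"
  have \<delta>: "\<delta> > 0" using c \<eta> by (simp add: \<delta>_def)
  show ?thesis
  proof (intro exI[of _ \<delta>] conjI ballI impI)
    show "\<delta> > 0" by (rule \<delta>)
    fix w assume w: "w \<in> U" and small: "nm (T (kk w)) < \<delta>"
    let ?G = "VU w (T (kk w))"
    \<comment> \<open>Measurability is read off from \<open>norm_VU\<close>, which replaces the
      Jacobians defined by derivatives with explicit Borel functions on \<open>U\<close>.\<close>
    have mG: "(\<lambda>v. ennreal (norm (?G v) powr q) * indicator U v) \<in> borel_measurable lborel" for q
    proof -
      note [measurable] = A2_borel[OF T_kk_A2[OF w]]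
      have "(\<lambda>v. ennreal ((norm (T (kk w) (phi_b \<alpha> (snd w) (phi_a \<alpha> (f_alpha \<alpha> w) v))) * jb (snd w) (phi_a \<alpha> (f_alpha \<alpha> w) v) * ja (f_alpha \<alpha> w) v) powr q) * indicator U v) \<in> borel_measurable borel"
        by measurable
      moreover have "(\<lambda>v. ennreal (norm (?G v) powr q) * indicator U v) = (\<lambda>v. ennreal ((norm (T (kk w) (phi_b \<alpha> (snd w) (phi_a \<alpha> (f_alpha \<alpha> w) v))) * jb (snd w) (phi_a \<alpha> (f_alpha \<alpha> w) v) * ja (f_alpha \<alpha> w) v) powr q) * indicator U v)"
        using norm_VU[OF w] by (auto simp: indicator_def)
      ultimately show ?thesis by simp
    qed
    have "(\<integral>\<^sup>+v. ennreal (norm (?G v) powr s) * indicator U v \<partial>lborel)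
      \<le> (\<integral>\<^sup>+v. ennreal a * (ennreal (norm (?G v) powr p) * indicator U v) + ennreal c * (ennreal (norm (?G v) powr 2) * indicator U v) \<partial>lborel)"
    proof (rule nn_integral_mono)
      fix v
      have "ennreal (norm (?G v) powr s) \<le> ennreal (a * norm (?G v) powr p + c * norm (?G v) powr 2)"
        using powr_interpolation[of "norm (?G v)" s p a] s a by (intro ennreal_leI) (auto simp: c_def)
      also have "\<dots> = ennreal a * ennreal (norm (?G v) powr p) + ennreal c * ennreal (norm (?G v) powr 2)"
        using a c by (simp add: ennreal_mult ennreal_plus)
      finally show "ennreal (norm (?G v) powr s) * indicator U v \<le> ennreal a * (ennreal (norm (?G v) powr p) * indicator U v) + ennreal c * (ennreal (norm (?G v) powr 2) * indicator U v)"
        by (cases "v \<in> U") auto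
    qed
    also have "\<dots> = ennreal a * (\<integral>\<^sup>+v. ennreal (norm (?G v) powr p) * indicator U v \<partial>lborel) + ennreal c * (\<integral>\<^sup>+v. ennreal (norm (?G v) powr 2) * indicator U v \<partial>lborel)"
      by (subst nn_integral_add) (intro borel_measurable_times_ennreal borel_measurable_const mG, intro borel_measurable_times_ennreal borel_measurable_const mG,
        simp only: nn_integral_cmult[OF mG])
    also have "(\<integral>\<^sup>+v. ennreal (norm (?G v) powr 2) * indicator U v \<partial>lborel) = ennreal ((nm (T (kk w)))\<^sup>2)"
      unfolding nn_integral_VU_square[OF w A2_borel[OF T_kk_A2[OF w]]] by (rule A2_nn_integral[OF T_kk_A2[OF w]])
    also have "ennreal a * (\<integral>\<^sup>+v. ennreal (norm (?G v) powr p) * indicator U v \<partial>lborel) + ennreal c * ennreal ((nm (T (kk w)))\<^sup>2)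
        \<le> ennreal a * ennreal (B powr p) + ennreal c * ennreal (\<delta>\<^sup>2)"
      using B w small nm_nonneg by (intro add_mono mult_left_mono ennreal_leI power_mono) auto
    also have "\<dots> = ennreal (a * B powr p + c * \<delta>\<^sup>2)"
      using a c by (simp add: ennreal_mult[symmetric] ennreal_plus[symmetric] del: ennreal_plus)
    also have "a * B powr p + c * \<delta>\<^sup>2 = \<eta> powr s"
      using a c B \<eta> by (simp add: a_def \<delta>_def)
    finally have "(\<integral>\<^sup>+v. ennreal (norm (?G v) powr s) * indicator U v \<partial>lborel) \<le> ennreal (\<eta> powr s)" .
    from schur_column_of_bound[OF C(2) w \<eta> this]
    show "(\<integral>\<^sup>+z. ennreal (r z w * h z) * indicator U z \<partial>lborel) \<le> ennreal (\<epsilon> * h w)"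
      using C by (simp add: \<eta>_def)
  qed
qed

text \<open>The formula that duality forces on a bounded extension of \<open>T\<close>. Unlike
  \<open>T\<close>, it makes sense on the whole Bergman space.\<close>

definition Bop :: "(complex \<times> complex \<Rightarrow> complex) \<Rightarrow> (complex \<times> complex \<Rightarrow> complex)" where
  "Bop f z = (if z \<in> U then ip f (cscale (of_real (X z)) (Tstar (kk z))) else 0)"

text \<open>By linearity it suffices to look at kernels, where it is the adjoint relation read
  through the reproducing property. Off \<open>U\<close> both sides vanish by normalisation.\<close>

lemma T_eq_Bop:
  assumes f: "f \<in> kernel_span \<alpha>"
  shows "T f = Bop f"
proof -
  have "f \<in> kernel_span \<alpha> \<and> T f z = Bop f z" if z: "z \<in> U" for z
    using f[unfolded kernel_span_def]
  proof (induction rule: cfun.span_induct_alt)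
    case base
    have 0: "0 \<in> kernel_span \<alpha>" unfolding kernel_span_def by (rule cfun.span_zero)
    have "T (cscale 0 0) = cscale 0 (T 0)"
      using T_lin 0 unfolding clinear_on_def by blast
    moreover have "cscale 0 g = 0" for g :: "complex \<times> complex \<Rightarrow> complex" by (auto simp: cscale_def)
    ultimately have T0: "T 0 z = 0" by simp
    have "Bop 0 z = 0" by (simp add: Bop_def inner_L2_def)
    from conjI[OF 0 trans[OF T0 this[symmetric]]] show ?case .
  next
    case (step c x y)
    then obtain w where w: "w \<in> U" "x = kk w" by blast
    have sx: "x \<in> kernel_span \<alpha>" unfolding w(2) by (rule kk_span[OF w(1)])
    have scx: "cscale c x \<in> kernel_span \<alpha>" using sx unfolding kernel_span_def by (rule cfun.span_scale)
    have sy: "y \<in> kernel_span \<alpha>" using step by blast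
    have sum: "cscale c x + y \<in> kernel_span \<alpha>" using scx sy unfolding kernel_span_def by (rule cfun.span_add)
    have "T (cscale c x + y) = T (cscale c x) + T y"
      using T_lin scx sy unfolding clinear_on_def by blast
    also have "T (cscale c x) = cscale c (T x)"
      using T_lin sx unfolding clinear_on_def by blast
    finally have e: "T (cscale c x + y) = cscale c (T x) + T y" .
    have "T (cscale c x + y) z = c * T x z + T y z" unfolding e by (simp add: cscale_def)
    also have "T x z = Bop x z"
    proof -
      have "Bop x z = of_real (X z) * ip (kk w) (Tstar (kk z))"
        using z by (simp add: Bop_def ip_cscale_right w)
      also have "ip (kk w) (Tstar (kk z)) = ip (T (kk w)) (kk z)" by (rule adj[OF w(1) z, symmetric])
      also have "\<dots> = T (kk w) z / of_real (X z)" by (rule ip_kk[OF z T_kk_A2[OF w(1)]])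
      finally show ?thesis using X_pos[OF z] w by simp
    qed
    also have "T y z = Bop y z" using step by blast
    also have "c * Bop x z + Bop y z = Bop (cscale c x + y) z"
    proof -
      have "cscale c x \<in> L2" "y \<in> L2" "cscale (of_real (X z)) (Tstar (kk z)) \<in> L2"
        using scx sy kernel_span_A2 A2_L2 L2_cscale Tstar_kk_A2[OF z] by blast+
      from ip_add_left[OF this] show ?thesis using z by (simp only: Bop_def ip_cscale_left if_True)
    qed
    finally show ?case using sum by blast
  qed
  moreover have "T f z = Bop f z" if "z \<notin> U" for z
    using that T_im f A2_zero_outside[of "T f" z] by (auto simp: Bop_def)
  ultimately show ?thesis by blast
qed

lemma norm_Bop_le:
  assumes z: "z \<in> U" and f: "f \<in> A2"
  shows "ennreal (norm (Bop f z)) \<le> (\<integral>\<^sup>+w. ennreal (r z w * norm (f w)) * indicator U w \<partial>lborel)"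
proof -
  let ?k = "cscale (of_real (X z)) (Tstar (kk z))"
  have k: "?k \<in> A2" by (rule A2_cscale[OF Tstar_kk_A2[OF z]])
  have "ennreal (norm (Bop f z)) = ennreal (norm (LINT w|M. f w * cnj (?k w)))"
    using z by (simp add: Bop_def inner_L2_def)
  also have "\<dots> \<le> (\<integral>\<^sup>+w. ennreal (norm (f w * cnj (?k w))) \<partial>M)"
    by (rule integral_norm_bound_ennreal[OF L2_integrable_mult[OF A2_L2[OF f] A2_L2[OF k]]])
  also have "\<dots> = (\<integral>\<^sup>+w. ennreal (r z w * norm (f w)) * indicator U w \<partial>lborel)"
    unfolding nn_integral_M
    using X_pos[OF z] by (intro nn_integral_cong) (auto simp: indicator_def r_eq[OF z] tk_adj[OF z] norm_mult cscale_def mult_ac)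
  finally show ?thesis .
qed

lemma measurable_r_integral:
  assumes [measurable]: "g \<in> borel_measurable borel" "E \<in> sets borel"
  shows "(\<lambda>z. \<integral>\<^sup>+w. ennreal (r z w * g w) * indicator E w \<partial>lborel) \<in> borel_measurable borel"
proof -
  have "(\<lambda>x. ennreal (r (fst x) (snd x) * g (snd x)) * indicator E (snd x)) \<in> borel_measurable (borel \<Otimes>\<^sub>M borel)"
    using measurable_r by measurable
  hence "case_prod (\<lambda>z w. ennreal (r z w * g w) * indicator E w) \<in> borel_measurable (lborel \<Otimes>\<^sub>M lborel)"
    by (simp add: case_prod_beta' borel_prod lborel_prod)
  from lborel.borel_measurable_nn_integral_fst[OF this] show ?thesis by simp
qed

text \<open>(a + b)^2 <= 2 a^2 + 2 b^2 separates \<open>E\<close> from its complement, and Schur's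
  test is applied to each part. That \<open>Bop f\<close> lies in the Bergman space is a premise
  because the bound is first used on the kernel span, where this is known from
  \<open>T\<close>.\<close>

lemma nm_Bop_split:
  assumes f: "f \<in> A2" and Bf: "Bop f \<in> A2" and E[measurable]: "E \<in> sets borel" "E \<subseteq> U" and C: "C1 \<ge> 0" "C2 \<ge> 0" "C3 \<ge> 0"
    and 1: "\<And>z. z \<in> U \<Longrightarrow> (\<integral>\<^sup>+w. ennreal (r z w * h w) * indicator U w \<partial>lborel) \<le> ennreal (C1 * h z)"
    and 2: "\<And>w. w \<in> E \<Longrightarrow> (\<integral>\<^sup>+z. ennreal (r z w * h z) * indicator U z \<partial>lborel) \<le> ennreal (C2 * h w)"
    and 3: "\<And>w. w \<in> U - E \<Longrightarrow> (\<integral>\<^sup>+z. ennreal (r z w * h z) * indicator U z \<partial>lborel) \<le> ennreal (C3 * h w)"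
  shows "ennreal ((nm (Bop f))\<^sup>2) \<le> ennreal (2 * (C1 * C2)) * (\<integral>\<^sup>+w. ennreal ((norm (f w))\<^sup>2) * indicator E w \<partial>lborel)
      + ennreal (2 * (C1 * C3) * (nm f)\<^sup>2)"
proof -
  note [measurable] = A2_borel[OF f] A2_borel[OF Bf]
  have fm: "(\<lambda>w. norm (f w)) \<in> borel_measurable borel" by measurable
  define a where "a z = (\<integral>\<^sup>+w. ennreal (r z w * norm (f w)) * indicator E w \<partial>lborel)" for z
  define b where "b z = (\<integral>\<^sup>+w. ennreal (r z w * norm (f w)) * indicator (U - E) w \<partial>lborel)" for z
  have [measurable]: "a \<in> borel_measurable borel" "b \<in> borel_measurable borel"
    unfolding a_def[abs_def] b_def[abs_def] by (intro measurable_r_integral; measurable)+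
  have [measurable]: "r z \<in> borel_measurable borel" for z
    using measurable_compose[OF measurable_Pair1'[of z borel borel] measurable_r] by simp
  have le: "ennreal (norm (Bop f z)) \<le> a z + b z" if z: "z \<in> U" for z
  proof -
    have "ennreal (norm (Bop f z)) \<le> (\<integral>\<^sup>+w. ennreal (r z w * norm (f w)) * indicator U w \<partial>lborel)"
      by (rule norm_Bop_le[OF z f])
    also have "\<dots> = (\<integral>\<^sup>+w. ennreal (r z w * norm (f w)) * indicator E w + ennreal (r z w * norm (f w)) * indicator (U - E) w \<partial>lborel)"
      using E by (intro nn_integral_cong) (auto simp: indicator_def)
    also have "\<dots> = a z + b z"
      unfolding a_def b_def by (intro nn_integral_add) measurable
    finally show ?thesis .
  qed
  \<comment> \<open>Either part may be infinite, so the inequality is needed in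
    \<open>ennreal\<close>.\<close>
  have sq: "ennreal (x\<^sup>2) \<le> 2 * u\<^sup>2 + 2 * v\<^sup>2" if "ennreal x \<le> u + v" "x \<ge> 0" for x u v
  proof (cases u rule: ennreal_cases)
    case u: (real u')
    show ?thesis
    proof (cases v rule: ennreal_cases)
      case v: (real v')
      have "x \<le> u' + v'" using that u v by (simp add: ennreal_plus[symmetric] ennreal_le_iff del: ennreal_plus)
      hence "x\<^sup>2 \<le> (u' + v')\<^sup>2" using that by (intro power_mono) auto
      also have "\<dots> \<le> 2 * u'\<^sup>2 + 2 * v'\<^sup>2"
        using sum_squares_bound[of u' v'] by (simp add: power2_sum)
      finally have "ennreal (x\<^sup>2) \<le> ennreal (2 * u'\<^sup>2 + 2 * v'\<^sup>2)" by (rule ennreal_leI)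
      also have "\<dots> = 2 * u\<^sup>2 + 2 * v\<^sup>2" using u v by (simp add: ennreal_power ennreal_mult)
      finally show ?thesis .
    qed (simp add: top_power_ennreal ennreal_mult_eq_top_iff)
  qed (simp add: top_power_ennreal ennreal_mult_eq_top_iff)
  have "ennreal ((nm (Bop f))\<^sup>2) = (\<integral>\<^sup>+z. ennreal ((norm (Bop f z))\<^sup>2) * indicator U z \<partial>lborel)"
    by (rule A2_nn_integral[OF Bf, symmetric])
  also have "\<dots> \<le> (\<integral>\<^sup>+z. 2 * ((a z)\<^sup>2 * indicator U z) + 2 * ((b z)\<^sup>2 * indicator U z) \<partial>lborel)"
    using sq[OF le] by (intro nn_integral_mono) (auto simp: indicator_def)
  also have "\<dots> = 2 * (\<integral>\<^sup>+z. (a z)\<^sup>2 * indicator U z \<partial>lborel) + 2 * (\<integral>\<^sup>+z. (b z)\<^sup>2 * indicator U z \<partial>lborel)"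
    by (subst nn_integral_add, measurable) (simp add: nn_integral_cmult)
  also have "\<dots> \<le> 2 * (ennreal (C1 * C2) * (\<integral>\<^sup>+w. ennreal ((norm (f w))\<^sup>2) * indicator E w \<partial>lborel))
      + 2 * (ennreal (C1 * C3) * (\<integral>\<^sup>+w. ennreal ((norm (f w))\<^sup>2) * indicator (U - E) w \<partial>lborel))"
    unfolding a_def b_def
    by (intro add_mono mult_left_mono schur_test[OF measurable_r r_nonneg _ _ fm] C 1 2 3) (use E in auto)
  also have "\<dots> \<le> 2 * (ennreal (C1 * C2) * (\<integral>\<^sup>+w. ennreal ((norm (f w))\<^sup>2) * indicator E w \<partial>lborel))
      + 2 * (ennreal (C1 * C3) * ennreal ((nm f)\<^sup>2))"
    unfolding A2_nn_integral[OF f, symmetric]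
    by (intro add_mono mult_left_mono nn_integral_mono order_refl) (auto simp: indicator_def)
  also have "\<dots> = ennreal (2 * (C1 * C2)) * (\<integral>\<^sup>+w. ennreal ((norm (f w))\<^sup>2) * indicator E w \<partial>lborel)
      + ennreal (2 * (C1 * C3) * (nm f)\<^sup>2)"
    using C by (simp add: ennreal_mult mult.assoc)
  finally show ?thesis .
qed

text \<open>The splitting with \<open>E\<close> empty, where the uniform column bound serves for all
  of \<open>U\<close>.\<close>

lemma nm_Bop_bound:
  "\<exists>C>0. \<forall>f\<in>A2. Bop f \<in> A2 \<longrightarrow> nm (Bop f) \<le> C * nm f"
proof -
  obtain C1 where C1: "C1 > 0" "\<forall>z\<in>U. (\<integral>\<^sup>+w. ennreal (r z w * h w) * indicator U w \<partial>lborel) \<le> ennreal (C1 * h z)"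
    using schur_row by blast
  obtain C2 where C2: "C2 > 0" "\<forall>w\<in>U. (\<integral>\<^sup>+z. ennreal (r z w * h z) * indicator U z \<partial>lborel) \<le> ennreal (C2 * h w)"
    using schur_column by blast
  have "nm (Bop f) \<le> sqrt (2 * (C1 * C2)) * nm f" if f: "f \<in> A2" "Bop f \<in> A2" for f
  proof -
    have "ennreal ((nm (Bop f))\<^sup>2) \<le> ennreal (2 * (C1 * C2)) * (\<integral>\<^sup>+w. ennreal ((norm (f w))\<^sup>2) * indicator {} w \<partial>lborel)
      + ennreal (2 * (C1 * C2) * (nm f)\<^sup>2)"
      using C1 C2 by (intro nm_Bop_split[OF f]) auto
    hence "(nm (Bop f))\<^sup>2 \<le> 2 * (C1 * C2) * (nm f)\<^sup>2" using C1 C2 by (simp add: ennreal_le_iff)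
    also have "\<dots> = (sqrt (2 * (C1 * C2)) * nm f)\<^sup>2" using C1 C2 by (simp add: power_mult_distrib)
    finally show ?thesis by (rule power2_le_imp_le) (use C1 C2 nm_nonneg in auto)
  qed
  thus ?thesis using C1 C2 by (intro exI[of _ "sqrt (2 * (C1 * C2))"]) auto
qed

section \<open>Extension of the operator to the whole Bergman space\<close>

lemma kernel_span_diff: "f \<in> kernel_span \<alpha> \<Longrightarrow> g \<in> kernel_span \<alpha> \<Longrightarrow> f - g \<in> kernel_span \<alpha>"
  unfolding kernel_span_def by (rule cfun.span_diff)

lemma Bop_add: "f \<in> A2 \<Longrightarrow> g \<in> A2 \<Longrightarrow> Bop (f + g) = Bop f + Bop g"
  using Tstar_kk_A2 A2_L2 L2_cscale by (auto simp: Bop_def fun_eq_iff ip_add_left)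

lemma Bop_diff: "f \<in> A2 \<Longrightarrow> g \<in> A2 \<Longrightarrow> Bop (f - g) = Bop f - Bop g"
  using Tstar_kk_A2 A2_L2 L2_cscale by (auto simp: Bop_def fun_eq_iff ip_diff_left)

lemma Bop_cscale: "Bop (cscale c f) = cscale c (Bop f)"
proof
  fix z
  have "cscale c (Bop f) z = c * Bop f z" by (simp add: cscale_def)
  thus "Bop (cscale c f) z = cscale c (Bop f) z" by (simp add: Bop_def ip_cscale_left)
qed

lemma Bop_pointwise_limit:
  assumes "\<And>n. s n \<in> A2" "f \<in> A2" "(\<lambda>n. nm (s n - f)) \<longlonglongrightarrow> 0" "z \<in> U"
  shows "(\<lambda>n. Bop (s n) z) \<longlonglongrightarrow> Bop f z"
  using Cauchy_Schwarz_limit[of s f "cscale (of_real (X z)) (Tstar (kk z))"] assms A2_L2 L2_cscale Tstar_kk_A2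
  by (simp add: Bop_def)

text \<open>For kernel combinations converging to f, the conditional bound makes their images
  Cauchy. The limit has the values of \<open>Bop f\<close>, since each value is an inner product and
  so continuous in f.\<close>

lemma Bop_A2:
  assumes f: "f \<in> A2"
  shows "Bop f \<in> A2"
proof -
  obtain s where s: "\<And>n::nat. s n \<in> kernel_span \<alpha>" "(\<lambda>n. nm (s n - f)) \<longlonglongrightarrow> 0"
    using kernel_span_dense[OF f] by blast
  have sA: "s n \<in> A2" for n using s kernel_span_A2 by blast
  have TsA: "T (s n) \<in> A2" for n using s T_im by blast
  obtain C where C: "C > 0" "\<forall>f\<in>A2. Bop f \<in> A2 \<longrightarrow> nm (Bop f) \<le> C * nm f" using nm_Bop_bound by blast
  have "\<exists>g\<in>A2. (\<lambda>n. nm (T (s n) - g)) \<longlonglongrightarrow> 0 \<and> (\<forall>z\<in>U. (\<lambda>n. T (s n) z) \<longlonglongrightarrow> g z)"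
  proof (rule A2_complete[OF TsA])
    fix e :: real assume e: "e > 0"
    have "e / (2 * C) > 0" using e C by simp
    from order_tendstoD(2)[OF s(2) this] obtain N where N: "\<And>n. n \<ge> N \<Longrightarrow> nm (s n - f) < e / (2 * C)"
      by (auto simp: eventually_sequentially)
    have "nm (T (s m) - T (s n)) < e" if "m \<ge> N" "n \<ge> N" for m n
    proof -
      have "T (s m) - T (s n) = Bop (s m - s n)"
        using s(1) by (simp add: T_eq_Bop Bop_diff[OF sA sA])
      moreover have "Bop (s m - s n) \<in> A2"
        using T_eq_Bop[OF kernel_span_diff[OF s(1) s(1)]] T_im kernel_span_diff[OF s(1) s(1)] by (metis image_subset_iff)
      ultimately have "nm (T (s m) - T (s n)) \<le> C * nm (s m - s n)"
        using C(2) A2_diff[OF sA sA] by simp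
      also have "\<dots> \<le> C * (nm (s m - f) + nm (f - s n))"
        using C nm_triangle_diff[OF A2_L2[OF sA] A2_L2[OF f] A2_L2[OF sA]] by (intro mult_left_mono) auto
      also have "\<dots> < C * (e / (2 * C) + e / (2 * C))"
        using N[OF that(1)] N[OF that(2)] C by (intro mult_strict_left_mono add_strict_mono) (auto simp: nm_minus_commute[of f])
      also have "\<dots> = e" using C by (simp add: field_simps)
      finally show ?thesis .
    qed
    thus "\<exists>N. \<forall>m\<ge>N. \<forall>n\<ge>N. nm (T (s m) - T (s n)) < e" by blast
  qed
  then obtain g where g: "g \<in> A2" "\<And>z. z \<in> U \<Longrightarrow> (\<lambda>n. T (s n) z) \<longlonglongrightarrow> g z" by blast
  have "g = Bop f"
  proof
    fix z
    show "g z = Bop f z"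
    proof (cases "z \<in> U")
      case True
      have "(\<lambda>n. T (s n) z) \<longlonglongrightarrow> Bop f z"
        using Bop_pointwise_limit[OF sA f s(2) True] by (simp add: T_eq_Bop[OF s(1)])
      thus ?thesis using g(2)[OF True] LIMSEQ_unique by blast
    qed (simp add: Bop_def A2_zero_outside[OF g(1)])
  qed
  thus ?thesis using g by simp
qed

lemma bounded_operator_Bop: "bounded_operator \<alpha> Bop"
  unfolding bounded_operator_def clinear_on_def
  using Bop_A2 nm_Bop_bound Bop_add Bop_cscale by blast

text \<open>Bounded point evaluations carry agreement on the dense span over to \<open>A2\<close>.
  Off \<open>A2\<close> the function \<open>B\<close> is arbitrary, so nothing more can be
  claimed.\<close>

lemma bounded_extension_unique:
  assumes B: "bounded_operator \<alpha> B" "\<forall>f\<in>kernel_span \<alpha>. B f = T f" and f: "f \<in> A2"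
  shows "B f = Bop f"
proof -
  obtain C where C: "\<forall>f\<in>A2. nm (B f) \<le> C * nm f" using B by (auto simp: bounded_operator_def)
  have BA: "B g \<in> A2" if "g \<in> A2" for g using B that by (auto simp: bounded_operator_def)
  obtain s where s: "\<And>n::nat. s n \<in> kernel_span \<alpha>" "(\<lambda>n. nm (s n - f)) \<longlonglongrightarrow> 0"
    using kernel_span_dense[OF f] by blast
  have sA: "s n \<in> A2" for n using s kernel_span_A2 by blast
  have Bd: "B (s n) - B f = B (s n - f)" for n
  proof -
    have "B (f + (s n - f)) = B f + B (s n - f)"
      using B(1) f A2_diff[OF sA f] unfolding bounded_operator_def clinear_on_def by blast
    thus ?thesis by simp
  qed
  show ?thesis
  proof (rule A2_eqI[OF BA[OF f] Bop_A2[OF f]])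
    fix z assume z: "z \<in> U"
    have "(\<lambda>n. X z * (C * nm (s n - f))) \<longlonglongrightarrow> X z * (C * 0)" by (intro tendsto_intros s)
    hence "(\<lambda>n. X z * (C * nm (s n - f))) \<longlonglongrightarrow> 0" by simp
    hence "(\<lambda>n. B (s n) z - B f z) \<longlonglongrightarrow> 0"
    proof (rule Lim_null_comparison[rotated], intro always_eventually allI)
      fix n
      have "norm (B (s n) z - B f z) = norm (B (s n - f) z)" using Bd[of n] by (metis fun_diff_def)
      also have "\<dots> \<le> X z * nm (B (s n - f))" by (rule norm_le_X[OF z BA[OF A2_diff[OF sA f]]])
      also have "\<dots> \<le> X z * (C * nm (s n - f))"
        using C A2_diff[OF sA f] X_pos[OF z] by (intro mult_left_mono) auto
      finally show "norm (B (s n) z - B f z) \<le> X z * (C * nm (s n - f))" .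
    qed
    hence "(\<lambda>n. B (s n) z) \<longlonglongrightarrow> B f z" by (simp add: LIM_zero_iff)
    moreover have "(\<lambda>n. B (s n) z) \<longlonglongrightarrow> Bop f z"
      using Bop_pointwise_limit[OF sA f s(2) z] B(2) s(1) by (simp add: T_eq_Bop)
    ultimately show "B f z = Bop f z" using LIMSEQ_unique by blast
  qed
qed

end

context thullen
begin

section \<open>Weak convergence to zero at the boundary\<close>

lemma zero_in_U: "(0, 0) \<in> U"
  by (simp add: mem_U_iff rho_def)

lemma measure_U_pos: "measure lborel U > 0"
proof -
  obtain r where r: "r > 0" "ball (0, 0) r \<subseteq> U"
    using open_U zero_in_U open_contains_ball by blast
  have "0 < measure lborel (ball (0 :: complex \<times> complex) r)" by (rule ball_content_pos[OF r(1)])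
  hence "0 < emeasure lborel (ball (0 :: complex \<times> complex) r)"
    by (simp add: measure_def enn2real_positive_iff)
  also have "\<dots> \<le> emeasure lborel U"
    using r(2) by (intro emeasure_mono) (auto simp: zero_prod_def)
  finally show ?thesis
    using emeasure_U_finite by (simp add: measure_def enn2real_positive_iff)
qed

text \<open>\<open>U\<close> is balanced, so the mean of a Bergman function over it is the value at
  the origin; hence a constant reproduces there.\<close>

lemma K_zero: "K (0, 0) = cscale (1 / of_real (measure lborel U)) one_U"
proof (rule kernel_unique[OF zero_in_U])
  show "K (0, 0) \<in> A2" by (rule K_A2[OF zero_in_U])
  show "f (0, 0) = ip f (K (0, 0))" if "f \<in> A2" for f by (rule K_reproducing[OF zero_in_U that])
  show "cscale (1 / of_real (measure lborel U)) one_U \<in> A2" by (rule A2_cscale[OF one_U_A2])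
  fix f assume f: "f \<in> A2"
  have "integrable M (\<lambda>w. f w * cnj (one_U w))"
    by (rule L2_integrable_mult[OF A2_L2[OF f] A2_L2[OF one_U_A2]])
  hence "integrable lebesgue (\<lambda>w. indicator U w *\<^sub>R (f w * cnj (one_U w)))"
    using open_U by (simp add: integrable_restrict_space)
  also have "(\<lambda>w. indicator U w *\<^sub>R (f w * cnj (one_U w))) = (\<lambda>w. indicator U w *\<^sub>R f w)"
    by (auto simp: fun_eq_iff one_U_def indicator_def)
  finally have int: "integrable lborel (\<lambda>w. indicator U w *\<^sub>R f w)"
    using A2_borel[OF f] by (subst (asm) integrable_completion) auto
  have "ip f one_U = (LINT w|lebesgue. indicator U w *\<^sub>R (f w * cnj (one_U w)))"
    unfolding inner_L2_def using open_U by (subst integral_restrict_space) auto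
  also have "(\<lambda>w. indicator U w *\<^sub>R (f w * cnj (one_U w))) = (\<lambda>w. indicator U w *\<^sub>R f w)"
    by (auto simp: fun_eq_iff one_U_def indicator_def)
  also have "(LINT w|lebesgue. indicator U w *\<^sub>R f w) = (LINT w|lborel. indicator U w *\<^sub>R f w)"
    using A2_borel[OF f] by (intro integral_completion) auto
  also have "\<dots> = measure lborel U *\<^sub>R f (0, 0)"
  proof (rule mean_value_balanced[OF U_in_borel emeasure_U_finite _ A2_borel[OF f] int])
    show "(t * fst w, t * snd w) \<in> U" if "w \<in> U" "norm t = 1" for w t
      using that by (simp add: mem_U_iff rho_def norm_mult)
    show "\<exists>S. open S \<and> cball 0 1 \<subseteq> S \<and> (\<lambda>t. f (t * fst w, t * snd w)) holomorphic_on S" if w: "w \<in> U" for w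
    proof (intro exI conjI)
      let ?S = "{t. rho (t * fst w, t * snd w) > 0}"
      show S: "open ?S"
        by (intro open_Collect_less continuous_intros continuous_on_compose2[OF continuous_on_rho[of UNIV]]) auto
      show "cball 0 1 \<subseteq> ?S"
      proof
        fix t :: complex assume "t \<in> cball 0 1"
        hence "norm t * norm (fst w) \<le> 1 * norm (fst w)" "norm t * norm (snd w) \<le> 1 * norm (snd w)"
          by (intro mult_right_mono; simp)+
        hence "norm (t * fst w) powr (2 / \<alpha>) \<le> norm (fst w) powr (2 / \<alpha>)" "(norm (t * snd w))\<^sup>2 \<le> (norm (snd w))\<^sup>2"
          using alpha_pos by (auto simp: norm_mult intro!: powr_mono2 power_mono)
        hence "rho w \<le> rho (t * fst w, t * snd w)" unfolding rho_def fst_conv snd_conv by linarith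
        thus "t \<in> ?S" using w by (simp add: mem_U_iff)
      qed
      show "(\<lambda>t. f (t * fst w, t * snd w)) holomorphic_on ?S"
        by (rule holomorphic2_on_compose_curve[OF A2_holomorphic[OF f] S])
           (auto intro!: holomorphic_intros simp: mem_U_iff)
    qed
  qed
  finally show "f (0, 0) = ip f (cscale (1 / of_real (measure lborel U)) one_U)"
    using measure_U_pos by (simp add: ip_cscale_right scaleR_conv_of_real)
qed

text \<open>\<open>K z (0, 0)\<close> is the conjugate of the value at z of \<open>K (0, 0)\<close>,
  which is constant on \<open>U\<close>. So in the pairing with the kernel at 0 only the
  normalisation by \<open>X z\<close> depends on z.\<close>

lemma skwarczynski_dist_zero:
  "\<exists>c>0. \<forall>z\<in>U. skwarczynski_dist \<alpha> z (0, 0) = sqrt (1 - c / X z)"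
proof (intro exI[of _ "1 / (measure lborel U * X (0, 0))"] conjI ballI)
  show "0 < 1 / (measure lborel U * X (0, 0))" using measure_U_pos X_pos[OF zero_in_U] by simp
  fix z assume z: "z \<in> U"
  have "K z (0, 0) = cnj (K (0, 0) z)"
    using K_reproducing[OF zero_in_U K_A2[OF z]] K_reproducing[OF z K_A2[OF zero_in_U]] ip_cnj[of "K z" "K (0, 0)"] by simp
  also have "\<dots> = 1 / of_real (measure lborel U)" unfolding K_zero using z by (simp add: cscale_def one_U_def)
  finally have K0: "K z (0, 0) = 1 / of_real (measure lborel U)" .
  have "ip (kk z) (kk (0, 0)) = K z (0, 0) / of_real (X z) / of_real (X (0, 0))"
    unfolding ip_kk[OF zero_in_U kk_A2[OF z]] by (simp add: normalized_kernel_def X_def)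
  hence "norm (ip (kk z) (kk (0, 0))) = 1 / (measure lborel U * X (0, 0)) / X z"
    unfolding K0 using measure_U_pos X_pos[OF z] X_pos[OF zero_in_U] by (simp add: norm_divide norm_mult mult_ac)
  thus "skwarczynski_dist \<alpha> z (0, 0) = sqrt (1 - 1 / (measure lborel U * X (0, 0)) / X z)"
    by (simp add: skwarczynski_dist_def)
qed

text \<open>Since the normalized kernel at 0 is constant, the Skwarczynski distance to 0 is a function of
  the norm of the kernel, and the limit at distance 1 is the limit of infinite kernel norm.\<close>

lemma tendsto_boundary_iff:
  fixes g :: "complex \<times> complex \<Rightarrow> real"
  shows "(g \<longlongrightarrow> 0) ((\<lambda>z. skwarczynski_dist \<alpha> z (0, 0)) going_to at 1 within U)
     \<longleftrightarrow> (\<forall>\<epsilon>>0. \<exists>R. \<forall>z\<in>U. X z > R \<longrightarrow> \<bar>g z\<bar> < \<epsilon>)"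
proof -
  let ?d = "\<lambda>z. skwarczynski_dist \<alpha> z (0, 0)"
  obtain c where c: "c > 0" "\<And>z. z \<in> U \<Longrightarrow> ?d z = sqrt (1 - c / X z)" using skwarczynski_dist_zero by blast
  have ev: "eventually Q (?d going_to at 1 within U) \<longleftrightarrow> (\<exists>R. \<forall>z\<in>U. X z > R \<longrightarrow> Q z)" for Q
  proof
    assume "eventually Q (?d going_to at 1 within U)"
    then obtain Q' where Q': "eventually Q' (at 1)" "\<And>z. Q' (?d z) \<Longrightarrow> z \<in> U \<Longrightarrow> Q z"
      unfolding going_to_within_def eventually_inf_principal eventually_filtercomap by blast
    then obtain \<delta> where \<delta>: "\<delta> > 0" "\<And>x. x \<noteq> 1 \<Longrightarrow> dist x 1 < \<delta> \<Longrightarrow> Q' x"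
      unfolding eventually_at by auto
    \<comment> \<open>The bound c gives t >= 0 and c / \<delta> gives 1 - t < \<delta>; then t <=
      sqrt t < 1 keeps the distance within \<delta> of 1 but different from 1.\<close>
    show "\<exists>R. \<forall>z\<in>U. X z > R \<longrightarrow> Q z"
    proof (intro exI[of _ "max c (c / \<delta>)"] ballI impI)
      fix z assume z: "z \<in> U" and "X z > max c (c / \<delta>)"
      hence X: "X z > c" "X z > c / \<delta>" "X z > 0" using c by auto
      define t where "t = 1 - c / X z"
      have t: "0 \<le> t" "t < 1" "1 - t < \<delta>"
        using X c \<delta> by (auto simp: t_def field_simps)
      have "sqrt t < 1" using t by simp
      moreover have "t \<le> sqrt t"
        using t by (intro real_le_rsqrt) (simp add: power2_eq_square mult_left_le_one_le)
      ultimately have "?d z \<noteq> 1" "dist (?d z) 1 < \<delta>"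
        using c(2)[OF z] t by (auto simp: t_def[symmetric] dist_norm)
      thus "Q z" using \<delta>(2) Q'(2) z by blast
    qed
  next
    assume "\<exists>R. \<forall>z\<in>U. X z > R \<longrightarrow> Q z"
    then obtain R where R: "\<forall>z\<in>U. X z > R \<longrightarrow> Q z" by blast
    define S where "S = max R 1"
    have S: "S > 0" "R \<le> S" by (auto simp: S_def)
    \<comment> \<open>The real \<open>sqrt\<close> is increasing on the whole line, with negative
      values at negative arguments, so 1 - c / S need not be positive.\<close>
    define \<delta> where "\<delta> = 1 - sqrt (1 - c / S)"
    have \<delta>: "\<delta> > 0" using c S by (simp add: \<delta>_def)
    have "eventually (\<lambda>x. dist x 1 < \<delta>) (at (1::real))"
      using \<delta> unfolding eventually_at by blast
    moreover have "Q z" if d: "dist (?d z) 1 < \<delta>" and z: "z \<in> U" for z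
    proof -
      have "sqrt (1 - c / S) < sqrt (1 - c / X z)"
        using d unfolding c(2)[OF z] \<delta>_def dist_norm real_norm_def by linarith
      hence "c / X z < c / S" by simp
      hence "S < X z" using c S X_pos[OF z] by (simp add: field_simps)
      thus ?thesis using R S z by auto
    qed
    ultimately show "eventually Q (?d going_to at 1 within U)"
      unfolding going_to_within_def eventually_inf_principal eventually_filtercomap by blast
  qed
  show ?thesis unfolding tendsto_iff ev by (simp add: dist_norm)
qed

section \<open>Dilations and approximation by bounded functions\<close>

lemma nn_integral_dilation:
  fixes f :: "complex \<times> complex \<Rightarrow> ennreal"
  assumes [measurable]: "f \<in> borel_measurable borel" and r: "r > 0"
  shows "(\<integral>\<^sup>+w. f (r *\<^sub>R w) \<partial>lborel) * ennreal (r ^ 4) = (\<integral>\<^sup>+w. f w \<partial>lborel)"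
proof -
  have "DIM(complex \<times> complex) = 4" by simp
  hence "(\<integral>\<^sup>+w. f w \<partial>lborel) = (\<integral>\<^sup>+w. f w \<partial>density (distr lborel borel (\<lambda>x. 0 + r *\<^sub>R x)) (\<lambda>_. ennreal (\<bar>r\<bar> ^ 4)))"
    using lborel_affine[of r "0 :: complex \<times> complex"] r by simp
  also have "\<dots> = (\<integral>\<^sup>+w. ennreal (r ^ 4) * f (r *\<^sub>R w) \<partial>lborel)"
    using r by (subst nn_integral_density) (auto simp: nn_integral_distr)
  also have "\<dots> = ennreal (r ^ 4) * (\<integral>\<^sup>+w. f (r *\<^sub>R w) \<partial>lborel)"
    by (rule nn_integral_cmult) measurable
  finally show ?thesis by (simp add: mult.commute)
qed

text \<open>Both terms subtracted in \<open>rho\<close> shrink at least by the factor max (t^2)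
  (t^(2/\<alpha>)), and their sum is below 1 on \<open>U\<close>. The dilated domain thus stays in a
  compact part of \<open>U\<close>.\<close>

lemma rho_scale_ge:
  assumes w: "w \<in> U" and t: "0 < t" "t < 1"
  shows "rho (t *\<^sub>R w) \<ge> 1 - max (t\<^sup>2) (t powr (2 / \<alpha>))"
proof -
  define m where "m = max (t\<^sup>2) (t powr (2 / \<alpha>))"
  have "(norm (snd (t *\<^sub>R w)))\<^sup>2 + norm (fst (t *\<^sub>R w)) powr (2 / \<alpha>) = t\<^sup>2 * (norm (snd w))\<^sup>2 + t powr (2 / \<alpha>) * norm (fst w) powr (2 / \<alpha>)"
    using t by (simp add: power_mult_distrib powr_mult)
  also have "\<dots> \<le> m * (norm (snd w))\<^sup>2 + m * norm (fst w) powr (2 / \<alpha>)"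
    by (intro add_mono mult_right_mono) (auto simp: m_def)
  also have "\<dots> = m * (1 - rho w)" by (simp add: rho_def algebra_simps)
  also have "\<dots> \<le> m * 1" using w t by (intro mult_left_mono) (auto simp: m_def mem_U_iff le_max_iff_disj)
  finally show ?thesis by (simp add: rho_def m_def)
qed

lemma dilate_factor:
  assumes "0 < t" "t < 1"
  shows "1 - max (t\<^sup>2) (t powr (2 / \<alpha>)) > 0"
proof -
  have "t\<^sup>2 < 1" using assms by (simp add: abs_square_less_1)
  moreover have "t powr (2 / \<alpha>) < 1" using powr_less_mono2[of "2 / \<alpha>" t 1] assms alpha_pos by simp
  ultimately show ?thesis by simp
qed

definition dilate :: "real \<Rightarrow> (complex \<times> complex \<Rightarrow> complex) \<Rightarrow> (complex \<times> complex \<Rightarrow> complex)" where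
  "dilate t f w = (if w \<in> U then f (t *\<^sub>R w) else 0)"

lemma dilate_props:
  assumes f: "f \<in> A2" and t: "0 < t" "t < 1"
  shows "dilate t f \<in> A2" "(nm (dilate t f))\<^sup>2 \<le> (nm f)\<^sup>2 / t ^ 4" "\<exists>B. \<forall>w. norm (dilate t f w) \<le> B"
proof -
  note [measurable] = A2_borel[OF f]
  have sU: "t *\<^sub>R w \<in> U" if "w \<in> U" for w
    using less_le_trans[OF dilate_factor[OF t] rho_scale_ge[OF that t]] by (simp only: mem_U_iff)
  have hol: "holomorphic2_on (dilate t f) U"
    unfolding holomorphic2_on_def
  proof
    fix z assume z: "z \<in> U"
    obtain a b where ab: "(f has_derivative (\<lambda>h. a * fst h + b * snd h)) (at (t *\<^sub>R z))"
      using A2_holomorphic[OF f] sU[OF z] by (auto simp: holomorphic2_on_def)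
    have "((\<lambda>w. t *\<^sub>R w) has_derivative (\<lambda>h. t *\<^sub>R h)) (at z)"
      by (auto intro!: derivative_eq_intros)
    from has_derivative_compose[OF this ab]
    have "((\<lambda>w. f (t *\<^sub>R w)) has_derivative (\<lambda>h. (of_real t * a) * fst h + (of_real t * b) * snd h)) (at z)"
      by (simp add: scaleR_conv_of_real mult_ac)
    hence "(dilate t f has_derivative (\<lambda>h. (of_real t * a) * fst h + (of_real t * b) * snd h)) (at z)"
      by (rule has_derivative_transform_within_open[OF _ open_U z]) (simp add: dilate_def)
    thus "\<exists>a b. (dilate t f has_derivative (\<lambda>h. a * fst h + b * snd h)) (at z)" by blast
  qed
  have db[measurable]: "dilate t f \<in> borel_measurable borel"
    unfolding dilate_def[abs_def] by measurable
  have "(\<integral>\<^sup>+w. ennreal ((norm (dilate t f w))\<^sup>2) * indicator U w \<partial>lborel)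
      \<le> (\<integral>\<^sup>+w. ennreal ((norm (f (t *\<^sub>R w)))\<^sup>2) * indicator U (t *\<^sub>R w) \<partial>lborel)"
    using sU by (intro nn_integral_mono) (auto simp: dilate_def indicator_def)
  hence "(\<integral>\<^sup>+w. ennreal ((norm (dilate t f w))\<^sup>2) * indicator U w \<partial>lborel) * ennreal (t ^ 4)
      \<le> (\<integral>\<^sup>+w. ennreal ((norm (f (t *\<^sub>R w)))\<^sup>2) * indicator U (t *\<^sub>R w) \<partial>lborel) * ennreal (t ^ 4)"
    by (intro mult_right_mono) auto
  also have "\<dots> = (\<integral>\<^sup>+w. ennreal ((norm (f w))\<^sup>2) * indicator U w \<partial>lborel)"
    by (rule nn_integral_dilation[OF _ t(1)]) measurable
  also have "\<dots> = ennreal ((nm f)\<^sup>2)" by (rule A2_nn_integral[OF f])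
  finally have le: "(\<integral>\<^sup>+w. ennreal ((norm (dilate t f w))\<^sup>2) * indicator U w \<partial>lborel) * ennreal (t ^ 4) \<le> ennreal ((nm f)\<^sup>2)" .
  have "(\<integral>\<^sup>+w. ennreal ((norm (dilate t f w))\<^sup>2) * indicator U w \<partial>lborel) < \<infinity>"
  proof (rule ccontr)
    assume "\<not> ?thesis"
    hence "(\<integral>\<^sup>+w. ennreal ((norm (dilate t f w))\<^sup>2) * indicator U w \<partial>lborel) = top" by (simp add: less_top[symmetric])
    thus False using le t by (simp add: ennreal_top_mult top_unique)
  qed
  hence L2: "dilate t f \<in> L2" by (rule L2_borelI[OF db])
  show A: "dilate t f \<in> A2" by (rule A2_I[OF hol L2]) (simp add: dilate_def)
  have "ennreal ((nm (dilate t f))\<^sup>2 * t ^ 4) \<le> ennreal ((nm f)\<^sup>2)"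
    using le t unfolding A2_nn_integral[OF A] by (simp add: ennreal_mult)
  hence "(nm (dilate t f))\<^sup>2 * t ^ 4 \<le> (nm f)\<^sup>2" by (simp add: ennreal_le_iff)
  thus "(nm (dilate t f))\<^sup>2 \<le> (nm f)\<^sup>2 / t ^ 4" using t by (simp add: field_simps)
  define c where "c = 1 - max (t\<^sup>2) (t powr (2 / \<alpha>))"
  have c: "c > 0" unfolding c_def by (rule dilate_factor[OF t])
  define Q where "Q = {w. c \<le> rho w}"
  have QU: "Q \<subseteq> U" using c by (auto simp: Q_def mem_U_iff)
  have "closed Q" unfolding Q_def by (intro closed_Collect_le continuous_intros continuous_on_rho)
  moreover have "bounded Q"
  proof -
    have "norm w \<le> 2" if "w \<in> Q" for w
      using norm_Pair_le[of "fst w" "snd w"] norm_fst_U[of w] norm_snd_U[of w] that QU by force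
    thus ?thesis unfolding bounded_iff by blast
  qed
  ultimately have "compact Q" by (simp add: compact_eq_bounded_closed)
  hence "bounded (f ` Q)"
    using A2_continuous[OF f] QU by (intro compact_imp_bounded compact_continuous_image) (auto intro: continuous_on_subset)
  then obtain B where B: "\<And>w. w \<in> Q \<Longrightarrow> norm (f w) \<le> B" by (auto simp: bounded_iff)
  have "norm (dilate t f w) \<le> max B 0" for w
    using B[of "t *\<^sub>R w"] rho_scale_ge[OF _ t, of w] by (auto simp: dilate_def Q_def c_def le_max_iff_disj)
  thus "\<exists>B. \<forall>w. norm (dilate t f w) \<le> B" by blast
qed

text \<open>Fatou bounds the lower limit of ||g n + f||^2 below by 4 ||f||^2, the dilation bound
  keeps the upper limit of ||g n||^2 at most ||f||^2, and the parallelogram law turns the two into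
  norm convergence without a dominating function.\<close>

lemma bounded_functions_dense:
  assumes f: "f \<in> A2" and \<epsilon>: "\<epsilon> > 0"
  shows "\<exists>g\<in>A2. nm (f - g) < \<epsilon> \<and> (\<exists>B. \<forall>w. norm (g w) \<le> B)"
proof -
  note [measurable] = A2_borel[OF f]
  define t where "t n = 1 - 1 / real (n + 2)" for n :: nat
  have t: "0 < t n" "t n < 1" for n by (auto simp: t_def field_simps)
  have tl: "t \<longlonglongrightarrow> 1"
  proof -
    have "(\<lambda>n. 1 / real (n + 2)) \<longlonglongrightarrow> 0"
      using LIMSEQ_ignore_initial_segment[OF lim_1_over_n[where 'a = real], of 2] by simp
    from tendsto_diff[OF tendsto_const[of 1] this] show ?thesis by (simp add: t_def[abs_def])
  qed
  define g where "g n = dilate (t n) f" for n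
  have gA: "g n \<in> A2" for n unfolding g_def by (rule dilate_props(1)[OF f t])
  note [measurable] = A2_borel[OF gA]
  \<comment> \<open>The parallelogram law will leave 3 \<delta>, which is below \<epsilon>^2 = 4
    \<delta>.\<close>
  define \<delta> where "\<delta> = \<epsilon>\<^sup>2 / 4"
  have \<delta>: "\<delta> > 0" using \<epsilon> by (simp add: \<delta>_def)
  have lim: "(\<lambda>n. g n w) \<longlonglongrightarrow> f w" if w: "w \<in> U" for w
  proof -
    have "(\<lambda>n. t n *\<^sub>R w) \<longlonglongrightarrow> 1 *\<^sub>R w" by (intro tendsto_intros tl)
    moreover have "isCont f w" using A2_continuous[OF f] open_U w by (simp add: continuous_on_eq_continuous_at)
    ultimately have "(\<lambda>n. f (t n *\<^sub>R w)) \<longlonglongrightarrow> f w" by (auto intro: isCont_tendsto_compose)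
    thus ?thesis using w by (simp add: g_def dilate_def)
  qed
  have "ennreal (4 * (nm f)\<^sup>2) = (\<integral>\<^sup>+w. ennreal ((norm ((f + f) w))\<^sup>2) * indicator U w \<partial>lborel)"
  proof -
    have "f + f = cscale 2 f" by (auto simp: cscale_def)
    thus ?thesis unfolding A2_nn_integral[OF A2_add[OF f f]] by (simp add: nm_cscale power_mult_distrib)
  qed
  also have "\<dots> = (\<integral>\<^sup>+w. liminf (\<lambda>n. ennreal ((norm (g n w + f w))\<^sup>2) * indicator U w) \<partial>lborel)"
  proof (rule nn_integral_cong)
    fix w
    show "ennreal ((norm ((f + f) w))\<^sup>2) * indicator U w = liminf (\<lambda>n. ennreal ((norm (g n w + f w))\<^sup>2) * indicator U w)"
    proof (cases "w \<in> U")
      case True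
      have "(\<lambda>n. ennreal ((norm (g n w + f w))\<^sup>2)) \<longlonglongrightarrow> ennreal ((norm (f w + f w))\<^sup>2)"
        by (intro tendsto_ennrealI tendsto_intros lim True)
      from lim_imp_Liminf[OF _ this] show ?thesis using True by simp
    qed (simp add: Liminf_const)
  qed
  also have "\<dots> \<le> liminf (\<lambda>n. \<integral>\<^sup>+w. ennreal ((norm (g n w + f w))\<^sup>2) * indicator U w \<partial>lborel)"
    by (rule nn_integral_liminf) measurable
  also have "(\<lambda>n. \<integral>\<^sup>+w. ennreal ((norm (g n w + f w))\<^sup>2) * indicator U w \<partial>lborel) = (\<lambda>n. ennreal ((nm (g n + f))\<^sup>2))"
    using A2_nn_integral[OF A2_add[OF gA f]] by (simp add: plus_fun_def)
  finally have fatou: "ennreal (4 * (nm f)\<^sup>2) \<le> liminf (\<lambda>n. ennreal ((nm (g n + f))\<^sup>2))" .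
  have ev1: "\<forall>\<^sub>F n in sequentially. 4 * (nm f)\<^sup>2 - \<delta> < (nm (g n + f))\<^sup>2"
  \<comment> \<open>A negative left side would be truncated to 0 by \<open>ennreal\<close>, so that
    case is settled directly.\<close>
  proof (cases "4 * (nm f)\<^sup>2 - \<delta> \<ge> 0")
    case True
    have "ennreal (4 * (nm f)\<^sup>2 - \<delta>) < ennreal (4 * (nm f)\<^sup>2)" using True \<delta> by (subst ennreal_less_iff) auto
    hence "ennreal (4 * (nm f)\<^sup>2 - \<delta>) < liminf (\<lambda>n. ennreal ((nm (g n + f))\<^sup>2))" using fatou by (rule less_le_trans)
    from less_LiminfD[OF this] show ?thesis using True by (simp add: ennreal_less_iff)
  next
    case False
    have "4 * (nm f)\<^sup>2 - \<delta> < (nm (g n + f))\<^sup>2" for n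
      using False zero_le_power2[of "nm (g n + f)"] by linarith
    thus ?thesis by simp
  qed
  have "(\<lambda>n. (nm f)\<^sup>2 / t n ^ 4) \<longlonglongrightarrow> (nm f)\<^sup>2 / 1 ^ 4"
    by (intro tendsto_intros tl) auto
  hence ev2: "\<forall>\<^sub>F n in sequentially. (nm f)\<^sup>2 / t n ^ 4 < (nm f)\<^sup>2 + \<delta>"
    using \<delta> by (intro order_tendstoD) auto
  obtain n where n: "4 * (nm f)\<^sup>2 - \<delta> < (nm (g n + f))\<^sup>2" "(nm f)\<^sup>2 / t n ^ 4 < (nm f)\<^sup>2 + \<delta>"
    using eventually_happens[OF eventually_conj[OF ev1 ev2]] by auto
  have "(nm (g n))\<^sup>2 \<le> (nm f)\<^sup>2 / t n ^ 4" unfolding g_def by (rule dilate_props(2)[OF f t])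
  hence "(nm (g n - f))\<^sup>2 < 4 * \<delta>"
    using nm_parallelogram[OF A2_L2[OF gA] A2_L2[OF f], of n] n \<delta> by argo
  hence "(nm (f - g n))\<^sup>2 < \<epsilon>\<^sup>2" by (simp add: \<delta>_def nm_minus_commute[of f])
  hence "nm (f - g n) < \<epsilon>" by (rule power2_less_imp_less) (use \<epsilon> in simp)
  moreover have "\<exists>B. \<forall>w. norm (g n w) \<le> B" unfolding g_def by (rule dilate_props(3)[OF f t])
  ultimately show ?thesis using gA by blast
qed

text \<open>A bounded g divided by \<open>X\<close> tends to 0, while the remainder f - g
  contributes at most its norm, by \<open>norm_le_X\<close>.\<close>

lemma kernels_weakly_null:
  assumes f: "f \<in> A2" and z: "\<And>n::nat. z n \<in> U" and X: "filterlim (\<lambda>n. X (z n)) at_top sequentially"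
  shows "(\<lambda>n. f (z n) / of_real (X (z n))) \<longlonglongrightarrow> 0"
proof (rule tendsto_norm_zero_cancel, rule metric_LIMSEQ_I)
  fix e :: real assume e: "e > 0"
  obtain g B where g: "g \<in> A2" "nm (f - g) < e / 2" "\<And>w. norm (g w) \<le> B"
    using bounded_functions_dense[OF f, of "e / 2"] e by auto
  have B: "B \<ge> 0" using g(3)[of 0] norm_ge_zero order_trans by blast
  have "\<forall>\<^sub>F n in sequentially. X (z n) > 2 * B / e"
    using X by (auto simp: filterlim_at_top_dense)
  then obtain N where N: "\<And>n. n \<ge> N \<Longrightarrow> X (z n) > 2 * B / e" by (auto simp: eventually_sequentially)
  have "dist (norm (f (z n) / of_real (X (z n)))) 0 < e" if "n \<ge> N" for n
  proof -
    have p: "X (z n) > 0" by (rule X_pos[OF z])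
    have "norm (f (z n)) \<le> norm (g (z n)) + norm ((f - g) (z n))"
      using norm_triangle_ineq[of "g (z n)" "f (z n) - g (z n)"] by simp
    also have "\<dots> \<le> B + X (z n) * nm (f - g)"
      by (intro add_mono g norm_le_X z A2_diff f)
    also have "\<dots> < X (z n) * (e / 2) + X (z n) * (e / 2)"
      using N[OF that] e p g(2) by (intro add_less_le_mono mult_left_mono less_imp_le) (auto simp: field_simps)
    finally have "norm (f (z n)) < X (z n) * e" by (simp add: field_simps)
    thus ?thesis using p by (simp add: norm_divide field_simps)
  qed
  thus "\<exists>N. \<forall>n\<ge>N. dist (norm (f (z n) / of_real (X (z n)))) 0 < e" by blast
qed

section \<open>Compactness\<close>

text \<open>On \<open>U\<close> the square of \<open>X\<close> is the restriction of the jointly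
  measurable kernel to the diagonal.\<close>

lemma X_sublevel_borel: "{w \<in> U. X w \<le> R} \<in> sets borel"
proof -
  define F where "F z w = (if w \<in> U then K w z else 0)" for z w
  have "(\<lambda>x. indicator U (fst x) *\<^sub>R F (fst x) (snd x)) \<in> borel_measurable (borel \<Otimes>\<^sub>M borel)"
  proof (rule borel_measurable_caratheodory)
    show "continuous_on U (\<lambda>z. F z w)" for w
      unfolding F_def by (cases "w \<in> U") (auto intro: A2_continuous[OF K_A2])
    fix z assume z: "z \<in> U"
    have "(\<lambda>w. cnj (K z w)) \<in> borel_measurable borel"
      by (rule measurable_compose[OF A2_borel[OF K_A2[OF z]] borel_measurable_continuous_onI])
         (intro continuous_intros)
    moreover have "F z = (\<lambda>w. cnj (K z w))"
    proof
      fix w show "F z w = cnj (K z w)"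
        using K_reproducing[OF z K_A2, of w] K_reproducing[OF _ K_A2[OF z], of w] ip_cnj[of "K w" "K z"] A2_zero_outside[OF K_A2[OF z], of w]
        by (simp add: F_def)
    qed
    ultimately show "F z \<in> borel_measurable borel" by simp
  qed
  from measurable_compose[OF _ this, of "\<lambda>w. (w, w)" borel]
  have m: "(\<lambda>w. indicator U w *\<^sub>R F w w) \<in> borel_measurable borel" by simp
  have Xs: "norm (indicator U w *\<^sub>R F w w) = (X w)\<^sup>2" if "w \<in> U" for w
    using K_reproducing[OF that K_A2[OF that]] that by (simp add: F_def ip_self X_def del: of_real_power)
  have "{w \<in> U. X w \<le> R} = U \<inter> (\<lambda>w. norm (indicator U w *\<^sub>R F w w)) -` {x. sqrt x \<le> R}"
    using Xs X_pos by (auto simp: less_imp_le)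
  also have "\<dots> \<in> sets borel"
  proof -
    have n: "(\<lambda>w. norm (indicator U w *\<^sub>R F w w)) \<in> borel_measurable borel" using m by measurable
    have "{x. sqrt x \<le> R} \<in> sets borel" by (intro borel_closed closed_Collect_le continuous_intros)
    from measurable_sets_borel[OF n this] U_in_borel show ?thesis by (intro sets.Int)
  qed
  finally show ?thesis .
qed

text \<open>Weak sequential compactness of the unit ball, in terms of values. A diagonal argument
  gives convergence on a countable dense set. The kernels at its points span a dense subspace, since
  a continuous function vanishing there is 0, and boundedness carries convergence over to the
  pairing with every \<open>K z\<close>.\<close>

lemma pointwise_convergent_subsequence:
  fixes f :: "nat \<Rightarrow> complex \<times> complex \<Rightarrow> complex"
  assumes f: "\<And>n. f n \<in> A2" and b: "\<And>n. nm (f n) \<le> 1"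
  shows "\<exists>r :: nat \<Rightarrow> nat. strict_mono r \<and> (\<forall>z\<in>U. convergent (\<lambda>n. f (r n) z))"
proof -
  obtain D :: "(complex \<times> complex) set" where D: "countable D" "\<And>S. open S \<Longrightarrow> S \<noteq> {} \<Longrightarrow> \<exists>d\<in>D. d \<in> S"
    using countable_dense_setE by blast
  define Q where "Q = D \<inter> U"
  have Q: "countable Q" "Q \<subseteq> U" "Q \<noteq> {}"
    using D(1) D(2)[OF open_U] zero_in_U by (auto simp: Q_def)
  define q where "q = from_nat_into Q"
  have q: "range q = Q" unfolding q_def using Q by (intro range_from_nat_into)
  have qU: "q n \<in> U" for n using q Q by blast
  interpret subseqs "\<lambda>n s. convergent (\<lambda>i. f (s i) (q n))"
  proof
    fix n and s :: "nat \<Rightarrow> nat" assume "strict_mono s"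
    have "norm (f (s i) (q n)) \<le> X (q n)" for i
    proof -
      have "norm (f (s i) (q n)) \<le> X (q n) * nm (f (s i))" by (rule norm_le_X[OF qU f])
      also have "\<dots> \<le> X (q n) * 1" using b less_imp_le[OF X_pos[OF qU]] by (intro mult_left_mono) auto
      finally show ?thesis by simp
    qed
    hence "bounded (range (\<lambda>i. f (s i) (q n)))" unfolding bounded_iff by blast
    then obtain l r' where "strict_mono r'" "((\<lambda>i. f (s i) (q n)) \<circ> r') \<longlonglongrightarrow> l"
      using bounded_imp_convergent_subsequence by blast
    thus "\<exists>r'. strict_mono r' \<and> convergent (\<lambda>i. f ((s \<circ> r') i) (q n))"
      by (auto simp: convergent_def o_def)
  qed
  define d where "d = diagseq"
  have conv_q: "convergent (\<lambda>i. f (d i) (q n))" for n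
  proof -
    have "convergent (\<lambda>i. f ((diagseq \<circ> (+) (Suc n)) i) (q n))"
    proof (rule diagseq_holds)
      fix r s :: "nat \<Rightarrow> nat" and n assume r: "strict_mono r" and "convergent (\<lambda>i. f (s i) (q n))"
      then obtain l where "(\<lambda>i. f (s i) (q n)) \<longlonglongrightarrow> l" by (auto simp: convergent_def)
      from LIMSEQ_subseq_LIMSEQ[OF this r] show "convergent (\<lambda>i. f ((s \<circ> r) i) (q n))"
        by (auto simp: convergent_def o_def)
    qed
    \<comment> \<open>The diagonal sequence is known to refine the selection made for
      \<open>q n\<close> only from index \<open>Suc n\<close> on; the shift does not affect the
      limit.\<close>
    then obtain l where "(\<lambda>i. f (d (i + Suc n)) (q n)) \<longlonglongrightarrow> l"
      by (auto simp: convergent_def d_def add.commute)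
    hence "(\<lambda>i. f (d i) (q n)) \<longlonglongrightarrow> l" by (rule LIMSEQ_offset)
    thus ?thesis by (auto simp: convergent_def)
  qed
  have fd: "f (d i) \<in> L2" for i using f A2_L2 by blast
  have span_conv: "g \<in> A2 \<and> convergent (\<lambda>i. ip (f (d i)) g)" if "g \<in> cfun.span (K ` Q)" for g
    using that
  proof (induction rule: cfun.span_induct_alt)
    case base
    have "ip g 0 = 0" for g by (simp add: inner_L2_def)
    thus ?case by (simp only: A2_zero convergent_const simp_thms)
  next
    case (step c x y)
    then obtain w where w: "w \<in> Q" "x = K w" by blast
    obtain n where n: "w = q n" using w q by auto
    have xA: "x \<in> A2" unfolding w(2) using K_A2 w(1) Q(2) by blast
    have yA: "y \<in> A2" and yc: "convergent (\<lambda>i. ip (f (d i)) y)" using step by auto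
    have xq: "ip (f (d i)) x = f (d i) (q n)" for i
      unfolding w(2) n by (rule K_reproducing[OF qU f, symmetric])
    have eq: "ip (f (d i)) (cscale c x + y) = cnj c * f (d i) (q n) + ip (f (d i)) y" for i
      by (simp only: ip_add_right[OF L2_cscale[OF A2_L2[OF xA]] A2_L2[OF yA] fd] ip_cscale_right xq)
    have "convergent (\<lambda>i. cnj c * f (d i) (q n) + ip (f (d i)) y)"
      by (intro convergent_add convergent_mult convergent_const conv_q yc)
    hence "convergent (\<lambda>i. ip (f (d i)) (cscale c x + y))" by (simp only: eq)
    with A2_add[OF A2_cscale[OF xA] yA] show ?case by blast
  qed
  have "convergent (\<lambda>i. f (d i) z)" if z: "z \<in> U" for z
  proof -
    have "\<exists>s. (\<forall>n::nat. s n \<in> cfun.span (K ` Q)) \<and> (\<lambda>n. nm (s n - K z)) \<longlonglongrightarrow> 0"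
    proof (rule span_dense[OF _ _ K_A2[OF z]])
      show "K ` Q \<subseteq> A2" using K_A2 Q by blast
      fix g assume g: "g \<in> A2" and o: "\<And>s. s \<in> K ` Q \<Longrightarrow> ip g s = 0"
      have gq: "g w = 0" if "w \<in> Q" for w using o[of "K w"] K_reproducing[of w g] g that Q by auto
      have "g w = 0" if w: "w \<in> U" for w
      proof (rule ccontr)
        assume nz: "g w \<noteq> 0"
        have "open (U \<inter> g -` (- {0}))"
          using A2_continuous[OF g] open_U by (intro continuous_open_preimage) auto
        moreover have "w \<in> U \<inter> g -` (- {0})" using nz w by auto
        ultimately obtain x where "x \<in> D" "x \<in> U \<inter> g -` (- {0})" using D(2) by blast
        thus False using gq[of x] by (auto simp: Q_def)
      qed
      thus "g = 0" using A2_zero_outside[OF g] by (auto simp: fun_eq_iff)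
    qed
    then obtain s where s: "\<And>n::nat. s n \<in> cfun.span (K ` Q)" "(\<lambda>n. nm (s n - K z)) \<longlonglongrightarrow> 0" by blast
    have "Cauchy (\<lambda>i. f (d i) z)"
    proof (rule metric_CauchyI)
      fix e :: real assume e: "e > 0"
      have "e / 3 > 0" using e by simp
      from order_tendstoD(2)[OF s(2) this] obtain n where n: "nm (s n - K z) < e / 3"
        by (auto simp: eventually_sequentially)
      have sA: "s n \<in> A2" and "convergent (\<lambda>i. ip (f (d i)) (s n))" using span_conv[OF s(1)] by auto
      hence "Cauchy (\<lambda>i. ip (f (d i)) (s n))" by (simp add: Cauchy_convergent_iff)
      then obtain N where N: "\<And>i j. i \<ge> N \<Longrightarrow> j \<ge> N \<Longrightarrow> dist (ip (f (d i)) (s n)) (ip (f (d j)) (s n)) < e / 3"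
        using \<open>e / 3 > 0\<close> unfolding Cauchy_def by blast
      have cl: "norm (ip (f (d i)) (s n) - f (d i) z) < e / 3" for i
      proof -
        have "ip (f (d i)) (s n) - f (d i) z = ip (f (d i)) (s n - K z)"
          using K_reproducing[OF z f] by (simp add: ip_diff_right fd A2_L2 sA K_A2[OF z])
        also have "norm \<dots> \<le> nm (f (d i)) * nm (s n - K z)"
          by (intro Cauchy_Schwarz_ip fd A2_L2 A2_diff sA K_A2 z)
        also have "\<dots> \<le> 1 * nm (s n - K z)" by (intro mult_right_mono b nm_nonneg)
        finally show ?thesis using n by simp
      qed
      have "dist (f (d i) z) (f (d j) z) < e" if "i \<ge> N" "j \<ge> N" for i j
      proof -
        let ?a = "ip (f (d i)) (s n)" and ?b = "ip (f (d j)) (s n)"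
        have "f (d i) z - f (d j) z = (?a - ?b) - (?a - f (d i) z) + (?b - f (d j) z)" by simp
        hence "norm (f (d i) z - f (d j) z) \<le> norm (?a - ?b) + norm (?a - f (d i) z) + norm (?b - f (d j) z)"
          using norm_triangle_ineq[of "(?a - ?b) - (?a - f (d i) z)" "?b - f (d j) z"]
            norm_triangle_ineq4[of "?a - ?b" "?a - f (d i) z"] by simp
        also have "\<dots> < e / 3 + e / 3 + e / 3"
          using N[OF that] cl[of i] cl[of j] by (intro add_strict_mono) (auto simp: dist_norm)
        finally show ?thesis by (simp add: dist_norm)
      qed
      thus "\<exists>N. \<forall>i\<ge>N. \<forall>j\<ge>N. dist (f (d i) z) (f (d j) z) < e" by blast
    qed
    thus ?thesis by (simp add: Cauchy_convergent_iff)
  qed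
  thus ?thesis using subseq_diagseq by (auto simp: d_def)
qed

lemma Metric_space_A2: "Metric_space A2 (\<lambda>f g. nm (f - g))"
proof
  show "0 \<le> nm (x - y)" for x y by (rule nm_nonneg)
  show "nm (x - y) = nm (y - x)" for x y by (rule nm_minus_commute)
  show "nm (x - y) = 0 \<longleftrightarrow> x = y" if "x \<in> A2" "y \<in> A2" for x y
    using nm_eq_0_A2[OF A2_diff[OF that]] nm_zero by auto
  show "nm (x - z) \<le> nm (x - y) + nm (y - z)" if "x \<in> A2" "y \<in> A2" "z \<in> A2" for x y z
    using that by (intro nm_triangle_diff A2_L2)
qed

text \<open>In the complete space \<open>A2\<close>, compact closure of the image is total
  boundedness, and that means that every sequence in the image has a Cauchy subsequence.\<close>

lemma compact_operator_iff_subsequence: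
  assumes B: "bounded_operator \<alpha> B"
  shows "compact_operator \<alpha> B \<longleftrightarrow> (\<forall>f. (\<forall>n::nat. f n \<in> A2 \<and> nm (f n) \<le> 1) \<longrightarrow>
     (\<exists>r :: nat \<Rightarrow> nat. strict_mono r \<and> (\<forall>e>0. \<exists>N. \<forall>m\<ge>N. \<forall>n\<ge>N. nm (B (f (r m)) - B (f (r n))) < e)))" (is "_ \<longleftrightarrow> ?R")
proof -
  interpret MS: Metric_space A2 "\<lambda>f g. nm (f - g)" by (rule Metric_space_A2)
  have BA: "B g \<in> A2" if "g \<in> A2" for g using B that by (auto simp: bounded_operator_def)
  have compl: "MS.mcomplete"
    unfolding MS.mcomplete_def
  proof (intro allI impI)
    fix \<sigma> assume C: "MS.MCauchy \<sigma>"
    have "\<exists>f\<in>A2. (\<lambda>n. nm (\<sigma> n - f)) \<longlonglongrightarrow> 0 \<and> (\<forall>z\<in>U. (\<lambda>n. \<sigma> n z) \<longlonglongrightarrow> f z)"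
    proof (rule A2_complete)
      show "\<sigma> n \<in> A2" for n using C by (auto simp: MS.MCauchy_def)
      fix e :: real assume "e > 0"
      then obtain N where "\<forall>n n'. N \<le> n \<longrightarrow> N \<le> n' \<longrightarrow> nm (\<sigma> n - \<sigma> n') < e"
        using C unfolding MS.MCauchy_def by blast
      thus "\<exists>N. \<forall>m\<ge>N. \<forall>n\<ge>N. nm (\<sigma> m - \<sigma> n) < e" by blast
    qed
    then obtain f where "f \<in> A2" "(\<lambda>n. nm (\<sigma> n - f)) \<longlonglongrightarrow> 0" by blast
    moreover have "\<sigma> n \<in> A2" for n using C by (auto simp: MS.MCauchy_def)
    ultimately show "\<exists>x. limitin MS.mtopology \<sigma> x sequentially"
      unfolding MS.limitin_metric_dist_null by (intro exI[of _ f]) auto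
  qed
  let ?S = "B ` {f \<in> A2. nm f \<le> 1}"
  have SA: "?S \<subseteq> A2" using BA by blast
  have "compact_operator \<alpha> B \<longleftrightarrow> MS.mtotally_bounded ?S"
    unfolding compact_operator_def bergman_topology_def MS.mtotally_bounded_eq_compact_closure_of[OF compl]
    using B SA by simp
  also have "\<dots> \<longleftrightarrow> ?R"
  proof
    assume tb: "MS.mtotally_bounded ?S"
    show ?R
    proof (intro allI impI)
      fix f :: "nat \<Rightarrow> complex \<times> complex \<Rightarrow> complex" assume f: "\<forall>n. f n \<in> A2 \<and> nm (f n) \<le> 1"
      hence "range (\<lambda>n. B (f n)) \<subseteq> ?S" by blast
      then obtain r :: "nat \<Rightarrow> nat" where r: "strict_mono r" "MS.MCauchy ((\<lambda>n. B (f n)) \<circ> r)"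
        using mp[OF spec[OF conjunct2[OF iffD1[OF MS.mtotally_bounded_sequentially tb]]], of "\<lambda>n. B (f n)"] by blast
      thus "\<exists>r :: nat \<Rightarrow> nat. strict_mono r \<and> (\<forall>e>0. \<exists>N. \<forall>m\<ge>N. \<forall>n\<ge>N. nm (B (f (r m)) - B (f (r n))) < e)"
        by (intro exI[of _ r]) (auto simp: MS.MCauchy_def)
    qed
  next
    assume R: ?R
    show "MS.mtotally_bounded ?S"
      unfolding MS.mtotally_bounded_sequentially
    proof (intro conjI SA allI impI)
      fix \<sigma> :: "nat \<Rightarrow> complex \<times> complex \<Rightarrow> complex" assume "range \<sigma> \<subseteq> ?S"
      hence "\<forall>n. \<exists>f. f \<in> A2 \<and> nm f \<le> 1 \<and> \<sigma> n = B f" by blast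
      from choice[OF this] obtain f where f: "\<And>n. f n \<in> A2 \<and> nm (f n) \<le> 1 \<and> \<sigma> n = B (f n)" by blast
      then obtain r :: "nat \<Rightarrow> nat" where "strict_mono r" "\<forall>e>0. \<exists>N. \<forall>m\<ge>N. \<forall>n\<ge>N. nm (B (f (r m)) - B (f (r n))) < e"
        using R[rule_format, of f] by blast
      moreover have "\<sigma> = (\<lambda>n. B (f n))" "range \<sigma> \<subseteq> A2" using f BA by auto
      ultimately show "\<exists>r :: nat \<Rightarrow> nat. strict_mono r \<and> MS.MCauchy (\<sigma> \<circ> r)"
        unfolding MS.MCauchy_def o_def by (intro exI[of _ r]) auto
    qed
  qed
  finally show ?thesis .
qed

end

context thullen_op
begin

text \<open>Otherwise there are points with \<open>X\<close> tending to infinity and images of norm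
  at least \<epsilon>. A convergent subsequence of these images has limit 0: the value at w is
  \<open>X w\<close> times the conjugate of \<open>Tstar (kk w)\<close> at the moving point divided
  by \<open>X\<close> there, and this tends to 0.\<close>

lemma compact_imp_vanishing:
  assumes B: "bounded_operator \<alpha> B" and ext: "\<And>f. f \<in> A2 \<Longrightarrow> B f = Bop f" and cpt: "compact_operator \<alpha> B" and \<epsilon>: "\<epsilon> > 0"
  shows "\<exists>R. \<forall>z\<in>U. X z > R \<longrightarrow> nm (B (kk z)) < \<epsilon>"
proof (rule ccontr)
  assume neg: "\<not> ?thesis"
  have "\<exists>z. z \<in> U \<and> X z > real n \<and> nm (B (kk z)) \<ge> \<epsilon>" for n
  proof -
    obtain z where "z \<in> U" "X z > real n" "\<not> nm (B (kk z)) < \<epsilon>" using neg by blast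
    thus ?thesis by (intro exI[of _ z]) (simp add: not_less)
  qed
  hence "\<forall>n. \<exists>z. z \<in> U \<and> X z > real n \<and> nm (B (kk z)) \<ge> \<epsilon>" by blast
  from choice[OF this] obtain z where z: "\<And>n::nat. z n \<in> U" "\<And>n. X (z n) > real n" "\<And>n. nm (B (kk (z n))) \<ge> \<epsilon>" by blast
  have BA: "B g \<in> A2" if "g \<in> A2" for g using B that by (auto simp: bounded_operator_def)
  have "\<forall>n. kk (z n) \<in> A2 \<and> nm (kk (z n)) \<le> 1" using kk_A2 nm_kk z(1) by auto
  from mp[OF spec[OF iffD1[OF compact_operator_iff_subsequence[OF B] cpt]], OF this]
  obtain r :: "nat \<Rightarrow> nat" where r: "strict_mono r" "\<forall>e>0. \<exists>N. \<forall>m\<ge>N. \<forall>n\<ge>N. nm (B (kk (z (r m))) - B (kk (z (r n)))) < e"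
    by blast
  have "\<exists>g\<in>A2. (\<lambda>n. nm (B (kk (z (r n))) - g)) \<longlonglongrightarrow> 0 \<and> (\<forall>w\<in>U. (\<lambda>n. B (kk (z (r n))) w) \<longlonglongrightarrow> g w)"
    by (rule A2_complete) (use r(2) BA kk_A2 z(1) in auto)
  then obtain g where g: "g \<in> A2" "(\<lambda>n. nm (B (kk (z (r n))) - g)) \<longlonglongrightarrow> 0" "\<And>w. w \<in> U \<Longrightarrow> (\<lambda>n. B (kk (z (r n))) w) \<longlonglongrightarrow> g w"
    by blast
  have Xr: "filterlim (\<lambda>n. X (z (r n))) at_top sequentially"
  proof (rule filterlim_at_top_mono[OF filterlim_real_sequentially], rule always_eventually, rule allI)
    fix n
    have "real n \<le> real (r n)" using r(1) by (simp add: strict_mono_imp_increasing)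
    also have "\<dots> \<le> X (z (r n))" using z(2)[of "r n"] by simp
    finally show "real n \<le> X (z (r n))" .
  qed
  have "g w = 0" if w: "w \<in> U" for w
  proof -
    have "(\<lambda>n. of_real (X w) * cnj (Tstar (kk w) (z (r n)) / of_real (X (z (r n))))) \<longlonglongrightarrow> of_real (X w) * cnj 0"
      by (intro tendsto_intros kernels_weakly_null[OF Tstar_kk_A2[OF w] z(1) Xr])
    moreover have "B (kk (z (r n))) w = of_real (X w) * cnj (Tstar (kk w) (z (r n)) / of_real (X (z (r n))))" for n
      using w ip_cnj[of "kk (z (r n))" "Tstar (kk w)"] ip_kk[OF z(1) Tstar_kk_A2[OF w], of "r n"]
      by (simp add: ext[OF kk_A2[OF z(1)]] Bop_def ip_cscale_right)
    ultimately have "(\<lambda>n. B (kk (z (r n))) w) \<longlonglongrightarrow> 0" by simp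
    thus ?thesis using g(3)[OF w] LIMSEQ_unique by blast
  qed
  hence "g = 0" using A2_zero_outside[OF g(1)] by (auto simp: fun_eq_iff)
  hence "(\<lambda>n. nm (B (kk (z (r n))))) \<longlonglongrightarrow> 0" using g(2) by simp
  hence "\<epsilon> \<le> 0" by (rule tendsto_lowerbound) (use z(3) in auto)
  thus False using \<epsilon> by simp
qed

lemma vanishing_imp_compact:
  assumes B: "bounded_operator \<alpha> B" and ext: "\<And>f. f \<in> A2 \<Longrightarrow> B f = Bop f"
    and van: "\<And>\<epsilon>. \<epsilon> > 0 \<Longrightarrow> \<exists>R. \<forall>z\<in>U. X z > R \<longrightarrow> nm (B (kk z)) < \<epsilon>"
  shows "compact_operator \<alpha> B"
  unfolding compact_operator_iff_subsequence[OF B]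
proof (intro allI impI)
  fix f0 :: "nat \<Rightarrow> complex \<times> complex \<Rightarrow> complex" assume f0: "\<forall>n. f0 n \<in> A2 \<and> nm (f0 n) \<le> 1"
  obtain r0 :: "nat \<Rightarrow> nat" where r0: "strict_mono r0" "\<And>z. z \<in> U \<Longrightarrow> convergent (\<lambda>n. f0 (r0 n) z)"
    using pointwise_convergent_subsequence[of f0] f0 by blast
  define f where "f n = f0 (r0 n)" for n
  have f: "f n \<in> A2" "nm (f n) \<le> 1" for n using f0 by (auto simp: f_def)
  define \<phi> where "\<phi> z = (if z \<in> U then lim (\<lambda>n. f n z) else 0)" for z
  have lim: "(\<lambda>n. f n z) \<longlonglongrightarrow> \<phi> z" for z
  proof (cases "z \<in> U")
    case True
    thus ?thesis using r0(2)[OF True] by (simp add: \<phi>_def f_def convergent_LIMSEQ_iff)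
  qed (simp add: \<phi>_def A2_zero_outside[OF f(1)])
  note [measurable] = A2_borel[OF f(1)]
  have [measurable]: "\<phi> \<in> borel_measurable borel"
    by (rule borel_measurable_LIMSEQ_metric[OF _ lim]) measurable
  have "\<exists>N. \<forall>m\<ge>N. \<forall>n\<ge>N. nm (B (f m) - B (f n)) < e" if e: "e > 0" for e
  proof -
    obtain C1 where C1: "C1 > 0" "\<forall>z\<in>U. (\<integral>\<^sup>+w. ennreal (r z w * h w) * indicator U w \<partial>lborel) \<le> ennreal (C1 * h z)"
      using schur_row by blast
    obtain C2 where C2: "C2 > 0" "\<forall>w\<in>U. (\<integral>\<^sup>+z. ennreal (r z w * h z) * indicator U z \<partial>lborel) \<le> ennreal (C2 * h w)"
      using schur_column by blast
    \<comment> \<open>As f m - f n has norm at most 2, this makes the contribution from outside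
      \<open>E\<close> at most e^2 / 2; \<kappa> below makes the one from \<open>E\<close> at most
      e^2 / 4.\<close>
    define C3 where "C3 = e\<^sup>2 / (16 * C1)"
    have C3: "C3 > 0" using e C1 by (simp add: C3_def)
    obtain \<delta> where \<delta>: "\<delta> > 0" "\<forall>w\<in>U. nm (T (kk w)) < \<delta> \<longrightarrow> (\<integral>\<^sup>+z. ennreal (r z w * h z) * indicator U z \<partial>lborel) \<le> ennreal (C3 * h w)"
      using schur_column_small[OF C3] by blast
    obtain R where R: "\<forall>z\<in>U. X z > R \<longrightarrow> nm (B (kk z)) < \<delta>" using van[OF \<delta>(1)] by blast
    define E where "E = {w \<in> U. X w \<le> R}"
    have E[measurable]: "E \<in> sets borel" and EU: "E \<subseteq> U" unfolding E_def using X_sublevel_borel by auto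
    have out: "(\<integral>\<^sup>+z. ennreal (r z w * h z) * indicator U z \<partial>lborel) \<le> ennreal (C3 * h w)" if "w \<in> U - E" for w
    proof -
      have w: "w \<in> U" "X w > R" using that by (auto simp: E_def)
      have "B (kk w) = T (kk w)" using ext[OF kk_A2[OF w(1)]] T_eq_Bop[OF kk_span[OF w(1)]] by simp
      thus ?thesis using R \<delta> w by auto
    qed
    define I where "I n = (\<integral>\<^sup>+w. ennreal ((norm (f n w - \<phi> w))\<^sup>2) * indicator E w \<partial>lborel)" for n
    have "I \<longlonglongrightarrow> (\<integral>\<^sup>+w. 0 \<partial>(lborel :: (complex \<times> complex) measure))"
      unfolding I_def
    \<comment> \<open>On \<open>E\<close> point evaluation has norm at most R, and \<open>U\<close>
      has finite volume, so a constant dominates. \<open>max R 0\<close> covers a negative R, for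
      which \<open>E\<close> is empty.\<close>
    proof (rule nn_integral_dominated_convergence[where w = "\<lambda>w. ennreal ((2 * max R 0)\<^sup>2) * indicator U w"])
      show "(\<integral>\<^sup>+w. ennreal ((2 * max R 0)\<^sup>2) * indicator U w \<partial>lborel) < \<infinity>"
        using emeasure_U_finite by (simp add: nn_integral_cmult ennreal_mult_less_top)
      have bd: "norm (f n w) \<le> max R 0" if "w \<in> E" for n w
      proof -
        have w: "w \<in> U" "X w \<le> R" using that by (auto simp: E_def)
        have "norm (f n w) \<le> X w * nm (f n)" by (rule norm_le_X[OF w(1) f(1)])
        also have "\<dots> \<le> X w * 1" using f X_pos[OF w(1)] by (intro mult_left_mono) auto
        finally show ?thesis using w by simp
      qed
      have bd2: "norm (\<phi> w) \<le> max R 0" if "w \<in> E" for w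
        using tendsto_upperbound[OF tendsto_norm[OF lim[of w]], of "max R 0"] bd[OF that] by simp
      show "AE w in lborel. ennreal ((norm (f n w - \<phi> w))\<^sup>2) * indicator E w \<le> ennreal ((2 * max R 0)\<^sup>2) * indicator U w" for n
      proof (rule AE_I2)
        fix w
        show "ennreal ((norm (f n w - \<phi> w))\<^sup>2) * indicator E w \<le> ennreal ((2 * max R 0)\<^sup>2) * indicator U w"
        proof (cases "w \<in> E")
          case True
          have "norm (f n w - \<phi> w) \<le> 2 * max R 0"
            using norm_triangle_ineq4[of "f n w" "\<phi> w"] bd[OF True, of n] bd2[OF True] by linarith
          hence "(norm (f n w - \<phi> w))\<^sup>2 \<le> (2 * max R 0)\<^sup>2" by (intro power_mono) auto
          thus ?thesis using True EU by (auto simp: indicator_def intro!: ennreal_leI)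
        qed simp
      qed
      show "AE w in lborel. (\<lambda>n. ennreal ((norm (f n w - \<phi> w))\<^sup>2) * indicator E w) \<longlonglongrightarrow> 0"
      proof (rule AE_I2)
        fix w
        have "(\<lambda>n. ennreal ((norm (f n w - \<phi> w))\<^sup>2)) \<longlonglongrightarrow> ennreal ((norm (\<phi> w - \<phi> w))\<^sup>2)"
          by (intro tendsto_ennrealI tendsto_intros lim)
        thus "(\<lambda>n. ennreal ((norm (f n w - \<phi> w))\<^sup>2) * indicator E w) \<longlonglongrightarrow> 0"
          by (cases "w \<in> E") auto
      qed
    qed measurable
    hence I0: "I \<longlonglongrightarrow> 0" by simp
    define \<kappa> where "\<kappa> = e\<^sup>2 / (32 * (C1 * C2))"
    have \<kappa>: "\<kappa> > 0" using e C1 C2 by (simp add: \<kappa>_def)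
    have "\<forall>\<^sub>F n in sequentially. I n < ennreal \<kappa>" using I0 \<kappa> by (intro order_tendstoD) auto
    then obtain N where N: "\<And>n. n \<ge> N \<Longrightarrow> I n < ennreal \<kappa>" by (auto simp: eventually_sequentially)
    have "nm (B (f m) - B (f n)) < e" if mn: "m \<ge> N" "n \<ge> N" for m n
    proof -
      have d: "f m - f n \<in> A2" by (rule A2_diff[OF f(1) f(1)])
      have Bd: "B (f m) - B (f n) = Bop (f m - f n)" by (simp add: ext f Bop_diff)
      have "(\<integral>\<^sup>+w. ennreal ((norm ((f m - f n) w))\<^sup>2) * indicator E w \<partial>lborel)
         \<le> (\<integral>\<^sup>+w. 2 * (ennreal ((norm (f m w - \<phi> w))\<^sup>2) * indicator E w) + 2 * (ennreal ((norm (f n w - \<phi> w))\<^sup>2) * indicator E w) \<partial>lborel)"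
      proof (rule nn_integral_mono)
        fix w
        have "norm (f m w - f n w) \<le> norm (f m w - \<phi> w) + norm (f n w - \<phi> w)"
          using norm_triangle_ineq4[of "f m w - \<phi> w" "f n w - \<phi> w"] by simp
        hence "(norm (f m w - f n w))\<^sup>2 \<le> (norm (f m w - \<phi> w) + norm (f n w - \<phi> w))\<^sup>2" by (intro power_mono) auto
        also have "\<dots> \<le> 2 * (norm (f m w - \<phi> w))\<^sup>2 + 2 * (norm (f n w - \<phi> w))\<^sup>2"
          using sum_squares_bound[of "norm (f m w - \<phi> w)" "norm (f n w - \<phi> w)"] by (simp add: power2_sum)
        finally have "ennreal ((norm (f m w - f n w))\<^sup>2) \<le> ennreal (2 * (norm (f m w - \<phi> w))\<^sup>2 + 2 * (norm (f n w - \<phi> w))\<^sup>2)"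
          by (rule ennreal_leI)
        also have "\<dots> = 2 * ennreal ((norm (f m w - \<phi> w))\<^sup>2) + 2 * ennreal ((norm (f n w - \<phi> w))\<^sup>2)"
          by (simp add: ennreal_mult)
        finally show "ennreal ((norm ((f m - f n) w))\<^sup>2) * indicator E w
           \<le> 2 * (ennreal ((norm (f m w - \<phi> w))\<^sup>2) * indicator E w) + 2 * (ennreal ((norm (f n w - \<phi> w))\<^sup>2) * indicator E w)"
          by (cases "w \<in> E") auto
      qed
      also have "\<dots> = 2 * I m + 2 * I n"
        unfolding I_def by (subst nn_integral_add, measurable) (simp add: nn_integral_cmult)
      also have "\<dots> \<le> 2 * ennreal \<kappa> + 2 * ennreal \<kappa>"
        using N[OF mn(1)] N[OF mn(2)] by (intro add_mono mult_left_mono) auto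
      also have "\<dots> = ennreal (2 * \<kappa> + 2 * \<kappa>)"
        using \<kappa> by (simp only: ennreal_plus ennreal_mult ennreal_numeral mult_nonneg_nonneg zero_le_numeral less_imp_le)
      finally have small: "(\<integral>\<^sup>+w. ennreal ((norm ((f m - f n) w))\<^sup>2) * indicator E w \<partial>lborel) \<le> ennreal (4 * \<kappa>)" by simp
      have n2: "(nm (f m - f n))\<^sup>2 \<le> 4"
      proof -
        have "nm (f m - f n) \<le> nm (f m - 0) + nm (0 - f n)"
          by (intro nm_triangle_diff A2_L2 f A2_zero)
        hence "nm (f m - f n) \<le> 2" using f(2)[of m] f(2)[of n] by (simp add: nm_uminus)
        hence "(nm (f m - f n))\<^sup>2 \<le> 2\<^sup>2" using nm_nonneg by (intro power_mono) auto
        thus ?thesis by simp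
      qed
      have "ennreal ((nm (Bop (f m - f n)))\<^sup>2) \<le> ennreal (2 * (C1 * C2)) * (\<integral>\<^sup>+w. ennreal ((norm ((f m - f n) w))\<^sup>2) * indicator E w \<partial>lborel)
          + ennreal (2 * (C1 * C3) * (nm (f m - f n))\<^sup>2)"
        by (rule nm_Bop_split[OF d Bop_A2[OF d] E EU]) (use C1 C2 C3 EU out in auto)
      also have "\<dots> \<le> ennreal (2 * (C1 * C2)) * ennreal (4 * \<kappa>) + ennreal (2 * (C1 * C3) * 4)"
        using C1 C3 n2 by (intro add_mono mult_left_mono small ennreal_leI) auto
      also have "\<dots> = ennreal (2 * (C1 * C2) * (4 * \<kappa>) + 2 * (C1 * C3) * 4)"
        using C1 C2 C3 \<kappa> by (simp add: ennreal_mult[symmetric] ennreal_plus[symmetric] del: ennreal_plus)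
      also have "2 * (C1 * C2) * (4 * \<kappa>) + 2 * (C1 * C3) * 4 = 3 / 4 * e\<^sup>2"
        using C1 C2 by (simp add: \<kappa>_def C3_def field_simps)
      finally have "(nm (Bop (f m - f n)))\<^sup>2 \<le> 3 / 4 * e\<^sup>2" by (subst (asm) ennreal_le_iff) auto
      also have "\<dots> < e\<^sup>2" using e by simp
      finally have "nm (Bop (f m - f n)) < e" by (rule power2_less_imp_less) (use e in simp)
      thus ?thesis by (simp add: Bd)
    qed
    thus ?thesis by blast
  qed
  thus "\<exists>r :: nat \<Rightarrow> nat. strict_mono r \<and> (\<forall>e>0. \<exists>N. \<forall>m\<ge>N. \<forall>n\<ge>N. nm (B (f0 (r m)) - B (f0 (r n))) < e)"
    using r0(1) by (auto simp: f_def)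
qed

end

theorem theorem5p1:
  fixes \<alpha> p :: real
    and T Tstar :: "(complex \<times> complex \<Rightarrow> complex) \<Rightarrow> (complex \<times> complex \<Rightarrow> complex)"
  assumes "\<alpha> > 0" and "\<alpha> \<noteq> 1"
    and "clinear_on (kernel_span \<alpha>) T" and "T ` kernel_span \<alpha> \<subseteq> bergman_space \<alpha>"
    and "clinear_on (kernel_span \<alpha>) Tstar" and "Tstar ` kernel_span \<alpha> \<subseteq> bergman_space \<alpha>"
    and "\<And>z w. z \<in> U_dom \<alpha> \<Longrightarrow> w \<in> U_dom \<alpha> \<Longrightarrow>
           inner_L2 \<alpha> (T (normalized_kernel \<alpha> z)) (normalized_kernel \<alpha> w)
           = inner_L2 \<alpha> (normalized_kernel \<alpha> z) (Tstar (normalized_kernel \<alpha> w))"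
    and "p > 4"
    and "(SUP z\<in>U_dom \<alpha>. norm_Lp \<alpha> p
           (V_op \<alpha> (f_alpha \<alpha> z) (U_op \<alpha> z (T (normalized_kernel \<alpha> z))))) < \<infinity>"
    and "(SUP z\<in>U_dom \<alpha>. norm_Lp \<alpha> p
           (V_op \<alpha> (f_alpha \<alpha> z) (U_op \<alpha> z (Tstar (normalized_kernel \<alpha> z))))) < \<infinity>"
  shows "(\<exists>B. bounded_operator \<alpha> B \<and> (\<forall>f\<in>kernel_span \<alpha>. B f = T f)) \<and>
    (\<forall>B. bounded_operator \<alpha> B \<and> (\<forall>f\<in>kernel_span \<alpha>. B f = T f) \<longrightarrow>
      (((\<lambda>z. norm_L2 \<alpha> (B (normalized_kernel \<alpha> z))) \<longlongrightarrow> 0)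
          ((\<lambda>z. skwarczynski_dist \<alpha> z (0, 0)) going_to at 1 within U_dom \<alpha>)
        \<longleftrightarrow> compact_operator \<alpha> B))"
proof -
  interpret thullen \<alpha> by unfold_locales fact
  interpret thullen_op \<alpha> p T Tstar
    by unfold_locales (use assms in \<open>simp_all add: VU_def\<close>)
  show ?thesis
  proof (intro conjI allI impI)
    show "\<exists>B. bounded_operator \<alpha> B \<and> (\<forall>f\<in>kernel_span \<alpha>. B f = T f)"
      using bounded_operator_Bop T_eq_Bop by auto
    fix B assume B: "bounded_operator \<alpha> B \<and> (\<forall>f\<in>kernel_span \<alpha>. B f = T f)"
    \<comment> \<open>Every bounded extension is \<open>Bop\<close> on the Bergman space, so the
      choice of \<open>B\<close> does not matter.\<close>
    have ext: "B f = Bop f" if "f \<in> A2" for f using bounded_extension_unique B that by blast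
    have "((\<lambda>z. nm (B (kk z))) \<longlongrightarrow> 0) ((\<lambda>z. skwarczynski_dist \<alpha> z (0, 0)) going_to at 1 within U)
       \<longleftrightarrow> (\<forall>\<epsilon>>0. \<exists>R. \<forall>z\<in>U. X z > R \<longrightarrow> nm (B (kk z)) < \<epsilon>)"
      unfolding tendsto_boundary_iff by (simp add: nm_nonneg)
    also have "\<dots> \<longleftrightarrow> compact_operator \<alpha> B"
      using compact_imp_vanishing[OF conjunct1[OF B] ext] vanishing_imp_compact[OF conjunct1[OF B] ext] by blast
    finally show "((\<lambda>z. nm (B (kk z))) \<longlongrightarrow> 0) ((\<lambda>z. skwarczynski_dist \<alpha> z (0, 0)) going_to at 1 within U)
       \<longleftrightarrow> compact_operator \<alpha> B" .
  qed
qed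

end
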